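(* Let $\mathcal{D}$ be a finite tensor category over an algebraically closed field $\mathbf{k}$ and let $\mathcal{C}\subset\mathcal{D}$ be a tensor subcategory. If $A\in\mathcal{C}$ is an exact algebra in $\mathcal{C}$, then $A$ regarded as an algebra in $\mathcal{D}$ is also exact.
   Context: A tensor category over $\mathbf{k}$ is a $\mathbf{k}$-linear abelian rigid monoidal category with finite-length objects, finite-dimensional Hom spaces, $\mathbf{k}$-bilinear tensor product and $\mathrm{End}(\mathbf{1})=\mathbf{k}$; it is finite if it has finitely many simple objects and enough projectives. A tensor subcategory is a full subcategory containing $\mathbf{1}$ and closed under finite direct sums, subquotients, tensor products and duals. An algebra $A$ (unital, associative) in a finite tensor category $\mathcal{C}$ is exact if the category $\mathcal{C}_A$ of right $A$-modules in $\mathcal{C}$ is an exact left $\mathcal{C}$-module category, i.e. $P\otimes M$ is projective in $\mathcal{C}_A$ for every projective $P\in\mathcal{C}$ and every $M\in\mathcal{C}_A$. *)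

theory Defs
  imports "HOL-Algebra.Algebraic_Closure"
begin

section \<open>Categories\<close>

text \<open>
  All structure maps are meaningful only on objects in \<open>Ob C\<close> and on arrows in the relevant
  hom-sets. Hom-sets are not required to be disjoint, so a property of an arrow always names its
  source and target. \<open>g \<cdot> f\<close> means first \<open>f\<close>, then \<open>g\<close>.
\<close>

record ('o, 'm) category =
  Ob :: "'o set"
  Hom :: "'o \<Rightarrow> 'o \<Rightarrow> 'm set"
  Comp :: "'m \<Rightarrow> 'm \<Rightarrow> 'm"  (infixr \<open>\<cdot>\<index>\<close> 60)
  Ident :: "'o \<Rightarrow> 'm"

locale category =
  fixes C :: "('o, 'm, 'z) category_scheme" (structure)
  assumes Id_in_Hom: "a \<in> Ob C \<Longrightarrow> Ident C a \<in> Hom C a a"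
    and Comp_in_Hom:
      "\<lbrakk>a \<in> Ob C; b \<in> Ob C; c \<in> Ob C; f \<in> Hom C a b; g \<in> Hom C b c\<rbrakk> \<Longrightarrow> g \<cdot> f \<in> Hom C a c"
    and Comp_assoc:
      "\<lbrakk>a \<in> Ob C; b \<in> Ob C; c \<in> Ob C; d \<in> Ob C;
        f \<in> Hom C a b; g \<in> Hom C b c; h \<in> Hom C c d\<rbrakk> \<Longrightarrow> (h \<cdot> g) \<cdot> f = h \<cdot> (g \<cdot> f)"
    and Comp_Id_right: "\<lbrakk>a \<in> Ob C; b \<in> Ob C; f \<in> Hom C a b\<rbrakk> \<Longrightarrow> f \<cdot> Ident C a = f"
    and Comp_Id_left: "\<lbrakk>a \<in> Ob C; b \<in> Ob C; f \<in> Hom C a b\<rbrakk> \<Longrightarrow> Ident C b \<cdot> f = f"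

definition full_subcategory ::
    "('o, 'm, 'z) category_scheme \<Rightarrow> 'o set \<Rightarrow> ('o, 'm, 'z) category_scheme" where
  "full_subcategory C S = C\<lparr>Ob := S\<rparr>"

definition monic :: "('o, 'm, 'z) category_scheme \<Rightarrow> 'o \<Rightarrow> 'o \<Rightarrow> 'm \<Rightarrow> bool" where
  "monic C a b f \<longleftrightarrow> a \<in> Ob C \<and> b \<in> Ob C \<and> f \<in> Hom C a b \<and>
     (\<forall>c\<in>Ob C. \<forall>g\<in>Hom C c a. \<forall>h\<in>Hom C c a. f \<cdot>\<^bsub>C\<^esub> g = f \<cdot>\<^bsub>C\<^esub> h \<longrightarrow> g = h)"

definition epic :: "('o, 'm, 'z) category_scheme \<Rightarrow> 'o \<Rightarrow> 'o \<Rightarrow> 'm \<Rightarrow> bool" where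
  "epic C a b f \<longleftrightarrow> a \<in> Ob C \<and> b \<in> Ob C \<and> f \<in> Hom C a b \<and>
     (\<forall>c\<in>Ob C. \<forall>g\<in>Hom C b c. \<forall>h\<in>Hom C b c. g \<cdot>\<^bsub>C\<^esub> f = h \<cdot>\<^bsub>C\<^esub> f \<longrightarrow> g = h)"

definition inverse_arrows ::
    "('o, 'm, 'z) category_scheme \<Rightarrow> 'o \<Rightarrow> 'o \<Rightarrow> 'm \<Rightarrow> 'm \<Rightarrow> bool" where
  "inverse_arrows C a b f g \<longleftrightarrow> a \<in> Ob C \<and> b \<in> Ob C \<and> f \<in> Hom C a b \<and> g \<in> Hom C b a \<and>
     g \<cdot>\<^bsub>C\<^esub> f = Ident C a \<and> f \<cdot>\<^bsub>C\<^esub> g = Ident C b"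

definition iso_arrow :: "('o, 'm, 'z) category_scheme \<Rightarrow> 'o \<Rightarrow> 'o \<Rightarrow> 'm \<Rightarrow> bool" where
  "iso_arrow C a b f \<longleftrightarrow> (\<exists>g. inverse_arrows C a b f g)"

definition inv_arrow :: "('o, 'm, 'z) category_scheme \<Rightarrow> 'o \<Rightarrow> 'o \<Rightarrow> 'm \<Rightarrow> 'm" where
  "inv_arrow C a b f = (THE g. inverse_arrows C a b f g)"

definition isomorphic :: "('o, 'm, 'z) category_scheme \<Rightarrow> 'o \<Rightarrow> 'o \<Rightarrow> bool" where
  "isomorphic C a b \<longleftrightarrow> (\<exists>f. iso_arrow C a b f)"

definition zero_object :: "('o, 'm, 'z) category_scheme \<Rightarrow> 'o \<Rightarrow> bool" where
  "zero_object C z \<longleftrightarrow>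
     z \<in> Ob C \<and> (\<forall>a\<in>Ob C. (\<exists>!f. f \<in> Hom C z a) \<and> (\<exists>!f. f \<in> Hom C a z))"

definition projective :: "('o, 'm, 'z) category_scheme \<Rightarrow> 'o \<Rightarrow> bool" where
  "projective C p \<longleftrightarrow> p \<in> Ob C \<and>
     (\<forall>a b e. epic C a b e \<longrightarrow> (\<forall>f\<in>Hom C p b. \<exists>g\<in>Hom C p a. e \<cdot>\<^bsub>C\<^esub> g = f))"

definition enough_projectives :: "('o, 'm, 'z) category_scheme \<Rightarrow> bool" where
  "enough_projectives C \<longleftrightarrow> (\<forall>a\<in>Ob C. \<exists>p e. projective C p \<and> epic C p a e)"

definition simple_object :: "('o, 'm, 'z) category_scheme \<Rightarrow> 'o \<Rightarrow> bool" where
  "simple_object C a \<longleftrightarrow> a \<in> Ob C \<and> \<not> zero_object C a \<and>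
     (\<forall>b f. monic C b a f \<longrightarrow> zero_object C b \<or> iso_arrow C b a f)"

definition finitely_many_simples :: "('o, 'm, 'z) category_scheme \<Rightarrow> bool" where
  "finitely_many_simples C \<longleftrightarrow>
     (\<exists>T. finite T \<and> (\<forall>a. simple_object C a \<longrightarrow> (\<exists>b\<in>T. isomorphic C a b)))"


section \<open>Linear and abelian categories\<close>

text \<open>
  The ring multiplication and unit contained in the record \<open>hom_space C a b\<close> carry no
  information; only its underlying module is used.
\<close>

record ('o, 'm, 'k) linear_category = "('o, 'm) category" +
  hom_space :: "'o \<Rightarrow> 'o \<Rightarrow> ('k, 'm) module"

abbreviation zero_arrow :: "('o, 'm, 'k, 'z) linear_category_scheme \<Rightarrow> 'o \<Rightarrow> 'o \<Rightarrow> 'm" where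
  "zero_arrow C a b \<equiv> \<zero>\<^bsub>hom_space C a b\<^esub>"

locale linear_category = category C + field K
  for C :: "('o, 'm, 'k, 'z) linear_category_scheme" (structure)
    and K :: "('k, 'x) ring_scheme" +
  assumes carrier_hom_space: "\<lbrakk>a \<in> Ob C; b \<in> Ob C\<rbrakk> \<Longrightarrow> carrier (hom_space C a b) = Hom C a b"
    and module_hom_space: "\<lbrakk>a \<in> Ob C; b \<in> Ob C\<rbrakk> \<Longrightarrow> module K (hom_space C a b)"
    and Comp_add_right:
      "\<lbrakk>a \<in> Ob C; b \<in> Ob C; c \<in> Ob C; f \<in> Hom C a b; f' \<in> Hom C a b; g \<in> Hom C b c\<rbrakk>
       \<Longrightarrow> g \<cdot> (f \<oplus>\<^bsub>hom_space C a b\<^esub> f') = (g \<cdot> f) \<oplus>\<^bsub>hom_space C a c\<^esub> (g \<cdot> f')"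
    and Comp_add_left:
      "\<lbrakk>a \<in> Ob C; b \<in> Ob C; c \<in> Ob C; f \<in> Hom C a b; g \<in> Hom C b c; g' \<in> Hom C b c\<rbrakk>
       \<Longrightarrow> (g \<oplus>\<^bsub>hom_space C b c\<^esub> g') \<cdot> f = (g \<cdot> f) \<oplus>\<^bsub>hom_space C a c\<^esub> (g' \<cdot> f)"
    and Comp_smult_right:
      "\<lbrakk>a \<in> Ob C; b \<in> Ob C; c \<in> Ob C; f \<in> Hom C a b; g \<in> Hom C b c; r \<in> carrier K\<rbrakk>
       \<Longrightarrow> g \<cdot> (r \<odot>\<^bsub>hom_space C a b\<^esub> f) = r \<odot>\<^bsub>hom_space C a c\<^esub> (g \<cdot> f)"
    and Comp_smult_left:
      "\<lbrakk>a \<in> Ob C; b \<in> Ob C; c \<in> Ob C; f \<in> Hom C a b; g \<in> Hom C b c; r \<in> carrier K\<rbrakk>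
       \<Longrightarrow> (r \<odot>\<^bsub>hom_space C b c\<^esub> g) \<cdot> f = r \<odot>\<^bsub>hom_space C a c\<^esub> (g \<cdot> f)"

definition finite_dimensional_module ::
    "('k, 'x) ring_scheme \<Rightarrow> ('k, 'm, 'z) module_scheme \<Rightarrow> bool" where
  "finite_dimensional_module K V \<longleftrightarrow>
     (\<exists>B. finite B \<and> B \<subseteq> carrier V \<and>
       (\<forall>v\<in>carrier V. \<exists>c\<in>B \<rightarrow> carrier K. v = (\<Oplus>\<^bsub>V\<^esub>b\<in>B. c b \<odot>\<^bsub>V\<^esub> b)))"

definition is_direct_sum ::
    "('o, 'm, 'k, 'z) linear_category_scheme \<Rightarrow> 'o \<Rightarrow> 'o \<Rightarrow> 'o \<Rightarrow> bool" where
  "is_direct_sum C a b s \<longleftrightarrow> a \<in> Ob C \<and> b \<in> Ob C \<and> s \<in> Ob C \<and>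
     (\<exists>i\<in>Hom C a s. \<exists>j\<in>Hom C b s. \<exists>p\<in>Hom C s a. \<exists>q\<in>Hom C s b.
        p \<cdot>\<^bsub>C\<^esub> i = Ident C a \<and> q \<cdot>\<^bsub>C\<^esub> j = Ident C b \<and>
        p \<cdot>\<^bsub>C\<^esub> j = zero_arrow C b a \<and> q \<cdot>\<^bsub>C\<^esub> i = zero_arrow C a b \<and>
        (i \<cdot>\<^bsub>C\<^esub> p) \<oplus>\<^bsub>hom_space C s s\<^esub> (j \<cdot>\<^bsub>C\<^esub> q) = Ident C s)"

definition is_kernel ::
    "('o, 'm, 'k, 'z) linear_category_scheme \<Rightarrow> 'o \<Rightarrow> 'o \<Rightarrow> 'm \<Rightarrow> 'o \<Rightarrow> 'm \<Rightarrow> bool" where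
  "is_kernel C a b f k i \<longleftrightarrow>
     a \<in> Ob C \<and> b \<in> Ob C \<and> k \<in> Ob C \<and> f \<in> Hom C a b \<and> i \<in> Hom C k a \<and>
     f \<cdot>\<^bsub>C\<^esub> i = zero_arrow C k b \<and>
     (\<forall>x\<in>Ob C. \<forall>g\<in>Hom C x a. f \<cdot>\<^bsub>C\<^esub> g = zero_arrow C x b \<longrightarrow>
        (\<exists>!h. h \<in> Hom C x k \<and> i \<cdot>\<^bsub>C\<^esub> h = g))"

definition is_cokernel ::
    "('o, 'm, 'k, 'z) linear_category_scheme \<Rightarrow> 'o \<Rightarrow> 'o \<Rightarrow> 'm \<Rightarrow> 'o \<Rightarrow> 'm \<Rightarrow> bool" where
  "is_cokernel C a b f q p \<longleftrightarrow>
     a \<in> Ob C \<and> b \<in> Ob C \<and> q \<in> Ob C \<and> f \<in> Hom C a b \<and> p \<in> Hom C b q \<and>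
     p \<cdot>\<^bsub>C\<^esub> f = zero_arrow C a q \<and>
     (\<forall>x\<in>Ob C. \<forall>g\<in>Hom C b x. g \<cdot>\<^bsub>C\<^esub> f = zero_arrow C a x \<longrightarrow>
        (\<exists>!h. h \<in> Hom C q x \<and> h \<cdot>\<^bsub>C\<^esub> p = g))"

definition short_exact ::
    "('o, 'm, 'k, 'z) linear_category_scheme \<Rightarrow> 'o \<Rightarrow> 'o \<Rightarrow> 'o \<Rightarrow> 'm \<Rightarrow> 'm \<Rightarrow> bool" where
  "short_exact C a b c i p \<longleftrightarrow> is_kernel C b c p a i \<and> is_cokernel C a b i c p"

text \<open>
  A composition series of \<open>a\<close> is given as a chain \<open>0 = F 0 \<rightarrow> F 1 \<rightarrow> \<dots> \<rightarrow> F n = a\<close> of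
  monomorphisms with simple cokernels.
\<close>

definition finite_length :: "('o, 'm, 'k, 'z) linear_category_scheme \<Rightarrow> 'o \<Rightarrow> bool" where
  "finite_length C a \<longleftrightarrow>
     (\<exists>(n::nat) F. zero_object C (F 0) \<and> F n = a \<and>
        (\<forall>j<n. \<exists>s i p. simple_object C s \<and> short_exact C (F j) (F (Suc j)) s i p))"

locale abelian_category = linear_category C K
  for C :: "('o, 'm, 'k, 'z) linear_category_scheme" (structure)
    and K :: "('k, 'x) ring_scheme" +
  assumes ex_zero_object: "\<exists>z. zero_object C z"
    and ex_direct_sum: "\<lbrakk>a \<in> Ob C; b \<in> Ob C\<rbrakk> \<Longrightarrow> \<exists>s. is_direct_sum C a b s"
    and ex_kernel: "\<lbrakk>a \<in> Ob C; b \<in> Ob C; f \<in> Hom C a b\<rbrakk> \<Longrightarrow> \<exists>k i. is_kernel C a b f k i"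
    and ex_cokernel: "\<lbrakk>a \<in> Ob C; b \<in> Ob C; f \<in> Hom C a b\<rbrakk> \<Longrightarrow> \<exists>q p. is_cokernel C a b f q p"
    and monic_is_kernel: "monic C k a i \<Longrightarrow> \<exists>b f. is_kernel C a b f k i"
    and epic_is_cokernel: "epic C b q p \<Longrightarrow> \<exists>a f. is_cokernel C a b f q p"


section \<open>Tensor categories\<close>

record ('o, 'm, 'k) monoidal_linear_category = "('o, 'm, 'k) linear_category" +
  tensor_ob :: "'o \<Rightarrow> 'o \<Rightarrow> 'o"  (infixl \<open>\<boxtimes>\<index>\<close> 70)
  tensor_hom :: "'m \<Rightarrow> 'm \<Rightarrow> 'm"  (infixl \<open>\<star>\<index>\<close> 70)
  unit_ob :: "'o"
  associator :: "'o \<Rightarrow> 'o \<Rightarrow> 'o \<Rightarrow> 'm"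
  left_unitor :: "'o \<Rightarrow> 'm"
  right_unitor :: "'o \<Rightarrow> 'm"

locale monoidal_category = category C
  for C :: "('o, 'm, 'k, 'z) monoidal_linear_category_scheme" (structure) +
  assumes unit_ob_closed: "unit_ob C \<in> Ob C"
    and tensor_ob_closed: "\<lbrakk>a \<in> Ob C; b \<in> Ob C\<rbrakk> \<Longrightarrow> a \<boxtimes> b \<in> Ob C"
    and tensor_hom_closed:
      "\<lbrakk>a \<in> Ob C; b \<in> Ob C; a' \<in> Ob C; b' \<in> Ob C; f \<in> Hom C a b; f' \<in> Hom C a' b'\<rbrakk>
       \<Longrightarrow> f \<star> f' \<in> Hom C (a \<boxtimes> a') (b \<boxtimes> b')"
    and tensor_Id: "\<lbrakk>a \<in> Ob C; b \<in> Ob C\<rbrakk> \<Longrightarrow> Ident C a \<star> Ident C b = Ident C (a \<boxtimes> b)"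
    and tensor_Comp:
      "\<lbrakk>a \<in> Ob C; b \<in> Ob C; c \<in> Ob C; a' \<in> Ob C; b' \<in> Ob C; c' \<in> Ob C;
        f \<in> Hom C a b; g \<in> Hom C b c; f' \<in> Hom C a' b'; g' \<in> Hom C b' c'\<rbrakk>
       \<Longrightarrow> (g \<cdot> f) \<star> (g' \<cdot> f') = (g \<star> g') \<cdot> (f \<star> f')"
    and associator_iso:
      "\<lbrakk>a \<in> Ob C; b \<in> Ob C; c \<in> Ob C\<rbrakk>
       \<Longrightarrow> iso_arrow C ((a \<boxtimes> b) \<boxtimes> c) (a \<boxtimes> (b \<boxtimes> c)) (associator C a b c)"
    and associator_natural:
      "\<lbrakk>a \<in> Ob C; b \<in> Ob C; c \<in> Ob C; a' \<in> Ob C; b' \<in> Ob C; c' \<in> Ob C;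
        f \<in> Hom C a a'; g \<in> Hom C b b'; h \<in> Hom C c c'\<rbrakk>
       \<Longrightarrow> associator C a' b' c' \<cdot> ((f \<star> g) \<star> h) = (f \<star> (g \<star> h)) \<cdot> associator C a b c"
    and left_unitor_iso: "a \<in> Ob C \<Longrightarrow> iso_arrow C (unit_ob C \<boxtimes> a) a (left_unitor C a)"
    and left_unitor_natural:
      "\<lbrakk>a \<in> Ob C; b \<in> Ob C; f \<in> Hom C a b\<rbrakk>
       \<Longrightarrow> left_unitor C b \<cdot> (Ident C (unit_ob C) \<star> f) = f \<cdot> left_unitor C a"
    and right_unitor_iso: "a \<in> Ob C \<Longrightarrow> iso_arrow C (a \<boxtimes> unit_ob C) a (right_unitor C a)"
    and right_unitor_natural:
      "\<lbrakk>a \<in> Ob C; b \<in> Ob C; f \<in> Hom C a b\<rbrakk>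
       \<Longrightarrow> right_unitor C b \<cdot> (f \<star> Ident C (unit_ob C)) = f \<cdot> right_unitor C a"
    and pentagon:
      "\<lbrakk>a \<in> Ob C; b \<in> Ob C; c \<in> Ob C; d \<in> Ob C\<rbrakk>
       \<Longrightarrow> associator C a b (c \<boxtimes> d) \<cdot> associator C (a \<boxtimes> b) c d =
           (Ident C a \<star> associator C b c d) \<cdot> associator C a (b \<boxtimes> c) d \<cdot> (associator C a b c \<star> Ident C d)"
    and triangle:
      "\<lbrakk>a \<in> Ob C; b \<in> Ob C\<rbrakk>
       \<Longrightarrow> (Ident C a \<star> left_unitor C b) \<cdot> associator C a (unit_ob C) b = right_unitor C a \<star> Ident C b"

text \<open>
  \<open>is_left_dual C d a\<close>: there are arrows \<open>ev : d \<boxtimes> a \<rightarrow> 1\<close> and \<open>coev : 1 \<rightarrow> a \<boxtimes> d\<close> satisfying the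
  two zigzag identities. The unitors are moved to the right-hand sides. Equivalently, \<open>a\<close> is a
  right dual of \<open>d\<close>.
\<close>

definition is_left_dual ::
    "('o, 'm, 'k, 'z) monoidal_linear_category_scheme \<Rightarrow> 'o \<Rightarrow> 'o \<Rightarrow> bool" where
  "is_left_dual C d a \<longleftrightarrow> d \<in> Ob C \<and> a \<in> Ob C \<and>
     (\<exists>ev\<in>Hom C (d \<boxtimes>\<^bsub>C\<^esub> a) (unit_ob C). \<exists>coev\<in>Hom C (unit_ob C) (a \<boxtimes>\<^bsub>C\<^esub> d).
        right_unitor C a \<cdot>\<^bsub>C\<^esub> (Ident C a \<star>\<^bsub>C\<^esub> ev) \<cdot>\<^bsub>C\<^esub> associator C a d a \<cdot>\<^bsub>C\<^esub> (coev \<star>\<^bsub>C\<^esub> Ident C a)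
          = left_unitor C a \<and>
        left_unitor C d \<cdot>\<^bsub>C\<^esub> (ev \<star>\<^bsub>C\<^esub> Ident C d)
            \<cdot>\<^bsub>C\<^esub> inv_arrow C ((d \<boxtimes>\<^bsub>C\<^esub> a) \<boxtimes>\<^bsub>C\<^esub> d) (d \<boxtimes>\<^bsub>C\<^esub> (a \<boxtimes>\<^bsub>C\<^esub> d)) (associator C d a d)
            \<cdot>\<^bsub>C\<^esub> (Ident C d \<star>\<^bsub>C\<^esub> coev)
          = right_unitor C d)"

locale tensor_category = abelian_category C K + monoidal_category C
  for C :: "('o, 'm, 'k, 'z) monoidal_linear_category_scheme" (structure)
    and K :: "('k, 'x) ring_scheme" +
  assumes ex_left_dual: "a \<in> Ob C \<Longrightarrow> \<exists>d. is_left_dual C d a"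
    and ex_right_dual: "a \<in> Ob C \<Longrightarrow> \<exists>d. is_left_dual C a d"
    and objects_finite_length: "a \<in> Ob C \<Longrightarrow> finite_length C a"
    and hom_finite_dimensional:
      "\<lbrakk>a \<in> Ob C; b \<in> Ob C\<rbrakk> \<Longrightarrow> finite_dimensional_module K (hom_space C a b)"
    and tensor_add_left:
      "\<lbrakk>a \<in> Ob C; b \<in> Ob C; c \<in> Ob C; d \<in> Ob C; f \<in> Hom C a b; f' \<in> Hom C a b; g \<in> Hom C c d\<rbrakk>
       \<Longrightarrow> (f \<oplus>\<^bsub>hom_space C a b\<^esub> f') \<star> g = (f \<star> g) \<oplus>\<^bsub>hom_space C (a \<boxtimes> c) (b \<boxtimes> d)\<^esub> (f' \<star> g)"
    and tensor_add_right:
      "\<lbrakk>a \<in> Ob C; b \<in> Ob C; c \<in> Ob C; d \<in> Ob C; f \<in> Hom C a b; g \<in> Hom C c d; g' \<in> Hom C c d\<rbrakk>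
       \<Longrightarrow> f \<star> (g \<oplus>\<^bsub>hom_space C c d\<^esub> g') = (f \<star> g) \<oplus>\<^bsub>hom_space C (a \<boxtimes> c) (b \<boxtimes> d)\<^esub> (f \<star> g')"
    and tensor_smult_left:
      "\<lbrakk>a \<in> Ob C; b \<in> Ob C; c \<in> Ob C; d \<in> Ob C; f \<in> Hom C a b; g \<in> Hom C c d; r \<in> carrier K\<rbrakk>
       \<Longrightarrow> (r \<odot>\<^bsub>hom_space C a b\<^esub> f) \<star> g = r \<odot>\<^bsub>hom_space C (a \<boxtimes> c) (b \<boxtimes> d)\<^esub> (f \<star> g)"
    and tensor_smult_right:
      "\<lbrakk>a \<in> Ob C; b \<in> Ob C; c \<in> Ob C; d \<in> Ob C; f \<in> Hom C a b; g \<in> Hom C c d; r \<in> carrier K\<rbrakk>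
       \<Longrightarrow> f \<star> (r \<odot>\<^bsub>hom_space C c d\<^esub> g) = r \<odot>\<^bsub>hom_space C (a \<boxtimes> c) (b \<boxtimes> d)\<^esub> (f \<star> g)"
    and End_unit:
      "bij_betw (\<lambda>r. r \<odot>\<^bsub>hom_space C (unit_ob C) (unit_ob C)\<^esub> Ident C (unit_ob C))
         (carrier K) (Hom C (unit_ob C) (unit_ob C))"

locale finite_tensor_category = tensor_category C K
  for C :: "('o, 'm, 'k, 'z) monoidal_linear_category_scheme" (structure)
    and K :: "('k, 'x) ring_scheme" +
  assumes simples_finite: "finitely_many_simples C"
    and projectives_enough: "enough_projectives C"

text \<open>
  A tensor subcategory is a full subcategory, hence given by its set of objects. The closure
  conditions refer to arbitrary (not chosen) direct sums, subquotients and duals, so the set is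
  closed under isomorphism.
\<close>

definition tensor_subcategory ::
    "('o, 'm, 'k, 'z) monoidal_linear_category_scheme \<Rightarrow> 'o set \<Rightarrow> bool" where
  "tensor_subcategory C S \<longleftrightarrow> S \<subseteq> Ob C \<and> unit_ob C \<in> S \<and>
     (\<forall>z. zero_object C z \<longrightarrow> z \<in> S) \<and>
     (\<forall>a\<in>S. \<forall>b\<in>S. \<forall>s. is_direct_sum C a b s \<longrightarrow> s \<in> S) \<and>
     (\<forall>a\<in>S. \<forall>b c i p. monic C b a i \<and> epic C b c p \<longrightarrow> c \<in> S) \<and>
     (\<forall>a\<in>S. \<forall>b\<in>S. a \<boxtimes>\<^bsub>C\<^esub> b \<in> S) \<and>
     (\<forall>a\<in>S. \<forall>d. is_left_dual C d a \<or> is_left_dual C a d \<longrightarrow> d \<in> S)"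


section \<open>Algebras, modules and exactness\<close>

record ('o, 'm) algebra_object =
  alg_ob :: "'o"
  alg_mult :: "'m"
  alg_unit :: "'m"

definition algebra_in ::
    "('o, 'm, 'k, 'z) monoidal_linear_category_scheme \<Rightarrow> ('o, 'm) algebra_object \<Rightarrow> bool" where
  "algebra_in C A \<longleftrightarrow>
     (let a = alg_ob A; m = alg_mult A; u = alg_unit A in
        a \<in> Ob C \<and> m \<in> Hom C (a \<boxtimes>\<^bsub>C\<^esub> a) a \<and> u \<in> Hom C (unit_ob C) a \<and>
        m \<cdot>\<^bsub>C\<^esub> (m \<star>\<^bsub>C\<^esub> Ident C a) = m \<cdot>\<^bsub>C\<^esub> (Ident C a \<star>\<^bsub>C\<^esub> m) \<cdot>\<^bsub>C\<^esub> associator C a a a \<and>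
        m \<cdot>\<^bsub>C\<^esub> (u \<star>\<^bsub>C\<^esub> Ident C a) = left_unitor C a \<and>
        m \<cdot>\<^bsub>C\<^esub> (Ident C a \<star>\<^bsub>C\<^esub> u) = right_unitor C a)"

definition right_module_in ::
    "('o, 'm, 'k, 'z) monoidal_linear_category_scheme \<Rightarrow> ('o, 'm) algebra_object \<Rightarrow> 'o \<times> 'm \<Rightarrow> bool"
  where
  "right_module_in C A M \<longleftrightarrow>
     (let a = alg_ob A; (x, \<rho>) = M in
        x \<in> Ob C \<and> \<rho> \<in> Hom C (x \<boxtimes>\<^bsub>C\<^esub> a) x \<and>
        \<rho> \<cdot>\<^bsub>C\<^esub> (\<rho> \<star>\<^bsub>C\<^esub> Ident C a) = \<rho> \<cdot>\<^bsub>C\<^esub> (Ident C x \<star>\<^bsub>C\<^esub> alg_mult A) \<cdot>\<^bsub>C\<^esub> associator C x a a \<and>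
        \<rho> \<cdot>\<^bsub>C\<^esub> (Ident C x \<star>\<^bsub>C\<^esub> alg_unit A) = right_unitor C x)"

definition right_modules ::
    "('o, 'm, 'k, 'z) monoidal_linear_category_scheme \<Rightarrow> ('o, 'm) algebra_object
      \<Rightarrow> ('o \<times> 'm, 'm) category" where
  "right_modules C A =
     \<lparr>Ob = {M. right_module_in C A M},
      Hom = (\<lambda>(x, \<rho>) (y, \<sigma>). {f \<in> Hom C x y. f \<cdot>\<^bsub>C\<^esub> \<rho> = \<sigma> \<cdot>\<^bsub>C\<^esub> (f \<star>\<^bsub>C\<^esub> Ident C (alg_ob A))}),
      Comp = Comp C,
      Ident = (\<lambda>(x, \<rho>). Ident C x)\<rparr>"

text \<open>The left action of \<open>C\<close> on the objects of the category of right modules.\<close>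

definition act_on_module ::
    "('o, 'm, 'k, 'z) monoidal_linear_category_scheme \<Rightarrow> ('o, 'm) algebra_object
      \<Rightarrow> 'o \<Rightarrow> 'o \<times> 'm \<Rightarrow> 'o \<times> 'm" where
  "act_on_module C A p M =
     (let (x, \<rho>) = M in (p \<boxtimes>\<^bsub>C\<^esub> x, (Ident C p \<star>\<^bsub>C\<^esub> \<rho>) \<cdot>\<^bsub>C\<^esub> associator C p x (alg_ob A)))"

definition exact_algebra ::
    "('o, 'm, 'k, 'z) monoidal_linear_category_scheme \<Rightarrow> ('o, 'm) algebra_object \<Rightarrow> bool" where
  "exact_algebra C A \<longleftrightarrow> algebra_in C A \<and>
     (\<forall>p M. projective C p \<and> M \<in> Ob (right_modules C A) \<longrightarrow>
        projective (right_modules C A) (act_on_module C A p M))"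

end

theory Submission
  imports Defs "Jordan_Normal_Form.Missing_VectorSpace"
begin

text \<open>Quotients \<open>A / I\<close> of the right module \<open>A\<close> lie in the subcategory. The unit has a cover \<open>p\<close> that is
  projective in the subcategory, so \<open>p \<otimes> A / I\<close> is a projective module there, hence a summand of a free
  module; since every projective \<open>q\<close> of the large category is a summand of \<open>q \<otimes> p\<close>, also \<open>q \<otimes> A / I\<close> is
  projective. The general case is reduced to these quotients by a growth argument: if \<open>q \<otimes> N\<close> were not
  projective, then the minimal projective covers of \<open>x\<^sup>k \<otimes> q \<otimes> N\<close>, for a suitable object \<open>x\<close>, would
  at each step lose a summand of size comparable to \<open>x\<^sup>k\<close>, and the accumulated loss would exceed their
  size, which is at most a constant times that of \<open>x\<^sup>k\<close>.\<close>

section \<open>Categories presented by their arrows\<close>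

text \<open>A module in the large category need not have its underlying object in the subcategory,
  so the hypothesis never applies to it directly. Duality is the link: a projective module P embeds
  in some a \<otimes> A, and a nonzero submodule K of P transposes to a nonzero map d \<otimes> K to
  A, with d a left dual of a. Its image I is a right ideal. As q \<otimes> A / I is projective, q
  \<otimes> I is a nonzero projective summand of q \<otimes> A and a quotient of q \<otimes> d
  \<otimes> K. If K is the kernel of a cover P, it splits off q \<otimes> d \<otimes> P inside the
  kernel; hence the choice x = q \<otimes> d. One lost summand per step contradicts nothing, because
  the sizes grow too: the loss must be proportional to the number of composition factors of the
  power of x. Therefore the minimal covers of t \<otimes> q \<otimes> N are treated for all simple t
  at once, with one object a containing them all. Size is the dimension of Hom out of a suitable
  projective object; it is additive, but on tensor products only bounded by a constant times the
  product of lengths, whence the constants.\<close>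

text \<open>An arrow determines its source and target, and composition is total: an ill-typed
  composite is simply not an \<open>arr\<close>. This makes \<open>arr_cmp\<close> an equivalence
  and \<open>cmp_assoc\<close> unconditional, so the simplifier can rebracket chains freely.\<close>

locale acat =
  fixes Obj :: "'o set" and arr :: "'f \<Rightarrow> bool" and dm :: "'f \<Rightarrow> 'o" and cd :: "'f \<Rightarrow> 'o"
    and cmp :: "'f \<Rightarrow> 'f \<Rightarrow> 'f"  (infixr \<open>\<bullet>\<close> 60)
    and idt :: "'o \<Rightarrow> 'f"
  assumes arr_cmp [simp]: "arr (g \<bullet> f) \<longleftrightarrow> arr g \<and> arr f \<and> dm g = cd f"
    and dm_cmp [simp]: "\<lbrakk>arr g; arr f; dm g = cd f\<rbrakk> \<Longrightarrow> dm (g \<bullet> f) = dm f"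
    and cd_cmp [simp]: "\<lbrakk>arr g; arr f; dm g = cd f\<rbrakk> \<Longrightarrow> cd (g \<bullet> f) = cd g"
    and dm_Obj [simp]: "arr f \<Longrightarrow> dm f \<in> Obj"
    and cd_Obj [simp]: "arr f \<Longrightarrow> cd f \<in> Obj"
    and cmp_assoc [simp]: "(h \<bullet> g) \<bullet> f = h \<bullet> g \<bullet> f"
    and arr_idt [simp]: "a \<in> Obj \<Longrightarrow> arr (idt a)"
    and dm_idt [simp]: "a \<in> Obj \<Longrightarrow> dm (idt a) = a"
    and cd_idt [simp]: "a \<in> Obj \<Longrightarrow> cd (idt a) = a"
    and cmp_idt [simp]: "\<lbrakk>arr f; dm f = a\<rbrakk> \<Longrightarrow> f \<bullet> idt a = f"
    and idt_cmp [simp]: "\<lbrakk>arr f; cd f = b\<rbrakk> \<Longrightarrow> idt b \<bullet> f = f"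
begin

definition mono :: "'f \<Rightarrow> bool" where
  "mono f \<longleftrightarrow> arr f \<and> (\<forall>g h. arr g \<and> arr h \<and> dm g = dm h \<and> cd g = dm f \<and> cd h = dm f \<and>
     f \<bullet> g = f \<bullet> h \<longrightarrow> g = h)"

definition epi :: "'f \<Rightarrow> bool" where
  "epi f \<longleftrightarrow> arr f \<and> (\<forall>g h. arr g \<and> arr h \<and> cd g = cd h \<and> dm g = cd f \<and> dm h = cd f \<and>
     g \<bullet> f = h \<bullet> f \<longrightarrow> g = h)"

definition inv_pair :: "'f \<Rightarrow> 'f \<Rightarrow> bool" where
  "inv_pair f g \<longleftrightarrow> arr f \<and> arr g \<and> dm g = cd f \<and> cd g = dm f \<and>
     g \<bullet> f = idt (dm f) \<and> f \<bullet> g = idt (cd f)"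

definition iso :: "'f \<Rightarrow> bool" where
  "iso f \<longleftrightarrow> (\<exists>g. inv_pair f g)"

definition proj :: "'o \<Rightarrow> bool" where
  "proj p \<longleftrightarrow> p \<in> Obj \<and> (\<forall>e f. epi e \<and> arr f \<and> dm f = p \<and> cd f = cd e \<longrightarrow> (\<exists>g. e \<bullet> g = f))"

definition retract :: "'o \<Rightarrow> 'o \<Rightarrow> bool" where
  "retract a b \<longleftrightarrow> (\<exists>i p. arr i \<and> arr p \<and> dm i = a \<and> cd i = b \<and> dm p = b \<and> p \<bullet> i = idt a)"

text \<open>Since \<open>cmp_assoc\<close> nests chains to the right, an equation for two adjacent
  arrows must be extended by a tail \<open>k\<close> before it can rewrite inside a longer
  chain.\<close>

lemma cmp_reassoc: "f \<bullet> g = h \<Longrightarrow> f \<bullet> g \<bullet> k = h \<bullet> k"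
  by (metis cmp_assoc)

lemma cmp_reassoc3: "f \<bullet> g \<bullet> g' = h \<Longrightarrow> f \<bullet> g \<bullet> g' \<bullet> k = h \<bullet> k"
  by (metis cmp_assoc)

text \<open>Lifts and factorisations are obtained as bare equations; because \<open>arr_cmp\<close>
  is an equivalence, the typing of both factors can be recovered from the fact that the composite is
  an arrow.\<close>

lemma cmp_arrD:
  assumes "g \<bullet> f = h" "arr h"
  shows "arr g" "arr f" "dm g = cd f" "dm f = dm h" "cd g = cd h"
  using assms by auto

lemma epiD: "\<lbrakk>epi f; arr g; arr h; dm g = cd f; dm h = cd f; g \<bullet> f = h \<bullet> f\<rbrakk> \<Longrightarrow> g = h"
  unfolding epi_def by (metis cd_cmp)

lemma monoD: "\<lbrakk>mono f; arr g; arr h; cd g = dm f; cd h = dm f; f \<bullet> g = f \<bullet> h\<rbrakk> \<Longrightarrow> g = h"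
  unfolding mono_def by (metis dm_cmp)

lemma epi_arr [simp]: "epi f \<Longrightarrow> arr f" and mono_arr [simp]: "mono f \<Longrightarrow> arr f"
  by (auto simp: epi_def mono_def)

lemma epi_cmp: "\<lbrakk>epi f; epi g; dm g = cd f\<rbrakk> \<Longrightarrow> epi (g \<bullet> f)"
proof -
  assume a: "epi f" "epi g" "dm g = cd f"
  show ?thesis unfolding epi_def
  proof (intro conjI allI impI)
    fix h k assume "arr h \<and> arr k \<and> cd h = cd k \<and> dm h = cd (g \<bullet> f) \<and> dm k = cd (g \<bullet> f) \<and>
      h \<bullet> g \<bullet> f = k \<bullet> g \<bullet> f"
    then have hk: "arr h" "arr k" "dm h = cd g" "dm k = cd g" "(h \<bullet> g) \<bullet> f = (k \<bullet> g) \<bullet> f"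
      using a by auto
    have "h \<bullet> g = k \<bullet> g" using epiD[OF a(1), of "h \<bullet> g" "k \<bullet> g"] a hk by simp
    then show "h = k" using epiD[OF a(2), of h k] a hk by simp
  qed (use a in simp)
qed

lemma mono_cmp: "\<lbrakk>mono f; mono g; dm g = cd f\<rbrakk> \<Longrightarrow> mono (g \<bullet> f)"
proof -
  assume a: "mono f" "mono g" "dm g = cd f"
  show ?thesis unfolding mono_def
  proof (intro conjI allI impI)
    fix h k assume "arr h \<and> arr k \<and> dm h = dm k \<and> cd h = dm (g \<bullet> f) \<and> cd k = dm (g \<bullet> f) \<and>
      (g \<bullet> f) \<bullet> h = (g \<bullet> f) \<bullet> k"
    then have hk: "arr h" "arr k" "cd h = dm f" "cd k = dm f" "g \<bullet> (f \<bullet> h) = g \<bullet> (f \<bullet> k)"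
      using a by auto
    have "f \<bullet> h = f \<bullet> k" using monoD[OF a(2), of "f \<bullet> h" "f \<bullet> k"] a hk by simp
    then show "h = k" using monoD[OF a(1), of h k] a hk by simp
  qed (use a in simp)
qed

lemma epi_cmpD: "epi (g \<bullet> f) \<Longrightarrow> epi g"
proof -
  assume a: "epi (g \<bullet> f)"
  then have ga: "arr g" "arr f" "dm g = cd f" using epi_arr[OF a] by auto
  show ?thesis unfolding epi_def
  proof (intro conjI allI impI ga)
    fix h k assume hk: "arr h \<and> arr k \<and> cd h = cd k \<and> dm h = cd g \<and> dm k = cd g \<and> h \<bullet> g = k \<bullet> g"
    then have "h \<bullet> g \<bullet> f = k \<bullet> g \<bullet> f" using cmp_reassoc by metis
    then show "h = k" using epiD[OF a, of h k] ga hk by simp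
  qed
qed

lemma mono_cmpD: "mono (g \<bullet> f) \<Longrightarrow> mono f"
proof -
  assume a: "mono (g \<bullet> f)"
  then have ga: "arr g" "arr f" "dm g = cd f" using mono_arr[OF a] by auto
  show ?thesis unfolding mono_def
  proof (intro conjI allI impI ga)
    fix h k assume hk: "arr h \<and> arr k \<and> dm h = dm k \<and> cd h = dm f \<and> cd k = dm f \<and> f \<bullet> h = f \<bullet> k"
    then show "h = k" using monoD[OF a, of h k] ga hk by simp
  qed
qed

lemma epi_idt: "a \<in> Obj \<Longrightarrow> epi (idt a)" and mono_idt: "a \<in> Obj \<Longrightarrow> mono (idt a)"
  unfolding epi_def mono_def by (metis arr_idt cd_idt cmp_idt, metis arr_idt dm_idt idt_cmp)

lemma split_epi: "\<lbrakk>p \<bullet> i = idt a; a \<in> Obj\<rbrakk> \<Longrightarrow> epi p"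
  by (metis epi_cmpD epi_idt)

lemma split_mono: "\<lbrakk>p \<bullet> i = idt a; a \<in> Obj\<rbrakk> \<Longrightarrow> mono i"
  by (metis mono_cmpD mono_idt)

lemma inv_pair_sym: "inv_pair f g \<Longrightarrow> inv_pair g f"
  by (auto simp: inv_pair_def)

lemma inv_pair_iso: "inv_pair f g \<Longrightarrow> iso f" "inv_pair f g \<Longrightarrow> iso g"
  by (auto simp: iso_def dest: inv_pair_sym)

lemma iso_epi: "iso f \<Longrightarrow> epi f" and iso_mono: "iso f \<Longrightarrow> mono f"
  by (auto simp: iso_def inv_pair_def intro: split_epi split_mono)

lemma iso_idt: "a \<in> Obj \<Longrightarrow> iso (idt a)"
  by (auto simp: iso_def inv_pair_def intro!: exI[of _ "idt a"])

lemma iso_cmp: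
  assumes "iso f" "iso g" "dm g = cd f" shows "iso (g \<bullet> f)"
proof -
  obtain f' g' where "inv_pair f f'" "inv_pair g g'"
    using assms by (auto simp: iso_def)
  then have "inv_pair (g \<bullet> f) (f' \<bullet> g')"
    using assms(3) by (simp add: inv_pair_def cmp_reassoc)
  then show ?thesis by (auto simp: iso_def)
qed

lemma split_mono_epi_iso:
  assumes "mono p" "p \<bullet> i = idt (cd p)"
  shows "iso p"
proof -
  have a: "arr p" "arr i" "dm p = cd i" "dm i = cd p"
    using assms(1) cmp_arrD[OF assms(2)] by simp_all
  have "p \<bullet> i \<bullet> p = p \<bullet> idt (dm p)"
    using a by (simp add: cmp_reassoc[OF assms(2)])
  then have "i \<bullet> p = idt (dm p)"
    by (rule monoD[OF assms(1), rotated 4]) (use a in auto)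
  then have "inv_pair p i" using assms(2) a by (simp add: inv_pair_def)
  then show ?thesis by (auto simp: iso_def)
qed

lemma proj_lift: "\<lbrakk>proj p; epi e; arr f; dm f = p; cd f = cd e\<rbrakk> \<Longrightarrow> \<exists>g. e \<bullet> g = f"
  by (auto simp: proj_def)

lemma proj_split: "\<lbrakk>proj p; epi e; cd e = p\<rbrakk> \<Longrightarrow> \<exists>s. e \<bullet> s = idt p"
  by (auto simp: proj_def)

lemma proj_Obj: "proj p \<Longrightarrow> p \<in> Obj"
  by (simp add: proj_def)

lemma retractI: "\<lbrakk>p \<bullet> i = idt a; a \<in> Obj; dm p = b\<rbrakk> \<Longrightarrow> retract a b"
  unfolding retract_def using cmp_arrD by (metis arr_idt dm_idt)

lemma retractE:
  assumes "retract a b"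
  obtains i p where "arr i" "arr p" "dm i = a" "cd i = b" "dm p = b" "cd p = a" "p \<bullet> i = idt a"
proof -
  obtain i p where "arr i" "arr p" "dm i = a" "cd i = b" "dm p = b" "p \<bullet> i = idt a"
    using assms by (auto simp: retract_def)
  moreover then have "cd p = a" by (metis cd_cmp cd_idt dm_Obj)
  ultimately show ?thesis using that by blast
qed

lemma iso_retract: "iso f \<Longrightarrow> retract (dm f) (cd f)" "iso f \<Longrightarrow> retract (cd f) (dm f)"
  by (auto simp: iso_def inv_pair_def retract_def)

lemma retract_trans:
  assumes "retract a b" "retract b c" shows "retract a c"
proof -
  obtain i p where 1: "arr i" "arr p" "dm i = a" "cd i = b" "dm p = b" "cd p = a" "p \<bullet> i = idt a"
    by (rule retractE[OF assms(1)])
  obtain j q where 2: "arr j" "arr q" "dm j = b" "cd j = c" "dm q = c" "cd q = b" "q \<bullet> j = idt b"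
    by (rule retractE[OF assms(2)])
  have "(p \<bullet> q) \<bullet> (j \<bullet> i) = idt a"
    using 1 2 by (simp add: cmp_reassoc)
  then show ?thesis
    by (rule retractI) (use 1 2 in auto)
qed

lemma proj_retract:
  assumes "retract a b" "proj b" shows "proj a"
proof -
  obtain i p where 1: "arr i" "arr p" "dm i = a" "cd i = b" "dm p = b" "cd p = a" "p \<bullet> i = idt a"
    by (rule retractE[OF assms(1)])
  show ?thesis
    unfolding proj_def
  proof (intro conjI allI impI)
    show "a \<in> Obj" using 1 by auto
    fix e f assume ef: "epi e \<and> arr f \<and> dm f = a \<and> cd f = cd e"
    then obtain g where "e \<bullet> g = f \<bullet> p"
      using proj_lift[OF assms(2), of e "f \<bullet> p"] 1 by auto
    then have "e \<bullet> g \<bullet> i = f"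
      using ef 1 by (simp add: cmp_reassoc)
    then show "\<exists>g. e \<bullet> g = f" by blast
  qed
qed

end


section \<open>Abelian categories\<close>

locale preadd = acat Obj arr dm cd cmp idt
  for Obj :: "'o set" and arr :: "'f \<Rightarrow> bool" and dm cd
    and cmp (infixr \<open>\<bullet>\<close> 60) and idt +
  fixes add :: "'f \<Rightarrow> 'f \<Rightarrow> 'f"  (infixl \<open>+++\<close> 65)
    and neg :: "'f \<Rightarrow> 'f" and zer :: "'o \<Rightarrow> 'o \<Rightarrow> 'f"
  assumes arr_add [simp]: "\<lbrakk>arr f; arr g; dm f = dm g; cd f = cd g\<rbrakk> \<Longrightarrow>
      arr (f +++ g) \<and> dm (f +++ g) = dm f \<and> cd (f +++ g) = cd f"
    and arr_neg [simp]: "arr f \<Longrightarrow> arr (neg f) \<and> dm (neg f) = dm f \<and> cd (neg f) = cd f"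
    and arr_zer [simp]: "\<lbrakk>a \<in> Obj; b \<in> Obj\<rbrakk> \<Longrightarrow> arr (zer a b) \<and> dm (zer a b) = a \<and> cd (zer a b) = b"
    and add_assoc: "\<lbrakk>arr f; arr g; arr h; dm f = dm g; cd f = cd g; dm g = dm h; cd g = cd h\<rbrakk>
      \<Longrightarrow> (f +++ g) +++ h = f +++ (g +++ h)"
    and add_comm: "\<lbrakk>arr f; arr g; dm f = dm g; cd f = cd g\<rbrakk> \<Longrightarrow> f +++ g = g +++ f"
    and zer_add [simp]: "\<lbrakk>arr f; dm f = a; cd f = b\<rbrakk> \<Longrightarrow> zer a b +++ f = f"
    and neg_add [simp]: "arr f \<Longrightarrow> neg f +++ f = zer (dm f) (cd f)"
    and cmp_add: "\<lbrakk>arr f; arr f'; dm f = dm f'; cd f = cd f'; arr g; dm g = cd f\<rbrakk>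
      \<Longrightarrow> g \<bullet> (f +++ f') = (g \<bullet> f) +++ (g \<bullet> f')"
    and add_cmp: "\<lbrakk>arr g; arr g'; dm g = dm g'; cd g = cd g'; arr f; dm g = cd f\<rbrakk>
      \<Longrightarrow> (g +++ g') \<bullet> f = (g \<bullet> f) +++ (g' \<bullet> f)"
begin

lemma add_zer [simp]: "\<lbrakk>arr f; dm f = a; cd f = b\<rbrakk> \<Longrightarrow> f +++ zer a b = f"
  by (metis add_comm arr_zer cd_Obj dm_Obj zer_add)

lemma add_neg [simp]: "arr f \<Longrightarrow> f +++ neg f = zer (dm f) (cd f)"
  by (metis add_comm arr_neg neg_add)

lemma add_left_cancel:
  assumes "arr f" "arr g" "arr h" "dm f = dm g" "cd f = cd g" "dm f = dm h" "cd f = cd h"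
    "f +++ g = f +++ h"
  shows "g = h"
proof -
  have "(neg f +++ f) +++ g = neg f +++ (f +++ g)" by (rule add_assoc) (use assms in auto)
  also have "\<dots> = (neg f +++ f) +++ h"
    unfolding assms(8) by (rule add_assoc[symmetric]) (use assms in auto)
  finally have "(neg f +++ f) +++ g = (neg f +++ f) +++ h" .
  then show ?thesis using assms by simp
qed

lemma neg_zer [simp]: "\<lbrakk>a \<in> Obj; b \<in> Obj\<rbrakk> \<Longrightarrow> neg (zer a b) = zer a b"
  using zer_add[of "neg (zer a b)" a b] add_neg[of "zer a b"] by simp

lemma diff_zer: "\<lbrakk>arr f; arr g; dm f = dm g; cd f = cd g; f +++ neg g = zer (dm f) (cd f)\<rbrakk> \<Longrightarrow> f = g"
  by (metis add_comm add_left_cancel add_neg arr_neg)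

lemma cmp_zer [simp]:
  assumes "arr f" "b = dm f" "a \<in> Obj"
  shows "f \<bullet> zer a b = zer a (cd f)"
proof -
  let ?z = "f \<bullet> zer a b"
  have "?z +++ ?z = f \<bullet> (zer a b +++ zer a b)"
    using assms by (subst cmp_add) auto
  then have "?z +++ ?z = ?z +++ zer a (cd f)" using assms by simp
  then show ?thesis
    by (rule add_left_cancel[rotated 7]) (use assms in auto)
qed

lemma zer_cmp [simp]:
  assumes "arr f" "a = cd f" "b \<in> Obj"
  shows "zer a b \<bullet> f = zer (dm f) b"
proof -
  let ?z = "zer a b \<bullet> f"
  have "?z +++ ?z = (zer a b +++ zer a b) \<bullet> f"
    using assms by (subst add_cmp) auto
  then have "?z +++ ?z = ?z +++ zer (dm f) b" using assms by simp
  then show ?thesis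
    by (rule add_left_cancel[rotated 7]) (use assms in auto)
qed

lemma cmp_neg [simp]:
  assumes "arr f" "arr g" "dm g = cd f"
  shows "g \<bullet> neg f = neg (g \<bullet> f)"
proof -
  have "(g \<bullet> f) +++ (g \<bullet> neg f) = g \<bullet> (f +++ neg f)"
    using assms by (subst cmp_add) auto
  also have "\<dots> = (g \<bullet> f) +++ neg (g \<bullet> f)" using assms by simp
  finally show ?thesis
    by (rule add_left_cancel[rotated 7]) (use assms in auto)
qed

lemma neg_cmp [simp]:
  assumes "arr f" "arr g" "dm g = cd f"
  shows "neg g \<bullet> f = neg (g \<bullet> f)"
proof -
  have "(g \<bullet> f) +++ (neg g \<bullet> f) = (g +++ neg g) \<bullet> f"
    using assms by (subst add_cmp) auto
  also have "\<dots> = (g \<bullet> f) +++ neg (g \<bullet> f)" using assms by simp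
  finally show ?thesis
    by (rule add_left_cancel[rotated 7]) (use assms in auto)
qed

lemma mono_iff:
  "mono f \<longleftrightarrow> arr f \<and> (\<forall>g. arr g \<and> cd g = dm f \<and> f \<bullet> g = zer (dm g) (cd f) \<longrightarrow> g = zer (dm g) (dm f))"
  (is "_ \<longleftrightarrow> ?R")
proof
  assume m: "mono f"
  show ?R
  proof (intro conjI allI impI)
    fix g assume g: "arr g \<and> cd g = dm f \<and> f \<bullet> g = zer (dm g) (cd f)"
    then have "f \<bullet> g = f \<bullet> zer (dm g) (dm f)" using m by simp
    then show "g = zer (dm g) (dm f)"
      by (rule monoD[OF m, rotated 4]) (use g m in auto)
  qed (use m in simp)
next
  assume R: ?R
  show "mono f" unfolding mono_def
  proof (intro conjI allI impI)
    fix g h assume gh: "arr g \<and> arr h \<and> dm g = dm h \<and> cd g = dm f \<and> cd h = dm f \<and> f \<bullet> g = f \<bullet> h"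
    then have "f \<bullet> (g +++ neg h) = zer (dm h) (cd f)" using R by (simp add: cmp_add)
    then have "g +++ neg h = zer (dm h) (dm f)" using R gh by (metis arr_add arr_neg)
    then show "g = h" using gh by - (rule diff_zer, auto)
  qed (use R in simp)
qed

lemma epi_iff:
  "epi f \<longleftrightarrow> arr f \<and> (\<forall>g. arr g \<and> dm g = cd f \<and> g \<bullet> f = zer (dm f) (cd g) \<longrightarrow> g = zer (cd f) (cd g))"
  (is "_ \<longleftrightarrow> ?R")
proof
  assume m: "epi f"
  show ?R
  proof (intro conjI allI impI)
    fix g assume g: "arr g \<and> dm g = cd f \<and> g \<bullet> f = zer (dm f) (cd g)"
    then have "g \<bullet> f = zer (cd f) (cd g) \<bullet> f" using m by simp
    then show "g = zer (cd f) (cd g)"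
      by (rule epiD[OF m, rotated 4]) (use g m in auto)
  qed (use m in simp)
next
  assume R: ?R
  show "epi f" unfolding epi_def
  proof (intro conjI allI impI)
    fix g h assume gh: "arr g \<and> arr h \<and> cd g = cd h \<and> dm g = cd f \<and> dm h = cd f \<and> g \<bullet> f = h \<bullet> f"
    then have "(g +++ neg h) \<bullet> f = zer (dm f) (cd h)" using R by (simp add: add_cmp)
    then have "g +++ neg h = zer (cd f) (cd h)" using R gh by (metis arr_add arr_neg)
    then show "g = h" using gh by - (rule diff_zer, auto)
  qed (use R in simp)
qed

text \<open>Uniqueness of the factorisation is encoded by requiring \<open>k\<close> to be monic,
  and dually in \<open>is_cok\<close>.\<close>

definition is_ker :: "'f \<Rightarrow> 'f \<Rightarrow> bool" where
  "is_ker f k \<longleftrightarrow> arr f \<and> mono k \<and> cd k = dm f \<and> f \<bullet> k = zer (dm k) (cd f) \<and>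
     (\<forall>g. arr g \<and> cd g = dm f \<and> f \<bullet> g = zer (dm g) (cd f) \<longrightarrow> (\<exists>h. k \<bullet> h = g))"

definition is_cok :: "'f \<Rightarrow> 'f \<Rightarrow> bool" where
  "is_cok f p \<longleftrightarrow> arr f \<and> epi p \<and> dm p = cd f \<and> p \<bullet> f = zer (dm f) (cd p) \<and>
     (\<forall>g. arr g \<and> dm g = cd f \<and> g \<bullet> f = zer (dm f) (cd g) \<longrightarrow> (\<exists>h. h \<bullet> p = g))"

definition biprod :: "'f \<Rightarrow> 'f \<Rightarrow> 'f \<Rightarrow> 'f \<Rightarrow> bool" where
  "biprod i p j q \<longleftrightarrow> arr i \<and> arr p \<and> arr j \<and> arr q \<and> cd i = cd j \<and> dm p = cd i \<and> dm q = cd j \<and>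
     cd p = dm i \<and> cd q = dm j \<and>
     p \<bullet> i = idt (dm i) \<and> q \<bullet> j = idt (dm j) \<and> p \<bullet> j = zer (dm j) (dm i) \<and> q \<bullet> i = zer (dm i) (dm j) \<and>
     (i \<bullet> p) +++ (j \<bullet> q) = idt (cd i)"

definition null :: "'o \<Rightarrow> bool" where
  "null a \<longleftrightarrow> a \<in> Obj \<and> idt a = zer a a"

lemma null_arr: "\<lbrakk>null (dm f); arr f\<rbrakk> \<Longrightarrow> f = zer (dm f) (cd f)"
  "\<lbrakk>null (cd f); arr f\<rbrakk> \<Longrightarrow> f = zer (dm f) (cd f)"
  by (metis null_def cmp_idt cmp_zer, metis null_def idt_cmp zer_cmp)

lemma null_epi: "\<lbrakk>null (dm f); epi f\<rbrakk> \<Longrightarrow> null (cd f)"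
proof -
  assume a: "null (dm f)" "epi f"
  have "idt (cd f) \<bullet> f = zer (cd f) (cd f) \<bullet> f" using null_arr(1)[OF a(1)] a(2) by simp
  then have "idt (cd f) = zer (cd f) (cd f)"
    by (rule epiD[OF a(2), rotated 4]) (use a in auto)
  then show ?thesis using a by (simp add: null_def)
qed

lemma zer_epi_null:
  assumes "epi f" "f = zer (dm f) (cd f)"
  shows "null (cd f)"
proof -
  have "idt (cd f) \<bullet> f = f" using assms(1) by simp
  also have "\<dots> = zer (cd f) (cd f) \<bullet> f" using assms(1) by (subst assms(2)) simp
  finally have "idt (cd f) = zer (cd f) (cd f)"
    by (rule epiD[OF assms(1), rotated 4]) (use assms(1) in auto)
  then show ?thesis using assms(1) by (simp add: null_def)
qed

text \<open>The idempotent 1 - i p is killed by \<open>p\<close>, so it factors through the kernel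
  as j q; cancelling the monic \<open>j\<close> yields the remaining identities of a direct
  sum.\<close>

lemma retract_complement:
  assumes i: "arr i" "arr p" "dm p = cd i" "p \<bullet> i = idt (dm i)" and k: "is_ker p j"
  shows "\<exists>q. biprod i p j q"
proof -
  have pa: "cd p = dm i" using i by (metis cd_cmp cd_idt dm_Obj)
  have j: "arr j" "cd j = dm p" "p \<bullet> j = zer (dm j) (cd p)" "mono j" using k by (auto simp: is_ker_def)
  let ?e = "idt (cd i) +++ neg (i \<bullet> p)"
  have e: "arr ?e" "dm ?e = cd i" "cd ?e = cd i" using i pa by auto
  have "p \<bullet> ?e = zer (cd i) (cd p)"
    using i pa by (simp add: cmp_add cmp_reassoc[OF i(4)])
  then obtain q where q: "j \<bullet> q = ?e" using k e i by (auto simp: is_ker_def)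
  have qa: "arr q" "cd q = dm j" "dm q = cd i"
    using cmp_arrD[OF q e(1)] e by auto
  have "j \<bullet> q \<bullet> j = j \<bullet> idt (dm j)"
    using i j pa qa by (simp add: cmp_reassoc[OF q] add_cmp)
  then have qj: "q \<bullet> j = idt (dm j)"
    by (rule monoD[OF j(4), rotated 4]) (use i j qa in auto)
  have "j \<bullet> q \<bullet> i = j \<bullet> zer (dm i) (dm j)"
    using i j pa qa by (simp add: cmp_reassoc[OF q] add_cmp)
  then have qi: "q \<bullet> i = zer (dm i) (dm j)"
    by (rule monoD[OF j(4), rotated 4]) (use i j qa in auto)
  have "(i \<bullet> p) +++ (j \<bullet> q) = (i \<bullet> p) +++ (neg (i \<bullet> p) +++ idt (cd i))"
    unfolding q using i pa by (subst (2) add_comm) auto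
  also have "\<dots> = ((i \<bullet> p) +++ neg (i \<bullet> p)) +++ idt (cd i)"
    by (rule add_assoc[symmetric]) (use i pa in auto)
  finally have "(i \<bullet> p) +++ (j \<bullet> q) = idt (cd i)" using i pa by simp
  then have "biprod i p j q"
    using i j pa qa qj qi by (simp add: biprod_def)
  then show ?thesis ..
qed

text \<open>A map that vanishes on the first summand equals its restriction to the second one after
  the projection \<open>q\<close>. This is what allows a summand lying in the kernel to be dropped
  from a cover.\<close>

lemma biprod_epi:
  assumes "biprod i p j q" "arr f" "dm f = cd i" "epi f" "f \<bullet> i = zer (dm i) (cd f)"
  shows "epi (f \<bullet> j)"
proof -
  have "f = f \<bullet> ((i \<bullet> p) +++ (j \<bullet> q))" using assms by (simp add: biprod_def)
  also have "\<dots> = (f \<bullet> i \<bullet> p) +++ (f \<bullet> j \<bullet> q)"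
    by (rule cmp_add) (use assms in \<open>auto simp: biprod_def\<close>)
  also have "\<dots> = (f \<bullet> j) \<bullet> q"
    using assms by (simp add: biprod_def cmp_reassoc[OF assms(5)])
  finally show ?thesis using assms(4) epi_cmpD by metis
qed

lemma biprod_joint_epi:
  assumes b: "biprod i p j q" and f: "arr f" "dm f = cd i" "f \<bullet> i = zer (dm i) (cd f)" "f \<bullet> j = zer (dm j) (cd f)"
  shows "f = zer (dm f) (cd f)"
proof -
  have "f = f \<bullet> ((i \<bullet> p) +++ (j \<bullet> q))" using assms by (simp add: biprod_def)
  also have "\<dots> = (f \<bullet> i \<bullet> p) +++ (f \<bullet> j \<bullet> q)"
    by (rule cmp_add) (use assms in \<open>auto simp: biprod_def\<close>)
  also have "\<dots> = zer (dm f) (cd f)"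
    using assms by (simp add: biprod_def cmp_reassoc[OF f(3)] cmp_reassoc[OF f(4)])
  finally show ?thesis .
qed

lemma biprod_copair_epi:
  assumes b: "biprod i p j q" and b': "biprod i' p' j' q'"
    and e: "epi e" "epi e'" "cd e = dm i" "cd e' = dm j" "dm e = dm i'" "dm e' = dm j'"
  shows "epi ((i \<bullet> e \<bullet> p') +++ (j \<bullet> e' \<bullet> q'))"
    "dm ((i \<bullet> e \<bullet> p') +++ (j \<bullet> e' \<bullet> q')) = cd i'" "cd ((i \<bullet> e \<bullet> p') +++ (j \<bullet> e' \<bullet> q')) = cd i"
proof -
  let ?f = "(i \<bullet> e \<bullet> p') +++ (j \<bullet> e' \<bullet> q')"
  note B = b[unfolded biprod_def] and B' = b'[unfolded biprod_def]
  show f: "dm ?f = cd i'" "cd ?f = cd i" using B B' e by auto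
  have fa: "arr ?f" using B B' e by auto
  have fi: "?f \<bullet> i' = i \<bullet> e" using B B' e by (simp add: add_cmp)
  have fj: "?f \<bullet> j' = j \<bullet> e'" using B B' e by (simp add: add_cmp)
  show "epi ?f" unfolding epi_iff
  proof (intro conjI allI impI fa)
    fix g assume g: "arr g \<and> dm g = cd ?f \<and> g \<bullet> ?f = zer (dm ?f) (cd g)"
    then have g: "arr g" "dm g = cd i" and g0: "g \<bullet> ?f = zer (cd i') (cd g)" using f by auto
    have "(g \<bullet> i) \<bullet> e = zer (dm i) (cd g) \<bullet> e"
      using g fa f B B' e cmp_reassoc[OF g0, of i'] by (simp add: fi)
    then have gi: "g \<bullet> i = zer (dm i) (cd g)"
      by (rule epiD[OF e(1), rotated 4]) (use g B e in auto)
    have "(g \<bullet> j) \<bullet> e' = zer (dm j) (cd g) \<bullet> e'"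
      using g fa f B B' e cmp_reassoc[OF g0, of j'] by (simp add: fj)
    then have gj: "g \<bullet> j = zer (dm j) (cd g)"
      by (rule epiD[OF e(2), rotated 4]) (use g B e in auto)
    show "g = zer (cd ?f) (cd g)"
      using biprod_joint_epi[OF b g gi gj] g f by simp
  qed
qed

end

text \<open>Only monomorphisms are required to be normal here; the category of modules is shown to
  satisfy exactly these axioms. Normality of epimorphisms is added in \<open>rigid\<close>.\<close>

locale abel = preadd Obj arr dm cd cmp idt add neg zer
  for Obj :: "'o set" and arr :: "'f \<Rightarrow> bool" and dm cd
    and cmp (infixr \<open>\<bullet>\<close> 60) and idt and add (infixl \<open>+++\<close> 65) and neg and zer +
  assumes ex_ker: "arr f \<Longrightarrow> \<exists>k. is_ker f k"
    and ex_cok: "arr f \<Longrightarrow> \<exists>p. is_cok f p"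
    and mono_ker: "mono k \<Longrightarrow> \<exists>f. is_ker f k"
    and ex_biprod: "\<lbrakk>a \<in> Obj; b \<in> Obj\<rbrakk> \<Longrightarrow> \<exists>i p j q. biprod i p j q \<and> dm i = a \<and> dm j = b"
begin

lemma mono_epi_iso:
  assumes "mono m" "epi m" shows "iso m"
proof -
  obtain f where f: "is_ker f m" using mono_ker[OF assms(1)] ..
  then have "f = zer (dm f) (cd f)"
    using assms(2) unfolding is_ker_def epi_iff by metis
  then have "f \<bullet> idt (dm f) = zer (dm f) (cd f)" using f by (simp add: is_ker_def)
  then obtain s where "m \<bullet> s = idt (dm f)" using f unfolding is_ker_def by (metis arr_idt cd_idt dm_Obj dm_idt)
  then have "m \<bullet> s = idt (cd m)" using f by (simp add: is_ker_def)
  then show ?thesis using split_mono_epi_iso[OF assms(1)] by blast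
qed

text \<open>If \<open>m\<close> is a kernel of \<open>f\<close>, then \<open>f\<close> factors
  through the cokernel \<open>p\<close> of \<open>m\<close>, so whatever \<open>p\<close> kills is
  killed by \<open>f\<close> and factors through \<open>m\<close>.\<close>

lemma mono_ker_cok:
  assumes "mono m" "is_cok m p" shows "is_ker p m"
proof -
  obtain f where f: "is_ker f m" using mono_ker[OF assms(1)] ..
  then obtain h where h: "h \<bullet> p = f" using assms(2) unfolding is_ker_def is_cok_def by metis
  have ha: "arr h" "dm h = cd p" "cd h = cd f" "arr p" "dm p = dm f"
    using cmp_arrD[OF h] f by (auto simp: is_ker_def)
  show ?thesis unfolding is_ker_def
  proof (intro conjI allI impI)
    fix g assume g: "arr g \<and> cd g = dm p \<and> p \<bullet> g = zer (dm g) (cd p)"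
    then have ga: "arr g" "cd g = dm p" "p \<bullet> g = zer (dm g) (cd p)" by auto
    have "f \<bullet> g = h \<bullet> zer (dm g) (cd p)" unfolding ga(3)[symmetric] h[symmetric] by simp
    then have "f \<bullet> g = zer (dm g) (cd f)" using ha ga by simp
    moreover have "cd g = dm f" using ga ha by simp
    ultimately show "\<exists>h. m \<bullet> h = g" using f ga(1) unfolding is_ker_def by blast
  next
    show "p \<bullet> m = zer (dm m) (cd p)" "cd m = dm p" "mono m" "arr p"
      using assms by (auto simp: is_cok_def)
  qed
qed

lemma ker_null_mono:
  assumes k: "is_ker f k" and n: "null (dm k)"
  shows "mono f"
  unfolding mono_iff
proof (intro conjI allI impI)
  show "arr f" using k by (simp add: is_ker_def)
  fix g assume g: "arr g \<and> cd g = dm f \<and> f \<bullet> g = zer (dm g) (cd f)"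
  then obtain h where h: "k \<bullet> h = g" using k unfolding is_ker_def by blast
  then have ha: "arr k" "arr h" "cd h = dm k" "dm g = dm h" using cmp_arrD[OF h] g by auto
  have "h = zer (dm h) (dm k)" using null_arr(2)[of h] ha n by simp
  then have "k \<bullet> h = k \<bullet> zer (dm h) (dm k)" by simp
  then show "g = zer (dm g) (dm f)" using ha h k by (simp add: is_ker_def)
qed

lemma cok_null_epi:
  assumes p: "is_cok f p" and n: "null (cd p)"
  shows "epi f"
  unfolding epi_iff
proof (intro conjI allI impI)
  show "arr f" using p by (simp add: is_cok_def)
  fix g assume g: "arr g \<and> dm g = cd f \<and> g \<bullet> f = zer (dm f) (cd g)"
  then obtain h where h: "h \<bullet> p = g" using p unfolding is_cok_def by blast
  then have ha: "arr p" "arr h" "dm h = cd p" "cd g = cd h" using cmp_arrD[OF h] g by auto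
  have "h = zer (cd p) (cd h)" using null_arr(1)[of h] ha n by simp
  then have "h \<bullet> p = zer (cd p) (cd h) \<bullet> p" by simp
  then show "g = zer (cd f) (cd g)" using ha h p by (simp add: is_cok_def)
qed

text \<open>The monic part \<open>m\<close> is the kernel of the cokernel of \<open>f\<close>. For
  the epic part, let \<open>g\<close> kill \<open>e\<close> and let \<open>n\<close> be its kernel:
  m n is monic, hence the kernel of some \<open>h\<close>, and \<open>h\<close> kills
  \<open>f\<close>. So \<open>h\<close> factors through the cokernel and kills \<open>m\<close>,
  which makes \<open>n\<close> split epic and \<open>g\<close> zero.\<close>

lemma image:
  assumes "arr f"
  shows "\<exists>m e. mono m \<and> epi e \<and> m \<bullet> e = f"
proof -
  obtain p where p: "is_cok f p" using ex_cok[OF assms] ..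
  have "arr p" using p by (simp add: is_cok_def)
  then obtain m where m: "is_ker p m" using ex_ker by blast
  obtain e where e: "m \<bullet> e = f" using p m unfolding is_cok_def is_ker_def by metis
  have ea: "arr e" "cd e = dm m" "dm e = dm f" "arr m" "cd m = cd f" "mono m"
    using cmp_arrD[OF e assms] m by (auto simp: is_ker_def)
  have "epi e" unfolding epi_iff
  proof (intro conjI allI impI ea)
    fix g assume g: "arr g \<and> dm g = cd e \<and> g \<bullet> e = zer (dm e) (cd g)"
    obtain n where n: "is_ker g n" using ex_ker g by blast
    obtain e' where e': "n \<bullet> e' = e" using n g ea unfolding is_ker_def by metis
    have na: "mono n" "cd n = dm m" "arr e'" "dm n = cd e'" "dm e' = dm f"
      using cmp_arrD[OF e' ea(1)] n g ea by (auto simp: is_ker_def)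
    have "mono (m \<bullet> n)" using na ea by (intro mono_cmp) auto
    then obtain h where h: "is_ker h (m \<bullet> n)" using mono_ker by blast
    have ha: "arr h" "dm h = cd m" "h \<bullet> m \<bullet> n = zer (dm n) (cd h)"
      using h na ea by (auto simp: is_ker_def)
    have "h \<bullet> f = zer (dm f) (cd h)"
      using cmp_reassoc[OF ha(3), of e'] ha na ea by (simp add: e' e)
    then obtain h' where h': "h' \<bullet> p = h" using p ha ea unfolding is_cok_def by metis
    have "h \<bullet> m = h' \<bullet> zer (dm m) (cd p)"
      using m unfolding h'[symmetric] is_ker_def by simp
    then have "h \<bullet> m = zer (dm m) (cd h)"
      using ea cmp_arrD[OF h' ha(1)] by simp
    then obtain s where s: "(m \<bullet> n) \<bullet> s = m" using h ha ea unfolding is_ker_def by metis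
    have sa: "arr s" "dm s = dm m" "cd s = dm n" using cmp_arrD[OF s] ea na by auto
    have "m \<bullet> (n \<bullet> s) = m \<bullet> idt (dm m)" using s ea by simp
    then have "n \<bullet> s = idt (dm m)"
      by (rule monoD[OF ea(6), rotated 4]) (use sa na ea in auto)
    then have "g = (g \<bullet> n) \<bullet> s" using g ea by simp
    also have "g \<bullet> n = zer (dm n) (cd g)" using n by (simp add: is_ker_def)
    also have "zer (dm n) (cd g) \<bullet> s = zer (cd e) (cd g)" using g sa ea na by simp
    finally show "g = zer (cd e) (cd g)" .
  qed
  then show ?thesis using e ea by blast
qed

lemma ex_complement:
  assumes "arr i" "arr p" "dm p = cd i" "p \<bullet> i = idt (dm i)"
  shows "\<exists>j q. biprod i p j q"
  using retract_complement[OF assms] ex_ker[OF assms(2)] by blast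

end

section \<open>Minimal projective covers in abelian categories with a size function\<close>

locale sized_abel = abel +
  fixes sz :: "'a \<Rightarrow> nat"
  assumes mono_size: "mono m \<Longrightarrow> sz (dm m) \<le> sz (cd m)"
    and mono_size_iso: "\<lbrakk>mono m; sz (cd m) \<le> sz (dm m)\<rbrakk> \<Longrightarrow> iso m"
    and epi_size_iso: "\<lbrakk>epi e; sz (dm e) \<le> sz (cd e)\<rbrakk> \<Longrightarrow> iso e"
begin

text \<open>Minimality of a projective cover is expressed by its endomorphisms over the target. In
  this form it shows that a minimal cover of a summand is itself a summand of any projective cover
  of the whole.\<close>

definition min_cover :: "'b \<Rightarrow> bool" where
  "min_cover \<pi> \<longleftrightarrow> epi \<pi> \<and> proj (dm \<pi>) \<and>
     (\<forall>\<theta>. arr \<theta> \<and> dm \<theta> = dm \<pi> \<and> cd \<theta> = dm \<pi> \<and> \<pi> \<bullet> \<theta> = \<pi> \<longrightarrow> iso \<theta>)"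

text \<open>Among the subobjects of a projective cover that still cover the target, one of minimal size
  is a retract of the cover.\<close>

lemma ex_min_cover:
  assumes e: "epi e" "proj (dm e)"
  shows "\<exists>\<pi>. min_cover \<pi> \<and> cd \<pi> = cd e"
proof -
  define good where "good u \<longleftrightarrow> mono u \<and> cd u = dm e \<and> epi (e \<bullet> u)" for u
  have "good (idt (dm e))" using e by (simp add: good_def mono_idt)
  then obtain u where u: "good u" and least: "\<And>v. good v \<Longrightarrow> sz (dm u) \<le> sz (dm v)"
    using arg_min_nat_lemma[of good _ "\<lambda>u. sz (dm u)"] by metis
  have ua: "arr u" "mono u" "cd u = dm e" "epi (e \<bullet> u)" using u by (auto simp: good_def)
  \<comment> \<open>The image of \<theta> composed with \<open>u\<close> is again a good subobject,
    so minimal size makes the inclusion \<open>m\<close> invertible; then \<theta> is an epic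
    endomorphism and invertible for reasons of size.\<close>
  have endo: "iso \<theta>" if t: "arr \<theta>" "dm \<theta> = dm u" "cd \<theta> = dm u" "(e \<bullet> u) \<bullet> \<theta> = e \<bullet> u" for \<theta>
  proof -
    obtain m k where mk: "mono m" "epi k" "m \<bullet> k = \<theta>" using image[OF t(1)] by blast
    have ma: "arr k" "dm k = dm u" "cd k = dm m" "arr m" "cd m = dm u"
      using cmp_arrD[OF mk(3) t(1)] mk t by auto
    have "epi ((e \<bullet> u \<bullet> m) \<bullet> k)" using ua(4) t(4) by (simp add: mk(3))
    then have "epi (e \<bullet> u \<bullet> m)" by (rule epi_cmpD)
    then have "good (u \<bullet> m)"
      using ua ma mk mono_cmp[OF mk(1) ua(2)] by (simp add: good_def)
    then have "sz (dm u) \<le> sz (dm m)" using least[of "u \<bullet> m"] ua ma by simp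
    then have "iso m" using mono_size_iso[OF mk(1)] ma by simp
    then have "epi \<theta>" using mk epi_cmp[OF mk(2) iso_epi[of m]] ma by simp
    then show ?thesis using epi_size_iso t by simp
  qed
  \<comment> \<open>Projectivity of the large cover gives a map back to the small one. The
    endomorphism g u lies over the target, hence is invertible, and this splits
    \<open>u\<close>.\<close>
  have "\<exists>g. (e \<bullet> u) \<bullet> g = e" by (rule proj_lift[OF e(2) ua(4)]) (use e ua in auto)
  then obtain g where g: "(e \<bullet> u) \<bullet> g = e" by blast
  have ga: "arr g" "dm g = dm e" "cd g = dm u" using cmp_arrD[OF g] e ua by auto
  have "iso (g \<bullet> u)"
    using ga ua e by (intro endo) (simp_all add: cmp_reassoc[OF g[simplified]] cmp_reassoc3[OF g[simplified]])
  then obtain w where w: "inv_pair (g \<bullet> u) w" by (auto simp: iso_def)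
  have "retract (dm u) (dm e)"
    by (rule retractI[of "w \<bullet> g" u]) (use w ga ua in \<open>auto simp: inv_pair_def\<close>)
  then have "proj (dm u)" using proj_retract e by blast
  then have "min_cover (e \<bullet> u)" using endo ua e by (simp add: min_cover_def)
  then show ?thesis using ua e by (intro exI[of _ "e \<bullet> u"]) auto
qed

end

section \<open>Monoidal categories and duals\<close>

text \<open>The inverses \<open>asi\<close>, \<open>lui\<close> and \<open>rui\<close> are part of
  the data, so that reversing the order of tensor factors merely exchanges parameters of the same
  locale.\<close>

locale moncat = acat Obj arr dm cd cmp idt
  for Obj :: "'o set" and arr :: "'f \<Rightarrow> bool" and dm cd
    and cmp (infixr \<open>\<bullet>\<close> 60) and idt +
  fixes tob :: "'o \<Rightarrow> 'o \<Rightarrow> 'o"  (infixl \<open>**\<close> 70)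
    and ten :: "'f \<Rightarrow> 'f \<Rightarrow> 'f"  (infixl \<open>##\<close> 70)
    and unt :: "'o"
    and asc asi :: "'o \<Rightarrow> 'o \<Rightarrow> 'o \<Rightarrow> 'f"
    and lun lui run rui :: "'o \<Rightarrow> 'f"
  assumes unt_Obj [simp]: "unt \<in> Obj"
    and tob_Obj [simp]: "\<lbrakk>a \<in> Obj; b \<in> Obj\<rbrakk> \<Longrightarrow> a ** b \<in> Obj"
    and arr_ten [simp]: "\<lbrakk>arr f; arr g\<rbrakk> \<Longrightarrow>
      arr (f ## g) \<and> dm (f ## g) = dm f ** dm g \<and> cd (f ## g) = cd f ** cd g"
    and idt_ten [simp]: "\<lbrakk>a \<in> Obj; b \<in> Obj\<rbrakk> \<Longrightarrow> idt a ## idt b = idt (a ** b)"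
    and ten_cmp: "\<lbrakk>arr g; arr f; dm g = cd f; arr g'; arr f'; dm g' = cd f'\<rbrakk>
      \<Longrightarrow> (g \<bullet> f) ## (g' \<bullet> f') = (g ## g') \<bullet> (f ## f')"
    and arr_asc [simp]: "\<lbrakk>a \<in> Obj; b \<in> Obj; c \<in> Obj\<rbrakk> \<Longrightarrow>
      arr (asc a b c) \<and> dm (asc a b c) = (a ** b) ** c \<and> cd (asc a b c) = a ** (b ** c)"
    and arr_asi [simp]: "\<lbrakk>a \<in> Obj; b \<in> Obj; c \<in> Obj\<rbrakk> \<Longrightarrow>
      arr (asi a b c) \<and> dm (asi a b c) = a ** (b ** c) \<and> cd (asi a b c) = (a ** b) ** c"
    and asc_asi [simp]: "\<lbrakk>a \<in> Obj; b \<in> Obj; c \<in> Obj\<rbrakk> \<Longrightarrow> asc a b c \<bullet> asi a b c = idt (a ** (b ** c))"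
    and asi_asc [simp]: "\<lbrakk>a \<in> Obj; b \<in> Obj; c \<in> Obj\<rbrakk> \<Longrightarrow> asi a b c \<bullet> asc a b c = idt ((a ** b) ** c)"
    and asc_nat: "\<lbrakk>arr f; arr g; arr h\<rbrakk> \<Longrightarrow>
      asc (cd f) (cd g) (cd h) \<bullet> ((f ## g) ## h) = (f ## (g ## h)) \<bullet> asc (dm f) (dm g) (dm h)"
    and arr_lun [simp]: "a \<in> Obj \<Longrightarrow> arr (lun a) \<and> dm (lun a) = unt ** a \<and> cd (lun a) = a"
    and arr_lui [simp]: "a \<in> Obj \<Longrightarrow> arr (lui a) \<and> dm (lui a) = a \<and> cd (lui a) = unt ** a"
    and lun_lui [simp]: "a \<in> Obj \<Longrightarrow> lun a \<bullet> lui a = idt a"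
    and lui_lun [simp]: "a \<in> Obj \<Longrightarrow> lui a \<bullet> lun a = idt (unt ** a)"
    and lun_nat: "arr f \<Longrightarrow> lun (cd f) \<bullet> (idt unt ## f) = f \<bullet> lun (dm f)"
    and arr_run [simp]: "a \<in> Obj \<Longrightarrow> arr (run a) \<and> dm (run a) = a ** unt \<and> cd (run a) = a"
    and arr_rui [simp]: "a \<in> Obj \<Longrightarrow> arr (rui a) \<and> dm (rui a) = a \<and> cd (rui a) = a ** unt"
    and run_rui [simp]: "a \<in> Obj \<Longrightarrow> run a \<bullet> rui a = idt a"
    and rui_run [simp]: "a \<in> Obj \<Longrightarrow> rui a \<bullet> run a = idt (a ** unt)"
    and run_nat: "arr f \<Longrightarrow> run (cd f) \<bullet> (f ## idt unt) = f \<bullet> run (dm f)"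
    and pentagon: "\<lbrakk>a \<in> Obj; b \<in> Obj; c \<in> Obj; d \<in> Obj\<rbrakk> \<Longrightarrow>
      asc a b (c ** d) \<bullet> asc (a ** b) c d = (idt a ## asc b c d) \<bullet> asc a (b ** c) d \<bullet> (asc a b c ## idt d)"
    and triangle: "\<lbrakk>a \<in> Obj; b \<in> Obj\<rbrakk> \<Longrightarrow> (idt a ## lun b) \<bullet> asc a unt b = run a ## idt b"
begin

lemma whisker_left: "\<lbrakk>arr g; arr f; dm g = cd f; x \<in> Obj\<rbrakk> \<Longrightarrow> idt x ## (g \<bullet> f) = (idt x ## g) \<bullet> (idt x ## f)"
  using ten_cmp[of "idt x" "idt x" g f] by simp

lemma whisker_right: "\<lbrakk>arr g; arr f; dm g = cd f; x \<in> Obj\<rbrakk> \<Longrightarrow> (g \<bullet> f) ## idt x = (g ## idt x) \<bullet> (f ## idt x)"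
  using ten_cmp[of g f "idt x" "idt x"] by simp

lemma interchange_left: "\<lbrakk>arr f; arr g; a = dm f; b = cd g\<rbrakk> \<Longrightarrow> (f ## idt b) \<bullet> (idt a ## g) = f ## g"
  using ten_cmp[of f "idt (dm f)" "idt (cd g)" g] by simp

lemma interchange_right: "\<lbrakk>arr f; arr g; a = cd f; b = dm g\<rbrakk> \<Longrightarrow> (idt a ## g) \<bullet> (f ## idt b) = f ## g"
  using ten_cmp[of "idt (cd f)" f g "idt (dm g)"] by simp

lemma interchange: "\<lbrakk>arr f; arr g; a = cd f; b = dm g; a' = dm f; b' = cd g\<rbrakk> \<Longrightarrow>
   (idt a ## g) \<bullet> (f ## idt b) = (f ## idt b') \<bullet> (idt a' ## g)"
  by (simp add: interchange_left interchange_right)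

lemma asc_asi_cmp [simp]: "\<lbrakk>a \<in> Obj; b \<in> Obj; c \<in> Obj; arr f; cd f = a ** (b ** c)\<rbrakk> \<Longrightarrow>
    asc a b c \<bullet> asi a b c \<bullet> f = f"
  by (subst cmp_reassoc[OF asc_asi]) auto

lemma asi_asc_cmp [simp]: "\<lbrakk>a \<in> Obj; b \<in> Obj; c \<in> Obj; arr f; cd f = (a ** b) ** c\<rbrakk> \<Longrightarrow>
    asi a b c \<bullet> asc a b c \<bullet> f = f"
  by (subst cmp_reassoc[OF asi_asc]) auto

lemma lun_lui_cmp [simp]: "\<lbrakk>a \<in> Obj; arr f; cd f = a\<rbrakk> \<Longrightarrow> lun a \<bullet> lui a \<bullet> f = f"
  by (subst cmp_reassoc[OF lun_lui]) auto

lemma lui_lun_cmp [simp]: "\<lbrakk>a \<in> Obj; arr f; cd f = unt ** a\<rbrakk> \<Longrightarrow> lui a \<bullet> lun a \<bullet> f = f"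
  by (subst cmp_reassoc[OF lui_lun]) auto

lemma rui_run_cmp [simp]: "\<lbrakk>a \<in> Obj; arr f; cd f = a ** unt\<rbrakk> \<Longrightarrow> rui a \<bullet> run a \<bullet> f = f"
  by (subst cmp_reassoc[OF rui_run]) auto

lemma asc_iso: "\<lbrakk>a \<in> Obj; b \<in> Obj; c \<in> Obj\<rbrakk> \<Longrightarrow> inv_pair (asc a b c) (asi a b c)"
  and lun_iso: "a \<in> Obj \<Longrightarrow> inv_pair (lun a) (lui a)"
  and run_iso: "a \<in> Obj \<Longrightarrow> inv_pair (run a) (rui a)"
  by (simp_all add: inv_pair_def)

lemma ten_inv_pair: "\<lbrakk>inv_pair f f'; inv_pair g g'\<rbrakk> \<Longrightarrow> inv_pair (f ## g) (f' ## g')"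
  by (simp add: inv_pair_def flip: ten_cmp)

lemma ten_iso: "\<lbrakk>iso f; iso g\<rbrakk> \<Longrightarrow> iso (f ## g)"
  unfolding iso_def using ten_inv_pair by blast

lemma asi_nat:
  assumes "arr f" "arr g" "arr h"
  shows "asi (cd f) (cd g) (cd h) \<bullet> (f ## (g ## h)) = ((f ## g) ## h) \<bullet> asi (dm f) (dm g) (dm h)"
proof -
  have "asi (cd f) (cd g) (cd h) \<bullet> (f ## (g ## h))
      = asi (cd f) (cd g) (cd h) \<bullet> ((f ## (g ## h)) \<bullet> asc (dm f) (dm g) (dm h)) \<bullet> asi (dm f) (dm g) (dm h)"
    using assms by simp
  also have "\<dots> = ((f ## g) ## h) \<bullet> asi (dm f) (dm g) (dm h)"
    unfolding asc_nat[OF assms, symmetric] using assms by simp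
  finally show ?thesis .
qed

lemma lui_nat:
  assumes "arr f" shows "(idt unt ## f) \<bullet> lui (dm f) = lui (cd f) \<bullet> f"
proof -
  have "(idt unt ## f) \<bullet> lui (dm f) = lui (cd f) \<bullet> (lun (cd f) \<bullet> (idt unt ## f)) \<bullet> lui (dm f)"
    using assms by simp
  also have "\<dots> = lui (cd f) \<bullet> f" unfolding lun_nat[OF assms] using assms by simp
  finally show ?thesis .
qed

lemma rui_nat:
  assumes "arr f" shows "(f ## idt unt) \<bullet> rui (dm f) = rui (cd f) \<bullet> f"
proof -
  have "(f ## idt unt) \<bullet> rui (dm f) = rui (cd f) \<bullet> (run (cd f) \<bullet> (f ## idt unt)) \<bullet> rui (dm f)"
    using assms by simp
  also have "\<dots> = rui (cd f) \<bullet> f" unfolding run_nat[OF assms] using assms by simp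
  finally show ?thesis .
qed

lemma pentagon_inv:
  assumes "a \<in> Obj" "b \<in> Obj" "c \<in> Obj" "d \<in> Obj"
  shows "asi (a ** b) c d \<bullet> asi a b (c ** d) = (asi a b c ## idt d) \<bullet> asi a (b ** c) d \<bullet> (idt a ## asi b c d)"
    (is "?L = ?R")
proof -
  let ?P = "asc a b (c ** d) \<bullet> asc (a ** b) c d"
  have "?R \<bullet> ?P = idt (a ** b ** c ** d)"
  proof -
    have 1: "(idt a ## asi b c d) \<bullet> (idt a ## asc b c d) = idt (a ** (b ** c ** d))"
      using assms by (simp flip: ten_cmp)
    have 2: "(asi a b c ## idt d) \<bullet> (asc a b c ## idt d) = idt (a ** b ** c ** d)"
      using assms by (simp flip: ten_cmp)
    show ?thesis unfolding pentagon[OF assms]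
      using assms by (simp add: cmp_reassoc[OF 1] 2)
  qed
  then have RP: "(?R \<bullet> ?P) \<bullet> ?L = ?L" using assms by simp
  have "?R = ?R \<bullet> (?P \<bullet> ?L)" using assms by simp
  also have "\<dots> = (?R \<bullet> ?P) \<bullet> ?L" by (simp only: cmp_assoc)
  finally show ?thesis unfolding RP by (rule sym)
qed

lemma triangle_inv:
  assumes "a \<in> Obj" "b \<in> Obj"
  shows "(run a ## idt b) \<bullet> asi a unt b = idt a ## lun b"
  unfolding triangle[OF assms, symmetric] using assms by simp

lemma cancel_unit:
  assumes "arr f" "arr g" "dm f = dm g" "cd f = cd g" "idt unt ## f = idt unt ## g"
  shows "f = g"
proof -
  have "f = lun (cd f) \<bullet> (idt unt ## f) \<bullet> lui (dm f)" using assms(1) by (simp add: lui_nat)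
  also have "\<dots> = g" unfolding assms(3,4,5) using assms(2) by (simp add: lui_nat)
  finally show ?thesis .
qed

text \<open>This is one of Kelly's unit coherences. After tensoring with the unit it follows from
  the pentagon for 1, 1, a, b and two triangles; the isomorphism \<open>?A\<close> and then the
  extra unit factor are cancelled.\<close>

lemma lun_tob:
  assumes a: "a \<in> Obj" and b: "b \<in> Obj"
  shows "lun (a ** b) \<bullet> asc unt a b = lun a ## idt b"
proof (rule cancel_unit)
  let ?A = "asc unt (unt ** a) b \<bullet> (asc unt unt a ## idt b)"
  have "(idt unt ## (lun (a ** b) \<bullet> asc unt a b)) \<bullet> ?A
      = (idt unt ## lun (a ** b)) \<bullet> (idt unt ## asc unt a b) \<bullet> ?A"
    using a b by (simp add: whisker_left)
  also have "\<dots> = ((idt unt ## lun (a ** b)) \<bullet> asc unt unt (a ** b)) \<bullet> asc (unt ** unt) a b"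
    using pentagon[of unt unt a b] a b by simp
  also have "\<dots> = (run unt ## (idt a ## idt b)) \<bullet> asc (unt ** unt) a b"
    unfolding triangle[OF unt_Obj tob_Obj[OF a b]] using a b by simp
  also have "\<dots> = asc unt a b \<bullet> ((run unt ## idt a) ## idt b)"
    using asc_nat[of "run unt" "idt a" "idt b"] a b by simp
  also have "\<dots> = (asc unt a b \<bullet> ((idt unt ## lun a) ## idt b)) \<bullet> (asc unt unt a ## idt b)"
    unfolding triangle[OF unt_Obj a, symmetric] using a b by (simp add: whisker_right)
  also have "\<dots> = (idt unt ## (lun a ## idt b)) \<bullet> ?A"
    using asc_nat[of "idt unt" "lun a" "idt b"] a b by simp
  finally have e: "(idt unt ## (lun (a ** b) \<bullet> asc unt a b)) \<bullet> ?A = (idt unt ## (lun a ## idt b)) \<bullet> ?A" .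
  have "epi ?A"
    using a b by (intro iso_epi iso_cmp ten_iso) (auto intro: inv_pair_iso(1)[OF asc_iso] iso_idt)
  then show "idt unt ## (lun (a ** b) \<bullet> asc unt a b) = idt unt ## (lun a ## idt b)"
    by (rule epiD[OF _ _ _ _ _ e]) (use a b in auto)
qed (use a b in auto)

section \<open>Duals and the adjunctions they induce\<close>

definition dual :: "'o \<Rightarrow> 'o \<Rightarrow> 'f \<Rightarrow> 'f \<Rightarrow> bool" where
  "dual d a ev co \<longleftrightarrow> d \<in> Obj \<and> a \<in> Obj \<and> arr ev \<and> arr co \<and>
     dm ev = d ** a \<and> cd ev = unt \<and> dm co = unt \<and> cd co = a ** d \<and>
     run a \<bullet> (idt a ## ev) \<bullet> asc a d a \<bullet> (co ## idt a) = lun a \<and>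
     lun d \<bullet> (ev ## idt d) \<bullet> asi d a d \<bullet> (idt d ## co) = run d"

text \<open>The two directions of the adjunction \<open>- \<otimes> a \<stileturn> - \<otimes> d\<close>.\<close>

definition curry_r :: "'o \<Rightarrow> 'o \<Rightarrow> 'f \<Rightarrow> 'o \<Rightarrow> 'f \<Rightarrow> 'f" where
  "curry_r d a co x f = (f ## idt d) \<bullet> asi x a d \<bullet> (idt x ## co) \<bullet> rui x"

definition uncurry_r :: "'o \<Rightarrow> 'o \<Rightarrow> 'f \<Rightarrow> 'o \<Rightarrow> 'f \<Rightarrow> 'f" where
  "uncurry_r d a ev z g = run z \<bullet> (idt z ## ev) \<bullet> asc z d a \<bullet> (g ## idt a)"

lemma curry_r_arr [simp]:
  assumes "dual d a ev co" "arr f" "dm f = x ** a" "x \<in> Obj"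
  shows "arr (curry_r d a co x f)" "dm (curry_r d a co x f) = x" "cd (curry_r d a co x f) = cd f ** d"
  using assms by (auto simp: dual_def curry_r_def)

lemma uncurry_r_arr [simp]:
  assumes "dual d a ev co" "arr g" "cd g = z ** d" "z \<in> Obj"
  shows "arr (uncurry_r d a ev z g)" "dm (uncurry_r d a ev z g) = dm g ** a" "cd (uncurry_r d a ev z g) = z"
  using assms by (auto simp: dual_def uncurry_r_def)

lemma uncurry_r_cmp:
  assumes "dual d a ev co" "arr g" "cd g = z ** d" "z \<in> Obj" "arr k" "cd k = dm g"
  shows "uncurry_r d a ev z (g \<bullet> k) = uncurry_r d a ev z g \<bullet> (k ## idt a)"
  using assms by (simp add: dual_def uncurry_r_def whisker_right)

lemma curry_r_precmp:
  assumes D: "dual d a ev co" "arr f" "dm f = x ** a" "x \<in> Obj" "arr k" "cd k = x"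
  shows "curry_r d a co (dm k) (f \<bullet> (k ## idt a)) = curry_r d a co x f \<bullet> k"
proof -
  note D' = D[unfolded dual_def]
  have 1: "((k ## idt a) ## idt d) \<bullet> asi (dm k) a d = asi x a d \<bullet> (k ## idt (a ** d))"
    using asi_nat[of k "idt a" "idt d"] D' by simp
  have 2: "(k ## idt (a ** d)) \<bullet> (idt (dm k) ## co) = (idt x ## co) \<bullet> (k ## idt unt)"
    using interchange[of k co] D' by simp
  have 3: "(k ## idt unt) \<bullet> rui (dm k) = rui x \<bullet> k" using rui_nat[of k] D' by simp
  show ?thesis
    using D' by (simp add: curry_r_def whisker_right cmp_reassoc[OF 1] cmp_reassoc[OF 2] 3)
qed

lemma uncurry_r_postcmp:
  assumes D: "dual d a ev co" "arr g" "cd g = z ** d" "arr h" "dm h = z"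
  shows "uncurry_r d a ev (cd h) ((h ## idt d) \<bullet> g) = h \<bullet> uncurry_r d a ev z g"
proof -
  note D' = D[unfolded dual_def]
  have z: "z \<in> Obj" using D' by auto
  have 1: "asc (cd h) d a \<bullet> ((h ## idt d) ## idt a) = (h ## idt (d ** a)) \<bullet> asc z d a"
    using asc_nat[of h "idt d" "idt a"] D' by simp
  have 2: "(idt (cd h) ## ev) \<bullet> (h ## idt (d ** a)) = (h ## idt unt) \<bullet> (idt z ## ev)"
    using interchange[of h ev] D' by simp
  have 3: "run (cd h) \<bullet> (h ## idt unt) = h \<bullet> run z" using run_nat[of h] D' by simp
  show ?thesis
    using D' z by (simp add: uncurry_r_def whisker_right cmp_reassoc[OF 1] cmp_reassoc[OF 2] cmp_reassoc[OF 3])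
qed

end

text \<open>With tensor factors in reversed order the associator and its inverse trade places, as do
  the two unitors. Every statement about - \<otimes> a thereby yields one about a \<otimes> -
  through the prefix \<open>rev\<close>.\<close>

locale moncat_rev = moncat +
  rev: moncat Obj arr dm cd cmp idt "\<lambda>a b. b ** a" "\<lambda>f g. g ## f" unt
    "\<lambda>a b c. asi c b a" "\<lambda>a b c. asc c b a" run rui lun lui

lemma (in moncat) rev_moncat:
  "moncat Obj arr dm cd (\<bullet>) idt (\<lambda>a b. b ** a) (\<lambda>f g. g ## f) unt
    (\<lambda>a b c. asi c b a) (\<lambda>a b c. asc c b a) run rui lun lui"
  by unfold_locales
    (simp_all add: ten_cmp asi_nat lun_nat run_nat pentagon_inv triangle_inv)

sublocale moncat \<subseteq> moncat_rev
  by (intro moncat_rev.intro rev_moncat moncat_axioms)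

context moncat begin

lemma run_tob:
  assumes "a \<in> Obj" "b \<in> Obj"
  shows "run (a ** b) \<bullet> asi a b unt = idt a ## run b"
  using rev.lun_tob[OF assms(2,1)] .

lemma asc_lui:
  assumes a: "a \<in> Obj" and b: "b \<in> Obj"
  shows "asc unt a b \<bullet> (lui a ## idt b) = lui (a ** b)"
proof -
  have "lui (a ** b) = lui (a ** b) \<bullet> ((lun a ## idt b) \<bullet> (lui a ## idt b))"
    using a b by (simp flip: ten_cmp)
  also have "\<dots> = asc unt a b \<bullet> (lui a ## idt b)"
    unfolding lun_tob[OF a b, symmetric] using a b by simp
  finally show ?thesis ..
qed

text \<open>Naturality moves \<open>f\<close> to the outside. What remains is \<open>x\<close>
  tensored with the first zigzag \<open>z1\<close>, which becomes visible after the pentagon, the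
  triangle and \<open>run_tob\<close> have removed the associators and unitors around it.\<close>

lemma uncurry_curry_r:
  assumes D: "dual d a ev co" and f: "arr f" "dm f = x ** a" "cd f = z" "x \<in> Obj"
  shows "uncurry_r d a ev z (curry_r d a co x f) = f"
proof -
  note D' = D[unfolded dual_def] and z = cd_Obj[OF f(1), unfolded f(3)]
  have o: "a \<in> Obj" "d \<in> Obj" using D' by auto
  have E: "arr ev" "arr co" "dm ev = d ** a" "cd ev = unt" "dm co = unt" "cd co = a ** d" using D' by auto
  have z1: "run a \<bullet> (idt a ## ev) \<bullet> asc a d a \<bullet> (co ## idt a) = lun a" using D' by blast
  have 1: "asc z d a \<bullet> ((f ## idt d) ## idt a) = (f ## idt (d ** a)) \<bullet> asc (x ** a) d a"
    using asc_nat[of f "idt d" "idt a"] f o by simp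
  have 2: "(idt z ## ev) \<bullet> (f ## idt (d ** a)) = (f ## idt unt) \<bullet> (idt (x ** a) ## ev)"
    using interchange[of f ev] D' f by simp
  have 3: "run z \<bullet> (f ## idt unt) = f \<bullet> run (x ** a)" using run_nat[of f] f by simp
  have 4: "asc (x ** a) d a \<bullet> (asi x a d ## idt a)
      = asi x a (d ** a) \<bullet> (idt x ## asc a d a) \<bullet> asc x (a ** d) a"
  proof -
    have i: "(asc x a d ## idt a) \<bullet> (asi x a d ## idt a) = idt (x ** (a ** d) ** a)"
      using f o by (simp flip: ten_cmp)
    have "asc (x ** a) d a \<bullet> (asi x a d ## idt a)
        = asi x a (d ** a) \<bullet> (asc x a (d ** a) \<bullet> asc (x ** a) d a) \<bullet> (asi x a d ## idt a)"
      using f o by simp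
    also have "\<dots> = asi x a (d ** a) \<bullet> (idt x ## asc a d a) \<bullet> asc x (a ** d) a"
      unfolding pentagon[OF f(4) o o(1)] using f o by (simp add: i)
    finally show ?thesis .
  qed
  have 5: "asc x (a ** d) a \<bullet> ((idt x ## co) ## idt a) = (idt x ## (co ## idt a)) \<bullet> asc x unt a"
    using asc_nat[of "idt x" co "idt a"] D' f by simp
  have 6: "asc x unt a \<bullet> (rui x ## idt a) = idt x ## lui a"
  proof -
    have "idt x ## lui a = (idt x ## lui a) \<bullet> (run x ## idt a) \<bullet> (rui x ## idt a)"
      using f o by (simp flip: ten_cmp)
    also have "\<dots> = ((idt x ## lui a) \<bullet> (idt x ## lun a)) \<bullet> asc x unt a \<bullet> (rui x ## idt a)"
      unfolding triangle[OF f(4) o(1), symmetric] by simp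
    also have "\<dots> = asc x unt a \<bullet> (rui x ## idt a)" using f o by (simp flip: ten_cmp)
    finally show ?thesis ..
  qed
  have 7: "(idt (x ** a) ## ev) \<bullet> asi x a (d ** a) = asi x a unt \<bullet> (idt x ## (idt a ## ev))"
    using asi_nat[of "idt x" "idt a" ev] f D' by simp
  have "uncurry_r d a ev z (curry_r d a co x f)
      = f \<bullet> run (x ** a) \<bullet> (idt (x ** a) ## ev) \<bullet> asc (x ** a) d a \<bullet> (asi x a d ## idt a)
          \<bullet> ((idt x ## co) ## idt a) \<bullet> (rui x ## idt a)"
    using f D' z by (simp add: uncurry_r_def curry_r_def whisker_right
        cmp_reassoc[OF 1] cmp_reassoc[OF 2] cmp_reassoc[OF 3])
  also have "\<dots> = f \<bullet> (run (x ** a) \<bullet> asi x a unt) \<bullet> (idt x ## (idt a ## ev)) \<bullet> (idt x ## asc a d a)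
          \<bullet> (idt x ## (co ## idt a)) \<bullet> (idt x ## lui a)"
    using f o E by (simp add: cmp_reassoc[OF 4] cmp_reassoc[OF 5] 6 cmp_reassoc[OF 7])
  also have "\<dots> = f \<bullet> (idt x ## ((run a \<bullet> (idt a ## ev) \<bullet> asc a d a \<bullet> (co ## idt a)) \<bullet> lui a))"
    unfolding run_tob[OF f(4) o(1)] using f o E by (simp add: whisker_left)
  also have "\<dots> = f" unfolding z1 using f o by simp
  finally show ?thesis .
qed

text \<open>The mirror computation: \<open>g\<close> moves to the inside, and the second zigzag
  \<open>z2\<close>, tensored with \<open>z\<close>, collapses.\<close>

lemma curry_uncurry_r:
  assumes D: "dual d a ev co" and g: "arr g" "cd g = z ** d" "dm g = x" "z \<in> Obj"
  shows "curry_r d a co x (uncurry_r d a ev z g) = g"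
proof -
  note D' = D[unfolded dual_def] and x = dm_Obj[OF g(1), unfolded g(3)]
  have o: "a \<in> Obj" "d \<in> Obj" using D' by auto
  have E: "arr ev" "arr co" "dm ev = d ** a" "cd ev = unt" "dm co = unt" "cd co = a ** d" using D' by auto
  have z2: "lun d \<bullet> (ev ## idt d) \<bullet> asi d a d \<bullet> (idt d ## co) = run d" using D' by blast
  have 1: "((g ## idt a) ## idt d) \<bullet> asi x a d = asi (z ** d) a d \<bullet> (g ## idt (a ** d))"
    using asi_nat[of g "idt a" "idt d"] g o by simp
  have 2: "(g ## idt (a ** d)) \<bullet> (idt x ## co) = (idt (z ** d) ## co) \<bullet> (g ## idt unt)"
    using interchange[of g co] D' g by simp
  have 3: "(g ## idt unt) \<bullet> rui x = rui (z ** d) \<bullet> g" using rui_nat[of g] g by simp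
  have 4: "(asc z d a ## idt d) \<bullet> asi (z ** d) a d
      = asi z (d ** a) d \<bullet> (idt z ## asi d a d) \<bullet> asc z d (a ** d)"
  proof -
    have i: "(asc z d a ## idt d) \<bullet> (asi z d a ## idt d) = idt (z ** (d ** a) ** d)"
      using g o by (simp flip: ten_cmp)
    have "(asc z d a ## idt d) \<bullet> asi (z ** d) a d
        = (asc z d a ## idt d) \<bullet> (asi (z ** d) a d \<bullet> asi z d (a ** d)) \<bullet> asc z d (a ** d)"
      using g o by simp
    also have "\<dots> = asi z (d ** a) d \<bullet> (idt z ## asi d a d) \<bullet> asc z d (a ** d)"
      unfolding pentagon_inv[OF g(4) o(2,1,2)] using g o by (simp add: cmp_reassoc[OF i])
    finally show ?thesis .
  qed
  have 5: "asc z d (a ** d) \<bullet> (idt (z ** d) ## co) = (idt z ## (idt d ## co)) \<bullet> asc z d unt"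
    using asc_nat[of "idt z" "idt d" co] D' g by simp
  have 6: "asc z d unt \<bullet> rui (z ** d) = idt z ## rui d"
  proof -
    have "asc z d unt \<bullet> rui (z ** d)
        = asc z d unt \<bullet> rui (z ** d) \<bullet> ((idt z ## run d) \<bullet> (idt z ## rui d))"
      using g o by (simp flip: ten_cmp)
    also have "\<dots> = idt z ## rui d"
      unfolding run_tob[OF g(4) o(2), symmetric] using g o by simp
    finally show ?thesis .
  qed
  have 7: "((idt z ## ev) ## idt d) \<bullet> asi z (d ** a) d = asi z unt d \<bullet> (idt z ## (ev ## idt d))"
    using asi_nat[of "idt z" ev "idt d"] g D' by simp
  have "curry_r d a co x (uncurry_r d a ev z g)
      = (run z ## idt d) \<bullet> ((idt z ## ev) ## idt d) \<bullet> (asc z d a ## idt d) \<bullet> asi (z ** d) a d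
          \<bullet> (idt (z ** d) ## co) \<bullet> rui (z ** d) \<bullet> g"
    using g D' x by (simp add: uncurry_r_def curry_r_def whisker_right
        cmp_reassoc[OF 1] cmp_reassoc[OF 2] 3)
  also have "\<dots> = ((run z ## idt d) \<bullet> asi z unt d) \<bullet> (idt z ## (ev ## idt d)) \<bullet> (idt z ## asi d a d)
          \<bullet> (idt z ## (idt d ## co)) \<bullet> (idt z ## rui d) \<bullet> g"
    using g o E by (simp add: cmp_reassoc[OF 4] cmp_reassoc[OF 5] cmp_reassoc[OF 6] cmp_reassoc[OF 7])
  also have "\<dots> = (idt z ## ((lun d \<bullet> (ev ## idt d) \<bullet> asi d a d \<bullet> (idt d ## co)) \<bullet> rui d)) \<bullet> g"
    unfolding triangle_inv[OF g(4) o(2)] using g o E by (simp add: whisker_left)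
  also have "\<dots> = g" unfolding z2 using g o by simp
  finally show ?thesis .
qed

lemma rev_dual: "rev.dual a d ev co \<longleftrightarrow> dual d a ev co"
  by (auto simp: rev.dual_def dual_def)

section \<open>Tensoring preserves epimorphisms, monomorphisms and projectives\<close>

text \<open>With a left dual \<open>d\<close> of \<open>a\<close>, the functor - \<otimes> a is left
  adjoint to - \<otimes> d, and left adjoints preserve epimorphisms.\<close>

lemma epi_ten_right:
  assumes "epi e" "dual d a ev co"
  shows "epi (e ## idt a)"
  unfolding epi_def
proof (intro conjI allI impI)
  have a: "a \<in> Obj" using assms by (simp add: dual_def)
  then show "arr (e ## idt a)" using assms by simp
  fix g h
  assume "arr g \<and> arr h \<and> cd g = cd h \<and> dm g = cd (e ## idt a) \<and> dm h = cd (e ## idt a) \<and>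
    g \<bullet> (e ## idt a) = h \<bullet> (e ## idt a)"
  then have gh: "arr g" "arr h" "cd g = cd h" "dm g = cd e ** a" "dm h = cd e ** a"
    "g \<bullet> (e ## idt a) = h \<bullet> (e ## idt a)"
    using a assms by auto
  have "curry_r d a co (cd e) g \<bullet> e = curry_r d a co (cd e) h \<bullet> e"
    using curry_r_precmp[OF assms(2) gh(1,4) _ epi_arr[OF assms(1)] refl]
      curry_r_precmp[OF assms(2) gh(2,5) _ epi_arr[OF assms(1)] refl] gh(6) assms by simp
  then have eq: "curry_r d a co (cd e) g = curry_r d a co (cd e) h"
    by (rule epiD[OF assms(1), rotated 4]) (use assms gh in auto)
  have e: "cd e \<in> Obj" using assms(1) by simp
  show "g = h"
    using uncurry_curry_r[OF assms(2) gh(1,4,3) e] uncurry_curry_r[OF assms(2) gh(2,5) refl e]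
    unfolding eq by (rule trans[OF sym])
qed

text \<open>Here \<open>a\<close> is the left dual of \<open>d\<close>, so - \<otimes> a is right
  adjoint to - \<otimes> d and preserves monomorphisms.\<close>

lemma mono_ten_right:
  assumes "mono m" "dual a d ev co"
  shows "mono (m ## idt a)"
  unfolding mono_def
proof (intro conjI allI impI)
  have a: "a \<in> Obj" using assms by (simp add: dual_def)
  then show "arr (m ## idt a)" using assms by simp
  fix g h
  assume "arr g \<and> arr h \<and> dm g = dm h \<and> cd g = dm (m ## idt a) \<and> cd h = dm (m ## idt a) \<and>
    (m ## idt a) \<bullet> g = (m ## idt a) \<bullet> h"
  then have gh: "arr g" "arr h" "dm g = dm h" "cd g = dm m ** a" "cd h = dm m ** a"
    "(m ## idt a) \<bullet> g = (m ## idt a) \<bullet> h"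
    using a assms by auto
  have "m \<bullet> uncurry_r a d ev (dm m) g = m \<bullet> uncurry_r a d ev (dm m) h"
    using uncurry_r_postcmp[OF assms(2) gh(1,4) mono_arr[OF assms(1)] refl]
      uncurry_r_postcmp[OF assms(2) gh(2,5) mono_arr[OF assms(1)] refl] gh(6) by simp
  then have eq: "uncurry_r a d ev (dm m) g = uncurry_r a d ev (dm m) h"
    by (rule monoD[OF assms(1), rotated 4]) (use assms gh in auto)
  have m: "dm m \<in> Obj" using assms(1) by simp
  show "g = h"
    using curry_uncurry_r[OF assms(2) gh(1,4,3) m] curry_uncurry_r[OF assms(2) gh(2,5) refl m]
    unfolding eq by (rule trans[OF sym])
qed

text \<open>A left adjoint preserves projectives as soon as its right adjoint - \<otimes> d
  preserves epimorphisms: the lifting problem is transposed, solved for \<open>p\<close>, and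
  transposed back.\<close>

lemma proj_ten_right:
  assumes "proj p" "dual d a ev co" "\<And>e. epi e \<Longrightarrow> epi (e ## idt d)"
  shows "proj (p ** a)"
  unfolding proj_def
proof (intro conjI allI impI)
  have p: "p \<in> Obj" using assms(1) by (rule proj_Obj)
  have o: "a \<in> Obj" "d \<in> Obj" using assms(2) by (auto simp: dual_def)
  then show "p ** a \<in> Obj" using p by simp
  fix e f assume ef: "epi e \<and> arr f \<and> dm f = p ** a \<and> cd f = cd e"
  then have "\<exists>g. (e ## idt d) \<bullet> g = curry_r d a co p f"
    using o p assms by (intro proj_lift[OF assms(1)]) auto
  then obtain g where g: "(e ## idt d) \<bullet> g = curry_r d a co p f" ..
  have ga: "arr g" "cd g = dm e ** d"
    using cmp_arrD[OF g] ef p o assms(2) by auto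
  have "e \<bullet> uncurry_r d a ev (dm e) g = f"
    using uncurry_r_postcmp[OF assms(2) ga, of e] uncurry_curry_r[OF assms(2), of f p "cd f"] ef p by (simp add: g)
  then show "\<exists>g. e \<bullet> g = f" by blast
qed

end

section \<open>Rigid abelian monoidal categories\<close>

locale rigid =
  abel Obj arr dm cd cmp idt add neg zer +
  moncat Obj arr dm cd cmp idt tob ten unt asc asi lun lui run rui
  for Obj :: "'o set" and arr :: "'f \<Rightarrow> bool" and dm cd
    and cmp (infixr \<open>\<bullet>\<close> 60) and idt and add (infixl \<open>+++\<close> 65) and neg and zer
    and tob (infixl \<open>**\<close> 70) and ten (infixl \<open>##\<close> 70) and unt asc asi lun lui run rui +
  assumes epi_cok: "epi p \<Longrightarrow> \<exists>f. is_cok f p"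
    and add_ten: "\<lbrakk>arr f; arr f'; dm f = dm f'; cd f = cd f'; arr g\<rbrakk>
      \<Longrightarrow> (f +++ f') ## g = (f ## g) +++ (f' ## g)"
    and ten_add: "\<lbrakk>arr f; arr f'; dm f = dm f'; cd f = cd f'; arr g\<rbrakk>
      \<Longrightarrow> g ## (f +++ f') = (g ## f) +++ (g ## f')"
    and ex_left_dual: "a \<in> Obj \<Longrightarrow> \<exists>d ev co. dual d a ev co"
    and ex_right_dual: "a \<in> Obj \<Longrightarrow> \<exists>d ev co. dual a d ev co"
begin

lemma rev_rigid: "rigid Obj arr dm cd (\<bullet>) idt (+++) neg zer (\<lambda>a b. b ** a) (\<lambda>f g. g ## f) unt
    (\<lambda>a b c. asi c b a) (\<lambda>a b c. asc c b a) run rui lun lui"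
proof (intro rigid.intro abel_axioms rev.moncat_axioms rigid_axioms.intro)
  fix a assume "a \<in> Obj"
  then show "\<exists>d ev co. rev.dual d a ev co" "\<exists>d ev co. rev.dual a d ev co"
    using ex_left_dual ex_right_dual by (simp_all add: rev_dual)
qed (auto simp: add_ten ten_add intro: epi_cok)

lemma zer_ten [simp]:
  assumes "a \<in> Obj" "b \<in> Obj" "arr f"
  shows "zer a b ## f = zer (a ** dm f) (b ** cd f)"
proof -
  have "(zer a b ## f) +++ (zer a b ## f) = (zer a b ## f) +++ zer (a ** dm f) (b ** cd f)"
    using assms by (simp flip: add_ten)
  then show ?thesis
    by (rule add_left_cancel[rotated 7]) (use assms in auto)
qed

lemma ten_zer [simp]:
  assumes "a \<in> Obj" "b \<in> Obj" "arr f"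
  shows "f ## zer a b = zer (dm f ** a) (cd f ** b)"
proof -
  have "(f ## zer a b) +++ (f ## zer a b) = (f ## zer a b) +++ zer (dm f ** a) (cd f ** b)"
    using assms by (simp flip: ten_add)
  then show ?thesis
    by (rule add_left_cancel[rotated 7]) (use assms in auto)
qed

lemma epi_cok_ker:
  assumes "epi p" "is_ker p i" shows "is_cok i p"
proof -
  obtain f where f: "is_cok f p" using epi_cok[OF assms(1)] ..
  have fa: "arr f" "arr p" "dm p = cd f" "p \<bullet> f = zer (dm f) (cd p)" using f by (auto simp: is_cok_def)
  then obtain h where h: "i \<bullet> h = f" using assms(2) unfolding is_ker_def by metis
  have ha: "arr h" "cd h = dm i" "arr i" "cd i = cd f" "dm h = dm f"
    using cmp_arrD[OF h fa(1)] by auto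
  show ?thesis unfolding is_cok_def
  proof (intro conjI allI impI)
    fix g assume g: "arr g \<and> dm g = cd i \<and> g \<bullet> i = zer (dm i) (cd g)"
    then have ga: "arr g" "dm g = cd f" and g0: "g \<bullet> i = zer (dm i) (cd g)" using ha by auto
    have "g \<bullet> f = (g \<bullet> i) \<bullet> h" unfolding h[symmetric] by simp
    also have "\<dots> = zer (dm f) (cd g)" unfolding g0 using ha ga by simp
    finally show "\<exists>h. h \<bullet> p = g" using f ga unfolding is_cok_def by blast
  next
    show "epi p" "arr i" "dm p = cd i" "p \<bullet> i = zer (dm i) (cd p)"
      using assms ha fa by (auto simp: is_ker_def)
  qed
qed

lemma epi_tr: "\<lbrakk>epi e; a \<in> Obj\<rbrakk> \<Longrightarrow> epi (e ## idt a)"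
  using ex_left_dual epi_ten_right by blast

lemma mono_tr: "\<lbrakk>mono m; a \<in> Obj\<rbrakk> \<Longrightarrow> mono (m ## idt a)"
  using ex_right_dual mono_ten_right by blast

lemma proj_tr: "\<lbrakk>proj p; a \<in> Obj\<rbrakk> \<Longrightarrow> proj (p ** a)"
  using ex_left_dual proj_ten_right epi_tr dual_def by metis

text \<open>The functor - \<otimes> a is a left adjoint, so it preserves cokernels: a map killing f
  \<otimes> a has a transpose killing \<open>f\<close>, which factors through
  \<open>p\<close>.\<close>

lemma cok_tr:
  assumes "is_cok f p" "a \<in> Obj"
  shows "is_cok (f ## idt a) (p ## idt a)"
proof -
  have f: "arr f" "epi p" "dm p = cd f" "p \<bullet> f = zer (dm f) (cd p)" using assms by (auto simp: is_cok_def)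
  obtain d ev co where D: "dual d a ev co" using ex_left_dual[OF assms(2)] by blast
  then have d: "d \<in> Obj" and co: "arr co" "dm co = unt" "cd co = a ** d" by (auto simp: dual_def)
  show ?thesis unfolding is_cok_def
  proof (intro conjI allI impI)
    show "arr (f ## idt a)" "dm (p ## idt a) = cd (f ## idt a)" "epi (p ## idt a)"
      using f assms epi_tr by auto
    show "(p ## idt a) \<bullet> (f ## idt a) = zer (dm (f ## idt a)) (cd (p ## idt a))"
      using f assms by (simp flip: whisker_right)
    fix g assume g: "arr g \<and> dm g = cd (f ## idt a) \<and> g \<bullet> (f ## idt a) = zer (dm (f ## idt a)) (cd g)"
    then have ga: "arr g" "dm g = cd f ** a" and g0: "g \<bullet> (f ## idt a) = zer (dm f ** a) (cd g)"
      using f assms by auto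
    have "curry_r d a co (cd f) g \<bullet> f = curry_r d a co (dm f) (zer (dm f ** a) (cd g))"
      using curry_r_precmp[OF D ga _ f(1) refl] f by (simp add: g0)
    also have "\<dots> = zer (dm f) (cd g ** d)"
      using f ga co d assms by (simp add: curry_r_def)
    finally have "\<exists>h. h \<bullet> p = curry_r d a co (cd f) g"
      using assms(1) f D ga unfolding is_cok_def by simp
    then obtain h where h: "h \<bullet> p = curry_r d a co (cd f) g" ..
    have ha: "arr h" "dm h = cd p" "cd h = cd g ** d"
      using cmp_arrD[OF h] D ga f by auto
    have "uncurry_r d a ev (cd g) h \<bullet> (p ## idt a) = g"
      using uncurry_r_cmp[OF D ha(1,3) cd_Obj[OF ga(1)] epi_arr[OF f(2)] ha(2)[symmetric]]
        uncurry_curry_r[OF D ga refl] f by (simp add: h)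
    then show "\<exists>h. h \<bullet> (p ## idt a) = g" by blast
  qed
qed

text \<open>Restricted to kernels of epimorphisms, the claim is exactness on short exact sequences:
  \<open>p\<close> is the cokernel of \<open>i\<close>, this survives tensoring, i \<otimes> a stays
  monic, and a monic is the kernel of its cokernel.\<close>

lemma ker_tr:
  assumes "epi p" "is_ker p i" "a \<in> Obj"
  shows "is_ker (p ## idt a) (i ## idt a)"
  using epi_cok_ker[OF assms(1,2)] assms
  by (intro mono_ker_cok cok_tr mono_tr) (auto simp: is_ker_def)

lemma null_tr:
  assumes "null a" "b \<in> Obj" shows "null (a ** b)"
proof -
  have a: "a \<in> Obj" "idt a = zer a a" using assms(1) by (auto simp: null_def)
  have "idt (a ** b) = idt a ## idt b" using a(1) assms(2) by simp
  also have "\<dots> = zer (a ** b) (a ** b)"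
    unfolding a(2) using a assms(2) by simp
  finally show ?thesis using a assms(2) by (simp add: null_def)
qed

end

locale rigid_rev = rigid +
  rev: rigid Obj arr dm cd cmp idt add neg zer "\<lambda>a b. b ** a" "\<lambda>f g. g ## f" unt
    "\<lambda>a b c. asi c b a" "\<lambda>a b c. asc c b a" run rui lun lui

sublocale rigid \<subseteq> rigid_rev
  by (intro rigid_rev.intro rev_rigid rigid_axioms)

context rigid begin

lemma epi_tl: "\<lbrakk>epi e; a \<in> Obj\<rbrakk> \<Longrightarrow> epi (idt a ## e)"
  by (rule rev.epi_tr)

lemma proj_tl: "\<lbrakk>proj p; a \<in> Obj\<rbrakk> \<Longrightarrow> proj (a ** p)"
  by (rule rev.proj_tr)

lemma cok_tl: "\<lbrakk>is_cok f p; a \<in> Obj\<rbrakk> \<Longrightarrow> is_cok (idt a ## f) (idt a ## p)"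
  by (rule rev.cok_tr)

lemma ker_tl: "\<lbrakk>epi p; is_ker p i; a \<in> Obj\<rbrakk> \<Longrightarrow> is_ker (idt a ## p) (idt a ## i)"
  by (rule rev.ker_tr)

lemma biprod_tl:
  assumes "biprod i p j q" "a \<in> Obj"
  shows "biprod (idt a ## i) (idt a ## p) (idt a ## j) (idt a ## q)"
proof -
  note b = assms(1)[unfolded biprod_def]
  have "((idt a ## i) \<bullet> (idt a ## p)) +++ ((idt a ## j) \<bullet> (idt a ## q))
      = idt a ## ((i \<bullet> p) +++ (j \<bullet> q))"
    by (subst ten_add) (use b assms(2) in \<open>auto simp: whisker_left\<close>)
  also have "\<dots> = idt (cd (idt a ## i))" using b assms(2) by simp
  finally show ?thesis
    unfolding biprod_def using b assms(2) by (simp flip: whisker_left)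
qed

lemma null_tl: "\<lbrakk>null a; b \<in> Obj\<rbrakk> \<Longrightarrow> null (b ** a)"
  by (rule rev.null_tr)

end

section \<open>Composition series\<close>

context abel begin

definition simple :: "'o \<Rightarrow> bool" where
  "simple s \<longleftrightarrow> s \<in> Obj \<and> \<not> null s \<and> (\<forall>m. mono m \<and> cd m = s \<longrightarrow> null (dm m) \<or> iso m)"

text \<open>Length is a relation between objects and numbers of simple factors rather than a
  function; the estimates that use it hold for every series.\<close>

inductive comp_series :: "nat \<Rightarrow> 'o \<Rightarrow> bool" where
  comp_null: "null a \<Longrightarrow> comp_series 0 a"
| comp_ext: "\<lbrakk>comp_series n (dm i); is_ker p i; epi p; simple (cd p)\<rbrakk> \<Longrightarrow> comp_series (Suc n) (dm p)"

lemma comp_series_Obj: "comp_series n a \<Longrightarrow> a \<in> Obj"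
  by (induction rule: comp_series.induct) (auto simp: null_def is_ker_def)

lemma simple_quotient:
  assumes "comp_series n a" "\<not> null a"
  shows "\<exists>p. epi p \<and> dm p = a \<and> simple (cd p)"
  using assms by cases auto

lemma to_simple_epi:
  assumes "simple s" "arr f" "cd f = s" "f \<noteq> zer (dm f) s"
  shows "epi f"
proof -
  obtain m e where me: "mono m" "epi e" "m \<bullet> e = f" using image[OF assms(2)] by blast
  have a: "arr m" "arr e" "dm m = cd e" "cd m = s" "dm e = dm f"
    using cmp_arrD[OF me(3) assms(2)] assms by auto
  have "\<not> null (dm m)"
  proof
    assume "null (dm m)"
    then have "m = zer (dm m) s" using null_arr(1)[of m] a by simp
    then have "m \<bullet> e = zer (dm m) s \<bullet> e" by simp
    also have "\<dots> = zer (dm f) s" using a assms(1) by (simp add: simple_def)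
    finally show False using me(3) assms(4) by metis
  qed
  then have "iso m" using assms(1) me a by (auto simp: simple_def)
  then have "epi (m \<bullet> e)" using epi_cmp[OF me(2) iso_epi] a by simp
  then show ?thesis by (simp add: me)
qed

end

section \<open>Additive size, simplicity of the unit and faithfulness of tensoring\<close>

text \<open>The size \<open>sz\<close> will be the dimension of Hom out of a projective object that
  maps onto every simple object. The assumption \<open>End_unt\<close> is the form in which End(1) =
  k enters.\<close>

locale fin_rigid = rigid Obj arr dm cd cmp idt add neg zer tob ten unt asc asi lun lui run rui
  for Obj :: "'o set" and arr :: "'f \<Rightarrow> bool" and dm cd
    and cmp (infixr \<open>\<bullet>\<close> 60) and idt and add (infixl \<open>+++\<close> 65) and neg and zer
    and tob (infixl \<open>**\<close> 70) and ten (infixl \<open>##\<close> 70) and unt asc asi lun lui run rui +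
  fixes sz :: "'o \<Rightarrow> nat"
  assumes sz_ses: "\<lbrakk>is_ker p i; epi p\<rbrakk> \<Longrightarrow> sz (dm p) = sz (dm i) + sz (cd p)"
    and sz_pos: "\<lbrakk>a \<in> Obj; \<not> null a\<rbrakk> \<Longrightarrow> 0 < sz a"
    and ex_comp_series: "a \<in> Obj \<Longrightarrow> \<exists>n. comp_series n a"
    and unt_not_null: "\<not> null unt"
    and End_unt: "\<lbrakk>arr f; dm f = unt; cd f = unt\<rbrakk> \<Longrightarrow> f = zer unt unt \<or> iso f"
    and fin_simples: "\<exists>T. finite T \<and> (\<forall>t\<in>T. simple t) \<and> (\<forall>s. simple s \<longrightarrow> (\<exists>f. iso f \<and> dm f = s \<and> cd f \<in> T))"
    and enough_proj: "a \<in> Obj \<Longrightarrow> \<exists>e. epi e \<and> cd e = a \<and> proj (dm e)"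
begin

lemma sz_epi: "epi e \<Longrightarrow> sz (cd e) \<le> sz (dm e)"
  using ex_ker[of e] sz_ses by fastforce

lemma sz_mono_cok:
  assumes "mono m" shows "\<exists>p. is_cok m p \<and> sz (cd m) = sz (dm m) + sz (cd p)"
proof -
  obtain p where p: "is_cok m p" using ex_cok[OF mono_arr[OF assms]] by blast
  then have "is_ker p m" "epi p" "dm p = cd m" using mono_ker_cok[OF assms p] by (auto simp: is_cok_def)
  then show ?thesis using sz_ses p by metis
qed

sublocale sized_abel Obj arr dm cd cmp idt add neg zer sz
proof unfold_locales
  fix m assume m: "mono m"
  then show "sz (dm m) \<le> sz (cd m)" using sz_mono_cok by fastforce
  assume "sz (cd m) \<le> sz (dm m)"
  then obtain p where p: "is_cok m p" "sz (cd p) = 0" using sz_mono_cok[OF m] by auto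
  then have "null (cd p)" using sz_pos[of "cd p"] by (auto simp: is_cok_def)
  then show "iso m" using cok_null_epi p m mono_epi_iso by blast
next
  fix e assume e: "epi e" "sz (dm e) \<le> sz (cd e)"
  obtain k where k: "is_ker e k" using ex_ker[OF epi_arr[OF e(1)]] by blast
  then have "sz (dm k) = 0" using sz_ses[OF k e(1)] e(2) by simp
  then have "null (dm k)" using sz_pos[of "dm k"] k by (auto simp: is_ker_def)
  then show "iso e" using ker_null_mono k e mono_epi_iso by blast
qed

lemma sz_iso: "iso f \<Longrightarrow> sz (dm f) = sz (cd f)"
  by (meson iso_epi iso_mono le_antisym mono_size sz_epi)

lemma sz_biprod:
  assumes "biprod i p j q" shows "sz (cd i) = sz (dm i) + sz (dm j)"
proof -
  note b = assms[unfolded biprod_def]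
  have "is_ker p j" unfolding is_ker_def
  proof (intro conjI allI impI)
    fix g assume g: "arr g \<and> cd g = dm p \<and> p \<bullet> g = zer (dm g) (cd p)"
    then have g0: "arr g" "cd g = dm p" "p \<bullet> g = zer (dm g) (cd p)" by auto
    have "g = ((i \<bullet> p) +++ (j \<bullet> q)) \<bullet> g" using b g0 by simp
    also have "\<dots> = ((i \<bullet> p) \<bullet> g) +++ ((j \<bullet> q) \<bullet> g)" by (rule add_cmp) (use b g0 in auto)
    also have "\<dots> = j \<bullet> q \<bullet> g" using b g0 by simp
    finally show "\<exists>h. j \<bullet> h = g" by metis
  next
    show "mono j" using split_mono[of q j "dm j"] b by simp
  qed (use b in auto)
  moreover have "epi p" using split_epi[of p i "dm i"] b by simp
  ultimately show ?thesis using sz_ses[of p j] b by simp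
qed

lemma ex_simple_quotient: "\<lbrakk>a \<in> Obj; \<not> null a\<rbrakk> \<Longrightarrow> \<exists>p. epi p \<and> dm p = a \<and> simple (cd p)"
  using ex_comp_series simple_quotient by blast

text \<open>If the evaluation vanished, the first zigzag identity would make the isomorphism
  \<open>lun a\<close> zero, forcing \<open>a\<close> to be null.\<close>

lemma ev_nonzero:
  assumes D: "dual d a ev co" and n: "\<not> null a" shows "ev \<noteq> zer (d ** a) unt"
proof
  assume e: "ev = zer (d ** a) unt"
  note D' = D[unfolded dual_def]
  have o: "a \<in> Obj" "d \<in> Obj" and ca: "arr co" "dm co = unt" "cd co = a ** d" using D' by auto
  have "lun a = run a \<bullet> (idt a ## ev) \<bullet> asc a d a \<bullet> (co ## idt a)" using D' by simp
  also have "\<dots> = zer (unt ** a) a" unfolding e using o ca by simp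
  finally have l: "lun a = zer (unt ** a) a" .
  have "null (cd (lun a))"
    using zer_epi_null[OF iso_epi[OF inv_pair_iso(1)[OF lun_iso[OF o(1)]]]] l o by simp
  then show False using n o by simp
qed

text \<open>For a simple quotient \<open>q : 1 \<rightarrow> c\<close> with left dual \<open>d\<close>, the map \<open>d \<rightarrow> 1\<close> dual to \<open>q\<close> is monic;
  tensoring it with \<open>c\<close> shows that evaluation gives a nonzero map \<open>c \<cong> d \<otimes> c \<rightarrow> 1\<close>.\<close>

lemma unt_quotient_iso:
  assumes q: "epi q" "dm q = unt" "simple (cd q)"
  shows "iso q"
proof -
  let ?c = "cd q"
  have c: "?c \<in> Obj" "\<not> null ?c" using q by (auto simp: simple_def)
  obtain d ev co where D: "dual d ?c ev co" using ex_left_dual[OF c(1)] by blast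
  note D' = D[unfolded dual_def]
  have o: "d \<in> Obj" and ea: "arr ev" "dm ev = d ** ?c" "cd ev = unt" using D' by auto
  let ?t = "ev \<bullet> (idt d ## q) \<bullet> rui d"
  have ta: "arr ?t" "dm ?t = d" "cd ?t = unt" using o ea q c by auto
  have ep: "epi ((idt x ## q) \<bullet> rui x)" if "x \<in> Obj" for x
    using epi_cmp[OF iso_epi[OF inv_pair_iso(2)[OF run_iso[OF that]]] epi_tl[OF q(1) that]] that q by simp
  have tg: "?t \<bullet> g = (ev \<bullet> (g ## idt ?c)) \<bullet> ((idt (dm g) ## q) \<bullet> rui (dm g))"
    if g: "arr g" "cd g = d" for g
  proof -
    have 1: "rui d \<bullet> g = (g ## idt unt) \<bullet> rui (dm g)" using rui_nat[OF g(1)] g by simp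
    have 2: "(idt d ## q) \<bullet> (g ## idt unt) = (g ## idt ?c) \<bullet> (idt (dm g) ## q)"
      using interchange[of g q] g q by simp
    show ?thesis by (simp add: 1 cmp_reassoc[OF 2])
  qed
  have ug: "uncurry_r d ?c ev unt (lui d \<bullet> g) = (run unt \<bullet> lui unt) \<bullet> (ev \<bullet> (g ## idt ?c))"
    if g: "arr g" "cd g = d" for g
  proof -
    have 1: "(idt unt ## ev) \<bullet> lui (d ** ?c) = lui unt \<bullet> ev" using lui_nat[of ev] ea by simp
    show ?thesis
      using g o c q ea cmp_reassoc[OF asc_lui[OF o c(1)]]
      by (simp add: uncurry_r_def whisker_right cmp_reassoc[OF 1])
  qed
  \<comment> \<open>By \<open>tg\<close> and cancellation of an epimorphism, the composite of
    \<open>?t\<close> with \<open>g\<close> determines the map from g \<otimes> c to the unit; by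
    \<open>ug\<close> this map is, up to unit isomorphisms, the transpose of \<open>g\<close> and so
    determines \<open>g\<close>.\<close>
  have "mono ?t" unfolding mono_def
  proof (intro conjI allI impI ta)
    fix g h assume "arr g \<and> arr h \<and> dm g = dm h \<and> cd g = dm ?t \<and> cd h = dm ?t \<and> ?t \<bullet> g = ?t \<bullet> h"
    then have g: "arr g" "cd g = d" and h: "arr h" "cd h = d" and gh: "dm g = dm h" "?t \<bullet> g = ?t \<bullet> h"
      using ta by auto
    have x: "dm h \<in> Obj" using h by simp
    have "ev \<bullet> (g ## idt ?c) = ev \<bullet> (h ## idt ?c)"
      by (rule epiD[OF ep[OF x]])
        (use g h gh o c ea q tg[OF g] tg[OF h] in \<open>auto simp del: cmp_assoc\<close>)
    then have u: "uncurry_r d ?c ev unt (lui d \<bullet> g) = uncurry_r d ?c ev unt (lui d \<bullet> h)"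
      unfolding ug[OF g] ug[OF h] by simp
    have "lui d \<bullet> g = curry_r d ?c co (dm h) (uncurry_r d ?c ev unt (lui d \<bullet> g))"
      by (rule curry_uncurry_r[OF D, symmetric]) (use g gh o in auto)
    also have "\<dots> = lui d \<bullet> h" unfolding u
      by (rule curry_uncurry_r[OF D]) (use h o in auto)
    finally show "g = h"
      by - (rule monoD[OF iso_mono[OF inv_pair_iso(2)[OF lun_iso[OF o]]]], use g h o in auto)
  qed
  then have "mono (?t ## idt ?c)" using c(1) by (rule mono_tr)
  then have "mono (lun ?c \<bullet> (?t ## idt ?c))"
    using mono_cmp[OF _ iso_mono[OF inv_pair_iso(1)[OF lun_iso[OF c(1)]]], of "?t ## idt ?c"] c ta
    by (simp del: cmp_assoc)
  moreover have "cd (lun ?c \<bullet> (?t ## idt ?c)) = ?c" "dm (lun ?c \<bullet> (?t ## idt ?c)) = d ** ?c"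
    using c ta by auto
  moreover have "\<not> null (d ** ?c)" using null_arr(1)[of ev] ev_nonzero[OF D c(2)] ea by auto
  ultimately have "iso (lun ?c \<bullet> (?t ## idt ?c))" using q(3) unfolding simple_def by metis
  then obtain w where w: "inv_pair (lun ?c \<bullet> (?t ## idt ?c)) w" unfolding iso_def ..
  let ?u = "lun ?c \<bullet> (?t ## idt ?c)"
  have wa: "arr w" "dm w = ?c" "cd w = d ** ?c" "w \<bullet> ?u = idt (d ** ?c)"
    using w c ta unfolding inv_pair_def by auto
  \<comment> \<open>A nonzero endomorphism of the unit that factors through \<open>q\<close>: being
    invertible, it makes \<open>q\<close> monic.\<close>
  let ?f = "(ev \<bullet> w) \<bullet> q"
  have "?f \<noteq> zer unt unt"
  proof
    assume "?f = zer unt unt"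
    then have "(ev \<bullet> w) \<bullet> q = zer ?c unt \<bullet> q" using q c by simp
    then have e: "ev \<bullet> w = zer ?c unt"
      by (rule epiD[OF q(1), rotated 4]) (use q c wa ea in auto)
    have "ev = ev \<bullet> (w \<bullet> ?u)" unfolding wa(4) using ea by simp
    also have "\<dots> = (ev \<bullet> w) \<bullet> ?u" by (simp only: cmp_assoc)
    also have "\<dots> = zer (d ** ?c) unt" unfolding e using c ta by simp
    finally show False using ev_nonzero[OF D c(2)] by simp
  qed
  then have "iso ?f" using End_unt[of ?f] q wa ea by simp
  then have "mono q" using iso_mono mono_cmpD by blast
  then show ?thesis using mono_epi_iso q by blast
qed

lemma unt_iso_simple: "\<exists>q. iso q \<and> dm q = unt \<and> simple (cd q)"
  using ex_simple_quotient[OF unt_Obj unt_not_null] unt_quotient_iso by blast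

text \<open>The unit is isomorphic to a simple object, and a nonzero map into a simple object is
  epic because its image is not null.\<close>

lemma to_unt_epi:
  assumes "arr f" "cd f = unt" "f \<noteq> zer (dm f) unt"
  shows "epi f"
proof -
  obtain q where q: "iso q" "dm q = unt" "simple (cd q)" using unt_iso_simple by blast
  then obtain q' where q': "inv_pair q q'" by (auto simp: iso_def)
  have qa: "arr q" "arr q'" "dm q' = cd q" "cd q' = unt" "q' \<bullet> q = idt unt"
    using q q' by (auto simp: inv_pair_def)
  have f: "f = q' \<bullet> (q \<bullet> f)" using qa assms by (simp add: cmp_reassoc[OF qa(5)])
  have "q \<bullet> f \<noteq> zer (dm f) (cd q)"
  proof
    assume z: "q \<bullet> f = zer (dm f) (cd q)"
    have "q' \<bullet> (q \<bullet> f) = zer (dm f) unt" unfolding z using qa assms(1) by simp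
    then show False using f assms(3) by metis
  qed
  then have "epi (q \<bullet> f)" using to_simple_epi[OF q(3), of "q \<bullet> f"] qa q assms by simp
  then have "epi (q' \<bullet> (q \<bullet> f))"
    using epi_cmp[OF _ iso_epi[OF inv_pair_iso(2)[OF q']]] qa q assms by simp
  then show ?thesis using f by metis
qed

lemma ev_epi_left:
  assumes "dual d a ev co" "\<not> null a" shows "epi ev"
  using ev_nonzero[OF assms] to_unt_epi[of ev] assms(1) by (simp add: dual_def)

text \<open>Evaluation on \<open>a\<close> is epic, so \<open>b\<close> is a quotient of d \<otimes>
  (a \<otimes> b).\<close>

lemma tob_not_null:
  assumes "a \<in> Obj" "b \<in> Obj" "\<not> null a" "\<not> null b"
  shows "\<not> null (a ** b)"
proof
  assume n: "null (a ** b)"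
  obtain d ev co where D: "dual d a ev co" using ex_left_dual[OF assms(1)] by blast
  then have e: "epi ev" "dm ev = d ** a" "cd ev = unt" "d \<in> Obj"
    using ev_epi_left[OF D assms(3)] by (auto simp: dual_def)
  have n': "null (d ** (a ** b))" by (rule null_tl[OF n e(4)])
  have "epi ((ev ## idt b) \<bullet> asi d a b)"
    using epi_cmp[OF iso_epi[OF inv_pair_iso(2)[OF asc_iso[of d a b]]] epi_tr[OF e(1) assms(2)]] e assms
    by simp
  then have "epi (lun b \<bullet> (ev ## idt b) \<bullet> asi d a b)"
    using epi_cmp[OF _ iso_epi[OF inv_pair_iso(1)[OF lun_iso[OF assms(2)]]]] e assms by simp
  then have "null (cd (lun b \<bullet> (ev ## idt b) \<bullet> asi d a b))"
    by (rule null_epi[rotated]) (use n' e assms in auto)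
  then show False using assms e by simp
qed

text \<open>If a \<otimes> f vanishes, so does (d \<otimes> a) \<otimes> f; the epic evaluation d
  \<otimes> a to 1 carries this over to 1 \<otimes> f and hence to \<open>f\<close>.\<close>

lemma ten_faithful:
  assumes "a \<in> Obj" "\<not> null a" "arr f" "idt a ## f = zer (a ** dm f) (a ** cd f)"
  shows "f = zer (dm f) (cd f)"
proof -
  obtain d ev co where D: "dual d a ev co" using ex_left_dual[OF assms(1)] by blast
  then have e: "epi ev" "dm ev = d ** a" "cd ev = unt" "d \<in> Obj"
    using ev_epi_left[OF D assms(2)] by (auto simp: dual_def)
  have n: "asi d a (cd f) \<bullet> (idt d ## (idt a ## f)) = (idt (d ** a) ## f) \<bullet> asi d a (dm f)"
    using asi_nat[of "idt d" "idt a" f] e assms(1,3) by simp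
  have "idt (d ** a) ## f = ((idt (d ** a) ## f) \<bullet> asi d a (dm f)) \<bullet> asc d a (dm f)"
    using e assms(1,3) by simp
  also have "\<dots> = asi d a (cd f) \<bullet> (idt d ## (idt a ## f)) \<bullet> asc d a (dm f)"
    unfolding n[symmetric] by simp
  also have "\<dots> = zer ((d ** a) ** dm f) ((d ** a) ** cd f)"
    unfolding assms(4) using e assms(1,3) by simp
  finally have z: "idt (d ** a) ## f = zer ((d ** a) ** dm f) ((d ** a) ** cd f)" .
  have "(idt unt ## f) \<bullet> (ev ## idt (dm f)) = (ev ## idt (cd f)) \<bullet> (idt (d ** a) ## f)"
    using interchange[of ev f] e assms by simp
  also have "\<dots> = zer (unt ** dm f) (unt ** cd f) \<bullet> (ev ## idt (dm f))"
    unfolding z using e assms(1,3) by simp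
  finally have "(idt unt ## f) \<bullet> (ev ## idt (dm f)) = zer (unt ** dm f) (unt ** cd f) \<bullet> (ev ## idt (dm f))" .
  moreover have "epi (ev ## idt (dm f))" using e assms by (intro epi_tr) auto
  ultimately have "idt unt ## f = zer (unt ** dm f) (unt ** cd f)"
    by - (rule epiD[of "ev ## idt (dm f)"], use e assms in auto)
  then have "idt unt ## f = idt unt ## zer (dm f) (cd f)" using assms(3) by simp
  then show ?thesis by - (rule cancel_unit, use assms(3) in auto)
qed

end

context rigid begin

lemma biprod_tr: "\<lbrakk>biprod i p j q; a \<in> Obj\<rbrakk> \<Longrightarrow> biprod (i ## idt a) (p ## idt a) (j ## idt a) (q ## idt a)"
  by (rule rev.biprod_tl)

lemma biprod_eqI:
  assumes b: "biprod i p j q" and f: "arr f" "arr g" "dm f = cd i" "dm g = cd i" "f \<bullet> i = g \<bullet> i" "f \<bullet> j = g \<bullet> j"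
  shows "f = g"
proof -
  note b' = b[unfolded biprod_def]
  have *: "h = (h \<bullet> i \<bullet> p) +++ (h \<bullet> j \<bullet> q)" if "arr h" "dm h = cd i" for h
  proof -
    have "h = h \<bullet> ((i \<bullet> p) +++ (j \<bullet> q))" using b' that by simp
    also have "\<dots> = (h \<bullet> i \<bullet> p) +++ (h \<bullet> j \<bullet> q)"
      by (rule cmp_add) (use b' that in auto)
    finally show ?thesis .
  qed
  have "f \<bullet> i \<bullet> p = g \<bullet> i \<bullet> p" "f \<bullet> j \<bullet> q = g \<bullet> j \<bullet> q"
    using cmp_reassoc[OF f(5), of p] cmp_reassoc[OF f(6), of q] by simp_all
  then show ?thesis using *[OF f(1,3)] *[OF f(2,4)] by metis
qed

end

section \<open>Modules over an algebra\<close>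

locale algebra = rigid Obj arr dm cd cmp idt add neg zer tob ten unt asc asi lun lui run rui
  for Obj :: "'o set" and arr :: "'f \<Rightarrow> bool" and dm cd
    and cmp (infixr \<open>\<bullet>\<close> 60) and idt and add (infixl \<open>+++\<close> 65) and neg and zer
    and tob (infixl \<open>**\<close> 70) and ten (infixl \<open>##\<close> 70) and unt asc asi lun lui run rui +
  fixes A :: 'o and mu u :: 'f
  assumes A_Obj [simp]: "A \<in> Obj"
    and arr_mu [simp]: "arr mu" "dm mu = A ** A" "cd mu = A"
    and arr_u [simp]: "arr u" "dm u = unt" "cd u = A"
    and mu_assoc: "mu \<bullet> (mu ## idt A) = mu \<bullet> (idt A ## mu) \<bullet> asc A A A"
    and mu_unit_left: "mu \<bullet> (u ## idt A) = lun A"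
    and mu_unit_right: "mu \<bullet> (idt A ## u) = run A"
begin

text \<open>A module is identified with its action map \<open>\<rho> : x \<otimes> A \<rightarrow> x\<close>; its underlying object is \<open>cd \<rho>\<close>.\<close>

definition act_typed :: "'f \<Rightarrow> bool" where
  "act_typed \<rho> \<longleftrightarrow> arr \<rho> \<and> dm \<rho> = cd \<rho> ** A"

definition is_mod :: "'f \<Rightarrow> bool" where
  "is_mod \<rho> \<longleftrightarrow> act_typed \<rho> \<and>
     \<rho> \<bullet> (\<rho> ## idt A) = \<rho> \<bullet> (idt (cd \<rho>) ## mu) \<bullet> asc (cd \<rho>) A A \<and>
     \<rho> \<bullet> (idt (cd \<rho>) ## u) = run (cd \<rho>)"

definition equivariant :: "'f \<Rightarrow> 'f \<Rightarrow> 'f \<Rightarrow> bool" where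
  "equivariant f \<rho> \<sigma> \<longleftrightarrow> arr f \<and> dm f = cd \<rho> \<and> cd f = cd \<sigma> \<and> f \<bullet> \<rho> = \<sigma> \<bullet> (f ## idt A)"

definition mhom :: "'f \<Rightarrow> 'f \<Rightarrow> 'f \<Rightarrow> bool" where
  "mhom f \<rho> \<sigma> \<longleftrightarrow> is_mod \<rho> \<and> is_mod \<sigma> \<and> equivariant f \<rho> \<sigma>"

lemma act_typedD: "act_typed \<rho> \<Longrightarrow> arr \<rho>" "act_typed \<rho> \<Longrightarrow> dm \<rho> = cd \<rho> ** A"
  by (auto simp: act_typed_def)

lemma is_modD:
  assumes "is_mod \<rho>"
  shows "act_typed \<rho>" "arr \<rho>" "dm \<rho> = cd \<rho> ** A" "cd \<rho> \<in> Obj"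
    "\<rho> \<bullet> (\<rho> ## idt A) = \<rho> \<bullet> (idt (cd \<rho>) ## mu) \<bullet> asc (cd \<rho>) A A"
    "\<rho> \<bullet> (idt (cd \<rho>) ## u) = run (cd \<rho>)"
  using assms by (auto simp: is_mod_def act_typed_def)

lemma mhomD:
  assumes "mhom f \<rho> \<sigma>"
  shows "is_mod \<rho>" "is_mod \<sigma>" "arr f" "dm f = cd \<rho>" "cd f = cd \<sigma>" "f \<bullet> \<rho> = \<sigma> \<bullet> (f ## idt A)"
  using assms by (auto simp: mhom_def equivariant_def)

text \<open>Each side of a module axiom for \<tau>, restricted along \<open>e\<close>, equals the
  same side for \<rho> followed by \<open>e\<close>. The axioms therefore pass to submodules by
  cancelling a monic, to quotients by cancelling an epic, and to direct sums by testing on the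
  summands.\<close>

lemma equivariant_axioms:
  assumes e: "equivariant e \<rho> \<tau>" and t: "act_typed \<rho>" "act_typed \<tau>"
  shows "(\<tau> \<bullet> (\<tau> ## idt A)) \<bullet> ((e ## idt A) ## idt A) = e \<bullet> \<rho> \<bullet> (\<rho> ## idt A)"
    "(\<tau> \<bullet> (idt (cd \<tau>) ## mu) \<bullet> asc (cd \<tau>) A A) \<bullet> ((e ## idt A) ## idt A)
      = e \<bullet> \<rho> \<bullet> (idt (cd \<rho>) ## mu) \<bullet> asc (cd \<rho>) A A"
    "(\<tau> \<bullet> (idt (cd \<tau>) ## u)) \<bullet> (e ## idt unt) = e \<bullet> \<rho> \<bullet> (idt (cd \<rho>) ## u)"
    "run (cd \<tau>) \<bullet> (e ## idt unt) = e \<bullet> run (cd \<rho>)"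
proof -
  note t' = act_typedD[OF t(1)] act_typedD[OF t(2)]
  have ea: "arr e" "dm e = cd \<rho>" "cd e = cd \<tau>" and eq: "e \<bullet> \<rho> = \<tau> \<bullet> (e ## idt A)"
    using e by (auto simp: equivariant_def)
  have 1: "(\<tau> ## idt A) \<bullet> ((e ## idt A) ## idt A) = (e ## idt A) \<bullet> (\<rho> ## idt A)"
    using t' ea eq by (simp flip: whisker_right)
  show "(\<tau> \<bullet> (\<tau> ## idt A)) \<bullet> ((e ## idt A) ## idt A) = e \<bullet> \<rho> \<bullet> (\<rho> ## idt A)"
    by (simp add: 1 cmp_reassoc[OF eq])
  have 2: "asc (cd \<tau>) A A \<bullet> ((e ## idt A) ## idt A) = (e ## idt (A ** A)) \<bullet> asc (cd \<rho>) A A"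
    using asc_nat[of e "idt A" "idt A"] ea by simp
  have 3: "(idt (cd \<tau>) ## mu) \<bullet> (e ## idt (A ** A)) = (e ## idt A) \<bullet> (idt (cd \<rho>) ## mu)"
    using interchange[of e mu] ea by simp
  show "(\<tau> \<bullet> (idt (cd \<tau>) ## mu) \<bullet> asc (cd \<tau>) A A) \<bullet> ((e ## idt A) ## idt A)
      = e \<bullet> \<rho> \<bullet> (idt (cd \<rho>) ## mu) \<bullet> asc (cd \<rho>) A A"
    by (simp add: 2 cmp_reassoc[OF 3] cmp_reassoc[OF eq])
  have 4: "(idt (cd \<tau>) ## u) \<bullet> (e ## idt unt) = (e ## idt A) \<bullet> (idt (cd \<rho>) ## u)"
    using interchange[of e u] ea by simp
  show "(\<tau> \<bullet> (idt (cd \<tau>) ## u)) \<bullet> (e ## idt unt) = e \<bullet> \<rho> \<bullet> (idt (cd \<rho>) ## u)"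
    by (simp add: 4 cmp_reassoc[OF eq])
  show "run (cd \<tau>) \<bullet> (e ## idt unt) = e \<bullet> run (cd \<rho>)" using run_nat[of e] ea by simp
qed

lemma submodule:
  assumes m: "mono i" and e: "equivariant i \<rho> \<tau>" "act_typed \<rho>" "is_mod \<tau>"
  shows "is_mod \<rho>"
proof -
  note t = is_modD[OF e(3)] and r = act_typedD[OF e(2)]
  have ia: "arr i" "dm i = cd \<rho>" "cd i = cd \<tau>" using e by (auto simp: equivariant_def)
  note E = equivariant_axioms[OF e(1,2) t(1)]
  have "i \<bullet> \<rho> \<bullet> (\<rho> ## idt A) = i \<bullet> \<rho> \<bullet> (idt (cd \<rho>) ## mu) \<bullet> asc (cd \<rho>) A A"
    unfolding E(1,2)[symmetric] t(5) ..
  then have "\<rho> \<bullet> (\<rho> ## idt A) = \<rho> \<bullet> (idt (cd \<rho>) ## mu) \<bullet> asc (cd \<rho>) A A"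
    by (rule monoD[OF m, rotated 4]) (use r ia in auto)
  moreover have "i \<bullet> \<rho> \<bullet> (idt (cd \<rho>) ## u) = i \<bullet> run (cd \<rho>)"
    unfolding E(3,4)[symmetric] t(6) ..
  then have "\<rho> \<bullet> (idt (cd \<rho>) ## u) = run (cd \<rho>)"
    by (rule monoD[OF m, rotated 4]) (use r ia in auto)
  ultimately show ?thesis using e by (simp add: is_mod_def)
qed

lemma quotient_module:
  assumes m: "epi p" and e: "equivariant p \<rho> \<tau>" "is_mod \<rho>" "act_typed \<tau>"
  shows "is_mod \<tau>"
proof -
  note r = is_modD[OF e(2)] and t = act_typedD[OF e(3)]
  have ia: "arr p" "dm p = cd \<rho>" "cd p = cd \<tau>" using e by (auto simp: equivariant_def)
  note E = equivariant_axioms[OF e(1) r(1) e(3)]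
  have m': "epi ((p ## idt A) ## idt A)" "epi (p ## idt unt)" using m by (simp_all add: epi_tr)
  have "(\<tau> \<bullet> (\<tau> ## idt A)) \<bullet> ((p ## idt A) ## idt A)
      = (\<tau> \<bullet> (idt (cd \<tau>) ## mu) \<bullet> asc (cd \<tau>) A A) \<bullet> ((p ## idt A) ## idt A)"
    unfolding E r(5) ..
  then have "\<tau> \<bullet> (\<tau> ## idt A) = \<tau> \<bullet> (idt (cd \<tau>) ## mu) \<bullet> asc (cd \<tau>) A A"
    by (rule epiD[OF m'(1), rotated 4]) (use t ia in auto)
  moreover have "(\<tau> \<bullet> (idt (cd \<tau>) ## u)) \<bullet> (p ## idt unt) = run (cd \<tau>) \<bullet> (p ## idt unt)"
    unfolding E r(6) ..
  then have "\<tau> \<bullet> (idt (cd \<tau>) ## u) = run (cd \<tau>)"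
    by (rule epiD[OF m'(2), rotated 4]) (use t ia in auto)
  ultimately show ?thesis using e by (simp add: is_mod_def)
qed

text \<open>The action on the sum is the diagonal one; its axioms are tested on the two summands,
  where \<open>equivariant_axioms\<close> reduces them to those of \<rho> and \<sigma>.\<close>

lemma biprod_module:
  assumes b: "biprod i p j q" and r: "is_mod \<rho>" "cd \<rho> = dm i" and s: "is_mod \<sigma>" "cd \<sigma> = dm j"
  shows "\<exists>\<tau>. mhom i \<rho> \<tau> \<and> mhom j \<sigma> \<tau> \<and> mhom p \<tau> \<rho> \<and> mhom q \<tau> \<sigma>"
proof -
  note b' = b[unfolded biprod_def] and r' = is_modD[OF r(1)] and s' = is_modD[OF s(1)]
  define \<tau> where "\<tau> = (i \<bullet> \<rho> \<bullet> (p ## idt A)) +++ (j \<bullet> \<sigma> \<bullet> (q ## idt A))"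
  have t: "arr \<tau>" "dm \<tau> = cd i ** A" "cd \<tau> = cd i" "act_typed \<tau>"
    using b' r r' s s' by (auto simp: \<tau>_def act_typed_def)
  note bA = biprod_tr[OF b A_Obj]
  note bA' = bA[unfolded biprod_def]
  have ti: "\<tau> \<bullet> (i ## idt A) = i \<bullet> \<rho>" "\<tau> \<bullet> (j ## idt A) = j \<bullet> \<sigma>"
    using b' r r' s s' bA' by (simp_all add: \<tau>_def add_cmp)
  have pt: "p \<bullet> \<tau> = \<rho> \<bullet> (p ## idt A)" "q \<bullet> \<tau> = \<sigma> \<bullet> (q ## idt A)"
  proof -
    have "p \<bullet> i \<bullet> \<rho> = \<rho>" "q \<bullet> j \<bullet> \<sigma> = \<sigma>" "p \<bullet> j \<bullet> \<sigma> = zer (dm \<sigma>) (dm i)" "q \<bullet> i \<bullet> \<rho> = zer (dm \<rho>) (dm j)"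
      using b' r r' s s' cmp_reassoc[of p i _ \<rho>] cmp_reassoc[of q j _ \<sigma>]
        cmp_reassoc[of p j _ \<sigma>] cmp_reassoc[of q i _ \<rho>] by simp_all
    then have "p \<bullet> i \<bullet> \<rho> \<bullet> (p ## idt A) = \<rho> \<bullet> (p ## idt A)" "q \<bullet> j \<bullet> \<sigma> \<bullet> (q ## idt A) = \<sigma> \<bullet> (q ## idt A)"
      "p \<bullet> j \<bullet> \<sigma> \<bullet> (q ## idt A) = zer (dm \<sigma>) (dm i) \<bullet> (q ## idt A)"
      "q \<bullet> i \<bullet> \<rho> \<bullet> (p ## idt A) = zer (dm \<rho>) (dm j) \<bullet> (p ## idt A)"
      by (simp_all only: cmp_assoc[symmetric])
    then show "p \<bullet> \<tau> = \<rho> \<bullet> (p ## idt A)" "q \<bullet> \<tau> = \<sigma> \<bullet> (q ## idt A)"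
      using b' r r' s s' by (simp_all add: \<tau>_def cmp_add)
  qed
  have e: "equivariant i \<rho> \<tau>" "equivariant j \<sigma> \<tau>" "equivariant p \<tau> \<rho>" "equivariant q \<tau> \<sigma>"
    using b' r r' s s' t ti pt by (simp_all add: equivariant_def)
  note Ei = equivariant_axioms[OF e(1) r'(1) t(4)] and Ej = equivariant_axioms[OF e(2) s'(1) t(4)]
  have "\<tau> \<bullet> (\<tau> ## idt A) = \<tau> \<bullet> (idt (cd \<tau>) ## mu) \<bullet> asc (cd \<tau>) A A"
  proof (rule biprod_eqI[OF biprod_tr[OF bA A_Obj]])
    show "(\<tau> \<bullet> (\<tau> ## idt A)) \<bullet> ((i ## idt A) ## idt A)
        = (\<tau> \<bullet> (idt (cd \<tau>) ## mu) \<bullet> asc (cd \<tau>) A A) \<bullet> ((i ## idt A) ## idt A)"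
      unfolding Ei r'(5) ..
    show "(\<tau> \<bullet> (\<tau> ## idt A)) \<bullet> ((j ## idt A) ## idt A)
        = (\<tau> \<bullet> (idt (cd \<tau>) ## mu) \<bullet> asc (cd \<tau>) A A) \<bullet> ((j ## idt A) ## idt A)"
      unfolding Ej s'(5) ..
  qed (use b' t in auto)
  moreover have "\<tau> \<bullet> (idt (cd \<tau>) ## u) = run (cd \<tau>)"
  proof (rule biprod_eqI[OF biprod_tr[OF b unt_Obj]])
    show "(\<tau> \<bullet> (idt (cd \<tau>) ## u)) \<bullet> (i ## idt unt) = run (cd \<tau>) \<bullet> (i ## idt unt)"
      unfolding Ei r'(6) ..
    show "(\<tau> \<bullet> (idt (cd \<tau>) ## u)) \<bullet> (j ## idt unt) = run (cd \<tau>) \<bullet> (j ## idt unt)"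
      unfolding Ej s'(6) ..
  qed (use b' t in auto)
  ultimately have "is_mod \<tau>" using t by (simp add: is_mod_def)
  then show ?thesis using e r s by (auto simp: mhom_def)
qed

lemma ker_module:
  assumes f: "mhom f \<rho> \<sigma>" and k: "is_ker f k"
  shows "\<exists>\<kappa>. mhom k \<kappa> \<rho>"
proof -
  note f' = mhomD[OF f] and k' = k[unfolded is_ker_def]
  note r = is_modD[OF f'(1)] and s = is_modD[OF f'(2)]
  have ka: "arr k" "cd k = cd \<rho>" "f \<bullet> k = zer (dm k) (cd f)" "mono k" using k' f' by auto
  have "f \<bullet> \<rho> \<bullet> (k ## idt A) = \<sigma> \<bullet> (f ## idt A) \<bullet> (k ## idt A)"
    by (simp add: cmp_reassoc[OF f'(6)])
  also have "\<dots> = zer (dm k ** A) (cd \<sigma>)"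
    using ka f' r s by (simp flip: whisker_right)
  finally have "\<exists>\<kappa>. k \<bullet> \<kappa> = \<rho> \<bullet> (k ## idt A)" using k' f' r ka by simp
  then obtain \<kappa> where x: "k \<bullet> \<kappa> = \<rho> \<bullet> (k ## idt A)" ..
  have xa: "arr \<kappa>" "cd \<kappa> = dm k" "dm \<kappa> = dm k ** A"
    using cmp_arrD[OF x] ka r by auto
  have e: "equivariant k \<kappa> \<rho>" "act_typed \<kappa>" using x xa ka by (auto simp: equivariant_def act_typed_def)
  then have "is_mod \<kappa>" using submodule[OF ka(4) e f'(1)] by simp
  then show ?thesis using e f'(1) by (auto simp: mhom_def)
qed

text \<open>Because p \<otimes> A is a cokernel of f \<otimes> A, the map \<sigma> followed by
  \<open>p\<close> descends to an action on the cokernel.\<close>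

lemma cok_module:
  assumes f: "mhom f \<rho> \<sigma>" and p: "is_cok f p"
  shows "\<exists>\<tau>. mhom p \<sigma> \<tau>"
proof -
  note f' = mhomD[OF f] and p' = p[unfolded is_cok_def]
  note r = is_modD[OF f'(1)] and s = is_modD[OF f'(2)]
  have pa: "arr p" "dm p = cd \<sigma>" "p \<bullet> f = zer (dm f) (cd p)" "epi p" using p' f' by auto
  have "(p \<bullet> \<sigma>) \<bullet> (f ## idt A) = (p \<bullet> f) \<bullet> \<rho>" using f'(6) by simp
  also have "\<dots> = zer (cd \<rho> ** A) (cd p)" unfolding pa(3) using f' r pa by simp
  finally have "\<exists>\<tau>. \<tau> \<bullet> (p ## idt A) = p \<bullet> \<sigma>"
    using cok_tr[OF p A_Obj] f' pa s unfolding is_cok_def by simp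
  then obtain \<tau> where x: "\<tau> \<bullet> (p ## idt A) = p \<bullet> \<sigma>" ..
  have xa: "arr \<tau>" "dm \<tau> = cd p ** A" "cd \<tau> = cd p"
    using cmp_arrD[OF x] pa s by auto
  have e: "equivariant p \<sigma> \<tau>" "act_typed \<tau>" using x xa pa by (auto simp: equivariant_def act_typed_def)
  then have "is_mod \<tau>" using quotient_module[OF pa(4) e(1) f'(2) e(2)] by simp
  then show ?thesis using e f'(2) by (auto simp: mhom_def)
qed

lemma mhom_cmp:
  assumes "mhom f \<rho> \<sigma>" "mhom g \<sigma> \<tau>" shows "mhom (g \<bullet> f) \<rho> \<tau>"
proof -
  note f = mhomD[OF assms(1)] and g = mhomD[OF assms(2)]
  have "(g \<bullet> f) \<bullet> \<rho> = \<tau> \<bullet> ((g \<bullet> f) ## idt A)"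
    using f g by (simp add: whisker_right cmp_reassoc[OF g(6)])
  then show ?thesis using f g by (simp add: mhom_def equivariant_def)
qed

lemma mhom_idt: "is_mod \<rho> \<Longrightarrow> mhom (idt (cd \<rho>)) \<rho> \<rho>"
  using is_modD[of \<rho>] by (simp add: mhom_def equivariant_def)

lemma mhom_add: "\<lbrakk>mhom f \<rho> \<sigma>; mhom g \<rho> \<sigma>\<rbrakk> \<Longrightarrow> mhom (f +++ g) \<rho> \<sigma>"
  using is_modD[of \<rho>] is_modD[of \<sigma>] by (simp add: mhom_def equivariant_def add_cmp add_ten cmp_add)

lemma neg_ten: "\<lbrakk>arr f; arr g\<rbrakk> \<Longrightarrow> neg f ## g = neg (f ## g)"
proof -
  assume a: "arr f" "arr g"
  have "(f ## g) +++ (neg f ## g) = (f +++ neg f) ## g" by (rule add_ten[symmetric]) (use a in auto)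
  also have "\<dots> = (f ## g) +++ neg (f ## g)" using a by simp
  finally show ?thesis by (rule add_left_cancel[rotated 7]) (use a in auto)
qed

lemma mhom_neg: "mhom f \<rho> \<sigma> \<Longrightarrow> mhom (neg f) \<rho> \<sigma>"
  using is_modD[of \<rho>] is_modD[of \<sigma>] by (simp add: mhom_def equivariant_def neg_ten)

lemma mhom_zer: "\<lbrakk>is_mod \<rho>; is_mod \<sigma>\<rbrakk> \<Longrightarrow> mhom (zer (cd \<rho>) (cd \<sigma>)) \<rho> \<sigma>"
  using is_modD[of \<rho>] is_modD[of \<sigma>] by (simp add: mhom_def equivariant_def)

lemma mhom_mono_cancel:
  assumes "mono m" "mhom m \<sigma> \<tau>" "mhom (m \<bullet> f) \<rho> \<tau>" "arr f" "cd f = dm m"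
  shows "mhom f \<rho> \<sigma>"
proof -
  note m = mhomD[OF assms(2)] and mf = mhomD[OF assms(3)]
  note r = is_modD[OF mf(1)] and s = is_modD[OF m(1)]
  have d: "dm f = cd \<rho>" using mf assms m by simp
  have "m \<bullet> f \<bullet> \<rho> = m \<bullet> \<sigma> \<bullet> (f ## idt A)"
    using mf(6) assms m by (simp add: whisker_right cmp_reassoc[OF m(6)])
  then have "f \<bullet> \<rho> = \<sigma> \<bullet> (f ## idt A)"
    by (rule monoD[OF assms(1), rotated 4]) (use assms m mf r s d in auto)
  then show ?thesis using m mf d assms by (simp add: mhom_def equivariant_def)
qed

lemma mhom_epi_cancel:
  assumes "epi p" "mhom p \<rho> \<sigma>" "mhom (f \<bullet> p) \<rho> \<tau>" "arr f" "dm f = cd p"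
  shows "mhom f \<sigma> \<tau>"
proof -
  note p = mhomD[OF assms(2)] and fp = mhomD[OF assms(3)]
  note r = is_modD[OF p(1)] and s = is_modD[OF p(2)] and t = is_modD[OF fp(2)]
  have d: "cd f = cd \<tau>" using fp assms p by simp
  have "(f \<bullet> \<sigma>) \<bullet> (p ## idt A) = (f \<bullet> p) \<bullet> \<rho>" using p(6) by simp
  also have "\<dots> = (\<tau> \<bullet> (f ## idt A)) \<bullet> (p ## idt A)"
    unfolding fp(6) using assms by (simp add: whisker_right)
  finally have "f \<bullet> \<sigma> = \<tau> \<bullet> (f ## idt A)"
    by (rule epiD[OF epi_tr[OF assms(1) A_Obj], rotated 4]) (use assms p fp r s t d in auto)
  then show ?thesis using p fp d assms by (simp add: mhom_def equivariant_def)
qed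

end

section \<open>The abelian category of modules\<close>

context preadd begin

lemma zer_mono_null:
  assumes "mono f" "f = zer (dm f) (cd f)"
  shows "null (dm f)"
proof -
  have "f \<bullet> idt (dm f) = f" using assms(1) by simp
  also have "\<dots> = f \<bullet> zer (dm f) (dm f)" using assms(1) by (subst assms(2)) simp
  finally have "idt (dm f) = zer (dm f) (dm f)"
    by (rule monoD[OF assms(1), rotated 4]) (use assms(1) in auto)
  then show ?thesis using assms(1) by (simp add: null_def)
qed

end

context algebra begin

text \<open>Arrows of the category of modules are triples (source, map, target); \<open>None\<close> is the result of
  an undefined composition, which makes composition associative without side conditions.\<close>

definition marr :: "('f \<times> 'f \<times> 'f) option \<Rightarrow> bool" where
  "marr F \<longleftrightarrow> (\<exists>\<rho> f \<sigma>. F = Some (\<rho>, f, \<sigma>) \<and> mhom f \<rho> \<sigma>)"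

definition mdm :: "('f \<times> 'f \<times> 'f) option \<Rightarrow> 'f" where
  "mdm F = fst (the F)"

definition mcd :: "('f \<times> 'f \<times> 'f) option \<Rightarrow> 'f" where
  "mcd F = snd (snd (the F))"

definition und :: "('f \<times> 'f \<times> 'f) option \<Rightarrow> 'f" where
  "und F = fst (snd (the F))"

definition marrow :: "'f \<Rightarrow> 'f \<Rightarrow> 'f \<Rightarrow> ('f \<times> 'f \<times> 'f) option" where
  "marrow \<rho> f \<sigma> = Some (\<rho>, f, \<sigma>)"

definition mcmp :: "('f \<times> 'f \<times> 'f) option \<Rightarrow> ('f \<times> 'f \<times> 'f) option \<Rightarrow> ('f \<times> 'f \<times> 'f) option"
    (infixr \<open>\<bullet>\<^sub>m\<close> 60) where
  "G \<bullet>\<^sub>m F = (if marr G \<and> marr F \<and> mdm G = mcd F then marrow (mdm F) (und G \<bullet> und F) (mcd G) else None)"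

definition midt :: "'f \<Rightarrow> ('f \<times> 'f \<times> 'f) option" where
  "midt \<rho> = marrow \<rho> (idt (cd \<rho>)) \<rho>"

definition madd :: "('f \<times> 'f \<times> 'f) option \<Rightarrow> ('f \<times> 'f \<times> 'f) option \<Rightarrow> ('f \<times> 'f \<times> 'f) option"
    (infixl \<open>+++\<^sub>m\<close> 65) where
  "F +++\<^sub>m G = marrow (mdm F) (und F +++ und G) (mcd F)"

definition mneg :: "('f \<times> 'f \<times> 'f) option \<Rightarrow> ('f \<times> 'f \<times> 'f) option" where
  "mneg F = marrow (mdm F) (neg (und F)) (mcd F)"

definition mzer :: "'f \<Rightarrow> 'f \<Rightarrow> ('f \<times> 'f \<times> 'f) option" where
  "mzer \<rho> \<sigma> = marrow \<rho> (zer (cd \<rho>) (cd \<sigma>)) \<sigma>"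

lemma marrow_simps [simp]:
  "mdm (marrow \<rho> f \<sigma>) = \<rho>" "mcd (marrow \<rho> f \<sigma>) = \<sigma>" "und (marrow \<rho> f \<sigma>) = f"
  "marr (marrow \<rho> f \<sigma>) \<longleftrightarrow> mhom f \<rho> \<sigma>"
  by (auto simp: marrow_def mdm_def mcd_def und_def marr_def)

lemma marr_None [simp]: "\<not> marr None"
  by (simp add: marr_def)

lemma marr_iff: "marr F \<longleftrightarrow> F = marrow (mdm F) (und F) (mcd F) \<and> mhom (und F) (mdm F) (mcd F)"
  by (cases F) (auto simp: marrow_def mdm_def mcd_def und_def marr_def)

lemma marrD:
  assumes "marr F"
  shows "mhom (und F) (mdm F) (mcd F)" "is_mod (mdm F)" "is_mod (mcd F)" "arr (und F)"
    "dm (und F) = cd (mdm F)" "cd (und F) = cd (mcd F)"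
  using assms mhomD[of "und F" "mdm F" "mcd F"] by (auto simp: marr_iff)

lemma marr_eqI: "\<lbrakk>marr F; marr G; mdm F = mdm G; mcd F = mcd G; und F = und G\<rbrakk> \<Longrightarrow> F = G"
  using marr_iff[of F] marr_iff[of G] by simp

lemma marr_mcmp: "marr (G \<bullet>\<^sub>m F) \<longleftrightarrow> marr G \<and> marr F \<and> mdm G = mcd F"
  using mhom_cmp[OF marrD(1)[of F], of "und G" "mcd G"] marrD(1)[of G] by (auto simp: mcmp_def)

lemma mcmp_simps:
  assumes "marr G" "marr F" "mdm G = mcd F"
  shows "mdm (G \<bullet>\<^sub>m F) = mdm F" "mcd (G \<bullet>\<^sub>m F) = mcd G" "und (G \<bullet>\<^sub>m F) = und G \<bullet> und F"
  using assms by (simp_all add: mcmp_def)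

lemma mod_acat: "acat {\<rho>. is_mod \<rho>} marr mdm mcd mcmp midt"
proof
  fix F G H
  show "marr (G \<bullet>\<^sub>m F) = (marr G \<and> marr F \<and> mdm G = mcd F)" by (rule marr_mcmp)
  show "(H \<bullet>\<^sub>m G) \<bullet>\<^sub>m F = H \<bullet>\<^sub>m G \<bullet>\<^sub>m F"
  proof (cases "marr H \<and> marr G \<and> marr F \<and> mdm H = mcd G \<and> mdm G = mcd F")
    case True
    then show ?thesis by (intro marr_eqI) (simp_all add: marr_mcmp mcmp_simps)
  next
    case False
    then have "\<not> marr ((H \<bullet>\<^sub>m G) \<bullet>\<^sub>m F)" "\<not> marr (H \<bullet>\<^sub>m G \<bullet>\<^sub>m F)"
      by (auto simp: marr_mcmp mcmp_simps)
    then show ?thesis by (metis marr_mcmp mcmp_def)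
  qed
next
  fix F G assume "marr G" "marr F" "mdm G = mcd F"
  then show "mdm (G \<bullet>\<^sub>m F) = mdm F" "mcd (G \<bullet>\<^sub>m F) = mcd G" by (simp_all add: mcmp_simps)
next
  fix \<rho> assume "\<rho> \<in> {\<rho>. is_mod \<rho>}"
  then show "marr (midt \<rho>)" "mdm (midt \<rho>) = \<rho>" "mcd (midt \<rho>) = \<rho>"
    by (simp_all add: midt_def mhom_idt)
next
  fix F \<rho> assume F: "marr F" "mdm F = \<rho>"
  note f = marrD[OF F(1)]
  have i: "marr (midt \<rho>)" using f F by (simp add: midt_def mhom_idt)
  have c: "mcd (midt \<rho>) = \<rho>" "mdm (midt \<rho>) = \<rho>" "und (midt \<rho>) = idt (cd \<rho>)" by (simp_all add: midt_def)
  show "F \<bullet>\<^sub>m midt \<rho> = F"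
    by (rule marr_eqI) (use i F f c in \<open>simp_all add: marr_mcmp mcmp_simps\<close>)
next
  fix F \<rho> assume F: "marr F" "mcd F = \<rho>"
  note f = marrD[OF F(1)]
  have i: "marr (midt \<rho>)" using f F by (simp add: midt_def mhom_idt)
  have c: "mcd (midt \<rho>) = \<rho>" "mdm (midt \<rho>) = \<rho>" "und (midt \<rho>) = idt (cd \<rho>)" by (simp_all add: midt_def)
  show "midt \<rho> \<bullet>\<^sub>m F = F"
    by (rule marr_eqI) (use i F f c in \<open>simp_all add: marr_mcmp mcmp_simps\<close>)
qed (simp_all add: marrD)

sublocale M: acat "{\<rho>. is_mod \<rho>}" marr mdm mcd mcmp midt
  by (rule mod_acat)

lemma und_simps [simp]:
  "\<lbrakk>marr G; marr F; mdm G = mcd F\<rbrakk> \<Longrightarrow> und (G \<bullet>\<^sub>m F) = und G \<bullet> und F"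
  "und (midt \<rho>) = idt (cd \<rho>)" "und (F +++\<^sub>m G) = und F +++ und G" "und (mneg F) = neg (und F)"
  "und (mzer \<rho> \<sigma>) = zer (cd \<rho>) (cd \<sigma>)"
  by (simp_all add: mcmp_simps midt_def madd_def mneg_def mzer_def)

lemma mod_preadd: "preadd {\<rho>. is_mod \<rho>} marr mdm mcd mcmp midt madd mneg mzer"
proof (unfold_locales, goal_cases)
  case (1 F G) then show ?case by (simp add: madd_def) (metis mhom_add marrD(1))
next
  case (2 F) then show ?case by (simp add: mneg_def mhom_neg marrD(1))
next
  case (3 a b) then show ?case by (simp add: mzer_def mhom_zer)
next
  case (4 F G H)
  show ?case using 4 marrD[OF 4(1)] marrD[OF 4(2)] marrD[OF 4(3)]
    by (simp add: madd_def add_assoc)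
next
  case (5 F G)
  show ?case using 5 marrD[OF 5(1)] marrD[OF 5(2)] by (simp add: madd_def add_comm)
next
  case (6 F a b)
  show ?case using 6 marrD[OF 6(1)] marr_iff[of F] by (simp add: madd_def mzer_def)
next
  case (7 F)
  show ?case using 7 marrD[OF 7] by (simp add: madd_def mneg_def mzer_def)
next
  case (8 F F' G)
  have a: "marr (F +++\<^sub>m F')" using 8 by (simp add: madd_def) (metis mhom_add marrD(1))
  show ?case using 8 a marrD[OF 8(1)] marrD[OF 8(2)] marrD[OF 8(5)]
    by (simp add: mcmp_def madd_def cmp_add)
next
  case (9 G G' F)
  have a: "marr (G +++\<^sub>m G')" using 9 by (simp add: madd_def) (metis mhom_add marrD(1))
  show ?case using 9 a marrD[OF 9(1)] marrD[OF 9(2)] marrD[OF 9(5)]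
    by (simp add: mcmp_def madd_def add_cmp)
qed

sublocale M: preadd "{\<rho>. is_mod \<rho>}" marr mdm mcd mcmp midt madd mneg mzer
  by (rule mod_preadd)

lemma mono_und: "\<lbrakk>marr F; mono (und F)\<rbrakk> \<Longrightarrow> M.mono F"
  unfolding M.mono_def
proof (intro conjI allI impI)
  fix G H assume F: "marr F" "mono (und F)"
    and "marr G \<and> marr H \<and> mdm G = mdm H \<and> mcd G = mdm F \<and> mcd H = mdm F \<and> F \<bullet>\<^sub>m G = F \<bullet>\<^sub>m H"
  then have gh: "marr G" "marr H" "mdm G = mdm H" "mcd G = mdm F" "mcd H = mdm F" "F \<bullet>\<^sub>m G = F \<bullet>\<^sub>m H" by auto
  have "und F \<bullet> und G = und F \<bullet> und H" using arg_cong[OF gh(6), of und] gh(1-5) F by simp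
  then have "und G = und H"
    by (rule monoD[OF F(2), rotated 4]) (use gh F marrD in simp_all)
  then show "G = H" using gh by (intro marr_eqI) auto
qed

lemma epi_und: "\<lbrakk>marr F; epi (und F)\<rbrakk> \<Longrightarrow> M.epi F"
  unfolding M.epi_def
proof (intro conjI allI impI)
  fix G H assume F: "marr F" "epi (und F)"
    and "marr G \<and> marr H \<and> mcd G = mcd H \<and> mdm G = mcd F \<and> mdm H = mcd F \<and> G \<bullet>\<^sub>m F = H \<bullet>\<^sub>m F"
  then have gh: "marr G" "marr H" "mcd G = mcd H" "mdm G = mcd F" "mdm H = mcd F" "G \<bullet>\<^sub>m F = H \<bullet>\<^sub>m F" by auto
  have "und G \<bullet> und F = und H \<bullet> und F" using arg_cong[OF gh(6), of und] gh(1-5) F by simp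
  then have "und G = und H"
    by (rule epiD[OF F(2), rotated 4]) (use gh F marrD in simp_all)
  then show "G = H" using gh by (intro marr_eqI) auto
qed

lemma M_kerI:
  assumes F: "marr F" and K: "marr K" "mcd K = mdm F" and k: "is_ker (und F) (und K)"
  shows "M.is_ker F K"
proof -
  note f = marrD[OF F] and k' = k[unfolded is_ker_def] and kk = marrD[OF K(1)]
  show ?thesis unfolding M.is_ker_def
  proof (intro conjI allI impI F K)
    show "M.mono K" using mono_und K k' by simp
    have z: "marr (mzer (mdm K) (mcd F))" using f kk by simp
    show "F \<bullet>\<^sub>m K = mzer (mdm K) (mcd F)"
      by (rule marr_eqI) (use z F K f kk k' in auto)
    fix G assume "marr G \<and> mcd G = mdm F \<and> F \<bullet>\<^sub>m G = mzer (mdm G) (mcd F)"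
    then have G: "marr G" "mcd G = mdm F" "F \<bullet>\<^sub>m G = mzer (mdm G) (mcd F)" by auto
    note g = marrD[OF G(1)]
    have "und F \<bullet> und G = zer (cd (mdm G)) (cd (mcd F))" using arg_cong[OF G(3), of und] G(1,2) F by simp
    then have "\<exists>h. und K \<bullet> h = und G" using k' g f G by simp
    then obtain h where h: "und K \<bullet> h = und G" ..
    have ha: "arr h" "cd h = dm (und K)" using cmp_arrD[OF h g(4)] by auto
    have "mhom h (mdm G) (mdm K)"
      by (rule mhom_mono_cancel[of "und K" _ "mcd K"]) (use k' kk g h ha G K in auto)
    then have "K \<bullet>\<^sub>m marrow (mdm G) h (mdm K) = G"
      by (intro marr_eqI) (use h G K g in auto)
    then show "\<exists>H. K \<bullet>\<^sub>m H = G" by blast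
  qed
qed

lemma M_cokI:
  assumes F: "marr F" and P: "marr P" "mdm P = mcd F" and p: "is_cok (und F) (und P)"
  shows "M.is_cok F P"
proof -
  note f = marrD[OF F] and p' = p[unfolded is_cok_def] and pp = marrD[OF P(1)]
  show ?thesis unfolding M.is_cok_def
  proof (intro conjI allI impI F P)
    show "M.epi P" using epi_und P p' by simp
    have z: "marr (mzer (mdm F) (mcd P))" using f pp by simp
    show "P \<bullet>\<^sub>m F = mzer (mdm F) (mcd P)"
      by (rule marr_eqI) (use z F P f pp p' in auto)
    fix G assume "marr G \<and> mdm G = mcd F \<and> G \<bullet>\<^sub>m F = mzer (mdm F) (mcd G)"
    then have G: "marr G" "mdm G = mcd F" "G \<bullet>\<^sub>m F = mzer (mdm F) (mcd G)" by auto
    note g = marrD[OF G(1)]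
    have "und G \<bullet> und F = zer (cd (mdm F)) (cd (mcd G))" using arg_cong[OF G(3), of und] G(1,2) F by simp
    then have "\<exists>h. h \<bullet> und P = und G" using p' g f G by simp
    then obtain h where h: "h \<bullet> und P = und G" ..
    have ha: "arr h" "dm h = cd (und P)" using cmp_arrD[OF h g(4)] by auto
    have "mhom h (mcd P) (mcd G)"
      by (rule mhom_epi_cancel[of "und P" "mdm P"]) (use p' pp g h ha G P in auto)
    then have "marrow (mcd P) h (mcd G) \<bullet>\<^sub>m P = G"
      by (intro marr_eqI) (use h G P g in auto)
    then show "\<exists>H. H \<bullet>\<^sub>m P = G" by blast
  qed
qed

lemma ex_M_ker:
  assumes F: "marr F"
  shows "\<exists>K. M.is_ker F K \<and> is_ker (und F) (und K)"
proof -
  obtain k where k: "is_ker (und F) k" using ex_ker marrD(4)[OF F] by blast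
  then obtain \<kappa> where "mhom k \<kappa> (mdm F)" using ker_module marrD(1)[OF F] by blast
  then have "M.is_ker F (marrow \<kappa> k (mdm F))" by (intro M_kerI F) (use k in auto)
  then show ?thesis using k by (intro exI[of _ "marrow \<kappa> k (mdm F)"]) simp
qed

lemma ex_M_cok:
  assumes F: "marr F"
  shows "\<exists>P. M.is_cok F P \<and> is_cok (und F) (und P)"
proof -
  obtain p where p: "is_cok (und F) p" using ex_cok marrD(4)[OF F] by blast
  then obtain \<tau> where "mhom p (mcd F) \<tau>" using cok_module marrD(1)[OF F] by blast
  then have "M.is_cok F (marrow (mcd F) p \<tau>)" by (intro M_cokI F) (use p in auto)
  then show ?thesis using p by (intro exI[of _ "marrow (mcd F) p \<tau>"]) simp
qed

text \<open>Kernels of module maps are kernels of the underlying maps with an induced action, so a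
  monic module map has a null underlying kernel.\<close>

lemma und_mono:
  assumes F: "M.mono F" shows "mono (und F)"
proof -
  have Fa: "marr F" using F by simp
  obtain K where K: "M.is_ker F K" "is_ker (und F) (und K)" using ex_M_ker[OF Fa] by blast
  have Ka: "marr K" "mcd K = mdm F" "F \<bullet>\<^sub>m K = mzer (mdm K) (mcd F)" using K by (auto simp: M.is_ker_def)
  have "K = mzer (mdm K) (mdm F)" using F Ka unfolding M.mono_iff by blast
  then have "und K = zer (cd (mdm K)) (cd (mdm F))" using und_simps(5) by metis
  moreover note k = marrD[OF Ka(1)] and mono = K(2)[unfolded is_ker_def]
  ultimately have "und K = zer (dm (und K)) (cd (und K))" using Ka by metis
  then have "null (dm (und K))" using zer_mono_null mono by blast
  then show ?thesis using ker_null_mono K(2) by blast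
qed

text \<open>The cokernel argument dual to \<open>und_mono\<close>. It lets lifting problems for
  modules be solved on underlying objects.\<close>

lemma und_epi:
  assumes F: "M.epi F" shows "epi (und F)"
proof -
  have Fa: "marr F" using F by simp
  obtain P where P: "M.is_cok F P" "is_cok (und F) (und P)" using ex_M_cok[OF Fa] by blast
  have Pa: "marr P" "mdm P = mcd F" "P \<bullet>\<^sub>m F = mzer (mdm F) (mcd P)" using P by (auto simp: M.is_cok_def)
  have "P = mzer (mcd F) (mcd P)" using F Pa unfolding M.epi_iff by blast
  then have "und P = zer (cd (mcd F)) (cd (mcd P))" using und_simps(5) by metis
  moreover note p = marrD[OF Pa(1)] and epi = P(2)[unfolded is_cok_def]
  ultimately have "und P = zer (dm (und P)) (cd (und P))" using Pa by metis
  then have "null (cd (und P))" using zer_epi_null epi by blast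
  then show ?thesis using cok_null_epi P(2) by blast
qed

lemma M_biprodI:
  assumes "marr I" "marr P" "marr J" "marr Q" "mcd I = mcd J" "mdm P = mcd I" "mdm Q = mcd J"
    "mcd P = mdm I" "mcd Q = mdm J" "biprod (und I) (und P) (und J) (und Q)"
  shows "M.biprod I P J Q"
proof -
  note m = marrD[OF assms(1)] marrD[OF assms(2)] marrD[OF assms(3)] marrD[OF assms(4)]
  note b = assms(10)[unfolded biprod_def]
  have z: "marr (mzer (mdm J) (mdm I))" "marr (mzer (mdm I) (mdm J))" "marr (midt (mdm I))" "marr (midt (mdm J))"
    "marr (midt (mcd I))" "marr (midt (mcd J))"
    using m by simp_all
  have "P \<bullet>\<^sub>m I = midt (mdm I)" by (rule marr_eqI) (use assms(1-9) m b z in auto)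
  moreover have "Q \<bullet>\<^sub>m J = midt (mdm J)" by (rule marr_eqI) (use assms(1-9) m b z in auto)
  moreover have "P \<bullet>\<^sub>m J = mzer (mdm J) (mdm I)" by (rule marr_eqI) (use assms(1-9) m b z in auto)
  moreover have "Q \<bullet>\<^sub>m I = mzer (mdm I) (mdm J)" by (rule marr_eqI) (use assms(1-9) m b z in auto)
  moreover have "(I \<bullet>\<^sub>m P) +++\<^sub>m (J \<bullet>\<^sub>m Q) = midt (mcd I)"
    by (rule marr_eqI) (use assms(1-9) m b z in auto)
  ultimately show ?thesis unfolding M.biprod_def using assms(1-9) by simp
qed

lemma mod_abel: "abel {\<rho>. is_mod \<rho>} marr mdm mcd mcmp midt madd mneg mzer"
proof (unfold_locales)
  fix F assume "marr F"
  then show "\<exists>K. M.is_ker F K" "\<exists>P. M.is_cok F P" using ex_M_ker ex_M_cok by blast+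
next
  fix F assume F: "M.mono F"
  then obtain P where P: "M.is_cok F P" "is_cok (und F) (und P)" using ex_M_cok[OF M.mono_arr[OF F]] by blast
  then have "is_ker (und P) (und F)" using mono_ker_cok und_mono[OF F] by blast
  then have "M.is_ker P F" by (intro M_kerI) (use P F in \<open>auto simp: M.is_cok_def\<close>)
  then show "\<exists>P. M.is_ker P F" ..
next
  fix \<rho> \<sigma> assume "\<rho> \<in> {\<rho>. is_mod \<rho>}" "\<sigma> \<in> {\<rho>. is_mod \<rho>}"
  then have m: "is_mod \<rho>" "is_mod \<sigma>" by auto
  obtain i p j q where b: "biprod i p j q" "dm i = cd \<rho>" "dm j = cd \<sigma>"
    using ex_biprod is_modD(4)[OF m(1)] is_modD(4)[OF m(2)] by blast
  then obtain \<tau> where "mhom i \<rho> \<tau>" "mhom j \<sigma> \<tau>" "mhom p \<tau> \<rho>" "mhom q \<tau> \<sigma>"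
    using biprod_module[OF b(1) m(1) _ m(2)] by auto
  then have "M.biprod (marrow \<rho> i \<tau>) (marrow \<tau> p \<rho>) (marrow \<sigma> j \<tau>) (marrow \<tau> q \<sigma>)"
    by (intro M_biprodI) (use b in auto)
  then show "\<exists>I P J Q. M.biprod I P J Q \<and> mdm I = \<rho> \<and> mdm J = \<sigma>"
    by (intro exI conjI) auto
qed

sublocale M: abel "{\<rho>. is_mod \<rho>}" marr mdm mcd mcmp midt madd mneg mzer
  by (rule mod_abel)

end

section \<open>Tensoring modules from the left, free modules and transposition\<close>

context rigid begin

text \<open>The composite in the hypothesis is the transpose of \<open>g\<close> under the
  adjunction between d \<otimes> - and a \<otimes> -, which is taken from the reversed category;
  transposing zero back gives zero.\<close>

lemma uncurry_left_zero:
  assumes D: "dual d a ev co" and g: "arr g" "cd g = a ** z" "z \<in> Obj"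
    and e: "(lun z \<bullet> (ev ## idt z) \<bullet> asi d a z) \<bullet> (idt d ## g) = zer (d ** dm g) z"
  shows "g = zer (dm g) (a ** z)"
proof -
  note D' = D[unfolded dual_def]
  have R: "rev.dual a d ev co" using D by (simp add: rev_dual)
  have "g = rev.curry_r a d co (dm g) (rev.uncurry_r a d ev z g)"
    by (rule rev.curry_uncurry_r[OF R, symmetric]) (use g in auto)
  also have "rev.uncurry_r a d ev z g = zer (d ** dm g) z"
    using e by (simp add: rev.uncurry_r_def)
  also have "rev.curry_r a d co (dm g) (zer (d ** dm g) z) = zer (dm g) (a ** z)"
    using D' g by (simp add: rev.curry_r_def)
  finally show ?thesis .
qed

end

context algebra begin

definition act :: "'o \<Rightarrow> 'f \<Rightarrow> 'f" where
  "act x \<rho> = (idt x ## \<rho>) \<bullet> asc x (cd \<rho>) A"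

lemma act_arr:
  assumes "x \<in> Obj" "act_typed \<rho>"
  shows "arr (act x \<rho>)" "dm (act x \<rho>) = (x ** cd \<rho>) ** A" "cd (act x \<rho>) = x ** cd \<rho>"
  using assms by (auto simp: act_def act_typed_def)

lemma cd_act [simp]: "\<lbrakk>x \<in> Obj; is_mod \<rho>\<rbrakk> \<Longrightarrow> cd (act x \<rho>) = x ** cd \<rho>"
  by (simp add: act_arr is_modD)

lemma is_mod_act [simp]:
  assumes x: "x \<in> Obj" and m: "is_mod \<rho>"
  shows "is_mod (act x \<rho>)"
proof -
  note r = is_modD[OF m]
  let ?y = "cd \<rho>"
  have 1: "asc x ?y A \<bullet> ((idt x ## \<rho>) ## idt A) = (idt x ## (\<rho> ## idt A)) \<bullet> asc x (?y ** A) A"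
    using asc_nat[of "idt x" \<rho> "idt A"] x r by simp
  have 2: "(idt x ## \<rho>) \<bullet> (idt x ## (\<rho> ## idt A))
      = (idt x ## \<rho>) \<bullet> (idt x ## (idt ?y ## mu)) \<bullet> (idt x ## asc ?y A A)"
    using x r by (simp flip: whisker_left)
  have 3: "asc x ?y A \<bullet> (idt (x ** ?y) ## mu) = (idt x ## (idt ?y ## mu)) \<bullet> asc x ?y (A ** A)"
    using asc_nat[of "idt x" "idt ?y" mu] x r by simp
  have 4: "asc x ?y A \<bullet> (idt (x ** ?y) ## u) = (idt x ## (idt ?y ## u)) \<bullet> asc x ?y unt"
    using asc_nat[of "idt x" "idt ?y" u] x r by simp
  have "act x \<rho> \<bullet> (act x \<rho> ## idt A)
      = (idt x ## \<rho>) \<bullet> (idt x ## (\<rho> ## idt A)) \<bullet> asc x (?y ** A) A \<bullet> (asc x ?y A ## idt A)"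
    using x r(2-4) by (simp add: act_def whisker_right cmp_reassoc[OF 1])
  also have "\<dots> = (idt x ## \<rho>) \<bullet> (idt x ## (idt ?y ## mu)) \<bullet>
      (idt x ## asc ?y A A) \<bullet> asc x (?y ** A) A \<bullet> (asc x ?y A ## idt A)"
    by (simp add: cmp_reassoc[OF 2])
  also have "\<dots> = (idt x ## \<rho>) \<bullet> (idt x ## (idt ?y ## mu)) \<bullet> asc x ?y (A ** A) \<bullet> asc (x ** ?y) A A"
    unfolding pentagon[OF x r(4) A_Obj A_Obj] by simp
  also have "\<dots> = act x \<rho> \<bullet> (idt (x ** ?y) ## mu) \<bullet> asc (x ** ?y) A A"
    by (simp add: act_def cmp_reassoc[OF 3])
  finally have a: "act x \<rho> \<bullet> (act x \<rho> ## idt A) = act x \<rho> \<bullet> (idt (x ** ?y) ## mu) \<bullet> asc (x ** ?y) A A" .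
  have "act x \<rho> \<bullet> (idt (x ** ?y) ## u) = ((idt x ## \<rho>) \<bullet> (idt x ## (idt ?y ## u))) \<bullet> asc x ?y unt"
    by (simp add: act_def 4)
  also have "(idt x ## \<rho>) \<bullet> (idt x ## (idt ?y ## u)) = idt x ## run ?y"
    using x r by (simp flip: whisker_left)
  also have "\<dots> \<bullet> asc x ?y unt = run (x ** ?y)"
    unfolding run_tob[OF x r(4), symmetric] using x r(4) by simp
  finally have b: "act x \<rho> \<bullet> (idt (x ** ?y) ## u) = run (x ** ?y)" .
  show ?thesis using a b act_arr[OF x r(1)] by (simp add: is_mod_def act_typed_def)
qed

lemma is_mod_mu [simp]: "is_mod mu"
  by (simp add: is_mod_def act_typed_def mu_assoc mu_unit_right)

lemma mhom_tl:
  assumes x: "x \<in> Obj" and f: "mhom f \<rho> \<sigma>"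
  shows "mhom (idt x ## f) (act x \<rho>) (act x \<sigma>)"
proof -
  note f' = mhomD[OF f] and r = is_modD[OF mhomD(1)[OF f]] and s = is_modD[OF mhomD(2)[OF f]]
  have 1: "asc x (cd \<sigma>) A \<bullet> ((idt x ## f) ## idt A) = (idt x ## (f ## idt A)) \<bullet> asc x (cd \<rho>) A"
    using asc_nat[of "idt x" f "idt A"] x f' by simp
  have 2: "(idt x ## f) \<bullet> (idt x ## \<rho>) = (idt x ## \<sigma>) \<bullet> (idt x ## (f ## idt A))"
    using x f' r s by (simp flip: whisker_left)
  have "(idt x ## f) \<bullet> act x \<rho> = act x \<sigma> \<bullet> ((idt x ## f) ## idt A)"
    by (simp add: act_def 1 cmp_reassoc[OF 2])
  then show ?thesis using x f' r s by (simp add: mhom_def equivariant_def)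
qed

lemma mhom_tw:
  assumes f: "arr f" and m: "is_mod \<rho>"
  shows "mhom (f ## idt (cd \<rho>)) (act (dm f) \<rho>) (act (cd f) \<rho>)"
proof -
  note r = is_modD[OF m]
  have 1: "asc (cd f) (cd \<rho>) A \<bullet> ((f ## idt (cd \<rho>)) ## idt A) = (f ## idt (cd \<rho> ** A)) \<bullet> asc (dm f) (cd \<rho>) A"
    using asc_nat[of f "idt (cd \<rho>)" "idt A"] f r by simp
  have 2: "(f ## idt (cd \<rho>)) \<bullet> (idt (dm f) ## \<rho>) = (idt (cd f) ## \<rho>) \<bullet> (f ## idt (cd \<rho> ** A))"
    using interchange[of f \<rho>] f r by simp
  have "(f ## idt (cd \<rho>)) \<bullet> act (dm f) \<rho> = act (cd f) \<rho> \<bullet> ((f ## idt (cd \<rho>)) ## idt A)"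
    by (simp add: act_def 1 cmp_reassoc[OF 2])
  then show ?thesis using f m r by (simp add: mhom_def equivariant_def)
qed

lemma mhom_asc:
  assumes x: "x \<in> Obj" "y \<in> Obj" and m: "is_mod \<rho>"
  shows "mhom (asc x y (cd \<rho>)) (act (x ** y) \<rho>) (act x (act y \<rho>))"
proof -
  note r = is_modD[OF m]
  have 1: "asc x y (cd \<rho>) \<bullet> (idt (x ** y) ## \<rho>) = (idt x ## (idt y ## \<rho>)) \<bullet> asc x y (cd \<rho> ** A)"
    using asc_nat[of "idt x" "idt y" \<rho>] x r by simp
  have "asc x y (cd \<rho>) \<bullet> act (x ** y) \<rho>
      = (idt x ## (idt y ## \<rho>)) \<bullet> (asc x y (cd \<rho> ** A) \<bullet> asc (x ** y) (cd \<rho>) A)"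
    by (simp add: act_def cmp_reassoc[OF 1])
  also have "\<dots> = act x (act y \<rho>) \<bullet> (asc x y (cd \<rho>) ## idt A)"
    unfolding pentagon[OF x r(4) A_Obj] using x r(2-4) by (simp add: act_def whisker_left)
  finally show ?thesis using x m r by (simp add: mhom_def equivariant_def)
qed

lemma mhom_inv:
  assumes "mhom f \<rho> \<sigma>" "inv_pair f g" shows "mhom g \<sigma> \<rho>"
proof -
  note f = mhomD[OF assms(1)] and g = assms(2)[unfolded inv_pair_def]
  have "mhom (f \<bullet> g) \<sigma> \<sigma>" using mhom_idt[OF f(2)] f g by simp
  then show ?thesis
    by (rule mhom_mono_cancel[OF iso_mono[OF inv_pair_iso(1)[OF assms(2)]] assms(1)]) (use g in auto)
qed

lemma mhom_asi:
  assumes "x \<in> Obj" "y \<in> Obj" "is_mod \<rho>"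
  shows "mhom (asi x y (cd \<rho>)) (act x (act y \<rho>)) (act (x ** y) \<rho>)"
  by (rule mhom_inv[OF mhom_asc[OF assms] asc_iso]) (use assms is_modD in auto)

lemma mhom_lun:
  assumes m: "is_mod \<rho>"
  shows "mhom (lun (cd \<rho>)) (act unt \<rho>) \<rho>"
proof -
  note r = is_modD[OF m]
  have 1: "lun (cd \<rho>) \<bullet> (idt unt ## \<rho>) = \<rho> \<bullet> lun (cd \<rho> ** A)" using lun_nat[of \<rho>] r by simp
  have "lun (cd \<rho>) \<bullet> act unt \<rho> = \<rho> \<bullet> (lun (cd \<rho> ** A) \<bullet> asc unt (cd \<rho>) A)"
    by (simp add: act_def cmp_reassoc[OF 1])
  also have "\<dots> = \<rho> \<bullet> (lun (cd \<rho>) ## idt A)" unfolding lun_tob[OF r(4) A_Obj] ..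
  finally show ?thesis using m r by (simp add: mhom_def equivariant_def)
qed

text \<open>Associativity of \<rho> says precisely that \<rho> is a module map from the free module
  on its own underlying object. Together with \<open>epi_action\<close> this presents every module
  as a quotient of a free one.\<close>

lemma mhom_action:
  assumes m: "is_mod \<rho>"
  shows "mhom \<rho> (act (cd \<rho>) mu) \<rho>"
proof -
  note r = is_modD[OF m]
  have "\<rho> \<bullet> act (cd \<rho>) mu = \<rho> \<bullet> (\<rho> ## idt A)" using r(5) by (simp add: act_def)
  then show ?thesis using m r(2-4) by (simp add: mhom_def equivariant_def)
qed

lemma epi_action: assumes m: "is_mod \<rho>" shows "epi \<rho>"
proof -
  note r = is_modD[OF m]
  have "\<rho> \<bullet> (idt (cd \<rho>) ## u) \<bullet> rui (cd \<rho>) = run (cd \<rho>) \<bullet> rui (cd \<rho>)"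
    by (simp add: cmp_reassoc[OF r(6)])
  then have "\<rho> \<bullet> (idt (cd \<rho>) ## u) \<bullet> rui (cd \<rho>) = idt (cd \<rho>)" using r(4) by simp
  then show ?thesis using r(4) by (rule split_epi)
qed

lemma M_retractI:
  assumes "mhom i \<rho> \<sigma>" "mhom p \<sigma> \<rho>" "p \<bullet> i = idt (cd \<rho>)"
  shows "M.retract \<rho> \<sigma>"
proof (rule M.retractI)
  show "marrow \<sigma> p \<rho> \<bullet>\<^sub>m marrow \<rho> i \<sigma> = midt \<rho>"
    using assms mhomD(1)[OF assms(1)] by (intro marr_eqI) auto
qed (use mhomD(1)[OF assms(1)] in auto)

lemma M_retractE:
  assumes "M.retract \<rho> \<sigma>"
  obtains i p where "mhom i \<rho> \<sigma>" "mhom p \<sigma> \<rho>" "p \<bullet> i = idt (cd \<rho>)"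
proof -
  obtain I P where 1: "marr I" "marr P" "mdm I = \<rho>" "mcd I = \<sigma>" "mdm P = \<sigma>" "mcd P = \<rho>" "P \<bullet>\<^sub>m I = midt \<rho>"
    by (rule M.retractE[OF assms])
  have "und P \<bullet> und I = idt (cd \<rho>)" using arg_cong[OF 1(7), of und] 1(1-6) by simp
  then show ?thesis using that[of "und I" "und P"] marrD(1)[OF 1(1)] marrD(1)[OF 1(2)] 1(1-6) by simp
qed

lemma act_retract:
  assumes "x \<in> Obj" "M.retract \<rho> \<sigma>"
  shows "M.retract (act x \<rho>) (act x \<sigma>)"
proof -
  obtain i p where 1: "mhom i \<rho> \<sigma>" "mhom p \<sigma> \<rho>" "p \<bullet> i = idt (cd \<rho>)" by (rule M_retractE[OF assms(2)])
  note i = mhomD[OF 1(1)] and p = mhomD[OF 1(2)]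
  have "(idt x ## p) \<bullet> (idt x ## i) = idt (cd (act x \<rho>))"
    using 1(3) i p assms(1) is_modD(4)[of \<rho>] by (simp flip: whisker_left)
  then show ?thesis using mhom_tl[OF assms(1)] 1 by (intro M_retractI) auto
qed

lemma act_retract_left:
  assumes "retract x y" "is_mod \<rho>"
  shows "M.retract (act x \<rho>) (act y \<rho>)"
proof -
  obtain i p where 1: "arr i" "arr p" "dm i = x" "cd i = y" "dm p = y" "cd p = x" "p \<bullet> i = idt x"
    by (rule retractE[OF assms(1)])
  have x: "x \<in> Obj" using 1 by auto
  note r = is_modD[OF assms(2)]
  have "(p ## idt (cd \<rho>)) \<bullet> (i ## idt (cd \<rho>)) = idt (cd (act x \<rho>))"
    using 1 r x assms(2) by (simp flip: whisker_right)
  then show ?thesis using mhom_tw[OF 1(1) assms(2)] mhom_tw[OF 1(2) assms(2)] 1 by (intro M_retractI) auto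
qed

lemma act_act_retract:
  assumes "x \<in> Obj" "y \<in> Obj" "is_mod \<rho>"
  shows "M.retract (act (x ** y) \<rho>) (act x (act y \<rho>))" "M.retract (act x (act y \<rho>)) (act (x ** y) \<rho>)"
  using mhom_asc[OF assms] mhom_asi[OF assms] assms is_modD(4)[OF assms(3)] by (auto intro!: M_retractI)

text \<open>Module maps out of y \<otimes> A correspond to plain maps out of \<open>y\<close>: the
  map is restricted along the unit of A to \<open>g\<close>, lifted to \<open>h\<close> by
  projectivity of \<open>y\<close>, and the lift is extended again by the action.\<close>

lemma free_proj:
  assumes y: "proj y" shows "M.proj (act y mu)"
  unfolding M.proj_def
proof (intro conjI allI impI)
  have yO: "y \<in> Obj" using y by (rule proj_Obj)
  then show "act y mu \<in> {\<rho>. is_mod \<rho>}" by simp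
  fix E F assume "M.epi E \<and> marr F \<and> mdm F = act y mu \<and> mcd F = mcd E"
  then have EF: "M.epi E" "marr E" "marr F" "mdm F = act y mu" "mcd F = mcd E" by auto
  note e = marrD[OF EF(2)] and f = marrD[OF EF(3)]
  note f' = mhomD[OF f(1)] and m = is_modD[OF e(2)] and n = is_modD[OF e(3)]
  let ?e = "und E" and ?f = "und F" and ?\<rho> = "mdm E" and ?\<sigma> = "mcd E"
  have fa: "dm ?f = y ** A" "cd ?f = cd ?\<sigma>" using f EF yO by simp_all
  define g where "g = ?f \<bullet> (idt y ## u) \<bullet> rui y"
  have g: "arr g" "dm g = y" "cd g = cd ?\<sigma>" using f yO fa by (simp_all add: g_def)
  have "\<exists>h. ?e \<bullet> h = g"
    by (rule proj_lift[OF y und_epi[OF EF(1)]]) (use g e in auto)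
  then obtain h where h: "?e \<bullet> h = g" ..
  have ha: "arr h" "dm h = y" "cd h = cd ?\<rho>" using cmp_arrD[OF h g(1)] g e by auto
  have hm: "mhom (?\<rho> \<bullet> (h ## idt A)) (act y mu) ?\<rho>"
    using mhom_cmp[OF mhom_tw[OF ha(1) is_mod_mu] , of ?\<rho> ?\<rho>] mhom_action[OF e(2)] ha by simp
  have fe: "?f \<bullet> (idt y ## mu) \<bullet> asc y A A = ?\<sigma> \<bullet> (?f ## idt A)"
    using f'(6) EF yO by (simp add: act_def)
  have 1: "asc y A A \<bullet> ((idt y ## u) ## idt A) = (idt y ## (u ## idt A)) \<bullet> asc y unt A"
    using asc_nat[of "idt y" u "idt A"] yO by simp
  have "?e \<bullet> ?\<rho> \<bullet> (h ## idt A) = ?\<sigma> \<bullet> (?e ## idt A) \<bullet> (h ## idt A)"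
    by (simp add: cmp_reassoc[OF mhomD(6)[OF e(1)]])
  also have "(?e ## idt A) \<bullet> (h ## idt A) = g ## idt A"
    unfolding h[symmetric] using e ha by (simp add: whisker_right)
  also have "g ## idt A = (?f ## idt A) \<bullet> ((idt y ## u) ## idt A) \<bullet> (rui y ## idt A)"
    unfolding g_def using f yO fa by (simp add: whisker_right)
  also have "?\<sigma> \<bullet> \<dots> = ?f \<bullet> ((idt y ## mu) \<bullet> (idt y ## (u ## idt A))) \<bullet> asc y unt A \<bullet> (rui y ## idt A)"
    using cmp_reassoc[OF fe[symmetric]] by (simp add: cmp_reassoc[OF 1])
  also have "(idt y ## mu) \<bullet> (idt y ## (u ## idt A)) = idt y ## lun A"
    using yO by (simp add: mu_unit_left flip: whisker_left)
  also have "?f \<bullet> (idt y ## lun A) \<bullet> asc y unt A \<bullet> (rui y ## idt A)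
      = ?f \<bullet> ((idt y ## lun A) \<bullet> asc y unt A) \<bullet> (rui y ## idt A)" by simp
  also have "\<dots> = ?f"
    unfolding triangle[OF yO A_Obj] using f yO fa by (simp flip: whisker_right)
  finally have "E \<bullet>\<^sub>m marrow (act y mu) (?\<rho> \<bullet> (h ## idt A)) ?\<rho> = F"
    using EF hm by (intro marr_eqI) auto
  then show "\<exists>G. E \<bullet>\<^sub>m G = F" by blast
qed

text \<open>For a left dual \<open>d\<close> of \<open>a\<close>, a module map \<open>\<rho> \<rightarrow> a \<otimes> A\<close> is transposed to \<open>d \<otimes> \<rho> \<rightarrow> A\<close>.\<close>

lemma mhom_transpose:
  assumes D: "dual d a ev co" and j: "mhom j \<rho> (act a mu)"
  shows "mhom ((lun A \<bullet> (ev ## idt A) \<bullet> asi d a A) \<bullet> (idt d ## j)) (act d \<rho>) mu"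
proof -
  note D' = D[unfolded dual_def]
  have o: "a \<in> Obj" "d \<in> Obj" and ea: "arr ev" "dm ev = d ** a" "cd ev = unt" using D' by auto
  have 1: "mhom (idt d ## j) (act d \<rho>) (act d (act a mu))" by (rule mhom_tl[OF o(2) j])
  have 2: "mhom (asi d a A) (act d (act a mu)) (act (d ** a) mu)" using mhom_asi[OF o(2,1) is_mod_mu] by simp
  have 3: "mhom (ev ## idt A) (act (d ** a) mu) (act unt mu)" using mhom_tw[OF ea(1) is_mod_mu] ea by simp
  have 4: "mhom (lun A) (act unt mu) mu" using mhom_lun[OF is_mod_mu] by simp
  show ?thesis using mhom_cmp[OF mhom_cmp[OF mhom_cmp[OF 1 2] 3] 4] by simp
qed

end

locale fin_algebra =
  fin_rigid Obj arr dm cd cmp idt add neg zer tob ten unt asc asi lun lui run rui sz +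
  algebra Obj arr dm cd cmp idt add neg zer tob ten unt asc asi lun lui run rui A mu u
  for Obj :: "'o set" and arr :: "'f \<Rightarrow> bool" and dm cd
    and cmp (infixr \<open>\<bullet>\<close> 60) and idt and add (infixl \<open>+++\<close> 65) and neg and zer
    and tob (infixl \<open>**\<close> 70) and ten (infixl \<open>##\<close> 70) and unt asc asi lun lui run rui sz A mu u
begin

sublocale M: sized_abel "{\<rho>. is_mod \<rho>}" marr mdm mcd mcmp midt madd mneg mzer "\<lambda>\<rho>. sz (cd \<rho>)"
proof unfold_locales
  have iso: "M.iso F" if F: "M.mono F" "iso (und F)" for F
  proof -
    obtain g where g: "inv_pair (und F) g" using F by (auto simp: iso_def)
    have Fa: "marr F" using F by simp
    note f = marrD[OF Fa] and g' = g[unfolded inv_pair_def]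
    have h: "mhom g (mcd F) (mdm F)" by (rule mhom_inv[OF f(1) g])
    then have "F \<bullet>\<^sub>m marrow (mcd F) g (mdm F) = midt (mcd F)"
      using Fa f g' by (intro marr_eqI) (auto simp: mhom_idt)
    then show ?thesis using M.split_mono_epi_iso[OF F(1)] by simp
  qed
  fix F
  {
    assume F: "M.mono F"
    then have m: "mono (und F)" "marr F" by (simp_all add: und_mono)
    note f = marrD[OF m(2)]
    show "sz (cd (mdm F)) \<le> sz (cd (mcd F))" using mono_size[OF m(1)] f by simp
    assume "sz (cd (mcd F)) \<le> sz (cd (mdm F))"
    then have "iso (und F)" using mono_size_iso[OF m(1)] f by simp
    then show "M.iso F" using iso F by blast
  }
  {
    assume F: "M.epi F" "sz (cd (mdm F)) \<le> sz (cd (mcd F))"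
    then have m: "epi (und F)" "marr F" by (simp_all add: und_epi)
    note f = marrD[OF m(2)]
    have "iso (und F)" using epi_size_iso[OF m(1)] F f by simp
    then show "M.iso F" using iso mono_und[OF m(2)] iso_mono by blast
  }
qed

text \<open>A projective cover \<open>e\<close> of the underlying object, tensored with A and
  followed by the action, is an epic module map onto \<rho>, which splits. Unlike the free module on
  the underlying object itself, this one has a projective generator object.\<close>

lemma proj_retract_free:
  assumes m: "M.proj \<rho>"
  shows "\<exists>y. proj y \<and> M.retract \<rho> (act y mu)"
proof -
  have r: "is_mod \<rho>" using M.proj_Obj[OF m] by simp
  obtain e where e: "epi e" "cd e = cd \<rho>" "proj (dm e)" using enough_proj is_modD(4)[OF r] by blast
  have ea: "arr e" using e by simp
  have h: "mhom (\<rho> \<bullet> (e ## idt A)) (act (dm e) mu) \<rho>"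
    using mhom_cmp[OF mhom_tw[OF ea is_mod_mu], of \<rho> \<rho>] mhom_action[OF r] e by simp
  have "epi (\<rho> \<bullet> (e ## idt A))"
    using epi_cmp[OF epi_tr[OF e(1) A_Obj] epi_action[OF r]] e is_modD[OF r] by simp
  then have "M.epi (marrow (act (dm e) mu) (\<rho> \<bullet> (e ## idt A)) \<rho>)" using h by (intro epi_und) auto
  then obtain S where "marrow (act (dm e) mu) (\<rho> \<bullet> (e ## idt A)) \<rho> \<bullet>\<^sub>m S = midt \<rho>"
    using M.proj_split[OF m] by fastforce
  then have "M.retract \<rho> (act (dm e) mu)" using r by (intro M.retractI) auto
  then show ?thesis using e by blast
qed

text \<open>A projective module is a summand of a free module on a projective \<open>y\<close>, and
  x \<otimes> y is again projective by rigidity.\<close>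

lemma M_proj_act:
  assumes "x \<in> Obj" "M.proj \<rho>" shows "M.proj (act x \<rho>)"
proof -
  obtain y where y: "proj y" "M.retract \<rho> (act y mu)" using proj_retract_free[OF assms(2)] by blast
  have yO: "y \<in> Obj" using y proj_Obj by blast
  have "M.retract (act x \<rho>) (act (x ** y) mu)"
    using M.retract_trans[OF act_retract[OF assms(1) y(2)] act_act_retract(2)[OF assms(1) yO is_mod_mu]] .
  then show ?thesis using M.proj_retract free_proj[OF proj_tl[OF y(1) assms(1)]] by blast
qed

lemma M_enough_proj:
  assumes r: "is_mod \<rho>" shows "\<exists>E. M.epi E \<and> mcd E = \<rho> \<and> M.proj (mdm E)"
proof -
  obtain e where e: "epi e" "cd e = cd \<rho>" "proj (dm e)" using enough_proj is_modD(4)[OF r] by blast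
  have ea: "arr e" using e by simp
  have h: "mhom (\<rho> \<bullet> (e ## idt A)) (act (dm e) mu) \<rho>"
    using mhom_cmp[OF mhom_tw[OF ea is_mod_mu], of \<rho> \<rho>] mhom_action[OF r] e by simp
  have "epi (\<rho> \<bullet> (e ## idt A))"
    using epi_cmp[OF epi_tr[OF e(1) A_Obj] epi_action[OF r]] e is_modD[OF r] by simp
  then have "M.epi (marrow (act (dm e) mu) (\<rho> \<bullet> (e ## idt A)) \<rho>)" using h by (intro epi_und) auto
  then show ?thesis using free_proj[OF e(3)] by (intro exI conjI) auto
qed

end

context rigid begin

text \<open>A direct sum of the finite family. It supplies one object in which finitely many modules
  embed freely, and one object that maps onto all simple objects.\<close>

lemma finite_common_retract:
  assumes "finite F" "F \<subseteq> Obj"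
  shows "\<exists>v\<in>Obj. \<forall>x\<in>F. retract x v"
  using assms
proof induction
  case empty
  then show ?case using unt_Obj by blast
next
  case (insert x F)
  then obtain v where v: "v \<in> Obj" "\<And>y. y \<in> F \<Longrightarrow> retract y v" by auto
  obtain i p j q where b: "biprod i p j q" "dm i = x" "dm j = v" using ex_biprod insert v by blast
  then have "retract x (cd i)" "retract v (cd i)"
    unfolding retract_def biprod_def by metis+
  moreover have "cd i \<in> Obj" using b by (simp add: biprod_def)
  ultimately show ?case using v(2) retract_trans by blast
qed

end

context preadd begin

lemma biprod_proj:
  assumes b: "biprod i p j q" and p: "proj (dm i)" "proj (dm j)"
  shows "proj (cd i)"
  unfolding proj_def
proof (intro conjI allI impI)
  note b' = b[unfolded biprod_def]
  show "cd i \<in> Obj" using b' by simp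
  fix e f assume ef: "epi e \<and> arr f \<and> dm f = cd i \<and> cd f = cd e"
  have "\<exists>g. e \<bullet> g = f \<bullet> i" "\<exists>g. e \<bullet> g = f \<bullet> j"
    by (rule proj_lift[OF p(1)], use ef b' in auto) (rule proj_lift[OF p(2)], use ef b' in auto)
  then obtain g h where gh: "e \<bullet> g = f \<bullet> i" "e \<bullet> h = f \<bullet> j" by blast
  have a: "arr (f \<bullet> i)" "arr (f \<bullet> j)" using ef b' by auto
  have ga: "arr g" "dm g = dm i" "cd g = dm e" "arr h" "dm h = dm j" "cd h = dm e"
    using cmp_arrD(1-4)[OF gh(1) a(1)] cmp_arrD(1-4)[OF gh(2) a(2)] ef b' by auto
  have "e \<bullet> ((g \<bullet> p) +++ (h \<bullet> q)) = (e \<bullet> g \<bullet> p) +++ (e \<bullet> h \<bullet> q)"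
    by (rule cmp_add) (use ga ef b' in auto)
  also have "\<dots> = (f \<bullet> i \<bullet> p) +++ (f \<bullet> j \<bullet> q)"
    by (simp add: cmp_reassoc[OF gh(1)] cmp_reassoc[OF gh(2)])
  also have "\<dots> = f \<bullet> ((i \<bullet> p) +++ (j \<bullet> q))"
    by (rule cmp_add[symmetric]) (use ef b' in auto)
  also have "\<dots> = f" using ef b' by simp
  finally show "\<exists>g. e \<bullet> g = f" by blast
qed

end

section \<open>Sizes of tensor products\<close>

context fin_rigid begin

lemma sz_null: assumes "null a" shows "sz a = 0"
proof -
  have a: "a \<in> Obj" "idt a = zer a a" using assms by (auto simp: null_def)
  have "is_ker (idt a) (idt a)" unfolding is_ker_def
  proof (intro conjI allI impI)
    have "idt a \<bullet> idt a = idt a" using a(1) by simp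
    also have "\<dots> = zer (dm (idt a)) (cd (idt a))" using a(1) by (simp add: a(2)[symmetric])
    finally show "idt a \<bullet> idt a = zer (dm (idt a)) (cd (idt a))" .
    fix g assume "arr g \<and> cd g = dm (idt a) \<and> idt a \<bullet> g = zer (dm g) (cd (idt a))"
    then have "arr g" "cd g = a" using a(1) by auto
    then have "idt a \<bullet> g = g" by (rule idt_cmp)
    then show "\<exists>h. idt a \<bullet> h = g" ..
  qed (use a(1) mono_idt in auto)
  then show ?thesis using sz_ses[of "idt a" "idt a"] a(1) epi_idt[OF a(1)] by simp
qed

text \<open>Each simple factor of \<open>z\<close>, tensored with a non-null \<open>b\<close>, is
  non-null and contributes at least 1. This turns one lost summand into a loss proportional to the
  length of the test object.\<close>

lemma comp_series_ten_ge:
  assumes "comp_series n z" "b \<in> Obj" "\<not> null b"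
  shows "n \<le> sz (z ** b)"
  using assms(1)
proof induction
  case (comp_ext n i p)
  have i: "arr i" "cd i = dm p" "arr p" using comp_ext by (auto simp: is_ker_def)
  have "sz (dm p ** b) = sz (dm i ** b) + sz (cd p ** b)"
    using sz_ses[OF ker_tr[OF comp_ext(3,2) assms(2)] epi_tr[OF comp_ext(3) assms(2)]] i assms(2) by simp
  moreover have "0 < sz (cd p ** b)"
    using comp_ext assms tob_not_null[of "cd p" b] by (intro sz_pos) (auto simp: simple_def)
  ultimately show ?case using comp_ext by simp
qed simp

lemma comp_series_ge: "comp_series n z \<Longrightarrow> n \<le> sz z"
proof (induction rule: comp_series.induct)
  case (comp_ext n i p)
  then show ?case using sz_ses[of p i] sz_pos[of "cd p"] by (simp add: simple_def)
qed simp

lemma comp_series_pos: "\<lbrakk>comp_series n z; \<not> null z\<rbrakk> \<Longrightarrow> 0 < n"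
  by (erule comp_series.cases) auto

text \<open>Up to isomorphism there are finitely many pairs of simple objects; the sum over all
  pairs of representatives is a crude common bound.\<close>

lemma sz_ten_simple_bound: "\<exists>C. \<forall>s t. simple s \<longrightarrow> simple t \<longrightarrow> sz (s ** t) \<le> C"
proof -
  obtain T where T: "finite T" "\<And>s. simple s \<Longrightarrow> \<exists>f. iso f \<and> dm f = s \<and> cd f \<in> T"
    using fin_simples by blast
  have "sz (s ** t) \<le> (\<Sum>x\<in>T \<times> T. sz (fst x ** snd x))" if st: "simple s" "simple t" for s t
  proof -
    obtain f g where fg: "iso f" "dm f = s" "cd f \<in> T" "iso g" "dm g = t" "cd g \<in> T"
      using T(2)[OF st(1)] T(2)[OF st(2)] by blast
    then have "sz (s ** t) = sz (cd f ** cd g)"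
      using sz_iso[OF ten_iso[OF fg(1,4)]] by (auto simp: iso_def inv_pair_def)
    also have "\<dots> \<le> (\<Sum>x\<in>T \<times> T. sz (fst x ** snd x))"
      using member_le_sum[of "(cd f, cd g)" "T \<times> T" "\<lambda>x. sz (fst x ** snd x)"] T(1) fg by simp
    finally show ?thesis .
  qed
  then show ?thesis by blast
qed

lemma sz_ten_left_le:
  assumes C: "\<And>s t. simple s \<Longrightarrow> simple t \<Longrightarrow> sz (s ** t) \<le> C"
    and z: "comp_series m z" and t: "simple t"
  shows "sz (z ** t) \<le> C * m"
  using z
proof induction
  case (comp_null a)
  then show ?case using sz_null[OF null_tr[OF comp_null]] t by (simp add: simple_def)
next
  case (comp_ext n i p)
  have tO: "t \<in> Obj" using t by (simp add: simple_def)
  have i: "arr i" "cd i = dm p" "arr p" using comp_ext by (auto simp: is_ker_def)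
  have "sz (dm p ** t) = sz (dm i ** t) + sz (cd p ** t)"
    using sz_ses[OF ker_tr[OF comp_ext(3,2) tO] epi_tr[OF comp_ext(3) tO]] i tO by simp
  then show ?case using comp_ext C[OF comp_ext(4) t] by simp
qed

text \<open>Additivity along the two composition series leaves m n pairs of simple factors, each of
  size at most \<open>C\<close>.\<close>

lemma sz_ten_le:
  assumes C: "\<And>s t. simple s \<Longrightarrow> simple t \<Longrightarrow> sz (s ** t) \<le> C"
    and z: "comp_series m z" and y: "comp_series n y"
  shows "sz (z ** y) \<le> C * m * n"
  using y
proof induction
  have zO: "z \<in> Obj" using z comp_series_Obj by blast
  {
    case (comp_null a)
    then show ?case using sz_null[OF null_tl[OF comp_null zO]] by simp
  next
    case (comp_ext n i p)
    have i: "arr i" "cd i = dm p" "arr p" using comp_ext by (auto simp: is_ker_def)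
    have "sz (z ** dm p) = sz (z ** dm i) + sz (z ** cd p)"
      using sz_ses[OF ker_tl[OF comp_ext(3,2) zO] epi_tl[OF comp_ext(3) zO]] i zO by simp
    then show ?case using comp_ext sz_ten_left_le[OF C z comp_ext(4)] by simp
  }
qed

end

context algebra begin

lemma und_biprod:
  assumes "M.biprod I P J Q"
  shows "biprod (und I) (und P) (und J) (und Q)"
proof -
  note b = assms[unfolded M.biprod_def]
  have m: "marr I" "marr P" "marr J" "marr Q" "mcd I = mcd J" "mdm P = mcd I" "mdm Q = mcd J"
    "mcd P = mdm I" "mcd Q = mdm J" using b by auto
  note m' = marrD[OF m(1)] marrD[OF m(2)] marrD[OF m(3)] marrD[OF m(4)]
  have "und (P \<bullet>\<^sub>m I) = und (midt (mdm I))" "und (Q \<bullet>\<^sub>m J) = und (midt (mdm J))"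
    "und (P \<bullet>\<^sub>m J) = und (mzer (mdm J) (mdm I))" "und (Q \<bullet>\<^sub>m I) = und (mzer (mdm I) (mdm J))"
    "und ((I \<bullet>\<^sub>m P) +++\<^sub>m (J \<bullet>\<^sub>m Q)) = und (midt (mcd I))"
    using b by simp_all
  then show ?thesis unfolding biprod_def using m m' by simp
qed

definition tl :: "'o \<Rightarrow> ('f \<times> 'f \<times> 'f) option \<Rightarrow> ('f \<times> 'f \<times> 'f) option" where
  "tl x F = marrow (act x (mdm F)) (idt x ## und F) (act x (mcd F))"

lemma tl_simps [simp]:
  "\<lbrakk>x \<in> Obj; marr F\<rbrakk> \<Longrightarrow> marr (tl x F)" "mdm (tl x F) = act x (mdm F)" "mcd (tl x F) = act x (mcd F)"
  "und (tl x F) = idt x ## und F"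
  by (simp_all add: tl_def mhom_tl marrD(1))

lemma tl_epi: "\<lbrakk>x \<in> Obj; M.epi F\<rbrakk> \<Longrightarrow> M.epi (tl x F)"
  by (intro epi_und) (auto simp: epi_tl und_epi)

lemma tl_biprod: "\<lbrakk>x \<in> Obj; M.biprod I P J Q\<rbrakk> \<Longrightarrow> M.biprod (tl x I) (tl x P) (tl x J) (tl x Q)"
  using biprod_tl[OF und_biprod, of I P J Q x] by (intro M_biprodI) (auto simp: M.biprod_def)

definition tw :: "'f \<Rightarrow> 'f \<Rightarrow> ('f \<times> 'f \<times> 'f) option" where
  "tw f \<rho> = marrow (act (dm f) \<rho>) (f ## idt (cd \<rho>)) (act (cd f) \<rho>)"

lemma tw_simps [simp]:
  "\<lbrakk>arr f; is_mod \<rho>\<rbrakk> \<Longrightarrow> marr (tw f \<rho>)" "mdm (tw f \<rho>) = act (dm f) \<rho>" "mcd (tw f \<rho>) = act (cd f) \<rho>"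
  "und (tw f \<rho>) = f ## idt (cd \<rho>)"
  by (simp_all add: tw_def mhom_tw)

lemma tw_biprod: "\<lbrakk>biprod i p j q; is_mod \<rho>\<rbrakk> \<Longrightarrow> M.biprod (tw i \<rho>) (tw p \<rho>) (tw j \<rho>) (tw q \<rho>)"
  using biprod_tr[of i p j q "cd \<rho>"] is_modD(4)[of \<rho>]
  by (intro M_biprodI) (auto simp: biprod_def)

end

section \<open>Splitting projective summands off covers\<close>

context fin_algebra begin

lemma sz_M_biprod:
  assumes b: "M.biprod I P J Q" and z: "z \<in> Obj"
  shows "sz (z ** cd (mcd I)) = sz (z ** cd (mdm I)) + sz (z ** cd (mdm J))"
proof -
  have m: "marr I" "marr J" using b by (auto simp: M.biprod_def)
  note m' = marrD[OF m(1)] marrD[OF m(2)]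
  show ?thesis using sz_biprod[OF biprod_tl[OF und_biprod[OF b] z]] m' z by simp
qed

text \<open>A module map \<open>\<pi>\<close> onto a non-projective module, starting at a submodule of \<open>a \<otimes> A\<close>, has a
  kernel that maps nontrivially to \<open>A\<close> after tensoring with a dual of \<open>a\<close>. Projectivity of
  \<open>q \<otimes> (A / I)\<close> for the image \<open>I\<close> then splits a projective summand \<open>\<beta>\<close> off.\<close>

lemma split_off_kernel:
  assumes H: "\<And>E. M.epi E \<Longrightarrow> mdm E = mu \<Longrightarrow> M.proj (act q (mcd E))"
    and q: "proj q" "\<not> null q"
    and F: "M.epi F" "M.proj (mdm F)" "\<not> M.proj (mcd F)"
    and j: "mhom j (mdm F) (act a mu)" "mono j"
    and D: "dual d a ev co"
  shows "\<exists>E. M.epi E \<and> M.proj (mdm E) \<and> mcd E = act (q ** d) (mcd F) \<and>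
    (\<forall>z m. comp_series m z \<longrightarrow> m + sz (z ** cd (mdm E)) \<le> sz (z ** ((q ** d) ** cd (mdm F))))"
proof -
  define \<rho> where "\<rho> = mdm F"
  have Fa: "marr F" using F by simp
  note \<pi> = marrD[OF Fa]
  have r: "is_mod \<rho>" using \<pi> by (simp add: \<rho>_def)
  note D' = D[unfolded dual_def]
  have o: "a \<in> Obj" "d \<in> Obj" "q \<in> Obj" "q ** d \<in> Obj" and ea: "arr ev" "dm ev = d ** a" "cd ev = unt"
    using D' q proj_Obj by auto
  obtain K where K: "M.is_ker F K" using M.ex_ker[OF Fa] by blast
  have Ka: "marr K" "M.mono K" "mcd K = \<rho>" "F \<bullet>\<^sub>m K = mzer (mdm K) (mcd F)"
    using K by (auto simp: M.is_ker_def \<rho>_def)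
  define \<kappa> and k where "\<kappa> = mdm K" and "k = und K"
  have k: "mhom k \<kappa> \<rho>" "is_mod \<kappa>" "arr k" "dm k = cd \<kappa>" "cd k = cd \<rho>"
    using marrD[OF Ka(1)] Ka by (auto simp: \<kappa>_def k_def)
  have kO: "cd \<kappa> \<in> Obj" "cd \<rho> \<in> Obj" using k(2) r is_modD(4) by blast+
  have \<pi>k: "und F \<bullet> k = zer (cd \<kappa>) (cd (mcd F))"
    using arg_cong[OF Ka(4), of und] Ka(1,3) Fa by (simp add: \<kappa>_def k_def \<rho>_def)
  \<comment> \<open>A zero kernel would make \<open>F\<close> invertible and its target projective,
    contrary to assumption.\<close>
  have k0: "k \<noteq> zer (cd \<kappa>) (cd \<rho>)"
  proof
    assume "k = zer (cd \<kappa>) (cd \<rho>)"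
    then have "K = mzer (mdm K) (mcd K)"
      using Ka k r by (intro marr_eqI) (auto simp: \<kappa>_def k_def)
    then have "M.null (mdm K)" using M.zer_mono_null[OF Ka(2)] by simp
    then have "M.mono F" using M.ker_null_mono[OF K] by simp
    then have "M.iso F" using M.mono_epi_iso F(1) by blast
    then have "M.proj (mcd F)" using M.proj_retract[OF M.iso_retract(2)] F(2) by blast
    then show False using F(3) by simp
  qed
  \<comment> \<open>Composing with \<open>b\<close> transposes maps into a \<otimes> A. Below,
    \<psi> is the transpose of \<open>j\<close> and \<phi> its restriction to the kernel; \<phi> is
    nonzero because transposition loses nothing and \<open>j\<close> is monic.\<close>
  define b where "b = lun A \<bullet> (ev ## idt A) \<bullet> asi d a A"
  have ba: "arr b" "dm b = d ** (a ** A)" "cd b = A" using o ea by (auto simp: b_def)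
  have ja: "arr j" "dm j = cd \<rho>" "cd j = a ** A" using mhomD[OF j(1)] o by (auto simp: \<rho>_def)
  define \<psi> where "\<psi> = b \<bullet> (idt d ## j)"
  define \<phi> where "\<phi> = \<psi> \<bullet> (idt d ## k)"
  have \<psi>: "mhom \<psi> (act d \<rho>) mu" using mhom_transpose[OF D j(1)] by (simp add: \<psi>_def b_def \<rho>_def)
  have \<phi>: "mhom \<phi> (act d \<kappa>) mu" unfolding \<phi>_def by (rule mhom_cmp[OF mhom_tl[OF o(2) k(1)] \<psi>])
  have \<psi>a: "arr \<psi>" "dm \<psi> = d ** cd \<rho>" "cd \<psi> = A" using mhomD[OF \<psi>] o r by auto
  have \<phi>a: "arr \<phi>" "dm \<phi> = d ** cd \<kappa>" "cd \<phi> = A" using mhomD[OF \<phi>] o k by auto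
  have \<phi>0: "\<phi> \<noteq> zer (d ** cd \<kappa>) A"
  proof
    assume z: "\<phi> = zer (d ** cd \<kappa>) A"
    have "b \<bullet> (idt d ## (j \<bullet> k)) = zer (d ** cd \<kappa>) A"
      using z o k ja by (simp add: \<phi>_def \<psi>_def whisker_left)
    then have "j \<bullet> k = zer (dm (j \<bullet> k)) (a ** A)"
      by - (rule uncurry_left_zero[OF D], use o k ja in \<open>auto simp: b_def\<close>)
    then have "j \<bullet> k = j \<bullet> zer (cd \<kappa>) (cd \<rho>)"
      using ja k is_modD(4)[OF k(2)] by simp
    then have "k = zer (cd \<kappa>) (cd \<rho>)"
      by (rule monoD[OF j(2), rotated 4]) (use ja k is_modD(4)[OF k(2)] is_modD(4)[OF r] in auto)
    then show False using k0 by simp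
  qed
  let ?\<Phi> = "marrow (act d \<kappa>) \<phi> mu"
  have \<Phi>a: "marr ?\<Phi>" using \<phi> by simp
  \<comment> \<open>The target of \<open>C\<close> is the quotient of A by the image I of \<phi>, so
    \<open>H\<close> applies to it and the sequence for q \<otimes> I inside q \<otimes> A
    splits.\<close>
  obtain C where C: "M.is_cok ?\<Phi> C" "is_cok \<phi> (und C)" using ex_M_cok[OF \<Phi>a] by auto
  have Ca: "marr C" "M.epi C" "mdm C = mu" using C by (auto simp: M.is_cok_def)
  note c = marrD[OF Ca(1)]
  have "M.proj (act q (mcd C))" using H Ca by blast
  then obtain S where S: "tl q C \<bullet>\<^sub>m S = midt (act q (mcd C))"
    using M.proj_split[of _ "tl q C"] tl_epi[OF o(3) Ca(2)] by auto
  have Sa: "marr S" "mdm S = act q (mcd C)" "mcd S = act q mu"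
    using M.cmp_arrD[OF S] c o Ca by auto
  \<comment> \<open>The complement \<beta> is q \<otimes> I up to isomorphism, with inclusion
    \<open>J\<close> and retraction \<open>T\<close>; as a summand of q \<otimes> A it is
    projective.\<close>
  obtain J T where B: "M.biprod S (tl q C) J T"
    using M.ex_complement[of S "tl q C"] S Sa Ca o by auto
  have JT: "marr J" "marr T" "mcd J = act q mu" "mdm T = act q mu" "mcd T = mdm J"
    using B Sa by (auto simp: M.biprod_def)
  define \<beta> where "\<beta> = mdm J"
  note g = marrD[OF JT(1)] and t = marrD[OF JT(2)]
  let ?g = "und J" and ?t = "und T" and ?c = "und C"
  have \<beta>: "is_mod \<beta>" "cd \<beta> \<in> Obj" using g is_modD(4) by (auto simp: \<beta>_def)
  have gt: "arr ?g" "dm ?g = cd \<beta>" "cd ?g = q ** A" "arr ?t" "dm ?t = q ** A" "cd ?t = cd \<beta>"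
    using g t JT o by (auto simp: \<beta>_def)
  have bp: "biprod (und S) (idt q ## ?c) ?g ?t" using und_biprod[OF B] by simp
  have "M.retract \<beta> (act q mu)"
    by (rule M.retractI[of T J]) (use B JT \<beta> in \<open>auto simp: M.biprod_def \<beta>_def\<close>)
  then have \<beta>p: "M.proj \<beta>" using M.proj_retract free_proj[OF q(1)] by blast
  let ?f = "idt q ## \<phi>"
  have fa: "arr ?f" "dm ?f = q ** (d ** cd \<kappa>)" "cd ?f = q ** A" using \<phi>a o by auto
  have cok: "is_cok ?f (idt q ## ?c)" by (rule cok_tl[OF C(2) o(3)])
  have cf: "(idt q ## ?c) \<bullet> ?f = zer (dm ?f) (cd (idt q ## ?c))" using cok by (simp add: is_cok_def)
  have gtf: "?g \<bullet> ?t \<bullet> ?f = ?f"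
  proof -
    note bp' = bp[unfolded biprod_def]
    have sc: "(und S \<bullet> (idt q ## ?c)) \<bullet> ?f = zer (dm ?f) (q ** A)"
      using cf fa bp' gt o kO by simp
    have "?f = ((und S \<bullet> (idt q ## ?c)) +++ (?g \<bullet> ?t)) \<bullet> ?f" using bp' fa gt by simp
    also have "\<dots> = ((und S \<bullet> (idt q ## ?c)) \<bullet> ?f) +++ ((?g \<bullet> ?t) \<bullet> ?f)"
      by (rule add_cmp) (use bp' fa gt in auto)
    also have "\<dots> = ?g \<bullet> ?t \<bullet> ?f" unfolding sc using fa gt o kO by simp
    finally show ?thesis ..
  qed
  \<comment> \<open>If \<open>h\<close> kills this composite, then \<open>h\<close> after
    \<open>?t\<close> factors through the cokernel q \<otimes> c of \<open>?f\<close>; restricting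
    to \<beta>, on which q \<otimes> c vanishes, gives h = 0.\<close>
  have tf: "epi (?t \<bullet> ?f)" unfolding epi_iff
  proof (intro conjI allI impI)
    show "arr (?t \<bullet> ?f)" using fa gt by simp
    fix h assume "arr h \<and> dm h = cd (?t \<bullet> ?f) \<and> h \<bullet> ?t \<bullet> ?f = zer (dm (?t \<bullet> ?f)) (cd h)"
    then have h: "arr h" "dm h = cd \<beta>" "(h \<bullet> ?t) \<bullet> ?f = zer (dm ?f) (cd h)" using fa gt by auto
    have "\<exists>l. l \<bullet> (idt q ## ?c) = h \<bullet> ?t"
      using cok h gt fa unfolding is_cok_def by (simp del: cmp_assoc)
    then obtain l where l: "l \<bullet> (idt q ## ?c) = h \<bullet> ?t" ..
    have la: "arr l" "dm l = cd (idt q ## ?c)" "cd l = cd h"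
      using cmp_arrD[OF l] h gt by auto
    note bp' = bp[unfolded biprod_def]
    have "h = (h \<bullet> ?t) \<bullet> ?g" using bp' h gt by simp
    also have "\<dots> = l \<bullet> (idt q ## ?c) \<bullet> ?g" unfolding l[symmetric] by simp
    also have "(idt q ## ?c) \<bullet> ?g = zer (dm ?g) (dm (und S))" using bp' by simp
    also have "l \<bullet> \<dots> = zer (cd \<beta>) (cd h)" using la gt bp' \<beta>(2) by simp
    finally show "h = zer (cd (?t \<bullet> ?f)) (cd h)" using fa gt by simp
  qed
  \<comment> \<open>By \<open>gtf\<close> the map q \<otimes> \<phi> factors through \<beta>, and
    tensoring with the non-null \<open>q\<close> is faithful.\<close>
  have \<beta>0: "\<not> null (cd \<beta>)"
  proof
    assume "null (cd \<beta>)"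
    then have tz: "?t = zer (q ** A) (cd \<beta>)" using null_arr(2)[of ?t] gt by simp
    have "?f = ?g \<bullet> ?t \<bullet> ?f" by (rule gtf[symmetric])
    also have "\<dots> = zer (q ** dm \<phi>) (q ** cd \<phi>)"
      unfolding tz using gt(1-3) fa \<beta> \<phi>a kO o by simp
    finally have "\<phi> = zer (dm \<phi>) (cd \<phi>)" by (rule ten_faithful[OF o(3) q(2) \<phi>a(1)])
    then show False using \<phi>0 \<phi>a by simp
  qed
  let ?N = "T \<bullet>\<^sub>m tl q ?\<Phi>"
  have Na: "marr (tl q ?\<Phi>)" "mcd (tl q ?\<Phi>) = act q mu" using \<Phi>a o by auto
  have "M.epi ?N" by (rule epi_und) (use tf Na JT in auto)
  then obtain G where G: "?N \<bullet>\<^sub>m G = midt \<beta>"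
    using M.proj_split[OF \<beta>p, of ?N] Na JT by (auto simp: \<beta>_def)
  have Ga: "marr G" "mdm G = \<beta>" "mcd G = act q (act d \<kappa>)"
    using M.cmp_arrD[OF G] \<beta> Na JT by auto
  note s = marrD[OF Ga(1)]
  let ?s = "und G"
  have sa: "arr ?s" "dm ?s = cd \<beta>" "cd ?s = q ** (d ** cd \<kappa>)" using s Ga o k by auto
  have tfs: "?t \<bullet> ?f \<bullet> ?s = idt (cd \<beta>)"
    using arg_cong[OF G, of und] Ga Na JT by simp
  \<comment> \<open>The section \<beta> to q \<otimes> d \<otimes> \<kappa> is pushed into the cover
    along the kernel, so \<beta> lands in the kernel of the tensored \<open>F\<close>. The
    retraction \<open>p\<close> exists on the whole cover because \<phi> is the restriction of
    \<psi>, which is defined on all of \<rho>.\<close>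
  define i where "i = asi q d (cd \<rho>) \<bullet> (idt q ## (idt d ## k)) \<bullet> ?s"
  define p where "p = ?t \<bullet> (idt q ## \<psi>) \<bullet> asc q d (cd \<rho>)"
  have im: "mhom i \<beta> (act (q ** d) \<rho>)"
  proof -
    have "mhom ?s \<beta> (act q (act d \<kappa>))" using s(1) Ga by simp
    from mhom_cmp[OF mhom_cmp[OF this mhom_tl[OF o(3) mhom_tl[OF o(2) k(1)]]] mhom_asi[OF o(3,2) r]]
    show ?thesis by (simp add: i_def)
  qed
  have pm: "mhom p (act (q ** d) \<rho>) \<beta>"
  proof -
    have "mhom ?t (act q mu) \<beta>" using t(1) JT by (simp add: \<beta>_def)
    from mhom_cmp[OF mhom_cmp[OF mhom_asc[OF o(3,2) r] mhom_tl[OF o(3) \<psi>]] this]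
    show ?thesis by (simp add: p_def)
  qed
  have rO: "cd \<rho> \<in> Obj" using r is_modD(4) by blast
  have 1: "(idt q ## \<psi>) \<bullet> (idt q ## (idt d ## k)) = ?f"
    using \<psi>a k o by (simp add: \<phi>_def flip: whisker_left)
  have pi: "p \<bullet> i = idt (cd \<beta>)"
    using o rO k sa tfs by (simp add: p_def i_def cmp_reassoc[OF 1])
  have \<pi>i: "(idt (q ** d) ## und F) \<bullet> i = zer (cd \<beta>) ((q ** d) ** cd (mcd F))"
  proof -
    have 2: "(idt (q ** d) ## und F) \<bullet> asi q d (cd \<rho>)
        = asi q d (cd (mcd F)) \<bullet> (idt q ## (idt d ## und F))"
      using asi_nat[of "idt q" "idt d" "und F"] \<pi> o by (simp add: \<rho>_def)
    have 3: "(idt q ## (idt d ## und F)) \<bullet> (idt q ## (idt d ## k))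
        = zer (q ** (d ** cd \<kappa>)) (q ** (d ** cd (mcd F)))"
      using \<pi> k o \<pi>k is_modD(4)[OF k(2)] is_modD(4)[OF \<pi>(3)] by (simp add: \<rho>_def flip: whisker_left)
    show ?thesis
      using sa o \<beta>(2) is_modD(4)[OF k(2)] is_modD(4)[OF \<pi>(3)] by (simp add: i_def cmp_reassoc[OF 2] cmp_reassoc[OF 3])
  qed
  let ?I = "marrow \<beta> i (act (q ** d) \<rho>)" and ?P = "marrow (act (q ** d) \<rho>) p \<beta>"
  have PI: "?P \<bullet>\<^sub>m ?I = midt \<beta>" using im pm pi \<beta> by (intro marr_eqI) auto
  \<comment> \<open>The complement of \<beta> still covers the target, since \<beta> is mapped to
    zero; the size lost is that of \<beta> tensored with the test object \<open>z\<close>.\<close>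
  then obtain J' T' where B': "M.biprod ?I ?P J' T'"
    using M.ex_complement[of ?I ?P] im pm by auto
  have J': "marr J'" "marr T'" "mcd J' = act (q ** d) \<rho>" "mdm T' = act (q ** d) \<rho>" "T' \<bullet>\<^sub>m J' = midt (mdm J')"
    using B' by (auto simp: M.biprod_def)
  have "M.retract (mdm J') (act (q ** d) \<rho>)"
    by (rule M.retractI[of T' J']) (use J' marrD[OF J'(1)] in auto)
  then have J'p: "M.proj (mdm J')" using M.proj_retract M_proj_act[OF o(4)] F(2) unfolding \<rho>_def by blast
  have "tl (q ** d) F \<bullet>\<^sub>m ?I = mzer \<beta> (act (q ** d) (mcd F))"
    by (rule marr_eqI) (use Fa o im \<pi>i \<beta> \<pi> in \<open>auto simp: \<rho>_def\<close>)
  then have "M.epi (tl (q ** d) F \<bullet>\<^sub>m J')"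
    using M.biprod_epi[OF B', of "tl (q ** d) F"] tl_epi[OF o(4) F(1)] Fa o by (simp add: \<rho>_def)
  moreover have "m + sz (z ** cd (mdm J')) \<le> sz (z ** ((q ** d) ** cd \<rho>))" if "comp_series m z" for m z
    using sz_M_biprod[OF B', of z] comp_series_Obj[OF that] comp_series_ten_ge[OF that \<beta>(2) \<beta>0] o r by simp
  ultimately show ?thesis
    using J'p J' Fa o by (intro exI[of _ "tl (q ** d) F \<bullet>\<^sub>m J'"]) (auto simp: \<rho>_def)
qed

end

context fin_algebra begin

lemma M_proj_null:
  assumes r: "is_mod \<rho>" and n: "null (cd \<rho>)"
  shows "M.proj \<rho>"
proof -
  obtain y where y: "y \<in> Obj" "proj y" using enough_proj[OF unt_Obj] proj_Obj by blast
  have "mhom (zer (cd \<rho>) (cd (act y mu))) \<rho> (act y mu)" "mhom (zer (cd (act y mu)) (cd \<rho>)) (act y mu) \<rho>"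
    using r y by (intro mhom_zer; simp)+
  moreover have "zer (cd (act y mu)) (cd \<rho>) \<bullet> zer (cd \<rho>) (cd (act y mu)) = idt (cd \<rho>)"
    using n y r is_modD(4)[OF r] by (simp add: null_def)
  ultimately have "M.retract \<rho> (act y mu)" by (rule M_retractI)
  then show ?thesis using M.proj_retract free_proj[OF y(2)] by blast
qed

text \<open>Evaluation on \<open>s\<close> makes the projective \<open>q\<close> a retract of w
  \<otimes> (s \<otimes> q) with w a left dual of \<open>s\<close>, so q \<otimes> \<rho> is a
  summand of w acting on a projective module.\<close>

lemma proj_act_cancel:
  assumes q: "proj q" and s: "s \<in> Obj" "\<not> null s" and r: "is_mod \<rho>"
    and p: "M.proj (act (s ** q) \<rho>)"
  shows "M.proj (act q \<rho>)"
proof -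
  have qO: "q \<in> Obj" using q by (rule proj_Obj)
  obtain w ev co where D: "dual w s ev co" using ex_left_dual[OF s(1)] by blast
  then have w: "w \<in> Obj" "dm ev = w ** s" "cd ev = unt" by (auto simp: dual_def)
  have ev: "epi ev" by (rule ev_epi_left[OF D s(2)])
  have "epi (lun q \<bullet> (ev ## idt q))"
    using epi_cmp[OF epi_tr[OF ev qO] iso_epi[OF inv_pair_iso(1)[OF lun_iso[OF qO]]]] ev w qO by simp
  then obtain f where f: "(lun q \<bullet> (ev ## idt q)) \<bullet> f = idt q"
    using proj_split[OF q] ev w qO by fastforce
  have "retract q ((w ** s) ** q)"
    by (rule retractI[OF f qO]) (use ev w qO in simp)
  moreover have "retract ((w ** s) ** q) (w ** (s ** q))"
    using iso_retract(1)[OF inv_pair_iso(1)[OF asc_iso[OF w(1) s(1) qO]]] w s qO by simp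
  ultimately have "retract q (w ** (s ** q))" by (rule retract_trans)
  then have "M.retract (act q \<rho>) (act (w ** (s ** q)) \<rho>)" using r by (rule act_retract_left)
  then have "M.retract (act q \<rho>) (act w (act (s ** q) \<rho>))"
    using M.retract_trans act_act_retract(1)[OF w(1) _ r] s qO by simp
  then show ?thesis using M.proj_retract M_proj_act[OF w(1) p] by blast
qed

text \<open>Since \<open>q\<close> is projective, y \<otimes> q decomposes along the composition
  series of \<open>y\<close> into summands t \<otimes> q with \<open>t\<close> simple. The minimal
  cover belonging to each factor occurs in \<open>F\<close> as a summand, so after tensoring with
  \<open>x\<close> each of the \<open>n\<close> factors gives its own loss.\<close>

lemma tensor_cover:
  assumes q: "proj q" and \<nu>: "is_mod \<nu>" and x: "x \<in> Obj"
    and T: "\<And>s. simple s \<Longrightarrow> \<exists>f. iso f \<and> dm f = s \<and> cd f \<in> T"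
    and mc: "\<And>t. t \<in> T \<Longrightarrow> \<exists>F E. M.min_cover F \<and> mcd F = act (t ** q) \<nu> \<and>
      M.epi E \<and> M.proj (mdm E) \<and> mcd E = act x (mcd F) \<and>
      (\<forall>z m. comp_series m z \<longrightarrow> m + sz (z ** cd (mdm E)) \<le> sz (z ** (x ** cd (mdm F))))"
    and y: "comp_series n y"
    and F: "M.epi F" "M.proj (mdm F)" "mcd F = act (y ** q) \<nu>"
  shows "\<exists>E. M.epi E \<and> M.proj (mdm E) \<and> mcd E = act x (mcd F) \<and>
    (\<forall>z m. comp_series m z \<longrightarrow> n * m + sz (z ** cd (mdm E)) \<le> sz (z ** (x ** cd (mdm F))))"
  using y F
proof (induction arbitrary: F)
  case (comp_null a)
  have "marr F" using comp_null by simp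
  then have "cd (act x (mdm F)) = x ** cd (mdm F)" using x marrD(2) by simp
  then show ?case
    using comp_null x by (intro exI[of _ "tl x F"]) (auto intro: tl_epi M_proj_act)
next
  case (comp_ext n i p)
  note F = comp_ext.prems
  have Fa: "marr F" using F by simp
  obtain f where f: "iso f" "dm f = cd p" "cd f \<in> T" using T comp_ext.hyps by blast
  \<comment> \<open>The simple quotient is replaced by its representative in \<open>T\<close>, for
    which \<open>mc\<close> provides a minimal cover and an improved cover.\<close>
  define t and p' where "t = cd f" and "p' = f \<bullet> p"
  have fa: "arr f" "epi f" "mono f" using f iso_epi iso_mono by auto
  have ia: "arr i" "cd i = dm p" "arr p" "epi p" "p \<bullet> i = zer (dm i) (cd p)"
    using comp_ext.hyps by (auto simp: is_ker_def)
  have p': "epi p'" "arr p'" "dm p' = dm p" "cd p' = t"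
    unfolding p'_def t_def using epi_cmp[OF ia(4) fa(2)] f fa ia by auto
  have tO: "t \<in> Obj" using fa by (simp add: t_def)
  have qO: "q \<in> Obj" using q by (rule proj_Obj)
  have ker: "is_ker p' i" unfolding is_ker_def
  proof (intro conjI allI impI)
    show "p' \<bullet> i = zer (dm i) (cd p')" using ia f fa p' by (simp add: p'_def t_def)
    fix g assume g: "arr g \<and> cd g = dm p' \<and> p' \<bullet> g = zer (dm g) (cd p')"
    then have "f \<bullet> (p \<bullet> g) = f \<bullet> zer (dm g) (dm f)" using fa p' by (simp add: p'_def t_def)
    then have "p \<bullet> g = zer (dm g) (dm f)"
      by (rule monoD[OF fa(3), rotated 4]) (use g p' fa ia f in auto)
    then show "\<exists>h. i \<bullet> h = g" using comp_ext.hyps g p' f unfolding is_ker_def by metis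
  qed (use comp_ext.hyps p' in \<open>auto simp: is_ker_def\<close>)
  \<comment> \<open>After tensoring with \<open>q\<close> the sequence splits, because t \<otimes> q
    is projective.\<close>
  have pq: "epi (p' ## idt q)" "cd (p' ## idt q) = t ** q" using epi_tr[OF p'(1) qO] p' qO by auto
  then obtain s where s: "(p' ## idt q) \<bullet> s = idt (t ** q)"
    using proj_split[OF proj_tl[OF q tO]] by blast
  have sa: "arr s" "dm s = t ** q" "cd s = dm p ** q"
    using cmp_arrD[OF s] tO qO p' by auto
  obtain r where "biprod s (p' ## idt q) (i ## idt q) r"
    using retract_complement[OF sa(1) _ _ _ ker_tr[OF p'(1) ker qO]] s sa p' qO by auto
  then have B: "M.biprod (tw s \<nu>) (tw (p' ## idt q) \<nu>) (tw (i ## idt q) \<nu>) (tw r \<nu>)"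
    using \<nu> by (rule tw_biprod)
  define S P I R where "S = tw s \<nu>" and "P = tw (p' ## idt q) \<nu>" and "I = tw (i ## idt q) \<nu>" and "R = tw r \<nu>"
  note B = B[folded S_def P_def I_def R_def]
  have m: "mdm S = act (t ** q) \<nu>" "mcd S = act (dm p ** q) \<nu>" "mdm I = act (dm i ** q) \<nu>"
    using sa ia qO by (simp_all add: S_def I_def)
  have B': "marr S" "marr P" "marr I" "marr R" "mcd I = mcd S" "mdm P = mcd S" "mdm R = mcd S" "mcd P = mdm S"
    "mcd R = mdm I" "P \<bullet>\<^sub>m S = midt (mdm S)" "R \<bullet>\<^sub>m I = midt (mdm I)" "R \<bullet>\<^sub>m S = mzer (mdm S) (mdm I)"
    using B by (auto simp: M.biprod_def)
  obtain F1 E1 where F1: "M.min_cover F1" "mcd F1 = act (t ** q) \<nu>"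
    and E1: "M.epi E1" "M.proj (mdm E1)" "mcd E1 = act x (mcd F1)"
      "\<And>z m. comp_series m z \<Longrightarrow> m + sz (z ** cd (mdm E1)) \<le> sz (z ** (x ** cd (mdm F1)))"
    using mc[OF f(3)] unfolding t_def by blast
  have F1': "M.epi F1" "marr F1" "M.proj (mdm F1)" using F1 M.epi_arr by (auto simp: M.min_cover_def)
  have FS: "mcd F = mcd S" using F m by simp
  \<comment> \<open>The maps \<open>G\<close> and \<open>H\<close> compare the two covers over the
    projection \<open>P\<close> and the inclusion \<open>S\<close>. As P S is the identity, G H is
    an endomorphism of \<open>F1\<close> over its target; minimality makes it invertible, so
    \<open>H\<close> embeds the minimal cover as a summand with complement \<open>J\<close>.\<close>
  have "\<exists>G. F1 \<bullet>\<^sub>m G = P \<bullet>\<^sub>m F" "\<exists>H. F \<bullet>\<^sub>m H = S \<bullet>\<^sub>m F1"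
    by (rule M.proj_lift[OF F(2) F1'(1)], use Fa FS B' F1 m in auto)
      (rule M.proj_lift[OF F1'(3) F(1)], use F1' FS B' F1 m in auto)
  then obtain G H where GH: "F1 \<bullet>\<^sub>m G = P \<bullet>\<^sub>m F" "F \<bullet>\<^sub>m H = S \<bullet>\<^sub>m F1" by blast
  have a: "marr (P \<bullet>\<^sub>m F)" "marr (S \<bullet>\<^sub>m F1)" using Fa FS B' F1 F1' m by auto
  have Ga: "marr G" "mdm G = mdm F" "mcd G = mdm F1" "marr H" "mdm H = mdm F1" "mcd H = mdm F"
    using M.cmp_arrD(1-4)[OF GH(1) a(1)] M.cmp_arrD(1-4)[OF GH(2) a(2)] Fa FS B' F1 F1' m by auto
  have "F1 \<bullet>\<^sub>m G \<bullet>\<^sub>m H = (P \<bullet>\<^sub>m F) \<bullet>\<^sub>m H" unfolding GH(1)[symmetric] by simp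
  also have "\<dots> = (P \<bullet>\<^sub>m S) \<bullet>\<^sub>m F1" using GH(2) by simp
  also have "\<dots> = F1" unfolding B'(10) using F1 F1' m by simp
  finally have "M.iso (G \<bullet>\<^sub>m H)" using F1(1) Ga unfolding M.min_cover_def by simp
  then obtain W where W: "M.inv_pair (G \<bullet>\<^sub>m H) W" by (auto simp: M.iso_def)
  have Wa: "marr W" "mdm W = mdm F1" "mcd W = mdm F1" "W \<bullet>\<^sub>m G \<bullet>\<^sub>m H = midt (mdm F1)"
    using W Ga by (auto simp: M.inv_pair_def)
  obtain J V where C: "M.biprod H (W \<bullet>\<^sub>m G) J V"
    using M.ex_complement[of H "W \<bullet>\<^sub>m G"] Ga Wa by auto
  have C': "marr J" "marr V" "mcd J = mdm F" "mdm V = mdm F" "mcd V = mdm J" "V \<bullet>\<^sub>m J = midt (mdm J)"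
    using C Ga by (auto simp: M.biprod_def)
  \<comment> \<open>Projecting to the other summand kills the copy of the minimal cover, because R S
    = 0; hence \<open>J\<close> alone covers the remaining part and the induction hypothesis applies
    to it.\<close>
  have RF: "M.epi (R \<bullet>\<^sub>m F)"
    using M.epi_cmp[OF F(1) M.split_epi[OF B'(11)]] B' FS marrD(2)[OF B'(3)] by simp
  have "(R \<bullet>\<^sub>m F) \<bullet>\<^sub>m H = (R \<bullet>\<^sub>m S) \<bullet>\<^sub>m F1" using GH(2) by simp
  also have "\<dots> = mzer (mdm H) (mdm I)" unfolding B'(12) using F1 F1' m Ga marrD(2)[OF B'(3)] by simp
  finally have "M.epi ((R \<bullet>\<^sub>m F) \<bullet>\<^sub>m J)"
    using M.biprod_epi[OF C _ _ RF] Ga Fa B' FS by simp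
  moreover have "M.proj (mdm J)"
    by (rule M.proj_retract[OF M.retractI[OF C'(6)] F(2)]) (use C' marrD(2)[OF C'(1)] in auto)
  moreover have "mcd ((R \<bullet>\<^sub>m F) \<bullet>\<^sub>m J) = act (dm i ** q) \<nu>" "mdm ((R \<bullet>\<^sub>m F) \<bullet>\<^sub>m J) = mdm J"
    using C' Fa B' FS m by simp_all
  ultimately obtain E2 where E2: "M.epi E2" "M.proj (mdm E2)" "mcd E2 = act x (act (dm i ** q) \<nu>)"
      "\<And>z m. comp_series m z \<Longrightarrow> n * m + sz (z ** cd (mdm E2)) \<le> sz (z ** (x ** cd (mdm J)))"
    using comp_ext.IH[of "(R \<bullet>\<^sub>m F) \<bullet>\<^sub>m J"] by metis
  have E: "marr E1" "marr E2" using E1 E2 by simp_all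
  obtain i' j' p'' q'' where N: "M.biprod i' p'' j' q''" "mdm i' = mdm E1" "mdm j' = mdm E2"
    using M.ex_biprod[of "mdm E1" "mdm E2"] marrD(2)[OF E(1)] marrD(2)[OF E(2)] by auto
  \<comment> \<open>The direct sum of the two improved covers; their losses m and n m add up to Suc
    n times m.\<close>
  define L where "L = (tl x S \<bullet>\<^sub>m E1 \<bullet>\<^sub>m p'') +++\<^sub>m (tl x I \<bullet>\<^sub>m E2 \<bullet>\<^sub>m q'')"
  have L: "M.epi L" "mdm L = mcd i'" "mcd L = mcd (tl x S)"
    unfolding L_def
    by (rule M.biprod_copair_epi[OF tl_biprod[OF x B] N(1) E1(1) E2(1)]; use E1 E2 F1 N m in simp)+
  have "M.proj (mdm L)" unfolding L(2) by (rule M.biprod_proj[OF N(1)]) (use N E1 E2 in auto)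
  moreover have "Suc n * k + sz (z ** cd (mdm L)) \<le> sz (z ** (x ** cd (mdm F)))" if z: "comp_series k z" for z k
  proof -
    have zO: "z \<in> Obj" using z comp_series_Obj by blast
    have "sz (z ** cd (mdm L)) = sz (z ** cd (mdm E1)) + sz (z ** cd (mdm E2))"
      using sz_M_biprod[OF N(1) zO] N L by simp
    moreover have "sz (z ** (x ** cd (mdm F))) = sz (z ** (x ** cd (mdm F1))) + sz (z ** (x ** cd (mdm J)))"
      using sz_M_biprod[OF tl_biprod[OF x C] zO] Ga C' x marrD(2)[OF Fa] marrD(2)[OF F1'(2)] marrD(2)[OF C'(1)]
      by simp
    ultimately show ?thesis using E1(4)[OF z] E2(4)[OF z] by simp
  qed
  ultimately show ?case using L m FS by (intro exI[of _ L]) auto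
qed

section \<open>Growth of sizes along the powers of x\<close>

text \<open>Covers are tensored with \<open>x\<close> on the left, so their targets grow as
  \<open>lpow\<close>; the test object takes over a factor \<open>x\<close> on its right, so it
  grows as \<open>rpow\<close>. Both are powers of \<open>x\<close>, bracketed differently.\<close>

primrec lpow :: "'o \<Rightarrow> nat \<Rightarrow> 'o" where
  "lpow x 0 = unt" | "lpow x (Suc k) = x ** lpow x k"

primrec rpow :: "'o \<Rightarrow> nat \<Rightarrow> 'o" where
  "rpow x 0 = unt" | "rpow x (Suc k) = rpow x k ** x"

lemma pow_Obj [simp]: "x \<in> Obj \<Longrightarrow> lpow x k \<in> Obj" "x \<in> Obj \<Longrightarrow> rpow x k \<in> Obj"
  by (induction k) auto

lemma sz_asc: "\<lbrakk>a \<in> Obj; b \<in> Obj; c \<in> Obj\<rbrakk> \<Longrightarrow> sz ((a ** b) ** c) = sz (a ** (b ** c))"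
  using sz_iso[OF inv_pair_iso(1)[OF asc_iso, of a b c]] by simp

lemma sz_pow: "x \<in> Obj \<Longrightarrow> sz (rpow x j ** lpow x k) = sz (rpow x (j + k))"
proof (induction k arbitrary: j)
  case 0
  then show ?case using sz_iso[OF inv_pair_iso(1)[OF run_iso, of "rpow x j"]] by simp
next
  case (Suc k)
  then show ?case using sz_asc[of "rpow x j" x "lpow x k"] Suc.IH[of "Suc j"] by simp
qed

text \<open>Projective covers of \<open>x\<^sup>k \<otimes> q \<otimes> \<nu>\<close> lose at every step a part whose size is comparable to
  \<open>x\<^sup>k\<close>, whereas the size of \<open>x\<^sup>k \<otimes> \<rho>\<close> is at most a constant times that of \<open>x\<^sup>k\<close>.\<close>

lemma no_uniform_loss:
  assumes q: "proj q" and \<nu>: "is_mod \<nu>" and x: "x \<in> Obj" "\<not> null x"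
    and step: "\<And>n y F. comp_series n y \<Longrightarrow> M.epi F \<Longrightarrow> M.proj (mdm F) \<Longrightarrow> mcd F = act (y ** q) \<nu> \<Longrightarrow>
      \<exists>E. M.epi E \<and> M.proj (mdm E) \<and> mcd E = act x (mcd F) \<and>
        (\<forall>z m. comp_series m z \<longrightarrow> n * m + sz (z ** cd (mdm E)) \<le> sz (z ** (x ** cd (mdm F))))"
  shows False
proof -
  have qO: "q \<in> Obj" using q by (rule proj_Obj)
  obtain C where C: "\<And>s t. simple s \<Longrightarrow> simple t \<Longrightarrow> sz (s ** t) \<le> C" using sz_ten_simple_bound by blast
  obtain N where N: "\<And>y. y \<in> Obj \<Longrightarrow> comp_series (N y) y" using ex_comp_series by metis
  have "is_mod (act (unt ** q) \<nu>)" using \<nu> qO by simp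
  then obtain F0 where F0: "M.epi F0" "mcd F0 = act (unt ** q) \<nu>" "M.proj (mdm F0)"
    using M_enough_proj by blast
  define r where "r = cd (mdm F0)"
  have rO: "r \<in> Obj" using marrD(2)[OF M.epi_arr[OF F0(1)]] is_modD(4) by (simp add: r_def)
  \<comment> \<open>The bound is kept for all test powers \<open>j\<close>, because the step from k
    to k + 1 hands one factor \<open>x\<close> to the test object and uses the bound at j + 1. The
    exponent j + k - 1 is truncated only for j = k = 0, where the factor k removes the term.\<close>
  have main: "\<exists>F. M.epi F \<and> M.proj (mdm F) \<and> mcd F = act (lpow x k ** q) \<nu> \<and>
    (\<forall>j. k * sz (rpow x (j + k - 1)) + C * sz (rpow x j ** cd (mdm F)) \<le> C * sz (rpow x (j + k) ** r))" for k
  proof (induction k)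
    case 0
    then show ?case using F0 by (intro exI[of _ F0]) (simp add: r_def)
  next
    case (Suc k)
    then obtain F where F: "M.epi F" "M.proj (mdm F)" "mcd F = act (lpow x k ** q) \<nu>"
      and le: "\<And>j. k * sz (rpow x (j + k - 1)) + C * sz (rpow x j ** cd (mdm F)) \<le> C * sz (rpow x (j + k) ** r)"
      by blast
    have fO: "cd (mdm F) \<in> Obj" using marrD(2)[OF M.epi_arr[OF F(1)]] is_modD(4) by simp
    have l: "lpow x k \<in> Obj" using x by simp
    obtain E where E: "M.epi E" "M.proj (mdm E)" "mcd E = act x (mcd F)"
      "\<And>z m. comp_series m z \<Longrightarrow> N (lpow x k) * m + sz (z ** cd (mdm E)) \<le> sz (z ** (x ** cd (mdm F)))"
      using step[OF N[OF l] F] by blast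
    \<comment> \<open>Only a rebracketing: \<open>a1\<close> and \<open>G\<close> identify x acting
      on the old target with the target built from the next power of \<open>x\<close>.\<close>
    define a1 where "a1 = asi x (lpow x k) q"
    have a1: "arr a1" "iso a1" "dm a1 = x ** (lpow x k ** q)" "cd a1 = lpow x (Suc k) ** q"
      using x qO inv_pair_iso(2)[OF asc_iso] by (auto simp: a1_def)
    define G where "G = tw a1 \<nu> \<bullet>\<^sub>m marrow (act x (act (lpow x k ** q) \<nu>))
      (asi x (lpow x k ** q) (cd \<nu>)) (act (x ** (lpow x k ** q)) \<nu>)"
    have asi: "mhom (asi x (lpow x k ** q) (cd \<nu>)) (act x (act (lpow x k ** q) \<nu>)) (act (x ** (lpow x k ** q)) \<nu>)"
      using x qO \<nu> by (intro mhom_asi) auto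
    have G: "marr G" "mdm G = mcd E" "mcd G = act (lpow x (Suc k) ** q) \<nu>"
      using a1 \<nu> asi E F by (simp_all add: G_def)
    have "epi (und G)"
    proof -
      have \<nu>O: "cd \<nu> \<in> Obj" using \<nu> is_modD(4) by blast
      have "epi (asi x (lpow x k ** q) (cd \<nu>))"
        using x qO \<nu>O by (intro iso_epi inv_pair_iso(2)[OF asc_iso]) auto
      moreover have "epi (a1 ## idt (cd \<nu>))" using a1 \<nu>O by (intro epi_tr iso_epi) auto
      ultimately show ?thesis
        using epi_cmp[of "asi x (lpow x k ** q) (cd \<nu>)" "a1 ## idt (cd \<nu>)"] a1 asi \<nu> \<nu>O x qO
        by (simp add: G_def)
    qed
    then have "M.epi (G \<bullet>\<^sub>m E)" using M.epi_cmp[OF E(1) epi_und[OF G(1)]] G by simp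
    moreover have "mdm (G \<bullet>\<^sub>m E) = mdm E" "mcd (G \<bullet>\<^sub>m E) = act (lpow x (Suc k) ** q) \<nu>"
      using G E by simp_all
    moreover have "Suc k * sz (rpow x (j + Suc k - 1)) + C * sz (rpow x j ** cd (mdm E))
        \<le> C * sz (rpow x (j + Suc k) ** r)" for j
    proof -
      \<comment> \<open>The loss is counted as a product of two lengths. Multiplying the estimate by
        \<open>C\<close> converts it into the size of a power of \<open>x\<close>; this is why
        \<open>C\<close> stands in front of the covers in \<open>main\<close>.\<close>
      have "sz (rpow x (j + k)) \<le> C * N (rpow x j) * N (lpow x k)"
        using sz_ten_le[OF C N N, of "rpow x j" "lpow x k"] sz_pow x by simp
      moreover have "N (lpow x k) * N (rpow x j) + sz (rpow x j ** cd (mdm E)) \<le> sz (rpow x (Suc j) ** cd (mdm F))"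
        using E(4)[OF N, of "rpow x j"] sz_asc[of "rpow x j" x "cd (mdm F)"] x fO by simp
      then have "C * (N (lpow x k) * N (rpow x j) + sz (rpow x j ** cd (mdm E))) \<le> C * sz (rpow x (Suc j) ** cd (mdm F))"
        by (rule mult_le_mono2)
      ultimately have "sz (rpow x (j + k)) + C * sz (rpow x j ** cd (mdm E)) \<le> C * sz (rpow x (Suc j) ** cd (mdm F))"
        by (simp add: algebra_simps)
      then show ?thesis using le[of "Suc j"] by simp
    qed
    ultimately show ?case using E(2) by (intro exI[of _ "G \<bullet>\<^sub>m E"]) simp
  qed
  \<comment> \<open>The case j = 0, k = l + 1 of \<open>main\<close> with the remaining cover
    dropped. Lengths are bounded by sizes, so the right-hand side becomes a fixed multiple of the
    size of the same power.\<close>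
  have bound: "Suc l * sz (rpow x l) \<le> C * (C * (C * sz (rpow x l) * N x) * N r)" for l
  proof -
    have "Suc l * sz (rpow x l) \<le> C * sz (rpow x (Suc l) ** r)"
      using main[of "Suc l"] by (metis add_0 add_leD1 diff_Suc_1)
    also have "sz (rpow x (Suc l) ** r) \<le> C * N (rpow x (Suc l)) * N r"
      using sz_ten_le[OF C N N, of "rpow x (Suc l)" r] x rO by simp
    also have "N (rpow x (Suc l)) \<le> sz (rpow x (Suc l))" using comp_series_ge[OF N] x by simp
    also have "\<dots> \<le> C * N (rpow x l) * N x" using sz_ten_le[OF C N N, of "rpow x l" x] x by simp
    also have "N (rpow x l) \<le> sz (rpow x l)" using comp_series_ge[OF N] x by simp
    finally show ?thesis by simp
  qed
  have pos: "0 < sz (rpow x l)" for l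
  proof -
    have "\<not> null (rpow x l)"
      by (induction l) (use x unt_not_null tob_not_null in auto)
    then show ?thesis using sz_pos x by simp
  qed
  \<comment> \<open>The fixed multiple occurring in \<open>bound\<close>; at this exponent the left
    factor is l + 1 and the right one is l.\<close>
  define l where "l = C * C * C * N x * N r"
  have "Suc l * sz (rpow x l) \<le> l * sz (rpow x l)" using bound[of l] by (simp add: l_def algebra_simps)
  then show False using pos[of l] by simp
qed

text \<open>Nonprojectivity of q \<otimes> \<nu> spreads to t \<otimes> q \<otimes> \<nu> for every
  simple \<open>t\<close>, so \<open>split_off_kernel\<close> applies to all their minimal covers;
  \<open>tensor_cover\<close> turns this into the uniform loss excluded by
  \<open>no_uniform_loss\<close>.\<close>

theorem exact_of_quotients:
  assumes H: "\<And>q E. proj q \<Longrightarrow> M.epi E \<Longrightarrow> mdm E = mu \<Longrightarrow> M.proj (act q (mcd E))"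
    and q: "proj q" and \<nu>: "is_mod \<nu>"
  shows "M.proj (act q \<nu>)"
proof (rule ccontr)
  assume np: "\<not> M.proj (act q \<nu>)"
  have qO: "q \<in> Obj" using q by (rule proj_Obj)
  have \<nu>O: "cd \<nu> \<in> Obj" using \<nu> is_modD(4) by blast
  have qn: "\<not> null q" using M_proj_null[of "act q \<nu>"] np \<nu> qO null_tr[of q "cd \<nu>"] \<nu>O by auto
  obtain T where T: "finite T" "\<And>t. t \<in> T \<Longrightarrow> simple t"
    "\<And>s. simple s \<Longrightarrow> \<exists>f. iso f \<and> dm f = s \<and> cd f \<in> T" using fin_simples by blast
  have tO: "t \<in> Obj" "\<not> null t" if "t \<in> T" for t using T(2)[OF that] by (auto simp: simple_def)
  have "\<exists>F. M.min_cover F \<and> mcd F = act (t ** q) \<nu>" if "t \<in> T" for t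
  proof -
    have "is_mod (act (t ** q) \<nu>)" using \<nu> qO tO[OF that] by simp
    then obtain E where "M.epi E" "mcd E = act (t ** q) \<nu>" "M.proj (mdm E)"
      using M_enough_proj by blast
    then show ?thesis using M.ex_min_cover by metis
  qed
  then obtain \<Phi> where \<Phi>: "\<And>t. t \<in> T \<Longrightarrow> M.min_cover (\<Phi> t)" "\<And>t. t \<in> T \<Longrightarrow> mcd (\<Phi> t) = act (t ** q) \<nu>"
    by metis
  have \<Phi>': "M.epi (\<Phi> t)" "M.proj (mdm (\<Phi> t))" "is_mod (mdm (\<Phi> t))" "cd (mdm (\<Phi> t)) \<in> Obj" if "t \<in> T" for t
  proof -
    show e: "M.epi (\<Phi> t)" "M.proj (mdm (\<Phi> t))" using \<Phi>(1)[OF that] by (auto simp: M.min_cover_def)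
    show "is_mod (mdm (\<Phi> t))" "cd (mdm (\<Phi> t)) \<in> Obj"
      using marrD(2)[OF M.epi_arr[OF e(1)]] is_modD(4) by auto
  qed
  \<comment> \<open>One object containing the underlying objects of all finitely many minimal covers
    as retracts: a single dual \<open>d\<close>, and thus a single q \<otimes> d, then serves every
    simple \<open>t\<close>.\<close>
  obtain a where a: "a \<in> Obj" "\<And>t. t \<in> T \<Longrightarrow> retract (cd (mdm (\<Phi> t))) a"
    using finite_common_retract[of "(\<lambda>t. cd (mdm (\<Phi> t))) ` T"] T(1) \<Phi>'(4) by auto
  obtain d ev co where D: "dual d a ev co" using ex_left_dual[OF a(1)] by blast
  have dO: "d \<in> Obj" using D by (simp add: dual_def)
  let ?x = "q ** d"
  have key: "\<exists>E. M.epi E \<and> M.proj (mdm E) \<and> mcd E = act ?x (mcd (\<Phi> t)) \<and>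
    (\<forall>z m. comp_series m z \<longrightarrow> m + sz (z ** cd (mdm E)) \<le> sz (z ** (?x ** cd (mdm (\<Phi> t)))))" if t: "t \<in> T" for t
  proof -
    let ?\<rho> = "mdm (\<Phi> t)"
    have act: "M.epi (marrow (act (cd ?\<rho>) mu) ?\<rho> ?\<rho>)"
      using mhom_action[OF \<Phi>'(3)[OF t]] epi_action[OF \<Phi>'(3)[OF t]] by (intro epi_und) auto
    then obtain S where "marrow (act (cd ?\<rho>) mu) ?\<rho> ?\<rho> \<bullet>\<^sub>m S = midt ?\<rho>"
      using M.proj_split[OF \<Phi>'(2)[OF t]] by fastforce
    then have "M.retract ?\<rho> (act (cd ?\<rho>) mu)" using \<Phi>'(3)[OF t] by (intro M.retractI) auto
    then have "M.retract ?\<rho> (act a mu)"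
      using M.retract_trans act_retract_left[OF a(2)[OF t] is_mod_mu] by blast
    then obtain j p where j: "mhom j ?\<rho> (act a mu)" "p \<bullet> j = idt (cd ?\<rho>)" by (rule M_retractE)
    then have "mono j" using split_mono \<Phi>'(4)[OF t] by blast
    \<comment> \<open>Otherwise the factor \<open>t\<close> could be cancelled against its dual,
      making q \<otimes> \<nu> projective.\<close>
    moreover have "\<not> M.proj (mcd (\<Phi> t))"
      using proj_act_cancel[OF q tO[OF t] \<nu>] np \<Phi>(2)[OF t] by auto
    ultimately show ?thesis
      using split_off_kernel[OF H[OF q] q qn \<Phi>'(1,2)[OF t] _ j(1) _ D] by blast
  qed
  have x: "?x \<in> Obj" using qO dO by simp
  \<comment> \<open>For a null \<open>?x\<close> the right-hand side of \<open>key\<close> with z =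
    1 would be 0, whereas the unit has positive length.\<close>
  have xn: "\<not> null ?x"
  proof
    assume n: "null ?x"
    obtain t where t: "t \<in> T" using T(3) unt_iso_simple by blast
    obtain m where m: "comp_series m unt" using ex_comp_series[OF unt_Obj] by blast
    have "null (unt ** (?x ** cd (mdm (\<Phi> t))))"
      using null_tl[OF null_tr[OF n \<Phi>'(4)[OF t]]] by simp
    then show False using key[OF t] m comp_series_pos[OF m unt_not_null] sz_null by fastforce
  qed
  show False
  proof (rule no_uniform_loss[OF q \<nu> x xn])
    fix n y F assume y: "comp_series n y" and F: "M.epi F" "M.proj (mdm F)" "mcd F = act (y ** q) \<nu>"
    show "\<exists>E. M.epi E \<and> M.proj (mdm E) \<and> mcd E = act ?x (mcd F) \<and>
      (\<forall>z m. comp_series m z \<longrightarrow> n * m + sz (z ** cd (mdm E)) \<le> sz (z ** (?x ** cd (mdm F))))"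
    proof (rule tensor_cover[OF q \<nu> x T(3) _ y F])
      fix t assume t: "t \<in> T"
      show "\<exists>F E. M.min_cover F \<and> mcd F = act (t ** q) \<nu> \<and> M.epi E \<and> M.proj (mdm E) \<and> mcd E = act ?x (mcd F) \<and>
        (\<forall>z m. comp_series m z \<longrightarrow> m + sz (z ** cd (mdm E)) \<le> sz (z ** (?x ** cd (mdm F))))"
        using key[OF t] \<Phi>[OF t] by blast
    qed
  qed
qed

end

section \<open>The arrow presentation of a tensor category\<close>

text \<open>Hom-sets may overlap, so an arrow must carry its ends. The value \<open>None\<close>
  stands for an undefined composite, which gives the unconditional associativity demanded by
  \<open>acat\<close>.\<close>

definition arrow :: "'o \<Rightarrow> 'm \<Rightarrow> 'o \<Rightarrow> ('o \<times> 'm \<times> 'o) option" where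
  "arrow a f b = Some (a, f, b)"

definition src :: "('o \<times> 'm \<times> 'o) option \<Rightarrow> 'o" where
  "src F = fst (the F)"

definition mor :: "('o \<times> 'm \<times> 'o) option \<Rightarrow> 'm" where
  "mor F = fst (snd (the F))"

definition trg :: "('o \<times> 'm \<times> 'o) option \<Rightarrow> 'o" where
  "trg F = snd (snd (the F))"

definition is_arrow :: "('o, 'm, 'z) category_scheme \<Rightarrow> ('o \<times> 'm \<times> 'o) option \<Rightarrow> bool" where
  "is_arrow C F \<longleftrightarrow> F \<noteq> None \<and> src F \<in> Ob C \<and> trg F \<in> Ob C \<and> mor F \<in> Hom C (src F) (trg F)"

definition arrow_cmp :: "('o, 'm, 'z) category_scheme \<Rightarrow> ('o \<times> 'm \<times> 'o) option \<Rightarrow>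
    ('o \<times> 'm \<times> 'o) option \<Rightarrow> ('o \<times> 'm \<times> 'o) option" where
  "arrow_cmp C G F = (if is_arrow C G \<and> is_arrow C F \<and> src G = trg F
     then arrow (src F) (mor G \<cdot>\<^bsub>C\<^esub> mor F) (trg G) else None)"

definition arrow_idt :: "('o, 'm, 'z) category_scheme \<Rightarrow> 'o \<Rightarrow> ('o \<times> 'm \<times> 'o) option" where
  "arrow_idt C a = arrow a (Ident C a) a"

definition arrow_add :: "('o, 'm, 'k, 'z) linear_category_scheme \<Rightarrow> ('o \<times> 'm \<times> 'o) option \<Rightarrow>
    ('o \<times> 'm \<times> 'o) option \<Rightarrow> ('o \<times> 'm \<times> 'o) option" where
  "arrow_add C F G = arrow (src F) (mor F \<oplus>\<^bsub>hom_space C (src F) (trg F)\<^esub> mor G) (trg F)"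

definition arrow_neg :: "('o, 'm, 'k, 'z) linear_category_scheme \<Rightarrow> ('o \<times> 'm \<times> 'o) option \<Rightarrow>
    ('o \<times> 'm \<times> 'o) option" where
  "arrow_neg C F = arrow (src F) (\<ominus>\<^bsub>hom_space C (src F) (trg F)\<^esub> mor F) (trg F)"

definition arrow_zer :: "('o, 'm, 'k, 'z) linear_category_scheme \<Rightarrow> 'o \<Rightarrow> 'o \<Rightarrow> ('o \<times> 'm \<times> 'o) option" where
  "arrow_zer C a b = arrow a (zero_arrow C a b) b"

definition arrow_ten :: "('o, 'm, 'k, 'z) monoidal_linear_category_scheme \<Rightarrow> ('o \<times> 'm \<times> 'o) option \<Rightarrow>
    ('o \<times> 'm \<times> 'o) option \<Rightarrow> ('o \<times> 'm \<times> 'o) option" where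
  "arrow_ten C F G = arrow (src F \<boxtimes>\<^bsub>C\<^esub> src G) (mor F \<star>\<^bsub>C\<^esub> mor G) (trg F \<boxtimes>\<^bsub>C\<^esub> trg G)"

definition arrow_inv :: "('o, 'm, 'z) category_scheme \<Rightarrow> ('o \<times> 'm \<times> 'o) option \<Rightarrow> ('o \<times> 'm \<times> 'o) option" where
  "arrow_inv C F = arrow (trg F) (inv_arrow C (src F) (trg F) (mor F)) (src F)"

definition arrow_asc :: "('o, 'm, 'k, 'z) monoidal_linear_category_scheme \<Rightarrow> 'o \<Rightarrow> 'o \<Rightarrow> 'o \<Rightarrow> ('o \<times> 'm \<times> 'o) option" where
  "arrow_asc C a b c = arrow ((a \<boxtimes>\<^bsub>C\<^esub> b) \<boxtimes>\<^bsub>C\<^esub> c) (associator C a b c) (a \<boxtimes>\<^bsub>C\<^esub> (b \<boxtimes>\<^bsub>C\<^esub> c))"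

definition arrow_lun :: "('o, 'm, 'k, 'z) monoidal_linear_category_scheme \<Rightarrow> 'o \<Rightarrow> ('o \<times> 'm \<times> 'o) option" where
  "arrow_lun C a = arrow (unit_ob C \<boxtimes>\<^bsub>C\<^esub> a) (left_unitor C a) a"

definition arrow_run :: "('o, 'm, 'k, 'z) monoidal_linear_category_scheme \<Rightarrow> 'o \<Rightarrow> ('o \<times> 'm \<times> 'o) option" where
  "arrow_run C a = arrow (a \<boxtimes>\<^bsub>C\<^esub> unit_ob C) (right_unitor C a) a"

lemma arrow_sel [simp]: "src (arrow a f b) = a" "mor (arrow a f b) = f" "trg (arrow a f b) = b"
  by (simp_all add: arrow_def src_def mor_def trg_def)

lemma arrow_eq [simp]: "arrow a f b = arrow a' f' b' \<longleftrightarrow> a = a' \<and> f = f' \<and> b = b'"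
  by (simp add: arrow_def)

lemma is_arrow_arrow [simp]: "is_arrow C (arrow a f b) \<longleftrightarrow> a \<in> Ob C \<and> b \<in> Ob C \<and> f \<in> Hom C a b"
  by (auto simp: is_arrow_def) (auto simp: arrow_def)

lemma is_arrow_None [simp]: "\<not> is_arrow C None"
  by (simp add: is_arrow_def)

lemma is_arrowD:
  assumes "is_arrow C F"
  shows "src F \<in> Ob C" "trg F \<in> Ob C" "mor F \<in> Hom C (src F) (trg F)" "F = arrow (src F) (mor F) (trg F)"
  using assms by (auto simp: is_arrow_def arrow_def src_def mor_def trg_def)

lemma is_arrowE:
  assumes "is_arrow C F"
  obtains a f b where "F = arrow a f b" "a \<in> Ob C" "b \<in> Ob C" "f \<in> Hom C a b"
  using is_arrowD[OF assms] by metis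

lemma arrow_cmp_arrow [simp]:
  "\<lbrakk>a \<in> Ob C; b \<in> Ob C; c \<in> Ob C; f \<in> Hom C a b; g \<in> Hom C b c\<rbrakk> \<Longrightarrow>
     arrow_cmp C (arrow b g c) (arrow a f b) = arrow a (g \<cdot>\<^bsub>C\<^esub> f) c"
  by (simp add: arrow_cmp_def)

context category begin

lemma is_arrow_cmp: "is_arrow C (arrow_cmp C G F) \<longleftrightarrow> is_arrow C G \<and> is_arrow C F \<and> src G = trg F"
proof (cases "is_arrow C G \<and> is_arrow C F \<and> src G = trg F")
  case True
  then show ?thesis using is_arrowD[of C F] is_arrowD[of C G] Comp_in_Hom
    by (auto simp: arrow_cmp_def)
qed (auto simp: arrow_cmp_def)

lemma arrow_acat: "acat (Ob C) (is_arrow C) src trg (arrow_cmp C) (arrow_idt C)"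
proof
  fix F G H
  show "is_arrow C (arrow_cmp C G F) = (is_arrow C G \<and> is_arrow C F \<and> src G = trg F)" by (rule is_arrow_cmp)
  show "arrow_cmp C (arrow_cmp C H G) F = arrow_cmp C H (arrow_cmp C G F)"
  proof (cases "is_arrow C H \<and> is_arrow C G \<and> is_arrow C F \<and> src H = trg G \<and> src G = trg F")
    case True
    then obtain a b c d f g h where
      "F = arrow a f b" "G = arrow b g c" "H = arrow c h d" "a \<in> Ob C" "b \<in> Ob C" "c \<in> Ob C" "d \<in> Ob C"
      "f \<in> Hom C a b" "g \<in> Hom C b c" "h \<in> Hom C c d"
      by (metis is_arrowE arrow_sel(1,3))
    then show ?thesis using Comp_in_Hom Comp_assoc by (simp add: arrow_cmp_def)
  next
    case False
    have "arrow_cmp C (arrow_cmp C H G) F = None" "arrow_cmp C H (arrow_cmp C G F) = None"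
      using False is_arrow_cmp[of H G] is_arrow_cmp[of G F] by (auto simp: arrow_cmp_def)
    then show ?thesis by simp
  qed
next
  fix F G assume "is_arrow C G" "is_arrow C F" "src G = trg F"
  then show "src (arrow_cmp C G F) = src F" "trg (arrow_cmp C G F) = trg G" by (simp_all add: arrow_cmp_def)
next
  fix a assume "a \<in> Ob C"
  then show "is_arrow C (arrow_idt C a)" "src (arrow_idt C a) = a" "trg (arrow_idt C a) = a"
    by (simp_all add: arrow_idt_def Id_in_Hom)
next
  fix F a assume "is_arrow C F" "src F = a"
  then show "arrow_cmp C F (arrow_idt C a) = F"
    by (auto elim!: is_arrowE simp: arrow_idt_def Id_in_Hom Comp_Id_right)
next
  fix F a assume "is_arrow C F" "trg F = a"
  then show "arrow_cmp C (arrow_idt C a) F = F"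
    by (auto elim!: is_arrowE simp: arrow_idt_def Id_in_Hom Comp_Id_left)
qed (auto dest: is_arrowD)

sublocale R: acat "Ob C" "is_arrow C" src trg "arrow_cmp C" "arrow_idt C"
  by (rule arrow_acat)

lemma monic_iff: "monic C a b f \<longleftrightarrow> R.mono (arrow a f b)"
proof
  assume m: "monic C a b f"
  then have f: "a \<in> Ob C" "b \<in> Ob C" "f \<in> Hom C a b" by (auto simp: monic_def)
  show "R.mono (arrow a f b)" unfolding R.mono_def
  proof (intro conjI allI impI)
    fix G H assume "is_arrow C G \<and> is_arrow C H \<and> src G = src H \<and> trg G = src (arrow a f b) \<and>
      trg H = src (arrow a f b) \<and> arrow_cmp C (arrow a f b) G = arrow_cmp C (arrow a f b) H"
    then obtain c g h where gh: "G = arrow c g a" "H = arrow c h a" "c \<in> Ob C" "g \<in> Hom C c a" "h \<in> Hom C c a"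
      "arrow_cmp C (arrow a f b) G = arrow_cmp C (arrow a f b) H"
      by (metis is_arrowE arrow_sel(1,3))
    then have "f \<cdot> g = f \<cdot> h" using f by simp
    then show "G = H" using m gh unfolding monic_def by blast
  qed (use f in simp)
next
  assume m: "R.mono (arrow a f b)"
  then have f: "a \<in> Ob C" "b \<in> Ob C" "f \<in> Hom C a b" using R.mono_arr[OF m] by auto
  have "g = h" if "c \<in> Ob C" "g \<in> Hom C c a" "h \<in> Hom C c a" "f \<cdot> g = f \<cdot> h" for c g h
    using R.monoD[OF m, of "arrow c g a" "arrow c h a"] f that by simp
  then show "monic C a b f" using f unfolding monic_def by blast
qed

lemma epic_iff: "epic C a b f \<longleftrightarrow> R.epi (arrow a f b)"
proof
  assume m: "epic C a b f"
  then have f: "a \<in> Ob C" "b \<in> Ob C" "f \<in> Hom C a b" by (auto simp: epic_def)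
  show "R.epi (arrow a f b)" unfolding R.epi_def
  proof (intro conjI allI impI)
    fix G H assume "is_arrow C G \<and> is_arrow C H \<and> trg G = trg H \<and> src G = trg (arrow a f b) \<and>
      src H = trg (arrow a f b) \<and> arrow_cmp C G (arrow a f b) = arrow_cmp C H (arrow a f b)"
    then obtain c g h where gh: "G = arrow b g c" "H = arrow b h c" "c \<in> Ob C" "g \<in> Hom C b c" "h \<in> Hom C b c"
      "arrow_cmp C G (arrow a f b) = arrow_cmp C H (arrow a f b)"
      by (metis is_arrowE arrow_sel(1,3))
    then have "g \<cdot> f = h \<cdot> f" using f by simp
    then show "G = H" using m gh unfolding epic_def by blast
  qed (use f in simp)
next
  assume m: "R.epi (arrow a f b)"
  then have f: "a \<in> Ob C" "b \<in> Ob C" "f \<in> Hom C a b" using R.epi_arr[OF m] by auto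
  have "g = h" if "c \<in> Ob C" "g \<in> Hom C b c" "h \<in> Hom C b c" "g \<cdot> f = h \<cdot> f" for c g h
    using R.epiD[OF m, of "arrow b g c" "arrow b h c"] f that by simp
  then show "epic C a b f" using f unfolding epic_def by blast
qed

lemma projective_iff: "projective C p \<longleftrightarrow> R.proj p"
proof
  assume p: "projective C p"
  show "R.proj p" unfolding R.proj_def
  proof (intro conjI allI impI)
    show "p \<in> Ob C" using p by (simp add: projective_def)
    fix E F assume "R.epi E \<and> is_arrow C F \<and> src F = p \<and> trg F = trg E"
    then obtain a e b f where ef: "E = arrow a e b" "F = arrow p f b" "a \<in> Ob C" "b \<in> Ob C" "e \<in> Hom C a b"
      "f \<in> Hom C p b" "R.epi E"
      by (metis is_arrowE R.epi_arr arrow_sel(1,3))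
    then obtain g where "g \<in> Hom C p a" "e \<cdot> g = f"
      using p unfolding projective_def by (metis epic_iff)
    then show "\<exists>G. arrow_cmp C E G = F"
      using ef p by (intro exI[of _ "arrow p g a"]) (simp add: projective_def)
  qed
next
  assume p: "R.proj p"
  show "projective C p" unfolding projective_def
  proof (intro conjI allI impI ballI)
    show "p \<in> Ob C" using p by (rule R.proj_Obj)
    fix a b e f assume e: "epic C a b e" and f: "f \<in> Hom C p b"
    have e': "R.epi (arrow a e b)" "a \<in> Ob C" "b \<in> Ob C" "e \<in> Hom C a b"
      using e by (auto simp: epic_iff[symmetric] epic_def)
    obtain G where G: "arrow_cmp C (arrow a e b) G = arrow p f b"
      using R.proj_lift[OF p e'(1), of "arrow p f b"] f e' R.proj_Obj[OF p] by auto
    then have "is_arrow C G" "trg G = a" "src G = p"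
      using R.cmp_arrD[OF G] f e' R.proj_Obj[OF p] by auto
    then obtain g where "G = arrow p g a" "g \<in> Hom C p a" by (metis is_arrowD(3,4))
    then show "\<exists>g\<in>Hom C p a. e \<cdot> g = f" using G e' R.proj_Obj[OF p] by auto
  qed
qed

lemma inv_arrow_inverse:
  assumes "iso_arrow C a b f"
  shows "inverse_arrows C a b f (inv_arrow C a b f)"
proof -
  obtain g where g: "inverse_arrows C a b f g" using assms by (auto simp: iso_arrow_def)
  have "h = g" if h: "inverse_arrows C a b f h" for h
  proof -
    have "h = h \<cdot> (f \<cdot> g)" using g h Comp_Id_right[of b a h] by (simp add: inverse_arrows_def)
    also have "\<dots> = (h \<cdot> f) \<cdot> g"
      using g h Comp_assoc[of b a b a g f h] by (simp add: inverse_arrows_def)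
    also have "\<dots> = g" using g h Comp_Id_left[of b a g] by (simp add: inverse_arrows_def)
    finally show ?thesis .
  qed
  then show ?thesis unfolding inv_arrow_def using g by (metis theI)
qed

lemma arrow_inv_pair:
  assumes "iso_arrow C a b f"
  shows "R.inv_pair (arrow a f b) (arrow_inv C (arrow a f b))"
  using inv_arrow_inverse[OF assms] by (simp add: R.inv_pair_def inverse_arrows_def arrow_inv_def arrow_idt_def)

lemma iso_arrow_iff: "iso_arrow C a b f \<longleftrightarrow> R.iso (arrow a f b)"
proof
  assume "iso_arrow C a b f"
  then show "R.iso (arrow a f b)" using arrow_inv_pair unfolding R.iso_def by blast
next
  assume "R.iso (arrow a f b)"
  then obtain G where G: "R.inv_pair (arrow a f b) G" by (auto simp: R.iso_def)
  then have G': "is_arrow C G" "src G = b" "trg G = a" "is_arrow C (arrow a f b)" by (auto simp: R.inv_pair_def)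
  then obtain g where g: "G = arrow b g a" "g \<in> Hom C b a" by (metis is_arrowD(3,4))
  then have "inverse_arrows C a b f g"
    using G G' by (auto simp: R.inv_pair_def inverse_arrows_def arrow_idt_def)
  then show "iso_arrow C a b f" by (auto simp: iso_arrow_def)
qed

end

context linear_category begin

lemma hom_module: "\<lbrakk>a \<in> Ob C; b \<in> Ob C\<rbrakk> \<Longrightarrow> abelian_group (hom_space C a b)"
  using module_hom_space module.axioms(2) by blast

lemma arrow_preadd: "preadd (Ob C) (is_arrow C) src trg (arrow_cmp C) (arrow_idt C)
  (arrow_add C) (arrow_neg C) (arrow_zer C)"
proof (intro preadd.intro arrow_acat preadd_axioms.intro)
  fix F G
  assume a: "is_arrow C F" "is_arrow C G" "src F = src G" "trg F = trg G"
  interpret H: abelian_group "hom_space C (src G) (trg G)" using a is_arrowD[of C G] hom_module by blast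
  show "is_arrow C (arrow_add C F G) \<and> src (arrow_add C F G) = src F \<and> trg (arrow_add C F G) = trg F"
    using a is_arrowD[OF a(1)] is_arrowD[OF a(2)] H.a_closed[of "mor F" "mor G"]
    by (simp add: arrow_add_def carrier_hom_space)
  show "arrow_add C F G = arrow_add C G F"
    using a is_arrowD[OF a(1)] is_arrowD[OF a(2)] H.a_comm[of "mor F" "mor G"]
    by (simp add: arrow_add_def carrier_hom_space)
next
  fix F assume a: "is_arrow C F"
  interpret H: abelian_group "hom_space C (src F) (trg F)" using a is_arrowD[of C F] hom_module by blast
  show "is_arrow C (arrow_neg C F) \<and> src (arrow_neg C F) = src F \<and> trg (arrow_neg C F) = trg F"
    using is_arrowD[OF a] H.a_inv_closed[of "mor F"] by (simp add: arrow_neg_def carrier_hom_space)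
  show "arrow_add C (arrow_neg C F) F = arrow_zer C (src F) (trg F)"
    using is_arrowD[OF a] H.l_neg[of "mor F"]
    by (simp add: arrow_neg_def arrow_add_def arrow_zer_def carrier_hom_space)
next
  fix a b assume a: "a \<in> Ob C" "b \<in> Ob C"
  interpret H: abelian_group "hom_space C a b" using a hom_module by blast
  show "is_arrow C (arrow_zer C a b) \<and> src (arrow_zer C a b) = a \<and> trg (arrow_zer C a b) = b"
    using a H.zero_closed by (simp add: arrow_zer_def carrier_hom_space)
next
  fix F G E assume a: "is_arrow C F" "is_arrow C G" "is_arrow C E" "src F = src G" "trg F = trg G"
    "src G = src E" "trg G = trg E"
  interpret H: abelian_group "hom_space C (src E) (trg E)" using a is_arrowD[of C E] hom_module by blast
  show "arrow_add C (arrow_add C F G) E = arrow_add C F (arrow_add C G E)"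
    using a is_arrowD[OF a(1)] is_arrowD[OF a(2)] is_arrowD[OF a(3)] H.a_assoc[of "mor F" "mor G" "mor E"]
    by (simp add: arrow_add_def carrier_hom_space)
next
  fix F a b assume a: "is_arrow C F" "src F = a" "trg F = b"
  interpret H: abelian_group "hom_space C (src F) (trg F)" using a is_arrowD[of C F] hom_module by blast
  show "arrow_add C (arrow_zer C a b) F = F"
    using is_arrowD[OF a(1)] a H.l_zero[of "mor F"] by (simp add: arrow_add_def arrow_zer_def carrier_hom_space)
next
  fix F F' G assume a: "is_arrow C F" "is_arrow C F'" "src F = src F'" "trg F = trg F'" "is_arrow C G" "src G = trg F"
  interpret H: abelian_group "hom_space C (src F') (trg F')" using a is_arrowD[of C F'] hom_module by blast
  have c: "mor F \<oplus>\<^bsub>hom_space C (src F') (trg F')\<^esub> mor F' \<in> Hom C (src F') (trg F')"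
    using a is_arrowD[OF a(1)] is_arrowD[OF a(2)] H.a_closed[of "mor F" "mor F'"] by (simp add: carrier_hom_space)
  show "arrow_cmp C G (arrow_add C F F') = arrow_add C (arrow_cmp C G F) (arrow_cmp C G F')"
    using a c is_arrowD[OF a(1)] is_arrowD[OF a(2)] is_arrowD[OF a(5)] Comp_add_right[of "src F'" "trg F'" "trg G" "mor F" "mor F'" "mor G"]
    by (simp add: arrow_add_def arrow_cmp_def)
next
  fix G G' F assume a: "is_arrow C G" "is_arrow C G'" "src G = src G'" "trg G = trg G'" "is_arrow C F" "src G = trg F"
  interpret H: abelian_group "hom_space C (src G') (trg G')" using a is_arrowD[of C G'] hom_module by blast
  have c: "mor G \<oplus>\<^bsub>hom_space C (src G') (trg G')\<^esub> mor G' \<in> Hom C (src G') (trg G')"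
    using a is_arrowD[OF a(1)] is_arrowD[OF a(2)] H.a_closed[of "mor G" "mor G'"] by (simp add: carrier_hom_space)
  show "arrow_cmp C (arrow_add C G G') F = arrow_add C (arrow_cmp C G F) (arrow_cmp C G' F)"
    using a c is_arrowD[OF a(1)] is_arrowD[OF a(2)] is_arrowD[OF a(5)] Comp_add_left[of "src F" "src G'" "trg G'" "mor F" "mor G" "mor G'"]
    by (simp add: arrow_add_def arrow_cmp_def)
qed

sublocale R: preadd "Ob C" "is_arrow C" src trg "arrow_cmp C" "arrow_idt C" "arrow_add C" "arrow_neg C" "arrow_zer C"
  by (rule arrow_preadd)

text \<open>The unique factorisation in \<open>is_kernel\<close> is split into existence of a
  factorisation and monicity of the kernel map, the form used by \<open>is_ker\<close>.\<close>

lemma is_kernel_ker: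
  assumes k: "is_kernel C a b f k i" shows "R.is_ker (arrow a f b) (arrow k i a)"
proof -
  have o: "a \<in> Ob C" "b \<in> Ob C" "k \<in> Ob C" "f \<in> Hom C a b" "i \<in> Hom C k a" "f \<cdot> i = zero_arrow C k b"
    and u: "\<And>x g. \<lbrakk>x \<in> Ob C; g \<in> Hom C x a; f \<cdot> g = zero_arrow C x b\<rbrakk> \<Longrightarrow> \<exists>!h. h \<in> Hom C x k \<and> i \<cdot> h = g"
    using k by (auto simp: is_kernel_def)
  have "monic C k a i" unfolding monic_def
  proof (intro conjI ballI impI o)
    fix c g h assume c: "c \<in> Ob C" "g \<in> Hom C c k" "h \<in> Hom C c k" "i \<cdot> g = i \<cdot> h"
    have "arrow_cmp C (arrow a f b) (arrow_cmp C (arrow k i a) (arrow c h k)) = arrow_zer C c b"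
    proof -
      have "arrow_cmp C (arrow a f b) (arrow k i a) = arrow_zer C k b" using o by (simp add: arrow_zer_def)
      then have "arrow_cmp C (arrow a f b) (arrow_cmp C (arrow k i a) (arrow c h k)) = arrow_cmp C (arrow_zer C k b) (arrow c h k)"
        by (rule R.cmp_reassoc)
      then show ?thesis using R.zer_cmp[of "arrow c h k" k b] o c by simp
    qed
    then have "f \<cdot> (i \<cdot> h) = zero_arrow C c b"
      using o c Comp_in_Hom[of c k a h i] by (simp add: arrow_zer_def)
    then show "g = h" using u[of c "i \<cdot> h"] c o Comp_in_Hom[of c k a h i] by metis
  qed
  then have m: "R.mono (arrow k i a)" by (simp add: monic_iff)
  show ?thesis unfolding R.is_ker_def
  proof (intro conjI allI impI m)
    show "arrow_cmp C (arrow a f b) (arrow k i a) = arrow_zer C (src (arrow k i a)) (trg (arrow a f b))"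
      using o by (simp add: arrow_zer_def)
    fix G assume G: "is_arrow C G \<and> trg G = src (arrow a f b) \<and>
      arrow_cmp C (arrow a f b) G = arrow_zer C (src G) (trg (arrow a f b))"
    then obtain x g where g: "G = arrow x g a" "x \<in> Ob C" "g \<in> Hom C x a" by (metis is_arrowE arrow_sel(1,3))
    then have "f \<cdot> g = zero_arrow C x b" using G o by (simp add: arrow_zer_def)
    then obtain h where "h \<in> Hom C x k" "i \<cdot> h = g" using u g by blast
    then show "\<exists>H. arrow_cmp C (arrow k i a) H = G"
      using g o by (intro exI[of _ "arrow x h k"]) simp
  qed (use o in auto)
qed

lemma is_cokernel_cok:
  assumes k: "is_cokernel C a b f q p" shows "R.is_cok (arrow a f b) (arrow b p q)"
proof -
  have o: "a \<in> Ob C" "b \<in> Ob C" "q \<in> Ob C" "f \<in> Hom C a b" "p \<in> Hom C b q" "p \<cdot> f = zero_arrow C a q"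
    and u: "\<And>x g. \<lbrakk>x \<in> Ob C; g \<in> Hom C b x; g \<cdot> f = zero_arrow C a x\<rbrakk> \<Longrightarrow> \<exists>!h. h \<in> Hom C q x \<and> h \<cdot> p = g"
    using k by (auto simp: is_cokernel_def)
  have "epic C b q p" unfolding epic_def
  proof (intro conjI ballI impI o)
    fix c g h assume c: "c \<in> Ob C" "g \<in> Hom C q c" "h \<in> Hom C q c" "g \<cdot> p = h \<cdot> p"
    have "arrow_cmp C (arrow_cmp C (arrow q h c) (arrow b p q)) (arrow a f b) = arrow_zer C a c"
    proof -
      have "arrow_cmp C (arrow b p q) (arrow a f b) = arrow_zer C a q" using o by (simp add: arrow_zer_def)
      then show ?thesis using R.cmp_zer[of "arrow q h c" q a] o c by (simp del: arrow_cmp_arrow)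
    qed
    then have "(h \<cdot> p) \<cdot> f = zero_arrow C a c"
      using o c Comp_in_Hom[of b q c p h] by (simp add: arrow_zer_def)
    then show "g = h" using u[of c "h \<cdot> p"] c o Comp_in_Hom[of b q c p h] by metis
  qed
  then have m: "R.epi (arrow b p q)" by (simp add: epic_iff)
  show ?thesis unfolding R.is_cok_def
  proof (intro conjI allI impI m)
    show "arrow_cmp C (arrow b p q) (arrow a f b) = arrow_zer C (src (arrow a f b)) (trg (arrow b p q))"
      using o by (simp add: arrow_zer_def)
    fix G assume G: "is_arrow C G \<and> src G = trg (arrow a f b) \<and>
      arrow_cmp C G (arrow a f b) = arrow_zer C (src (arrow a f b)) (trg G)"
    then obtain x g where g: "G = arrow b g x" "x \<in> Ob C" "g \<in> Hom C b x" by (metis is_arrowE arrow_sel(1,3))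
    then have "g \<cdot> f = zero_arrow C a x" using G o by (simp add: arrow_zer_def)
    then obtain h where "h \<in> Hom C q x" "h \<cdot> p = g" using u g by blast
    then show "\<exists>H. arrow_cmp C H (arrow b p q) = G"
      using g o by (intro exI[of _ "arrow q h x"]) simp
  qed (use o in auto)
qed

lemma biprod_direct_sum:
  assumes "R.biprod I P J Q"
  shows "is_direct_sum C (src I) (src J) (trg I)"
proof -
  note b = assms[unfolded R.biprod_def]
  have a: "is_arrow C I" "is_arrow C P" "is_arrow C J" "is_arrow C Q" using b by auto
  have m: "mor I \<in> Hom C (src I) (trg I)" "mor J \<in> Hom C (src J) (trg I)" "mor P \<in> Hom C (trg I) (src I)"
    "mor Q \<in> Hom C (trg I) (src J)" "src I \<in> Ob C" "src J \<in> Ob C" "trg I \<in> Ob C"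
    using b is_arrowD(1-3)[OF a(1)] is_arrowD(1-3)[OF a(2)] is_arrowD(1-3)[OF a(3)] is_arrowD(1-3)[OF a(4)] by auto
  have "mor P \<cdot> mor I = Ident C (src I)" "mor Q \<cdot> mor J = Ident C (src J)"
    "mor P \<cdot> mor J = zero_arrow C (src J) (src I)" "mor Q \<cdot> mor I = zero_arrow C (src I) (src J)"
    "(mor I \<cdot> mor P) \<oplus>\<^bsub>hom_space C (trg I) (trg I)\<^esub> (mor J \<cdot> mor Q) = Ident C (trg I)"
    using b by (auto simp: arrow_cmp_def arrow_idt_def arrow_zer_def arrow_add_def)
  then show ?thesis using m unfolding is_direct_sum_def by blast
qed

lemma direct_sum_biprod:
  assumes "is_direct_sum C a b s"
  shows "\<exists>I P J Q. R.biprod I P J Q \<and> src I = a \<and> src J = b"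
proof -
  obtain i j p q where h: "a \<in> Ob C" "b \<in> Ob C" "s \<in> Ob C"
      "i \<in> Hom C a s" "j \<in> Hom C b s" "p \<in> Hom C s a" "q \<in> Hom C s b"
    and e: "p \<cdot> i = Ident C a" "q \<cdot> j = Ident C b" "p \<cdot> j = zero_arrow C b a" "q \<cdot> i = zero_arrow C a b"
      "(i \<cdot> p) \<oplus>\<^bsub>hom_space C s s\<^esub> (j \<cdot> q) = Ident C s"
    using assms unfolding is_direct_sum_def by blast
  have "R.biprod (arrow a i s) (arrow s p a) (arrow b j s) (arrow s q b)"
    unfolding R.biprod_def using h e by (simp add: arrow_idt_def arrow_zer_def arrow_add_def)
  then show ?thesis by (intro exI conjI) auto
qed

lemma zero_object_iff: "zero_object C z \<longleftrightarrow> R.null z"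
proof
  assume z: "zero_object C z"
  then have o: "z \<in> Ob C" by (simp add: zero_object_def)
  have "arrow_idt C z = arrow_zer C z z"
    using z o Id_in_Hom[OF o] R.arr_zer[OF o o] unfolding zero_object_def arrow_idt_def arrow_zer_def
    by (metis arrow_sel(2) is_arrow_arrow)
  then show "R.null z" using o by (simp add: R.null_def)
next
  assume z: "R.null z"
  then have o: "z \<in> Ob C" by (simp add: R.null_def)
  show "zero_object C z" unfolding zero_object_def
  proof (intro conjI ballI o)
    fix a assume a: "a \<in> Ob C"
    have "f = zero_arrow C z a" if "f \<in> Hom C z a" for f
      using R.null_arr(1)[of "arrow z f a"] z o a that by (simp add: arrow_zer_def)
    moreover have "zero_arrow C z a \<in> Hom C z a" using R.arr_zer[OF o a] by (simp add: arrow_zer_def)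
    ultimately show "\<exists>!f. f \<in> Hom C z a" by blast
    have "f = zero_arrow C a z" if "f \<in> Hom C a z" for f
      using R.null_arr(2)[of "arrow a f z"] z o a that by (simp add: arrow_zer_def)
    moreover have "zero_arrow C a z \<in> Hom C a z" using R.arr_zer[OF a o] by (simp add: arrow_zer_def)
    ultimately show "\<exists>!f. f \<in> Hom C a z" by blast
  qed
qed

end

context abel begin

lemma simple_iso:
  assumes f: "iso f" and s: "simple (dm f)"
  shows "simple (cd f)"
  unfolding simple_def
proof (intro conjI allI impI)
  obtain g where g: "inv_pair f g" using f by (auto simp: iso_def)
  have ga: "arr f" "arr g" "dm g = cd f" "cd g = dm f" "f \<bullet> g = idt (cd f)" "iso g"
    using g inv_pair_iso(2)[OF g] by (auto simp: inv_pair_def)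
  show "cd f \<in> Obj" using ga by simp
  show "\<not> null (cd f)"
  proof
    assume "null (cd f)"
    then have "null (dm f)" using null_epi[OF _ iso_epi[OF ga(6)]] ga by simp
    then show False using s by (simp add: simple_def)
  qed
  fix m assume m: "mono m \<and> cd m = cd f"
  then have "mono (g \<bullet> m)" using mono_cmp[of m g] iso_mono[OF ga(6)] ga by simp
  then have "null (dm m) \<or> iso (g \<bullet> m)" using s m ga unfolding simple_def by force
  moreover have "m = f \<bullet> (g \<bullet> m)" using m ga by (simp add: cmp_reassoc[OF ga(5)])
  then have "iso m" if "iso (g \<bullet> m)" using iso_cmp[OF that f] m ga that by simp
  ultimately show "null (dm m) \<or> iso m" by blast
qed

end

context abelian_category begin

lemma arrow_abel: "abel (Ob C) (is_arrow C) src trg (arrow_cmp C) (arrow_idt C)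
  (arrow_add C) (arrow_neg C) (arrow_zer C)"
proof (intro abel.intro arrow_preadd abel_axioms.intro)
  fix F assume "is_arrow C F"
  then obtain a f b where F: "F = arrow a f b" "a \<in> Ob C" "b \<in> Ob C" "f \<in> Hom C a b" by (rule is_arrowE)
  then show "\<exists>k. R.is_ker F k" "\<exists>p. R.is_cok F p"
    using ex_kernel ex_cokernel is_kernel_ker is_cokernel_cok by metis+
next
  fix F assume F: "R.mono F"
  then obtain a f b where "F = arrow a f b" using is_arrowD(4) R.mono_arr by metis
  then show "\<exists>f. R.is_ker f F" using F monic_is_kernel is_kernel_ker monic_iff by metis
next
  fix a b assume "a \<in> Ob C" "b \<in> Ob C"
  then show "\<exists>i p j q. R.biprod i p j q \<and> src i = a \<and> src j = b"
    using ex_direct_sum direct_sum_biprod by blast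
qed

sublocale R: abel "Ob C" "is_arrow C" src trg "arrow_cmp C" "arrow_idt C" "arrow_add C" "arrow_neg C" "arrow_zer C"
  by (rule arrow_abel)

lemma epi_is_cok: "R.epi F \<Longrightarrow> \<exists>f. R.is_cok f F"
  using is_arrowD(4) R.epi_arr epic_is_cokernel is_cokernel_cok epic_iff by metis

lemma simple_object_iff: "simple_object C s \<longleftrightarrow> R.simple s"
proof
  assume s: "simple_object C s"
  show "R.simple s" unfolding R.simple_def
  proof (intro conjI allI impI)
    fix F assume F: "R.mono F \<and> trg F = s"
    then have e: "F = arrow (src F) (mor F) s" using is_arrowD(4) R.mono_arr by metis
    then have "monic C (src F) s (mor F)" using F monic_iff by metis
    then have "zero_object C (src F) \<or> iso_arrow C (src F) s (mor F)" using s by (simp add: simple_object_def)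
    then show "R.null (src F) \<or> R.iso F" using e zero_object_iff iso_arrow_iff by metis
  qed (use s in \<open>auto simp: simple_object_def zero_object_iff\<close>)
next
  assume s: "R.simple s"
  show "simple_object C s" unfolding simple_object_def
  proof (intro conjI allI impI)
    fix b f assume "monic C b s f"
    then have "R.null b \<or> R.iso (arrow b f s)" using s unfolding R.simple_def monic_iff by fastforce
    then show "zero_object C b \<or> iso_arrow C b s f" by (simp add: zero_object_iff iso_arrow_iff)
  qed (use s in \<open>auto simp: R.simple_def zero_object_iff\<close>)
qed

lemma finite_length_comp_series:
  assumes "finite_length C a" shows "\<exists>n. R.comp_series n a"
proof -
  obtain n c where c: "zero_object C (c 0)" "c n = a"
    "\<And>j. j < n \<Longrightarrow> \<exists>s i p. simple_object C s \<and> short_exact C (c j) (c (Suc j)) s i p"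
    using assms unfolding finite_length_def by blast
  have "R.comp_series j (c j)" if "j \<le> n" for j
    using that
  proof (induction j)
    case 0
    then show ?case using c(1) R.comp_null by (simp add: zero_object_iff)
  next
    case (Suc j)
    then obtain s i p where s: "simple_object C s" "short_exact C (c j) (c (Suc j)) s i p" using c(3)[of j] by auto
    have k: "R.is_ker (arrow (c (Suc j)) p s) (arrow (c j) i (c (Suc j)))"
      and "R.is_cok (arrow (c j) i (c (Suc j))) (arrow (c (Suc j)) p s)"
      using s(2) is_kernel_ker is_cokernel_cok by (auto simp: short_exact_def)
    then have "R.epi (arrow (c (Suc j)) p s)" by (simp add: R.is_cok_def)
    then show ?case using R.comp_ext[OF _ k] Suc s(1) by (simp add: simple_object_iff)
  qed
  then show ?thesis using c(2) by blast
qed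

end

context monoidal_category begin

lemma arrow_moncat: "moncat (Ob C) (is_arrow C) src trg (arrow_cmp C) (arrow_idt C)
  (tensor_ob C) (arrow_ten C) (unit_ob C) (arrow_asc C) (\<lambda>a b c. arrow_inv C (arrow_asc C a b c))
  (arrow_lun C) (\<lambda>a. arrow_inv C (arrow_lun C a)) (arrow_run C) (\<lambda>a. arrow_inv C (arrow_run C a))"
proof (intro moncat.intro arrow_acat moncat_axioms.intro)
  show "unit_ob C \<in> Ob C" by (rule unit_ob_closed)
next
  fix a b assume o: "a \<in> Ob C" "b \<in> Ob C"
  show "a \<boxtimes> b \<in> Ob C" using o by (rule tensor_ob_closed)
  show "arrow_ten C (arrow_idt C a) (arrow_idt C b) = arrow_idt C (a \<boxtimes> b)"
    using o by (simp add: arrow_ten_def arrow_idt_def tensor_Id)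
  have "left_unitor C b \<in> Hom C (unit_ob C \<boxtimes> b) b" "right_unitor C a \<in> Hom C (a \<boxtimes> unit_ob C) a"
    "associator C a (unit_ob C) b \<in> Hom C ((a \<boxtimes> unit_ob C) \<boxtimes> b) (a \<boxtimes> (unit_ob C \<boxtimes> b))"
    using left_unitor_iso[OF o(2)] right_unitor_iso[OF o(1)] associator_iso[OF o(1) unit_ob_closed o(2)]
    by (auto simp: iso_arrow_def inverse_arrows_def)
  then show "arrow_cmp C (arrow_ten C (arrow_idt C a) (arrow_lun C b)) (arrow_asc C a (unit_ob C) b)
      = arrow_ten C (arrow_run C a) (arrow_idt C b)"
    using triangle[OF o] tensor_hom_closed[OF o(1) o(1) _ o(2) Id_in_Hom[OF o(1)], of "unit_ob C \<boxtimes> b" "left_unitor C b"]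
      o unit_ob_closed tensor_ob_closed
    by (simp add: arrow_ten_def arrow_idt_def arrow_lun_def arrow_run_def arrow_asc_def)
next
  fix F G assume "is_arrow C F" "is_arrow C G"
  then show "is_arrow C (arrow_ten C F G) \<and> src (arrow_ten C F G) = src F \<boxtimes> src G \<and>
      trg (arrow_ten C F G) = trg F \<boxtimes> trg G"
    by (auto elim!: is_arrowE simp: arrow_ten_def tensor_ob_closed tensor_hom_closed)
next
  fix G F G' F' assume a: "is_arrow C G" "is_arrow C F" "src G = trg F" "is_arrow C G'" "is_arrow C F'" "src G' = trg F'"
  obtain a f b where F: "F = arrow a f b" "a \<in> Ob C" "b \<in> Ob C" "f \<in> Hom C a b" using a(2) by (rule is_arrowE)
  obtain g c where G: "G = arrow b g c" "c \<in> Ob C" "g \<in> Hom C b c" using a F by (auto elim!: is_arrowE)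
  obtain a' f' b' where F': "F' = arrow a' f' b'" "a' \<in> Ob C" "b' \<in> Ob C" "f' \<in> Hom C a' b'" using a(5) by (rule is_arrowE)
  obtain g' c' where G': "G' = arrow b' g' c'" "c' \<in> Ob C" "g' \<in> Hom C b' c'" using a F' by (auto elim!: is_arrowE)
  have "f \<star> f' \<in> Hom C (a \<boxtimes> a') (b \<boxtimes> b')" "g \<star> g' \<in> Hom C (b \<boxtimes> b') (c \<boxtimes> c')"
    using F G F' G' by (auto intro: tensor_hom_closed)
  then show "arrow_ten C (arrow_cmp C G F) (arrow_cmp C G' F') = arrow_cmp C (arrow_ten C G G') (arrow_ten C F F')"
    using F G F' G' tensor_Comp[of a b c a' b' c' f g f' g'] by (simp add: arrow_ten_def tensor_ob_closed)
next
  fix a b c assume o: "a \<in> Ob C" "b \<in> Ob C" "c \<in> Ob C"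
  have "R.inv_pair (arrow_asc C a b c) (arrow_inv C (arrow_asc C a b c))"
    unfolding arrow_asc_def by (rule arrow_inv_pair[OF associator_iso[OF o]])
  then show "is_arrow C (arrow_asc C a b c) \<and> src (arrow_asc C a b c) = (a \<boxtimes> b) \<boxtimes> c \<and>
      trg (arrow_asc C a b c) = a \<boxtimes> (b \<boxtimes> c)"
    "is_arrow C (arrow_inv C (arrow_asc C a b c)) \<and> src (arrow_inv C (arrow_asc C a b c)) = a \<boxtimes> (b \<boxtimes> c) \<and>
      trg (arrow_inv C (arrow_asc C a b c)) = (a \<boxtimes> b) \<boxtimes> c"
    "arrow_cmp C (arrow_asc C a b c) (arrow_inv C (arrow_asc C a b c)) = arrow_idt C (a \<boxtimes> (b \<boxtimes> c))"
    "arrow_cmp C (arrow_inv C (arrow_asc C a b c)) (arrow_asc C a b c) = arrow_idt C ((a \<boxtimes> b) \<boxtimes> c)"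
    by (auto simp: R.inv_pair_def arrow_asc_def)
next
  fix a assume o: "a \<in> Ob C"
  have "R.inv_pair (arrow_lun C a) (arrow_inv C (arrow_lun C a))"
    unfolding arrow_lun_def by (rule arrow_inv_pair[OF left_unitor_iso[OF o]])
  then show "is_arrow C (arrow_lun C a) \<and> src (arrow_lun C a) = unit_ob C \<boxtimes> a \<and> trg (arrow_lun C a) = a"
    "is_arrow C (arrow_inv C (arrow_lun C a)) \<and> src (arrow_inv C (arrow_lun C a)) = a \<and>
      trg (arrow_inv C (arrow_lun C a)) = unit_ob C \<boxtimes> a"
    "arrow_cmp C (arrow_lun C a) (arrow_inv C (arrow_lun C a)) = arrow_idt C a"
    "arrow_cmp C (arrow_inv C (arrow_lun C a)) (arrow_lun C a) = arrow_idt C (unit_ob C \<boxtimes> a)"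
    by (auto simp: R.inv_pair_def arrow_lun_def)
  have "R.inv_pair (arrow_run C a) (arrow_inv C (arrow_run C a))"
    unfolding arrow_run_def by (rule arrow_inv_pair[OF right_unitor_iso[OF o]])
  then show "is_arrow C (arrow_run C a) \<and> src (arrow_run C a) = a \<boxtimes> unit_ob C \<and> trg (arrow_run C a) = a"
    "is_arrow C (arrow_inv C (arrow_run C a)) \<and> src (arrow_inv C (arrow_run C a)) = a \<and>
      trg (arrow_inv C (arrow_run C a)) = a \<boxtimes> unit_ob C"
    "arrow_cmp C (arrow_run C a) (arrow_inv C (arrow_run C a)) = arrow_idt C a"
    "arrow_cmp C (arrow_inv C (arrow_run C a)) (arrow_run C a) = arrow_idt C (a \<boxtimes> unit_ob C)"
    by (auto simp: R.inv_pair_def arrow_run_def)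
next
  fix F G H assume "is_arrow C F" "is_arrow C G" "is_arrow C H"
  then obtain a f a' b g b' c h c' where F: "F = arrow a f a'" "G = arrow b g b'" "H = arrow c h c'"
    and o: "a \<in> Ob C" "b \<in> Ob C" "c \<in> Ob C" "a' \<in> Ob C" "b' \<in> Ob C" "c' \<in> Ob C"
    and h: "f \<in> Hom C a a'" "g \<in> Hom C b b'" "h \<in> Hom C c c'"
    by (metis is_arrowE)
  have "associator C a b c \<in> Hom C ((a \<boxtimes> b) \<boxtimes> c) (a \<boxtimes> (b \<boxtimes> c))"
    "associator C a' b' c' \<in> Hom C ((a' \<boxtimes> b') \<boxtimes> c') (a' \<boxtimes> (b' \<boxtimes> c'))"
    using associator_iso o by (auto simp: iso_arrow_def inverse_arrows_def)
  moreover have "(f \<star> g) \<star> h \<in> Hom C ((a \<boxtimes> b) \<boxtimes> c) ((a' \<boxtimes> b') \<boxtimes> c')"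
    "f \<star> (g \<star> h) \<in> Hom C (a \<boxtimes> (b \<boxtimes> c)) (a' \<boxtimes> (b' \<boxtimes> c'))"
    using o h by (auto intro!: tensor_hom_closed tensor_ob_closed)
  ultimately show "arrow_cmp C (arrow_asc C (trg F) (trg G) (trg H)) (arrow_ten C (arrow_ten C F G) H)
      = arrow_cmp C (arrow_ten C F (arrow_ten C G H)) (arrow_asc C (src F) (src G) (src H))"
    using F o associator_natural[OF o h] by (simp add: arrow_asc_def arrow_ten_def tensor_ob_closed)
next
  fix F assume "is_arrow C F"
  then obtain a f b where F: "F = arrow a f b" "a \<in> Ob C" "b \<in> Ob C" "f \<in> Hom C a b" by (rule is_arrowE)
  have u: "left_unitor C a \<in> Hom C (unit_ob C \<boxtimes> a) a" "right_unitor C a \<in> Hom C (a \<boxtimes> unit_ob C) a"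
    "left_unitor C b \<in> Hom C (unit_ob C \<boxtimes> b) b" "right_unitor C b \<in> Hom C (b \<boxtimes> unit_ob C) b"
    using left_unitor_iso right_unitor_iso F by (auto simp: iso_arrow_def inverse_arrows_def)
  have t: "Ident C (unit_ob C) \<star> f \<in> Hom C (unit_ob C \<boxtimes> a) (unit_ob C \<boxtimes> b)"
    "f \<star> Ident C (unit_ob C) \<in> Hom C (a \<boxtimes> unit_ob C) (b \<boxtimes> unit_ob C)"
    using F by (auto intro!: tensor_hom_closed unit_ob_closed Id_in_Hom)
  show "arrow_cmp C (arrow_lun C (trg F)) (arrow_ten C (arrow_idt C (unit_ob C)) F) = arrow_cmp C F (arrow_lun C (src F))"
    "arrow_cmp C (arrow_run C (trg F)) (arrow_ten C F (arrow_idt C (unit_ob C))) = arrow_cmp C F (arrow_run C (src F))"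
    using u t F left_unitor_natural[OF F(2-4)] right_unitor_natural[OF F(2-4)]
    by (simp_all add: arrow_lun_def arrow_run_def arrow_ten_def arrow_idt_def tensor_ob_closed unit_ob_closed)
next
  fix a b c d assume o: "a \<in> Ob C" "b \<in> Ob C" "c \<in> Ob C" "d \<in> Ob C"
  have asc: "associator C x y z \<in> Hom C ((x \<boxtimes> y) \<boxtimes> z) (x \<boxtimes> (y \<boxtimes> z))"
    if "x \<in> Ob C" "y \<in> Ob C" "z \<in> Ob C" for x y z
    using associator_iso[OF that] by (auto simp: iso_arrow_def inverse_arrows_def)
  have t: "Ident C a \<star> associator C b c d \<in> Hom C (a \<boxtimes> ((b \<boxtimes> c) \<boxtimes> d)) (a \<boxtimes> (b \<boxtimes> (c \<boxtimes> d)))"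
    "associator C a b c \<star> Ident C d \<in> Hom C (((a \<boxtimes> b) \<boxtimes> c) \<boxtimes> d) ((a \<boxtimes> (b \<boxtimes> c)) \<boxtimes> d)"
    using o by (auto intro!: tensor_hom_closed tensor_ob_closed asc Id_in_Hom)
  have "associator C a (b \<boxtimes> c) d \<cdot> (associator C a b c \<star> Ident C d)
      \<in> Hom C (((a \<boxtimes> b) \<boxtimes> c) \<boxtimes> d) (a \<boxtimes> ((b \<boxtimes> c) \<boxtimes> d))"
    by (rule Comp_in_Hom[OF _ _ _ t(2) asc]) (use o tensor_ob_closed in auto)
  then show "arrow_cmp C (arrow_asc C a b (c \<boxtimes> d)) (arrow_asc C (a \<boxtimes> b) c d)
      = arrow_cmp C (arrow_ten C (arrow_idt C a) (arrow_asc C b c d))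
          (arrow_cmp C (arrow_asc C a (b \<boxtimes> c) d) (arrow_ten C (arrow_asc C a b c) (arrow_idt C d)))"
    using pentagon[OF o] o t asc by (simp add: arrow_asc_def arrow_ten_def arrow_idt_def tensor_ob_closed)
qed

sublocale R: moncat "Ob C" "is_arrow C" src trg "arrow_cmp C" "arrow_idt C" "tensor_ob C" "arrow_ten C" "unit_ob C"
  "arrow_asc C" "\<lambda>a b c. arrow_inv C (arrow_asc C a b c)" "arrow_lun C" "\<lambda>a. arrow_inv C (arrow_lun C a)"
  "arrow_run C" "\<lambda>a. arrow_inv C (arrow_run C a)"
  by (rule arrow_moncat)

end

context tensor_category begin

lemma left_dual_dual:
  assumes "is_left_dual C d a"
  shows "\<exists>ev co. R.dual d a ev co"
proof -
  obtain ev co where o: "d \<in> Ob C" "a \<in> Ob C" and h: "ev \<in> Hom C (d \<boxtimes> a) (unit_ob C)" "co \<in> Hom C (unit_ob C) (a \<boxtimes> d)"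
    and z1: "right_unitor C a \<cdot> (Ident C a \<star> ev) \<cdot> associator C a d a \<cdot> (co \<star> Ident C a) = left_unitor C a"
    and z2: "left_unitor C d \<cdot> (ev \<star> Ident C d) \<cdot> inv_arrow C ((d \<boxtimes> a) \<boxtimes> d) (d \<boxtimes> (a \<boxtimes> d)) (associator C d a d)
      \<cdot> (Ident C d \<star> co) = right_unitor C d"
    using assms unfolding is_left_dual_def by blast
  let ?e = "arrow (d \<boxtimes> a) ev (unit_ob C)" and ?c = "arrow (unit_ob C) co (a \<boxtimes> d)"
  have m: "mor (arrow_cmp C G F) = mor G \<cdot> mor F" if "is_arrow C (arrow_cmp C G F)" for F G
    using that by (auto simp: arrow_cmp_def)
  have t: "is_arrow C ?e" "is_arrow C ?c" using o h by (simp_all add: tensor_ob_closed unit_ob_closed)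
  let ?l1 = "arrow_cmp C (arrow_run C a) (arrow_cmp C (arrow_ten C (arrow_idt C a) ?e)
      (arrow_cmp C (arrow_asc C a d a) (arrow_ten C ?c (arrow_idt C a))))"
  let ?l2 = "arrow_cmp C (arrow_lun C d) (arrow_cmp C (arrow_ten C ?e (arrow_idt C d))
      (arrow_cmp C (arrow_inv C (arrow_asc C d a d)) (arrow_ten C (arrow_idt C d) ?c)))"
  have l: "is_arrow C ?l1" "src ?l1 = unit_ob C \<boxtimes> a" "trg ?l1 = a" "is_arrow C ?l2" "src ?l2 = d \<boxtimes> unit_ob C" "trg ?l2 = d"
    using t o by simp_all
  have "mor ?l1 = left_unitor C a"
    using z1 l(1) by (simp only: m R.arr_cmp) (simp add: arrow_run_def arrow_ten_def arrow_asc_def arrow_idt_def)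
  then have 1: "?l1 = arrow_lun C a" using is_arrowD(4)[OF l(1)] l(2,3) by (simp add: arrow_lun_def)
  have "mor ?l2 = right_unitor C d"
    using z2 l(4) by (simp only: m R.arr_cmp) (simp add: arrow_lun_def arrow_ten_def arrow_asc_def arrow_idt_def arrow_inv_def)
  then have 2: "?l2 = arrow_run C d" using is_arrowD(4)[OF l(4)] l(5,6) by (simp add: arrow_run_def)
  have "R.dual d a ?e ?c" unfolding R.dual_def using t o 1 2 by simp
  then show ?thesis by blast
qed

lemma arrow_rigid: "rigid (Ob C) (is_arrow C) src trg (arrow_cmp C) (arrow_idt C)
  (arrow_add C) (arrow_neg C) (arrow_zer C)
  (tensor_ob C) (arrow_ten C) (unit_ob C) (arrow_asc C) (\<lambda>a b c. arrow_inv C (arrow_asc C a b c))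
  (arrow_lun C) (\<lambda>a. arrow_inv C (arrow_lun C a)) (arrow_run C) (\<lambda>a. arrow_inv C (arrow_run C a))"
proof (intro rigid.intro arrow_abel arrow_moncat rigid_axioms.intro)
  show "\<exists>f. R.is_cok f F" if "R.epi F" for F using that by (rule epi_is_cok)
next
  fix F F' G assume a: "is_arrow C F" "is_arrow C F'" "src F = src F'" "trg F = trg F'" "is_arrow C G"
  note f = is_arrowD[OF a(1)] is_arrowD[OF a(2)] is_arrowD[OF a(5)]
  show "arrow_ten C (arrow_add C F F') G = arrow_add C (arrow_ten C F G) (arrow_ten C F' G)"
    using a f tensor_add_left[of "src F'" "trg F'" "src G" "trg G" "mor F" "mor F'" "mor G"]
    by (simp add: arrow_ten_def arrow_add_def)
  show "arrow_ten C G (arrow_add C F F') = arrow_add C (arrow_ten C G F) (arrow_ten C G F')"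
    using a f tensor_add_right[of "src G" "trg G" "src F'" "trg F'" "mor G" "mor F" "mor F'"]
    by (simp add: arrow_ten_def arrow_add_def)
next
  fix a assume "a \<in> Ob C"
  then show "\<exists>d ev co. R.dual d a ev co" "\<exists>d ev co. R.dual a d ev co"
    using ex_left_dual ex_right_dual left_dual_dual by blast+
qed

sublocale R: rigid "Ob C" "is_arrow C" src trg "arrow_cmp C" "arrow_idt C" "arrow_add C" "arrow_neg C" "arrow_zer C"
  "tensor_ob C" "arrow_ten C" "unit_ob C"
  "arrow_asc C" "\<lambda>a b c. arrow_inv C (arrow_asc C a b c)" "arrow_lun C" "\<lambda>a. arrow_inv C (arrow_lun C a)"
  "arrow_run C" "\<lambda>a. arrow_inv C (arrow_run C a)"
  by (rule arrow_rigid)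

end

section \<open>A cover of the unit that is projective relative to a subcategory\<close>

context fin_rigid begin

text \<open>Among the quotients of a projective cover of \<open>1\<close> lying in \<open>S\<close>, one of maximal size is
  projective relative to \<open>S\<close>: a map into \<open>S\<close> that does not factor through it would give a
  larger quotient inside a direct sum.\<close>

lemma sub_cover_unit:
  assumes S: "S \<subseteq> Obj" "unt \<in> S"
    and sums: "\<And>i p j q. biprod i p j q \<Longrightarrow> dm i \<in> S \<Longrightarrow> dm j \<in> S \<Longrightarrow> cd i \<in> S"
    and subs: "\<And>m. mono m \<Longrightarrow> cd m \<in> S \<Longrightarrow> dm m \<in> S"
  shows "\<exists>t. epi t \<and> cd t = unt \<and> dm t \<in> S \<and>
    (\<forall>e f. epi e \<and> dm e \<in> S \<and> arr f \<and> dm f = dm t \<and> cd f = cd e \<longrightarrow> (\<exists>g. e \<bullet> g = f))"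
proof -
  obtain p0 where p0: "epi p0" "cd p0 = unt" "proj (dm p0)" using enough_proj[OF unt_Obj] by blast
  define good where "good p \<longleftrightarrow> epi p \<and> dm p = dm p0 \<and> cd p \<in> S" for p
  have g0: "good p0" using p0 S by (simp add: good_def)
  \<comment> \<open>Quotients of the fixed object \<open>dm p0\<close> have bounded size, so a
    quotient of maximal size exists.\<close>
  have b: "\<forall>p. good p \<longrightarrow> sz (cd p) < Suc (sz (dm p0))"
    using sz_epi unfolding good_def less_Suc_eq_le by metis
  obtain p where p: "good p" and max: "\<And>p'. good p' \<Longrightarrow> sz (cd p') \<le> sz (cd p)"
    using ex_has_greatest_nat[where f = "\<lambda>p. sz (cd p)", OF g0 b] by blast
  have pa: "epi p" "arr p" "dm p = dm p0" "cd p \<in> S" "cd p \<in> Obj" using p S by (auto simp: good_def)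
  have factor: "\<exists>g. g \<bullet> p = f" if f: "arr f" "dm f = dm p0" "cd f \<in> S" for f
  proof -
    obtain i q j r where B: "biprod i q j r" "dm i = cd p" "dm j = cd f"
      using ex_biprod[of "cd p" "cd f"] pa f by auto
    note B' = B(1)[unfolded biprod_def]
    \<comment> \<open>The image of the pair (p, f) lies in \<open>S\<close>, being a subobject of a
      sum, and is a quotient of \<open>dm p0\<close> mapping onto \<open>cd p\<close>. Maximality
      makes that last map invertible, so \<open>f\<close> can be read off from
      \<open>p\<close>.\<close>
    define h where "h = (i \<bullet> p) +++ (j \<bullet> f)"
    have h: "arr h" "dm h = dm p0" "cd h = cd i" using B' B pa f by (auto simp: h_def)
    have qh: "q \<bullet> h = p" "r \<bullet> h = f"
    proof -
      have "q \<bullet> i \<bullet> p = p" "r \<bullet> j \<bullet> f = f" "q \<bullet> j \<bullet> f = zer (dm p0) (cd p)" "r \<bullet> i \<bullet> p = zer (dm p0) (cd f)"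
        using B' B pa f cmp_reassoc[of q i _ p] cmp_reassoc[of r j _ f] cmp_reassoc[of q j _ f] cmp_reassoc[of r i _ p]
        by simp_all
      then show "q \<bullet> h = p" "r \<bullet> h = f" using B' B pa f by (simp_all add: h_def cmp_add)
    qed
    obtain m e where me: "mono m" "epi e" "m \<bullet> e = h" using image[OF h(1)] by blast
    have ma: "arr m" "arr e" "dm m = cd e" "dm e = dm p0" "cd m = cd i" using cmp_arrD[OF me(3) h(1)] h by auto
    have "cd e \<in> S" using subs[OF me(1)] sums[OF B(1)] B pa f ma by simp
    then have le: "sz (cd e) \<le> sz (cd p)" using max[of e] me ma by (simp add: good_def)
    have qme: "(q \<bullet> m) \<bullet> e = p" using qh me by simp
    have qm: "epi (q \<bullet> m)" by (rule epi_cmpD[of _ e]) (use qme pa in simp)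
    have qma: "dm (q \<bullet> m) = cd e" "cd (q \<bullet> m) = cd p" using B' B ma by auto
    then have "iso (q \<bullet> m)" using epi_size_iso[OF qm] le by simp
    then obtain w where w: "inv_pair (q \<bullet> m) w" unfolding iso_def ..
    have "w \<bullet> p = e" unfolding qme[symmetric] using w ma qma
      by (simp add: inv_pair_def cmp_reassoc[of w "q \<bullet> m" _ e, simplified])
    then have "(r \<bullet> m \<bullet> w) \<bullet> p = f" using qh(2) me by simp
    then show ?thesis by blast
  qed
  \<comment> \<open>The unit lies in \<open>S\<close>, so the original cover itself factors through
    \<open>p\<close>; the factor is the required cover.\<close>
  obtain t where t: "t \<bullet> p = p0" using factor[of p0] p0 S by auto
  have ta: "arr t" "dm t = cd p" "cd t = unt" using cmp_arrD[OF t] p0 by auto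
  have "epi t" using t p0 epi_cmpD by metis
  moreover have "\<exists>g. e \<bullet> g = f" if ef: "epi e" "dm e \<in> S" "arr f" "dm f = cd p" "cd f = cd e" for e f
  proof -
    \<comment> \<open>The lift exists on the projective \<open>dm p0\<close>; its target lies in
      \<open>S\<close>, so it descends along \<open>p\<close>, and cancelling the epic
      \<open>p\<close> shows that it still lifts \<open>f\<close>.\<close>
    have "\<exists>g. e \<bullet> g = f \<bullet> p" by (rule proj_lift[OF p0(3) ef(1)]) (use ef pa in auto)
    then obtain g where g: "e \<bullet> g = f \<bullet> p" ..
    have ga: "arr g" "dm g = dm p0" "cd g = dm e" using cmp_arrD(1-4)[OF g] ef pa by auto
    then obtain g' where g': "g' \<bullet> p = g" using factor[of g] ef by auto
    have g'a: "arr g'" "dm g' = cd p" "cd g' = dm e" using cmp_arrD[OF g'] ga by auto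
    have "(e \<bullet> g') \<bullet> p = f \<bullet> p" using g g' by simp
    then have "e \<bullet> g' = f" by (rule epiD[OF pa(1), rotated 4]) (use g'a ef in auto)
    then show ?thesis ..
  qed
  ultimately show ?thesis using ta pa by (intro exI[of _ t]) auto
qed

end

section \<open>Dimensions of Hom spaces\<close>

text \<open>The dimension is the least cardinality of a generating set, and the empty set spans only
  zero.\<close>

lemma (in vectorspace) dim_pos:
  assumes "fin_dim" "v \<in> carrier V" "v \<noteq> \<zero>\<^bsub>V\<^esub>"
  shows "0 < dim"
proof (rule ccontr)
  assume "\<not> 0 < dim"
  then have d: "dim = 0" by simp
  have "\<exists>n B. finite B \<and> card B = n \<and> B \<subseteq> carrier V \<and> gen_set B"
    using assms(1) unfolding fin_dim_def by blast
  from LeastI_ex[OF this] obtain B where "finite B" "card B = 0" "gen_set B"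
    using d unfolding dim_def by auto
  then have "carrier V = {\<zero>\<^bsub>V\<^esub>}" using span_empty by simp
  then show False using assms by simp
qed

context tensor_category begin

lemma hom_vectorspace: "\<lbrakk>a \<in> Ob C; b \<in> Ob C\<rbrakk> \<Longrightarrow> vectorspace K (hom_space C a b)"
  by (intro vectorspace.intro module_hom_space field_axioms)

lemma hom_fin_dim:
  assumes "a \<in> Ob C" "b \<in> Ob C" shows "vectorspace.fin_dim K (hom_space C a b)"
proof -
  interpret V: vectorspace K "hom_space C a b" using assms by (rule hom_vectorspace)
  obtain B where B: "finite B" "B \<subseteq> carrier (hom_space C a b)"
    "\<forall>v\<in>carrier (hom_space C a b). \<exists>c\<in>B \<rightarrow> carrier K. v = (\<Oplus>\<^bsub>hom_space C a b\<^esub>b'\<in>B. c b' \<odot>\<^bsub>hom_space C a b\<^esub> b')"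
    using hom_finite_dimensional[OF assms] unfolding finite_dimensional_module_def by blast
  have "V.span B = carrier (hom_space C a b)"
  proof
    show "V.span B \<subseteq> carrier (hom_space C a b)" using V.span_is_subset2[OF B(2)] .
    show "carrier (hom_space C a b) \<subseteq> V.span B"
      using B unfolding V.span_def V.lincomb_def by blast
  qed
  then show ?thesis using B unfolding V.fin_dim_def by blast
qed

lemma postcomp_linear:
  assumes o: "g \<in> Ob C" "a \<in> Ob C" "b \<in> Ob C" and f: "f \<in> Hom C a b"
  shows "linear_map K (hom_space C g a) (hom_space C g b) (\<lambda>h. f \<cdot> h)"
proof (intro linear_map.intro mod_hom.intro hom_vectorspace module_hom_space o mod_hom_axioms.intro)
  show "(\<lambda>h. f \<cdot> h) \<in> module_hom K (hom_space C g a) (hom_space C g b)"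
    unfolding module_hom_def using o f Comp_in_Hom Comp_add_right Comp_smult_right
    by (auto simp: carrier_hom_space)
qed

definition hom_dim :: "'o \<Rightarrow> 'o \<Rightarrow> nat" where
  "hom_dim g x = vectorspace.dim K (hom_space C g x)"

text \<open>For projective \<open>g\<close> the functor Hom(g, -) is exact, so rank-nullity for the
  two induced linear maps gives additivity.\<close>

lemma hom_dim_ses:
  assumes g: "R.proj g" and k: "R.is_ker P I" and e: "R.epi P"
  shows "hom_dim g (src P) = hom_dim g (src I) + hom_dim g (trg P)"
proof -
  have gO: "g \<in> Ob C" using g by (rule R.proj_Obj)
  have Pa: "is_arrow C P" and Ia: "R.mono I" "is_arrow C I" "trg I = src P" using k by (auto simp: R.is_ker_def)
  obtain b p c where P: "P = arrow b p c" "b \<in> Ob C" "c \<in> Ob C" "p \<in> Hom C b c" using Pa by (rule is_arrowE)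
  obtain a i where I: "I = arrow a i b" "a \<in> Ob C" "i \<in> Hom C a b"
    using is_arrowD[OF Ia(2)] Ia(3) P by (metis arrow_sel(1))
  let ?A = "hom_space C g a" and ?B = "hom_space C g b" and ?C = "hom_space C g c"
  have car: "carrier ?A = Hom C g a" "carrier ?B = Hom C g b" "carrier ?C = Hom C g c"
    using gO P I by (simp_all add: carrier_hom_space)
  interpret i: linear_map K ?A ?B "\<lambda>h. i \<cdot> h" using gO I P by (intro postcomp_linear)
  interpret p: linear_map K ?B ?C "\<lambda>h. p \<cdot> h" using gO P by (intro postcomp_linear)
  have inj: "inj_on (\<lambda>h. i \<cdot> h) (carrier ?A)"
  proof (rule inj_onI)
    have m: "monic C a b i" using Ia(1) I(1) by (simp add: monic_iff)
    fix h h' assume "h \<in> carrier ?A" "h' \<in> carrier ?A" "i \<cdot> h = i \<cdot> h'"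
    then show "h = h'" using m gO unfolding car monic_def by blast
  qed
  have surj: "(\<lambda>h. p \<cdot> h) ` carrier ?B = carrier ?C"
  proof
    show "(\<lambda>h. p \<cdot> h) ` carrier ?B \<subseteq> carrier ?C" using p.f_im by blast
    show "carrier ?C \<subseteq> (\<lambda>h. p \<cdot> h) ` carrier ?B"
    proof
      fix h assume "h \<in> carrier ?C"
      moreover have "projective C g" "epic C b c p" using g e P by (simp_all add: projective_iff epic_iff)
      ultimately obtain h' where "h' \<in> Hom C g b" "p \<cdot> h' = h" unfolding projective_def car by blast
      then show "h \<in> (\<lambda>h. p \<cdot> h) ` carrier ?B" unfolding car by blast
    qed
  qed
  have "i.im = p.ker"
  proof
    show "i.im \<subseteq> p.ker"
    proof
      fix h assume "h \<in> i.im"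
      then obtain h' where h': "h' \<in> Hom C g a" "h = i \<cdot> h'" unfolding i.im_def car by blast
      have "arrow_cmp C P I = arrow_zer C a c" using k P I by (simp add: R.is_ker_def)
      then have "arrow_cmp C P (arrow_cmp C I (arrow g h' a)) = arrow_cmp C (arrow_zer C a c) (arrow g h' a)"
        by (rule R.cmp_reassoc)
      also have "\<dots> = arrow_zer C g c" using h' gO I P by simp
      finally have "p \<cdot> h = zero_arrow C g c"
        using h' gO I P Comp_in_Hom[of g a b h' i] by (simp add: arrow_zer_def)
      then show "h \<in> p.ker" using h' gO I P Comp_in_Hom[of g a b h' i] unfolding p.ker_def car by simp
    qed
    show "p.ker \<subseteq> i.im"
    proof
      fix h assume "h \<in> p.ker"
      then have h: "h \<in> Hom C g b" "p \<cdot> h = zero_arrow C g c" unfolding p.ker_def car by auto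
      then have "\<exists>H. arrow_cmp C I H = arrow g h b"
        using k P gO unfolding R.is_ker_def by (simp add: arrow_zer_def)
      then obtain H where H: "arrow_cmp C I H = arrow g h b" ..
      then have "is_arrow C H" "src H = g" "trg H = a"
        using R.cmp_arrD[OF H] h gO P I by auto
      then obtain h' where "H = arrow g h' a" "h' \<in> Hom C g a" by (metis is_arrowD(3,4))
      then show "h \<in> i.im" using H I P gO unfolding i.im_def car by auto
    qed
  qed
  moreover have "p.im = carrier ?C" unfolding p.im_def using surj .
  moreover have "vectorspace.dim K (?A\<lparr>carrier := i.ker\<rparr>) = 0" using i.inj_imp_dim_ker0[OF inj] .
  ultimately show ?thesis
    using i.rank_nullity[OF hom_fin_dim] p.rank_nullity[OF hom_fin_dim] gO I P
    by (simp add: hom_dim_def)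
qed

lemma hom_dim_pos:
  assumes "is_arrow C F" "F \<noteq> arrow_zer C (src F) (trg F)"
  shows "0 < hom_dim (src F) (trg F)"
proof -
  obtain a f b where F: "F = arrow a f b" "a \<in> Ob C" "b \<in> Ob C" "f \<in> Hom C a b" using assms(1) by (rule is_arrowE)
  interpret V: vectorspace K "hom_space C a b" using F by (intro hom_vectorspace)
  show ?thesis
    using V.dim_pos[OF hom_fin_dim, of f] F assms(2) by (simp add: hom_dim_def carrier_hom_space arrow_zer_def)
qed

text \<open>If the identity of the unit were zero, the scalars 1 and 0 would give the same
  endomorphism, against injectivity in \<open>End_unit\<close>.\<close>

lemma unit_not_null: "\<not> R.null (unit_ob C)"
proof
  let ?u = "unit_ob C" and ?V = "hom_space C (unit_ob C) (unit_ob C)"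
  assume n: "R.null ?u"
  interpret V: vectorspace K ?V using unit_ob_closed by (intro hom_vectorspace)
  have "arrow_idt C ?u = arrow_zer C ?u ?u" using n by (simp add: R.null_def)
  then have "Ident C ?u = \<zero>\<^bsub>?V\<^esub>" by (simp add: arrow_idt_def arrow_zer_def)
  then have "\<one>\<^bsub>K\<^esub> \<odot>\<^bsub>?V\<^esub> Ident C ?u = \<zero>\<^bsub>K\<^esub> \<odot>\<^bsub>?V\<^esub> Ident C ?u" by simp
  then have "\<one>\<^bsub>K\<^esub> = \<zero>\<^bsub>K\<^esub>" using End_unit one_closed zero_closed unfolding bij_betw_def inj_on_def by blast
  then show False by simp
qed

text \<open>An endomorphism of the unit is a scalar multiple of the identity; a nonzero scalar is
  inverted in the field \<open>K\<close>.\<close>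

lemma End_unit_iso:
  assumes F: "is_arrow C F" "src F = unit_ob C" "trg F = unit_ob C"
  shows "F = arrow_zer C (unit_ob C) (unit_ob C) \<or> R.iso F"
proof -
  let ?u = "unit_ob C" and ?V = "hom_space C (unit_ob C) (unit_ob C)"
  interpret V: vectorspace K ?V using unit_ob_closed by (intro hom_vectorspace)
  have car: "carrier ?V = Hom C ?u ?u" using unit_ob_closed by (simp add: carrier_hom_space)
  have I: "Ident C ?u \<in> Hom C ?u ?u" using Id_in_Hom[OF unit_ob_closed] .
  have "mor F \<in> Hom C ?u ?u" using is_arrowD(3)[OF F(1)] F by simp
  then obtain r where r: "r \<in> carrier K" "mor F = r \<odot>\<^bsub>?V\<^esub> Ident C ?u"
    using End_unit unfolding bij_betw_def by blast
  have Fe: "F = arrow ?u (r \<odot>\<^bsub>?V\<^esub> Ident C ?u) ?u" using is_arrowD(4)[OF F(1)] F r by simp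
  have cl: "s \<odot>\<^bsub>?V\<^esub> Ident C ?u \<in> Hom C ?u ?u" if "s \<in> carrier K" for s
    using V.smult_closed[OF that, of "Ident C ?u"] I car by simp
  have mult: "(s \<odot>\<^bsub>?V\<^esub> Ident C ?u) \<cdot> (t \<odot>\<^bsub>?V\<^esub> Ident C ?u) = (s \<otimes>\<^bsub>K\<^esub> t) \<odot>\<^bsub>?V\<^esub> Ident C ?u"
    if "s \<in> carrier K" "t \<in> carrier K" for s t
    using that Comp_smult_left[OF unit_ob_closed unit_ob_closed unit_ob_closed cl[OF that(2)] I that(1)]
      Comp_Id_left[OF unit_ob_closed unit_ob_closed cl[OF that(2)]] V.smult_assoc1[OF that, of "Ident C ?u"] I car
    by simp
  show ?thesis
  proof (cases "r = \<zero>\<^bsub>K\<^esub>")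
    case True
    then show ?thesis using Fe I car by (simp add: arrow_zer_def)
  next
    case False
    then have u: "r \<in> Units K" using r field_Units by blast
    then have s: "inv\<^bsub>K\<^esub> r \<in> carrier K" by simp
    have "R.inv_pair F (arrow ?u (inv\<^bsub>K\<^esub> r \<odot>\<^bsub>?V\<^esub> Ident C ?u) ?u)"
      using Fe cl[OF s] cl[OF r(1)] unit_ob_closed mult[OF s r(1)] mult[OF r(1) s] u I car
      by (simp add: R.inv_pair_def arrow_idt_def)
    then show ?thesis using R.inv_pair_iso by blast
  qed
qed

end

section \<open>The size function of a finite tensor category\<close>

context finite_tensor_category begin

lemma enough_proj: "a \<in> Ob C \<Longrightarrow> \<exists>E. R.epi E \<and> trg E = a \<and> R.proj (src E)"
  using projectives_enough unfolding enough_projectives_def by (metis projective_iff epic_iff arrow_sel(1,3))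

lemma finite_simple_set:
  "\<exists>T. finite T \<and> (\<forall>t\<in>T. R.simple t) \<and> (\<forall>s. R.simple s \<longrightarrow> (\<exists>F. R.iso F \<and> src F = s \<and> trg F \<in> T))"
proof -
  obtain T where T: "finite T" "\<And>a. simple_object C a \<Longrightarrow> \<exists>b\<in>T. isomorphic C a b"
    using simples_finite unfolding finitely_many_simples_def by blast
  have "\<exists>F. R.iso F \<and> src F = s \<and> trg F \<in> {t\<in>T. R.simple t}" if s: "R.simple s" for s
  proof -
    obtain b f where b: "b \<in> T" "iso_arrow C s b f" using T(2) s unfolding simple_object_iff isomorphic_def by blast
    then have i: "R.iso (arrow s f b)" by (simp add: iso_arrow_iff)
    then have "R.simple b" using R.simple_iso[OF i] s by simp
    then show ?thesis using i b by (intro exI[of _ "arrow s f b"]) simp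
  qed
  then show ?thesis using T(1) by (intro exI[of _ "{t\<in>T. R.simple t}"]) auto
qed

text \<open>The size of an object is the dimension of Hom out of a projective cover of one object
  \<open>v\<close> that contains a representative of each simple object as a retract.\<close>

lemma arrow_fin_rigid:
  "\<exists>sz. fin_rigid (Ob C) (is_arrow C) src trg (arrow_cmp C) (arrow_idt C)
    (arrow_add C) (arrow_neg C) (arrow_zer C)
    (tensor_ob C) (arrow_ten C) (unit_ob C) (arrow_asc C) (\<lambda>a b c. arrow_inv C (arrow_asc C a b c))
    (arrow_lun C) (\<lambda>a. arrow_inv C (arrow_lun C a)) (arrow_run C) (\<lambda>a. arrow_inv C (arrow_run C a)) sz"
proof -
  obtain T where T: "finite T" "\<And>t. t \<in> T \<Longrightarrow> R.simple t"
    "\<And>s. R.simple s \<Longrightarrow> \<exists>F. R.iso F \<and> src F = s \<and> trg F \<in> T" using finite_simple_set by blast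
  have "T \<subseteq> Ob C" using T(2) by (auto simp: R.simple_def)
  then obtain v where v: "v \<in> Ob C" "\<And>t. t \<in> T \<Longrightarrow> R.retract t v" using R.finite_common_retract[OF T(1)] by blast
  obtain E where E: "R.epi E" "trg E = v" "R.proj (src E)" using enough_proj[OF v(1)] by blast
  let ?g = "src E"
  \<comment> \<open>A non-null object maps onto some representative in \<open>T\<close>, and so does
    \<open>?g\<close> through \<open>v\<close>. Projectivity of \<open>?g\<close> lifts the latter
    map to the object, and the lift is nonzero because its image in the simple object is.\<close>
  have pos: "0 < hom_dim ?g a" if a: "a \<in> Ob C" "\<not> R.null a" for a
  proof -
    obtain n where "R.comp_series n a" using finite_length_comp_series objects_finite_length a by blast
    then obtain P where P: "R.epi P" "src P = a" "R.simple (trg P)" using R.simple_quotient a by blast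
    obtain F where F: "R.iso F" "src F = trg P" "trg F \<in> T" using T(3)[OF P(3)] by blast
    obtain i p where ip: "is_arrow C i" "is_arrow C p" "src p = v" "trg p = trg F" "arrow_cmp C p i = arrow_idt C (trg F)"
      using v(2)[OF F(3)] by (rule R.retractE)
    have FP: "R.epi (arrow_cmp C F P)" using R.epi_cmp[OF P(1) R.iso_epi[OF F(1)]] F by simp
    have tF: "trg F \<in> Ob C" "\<not> R.null (trg F)" using T(2)[OF F(3)] by (auto simp: R.simple_def)
    have pE: "R.epi (arrow_cmp C p E)" using R.epi_cmp[OF E(1) R.split_epi[OF ip(5) tF(1)]] E ip by simp
    have Fa: "is_arrow C F" "is_arrow C P" using R.iso_epi[OF F(1)] P(1) by auto
    obtain H where H: "arrow_cmp C (arrow_cmp C F P) H = arrow_cmp C p E"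
      using R.proj_lift[OF E(3) FP, of "arrow_cmp C p E"] Fa F P E ip by auto
    have Ha: "is_arrow C H" "src H = ?g" "trg H = a"
      using R.cmp_arrD(1-4)[OF H] Fa F P E ip by auto
    have "H \<noteq> arrow_zer C (src H) (trg H)"
    proof
      assume "H = arrow_zer C (src H) (trg H)"
      then have "arrow_cmp C p E = arrow_cmp C (arrow_cmp C F P) (arrow_zer C ?g a)" using H Ha by simp
      also have "\<dots> = arrow_zer C ?g (trg F)" using Fa F P E by (simp add: R.epi_arr)
      finally have "arrow_cmp C p E = arrow_zer C ?g (trg F)" .
      then have "R.null (trg F)" using R.zer_epi_null[OF pE] tF(1) R.proj_Obj[OF E(3)] by simp
      then show False using tF(2) by simp
    qed
    then show ?thesis using hom_dim_pos[OF Ha(1)] Ha by simp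
  qed
  have "fin_rigid (Ob C) (is_arrow C) src trg (arrow_cmp C) (arrow_idt C)
    (arrow_add C) (arrow_neg C) (arrow_zer C)
    (tensor_ob C) (arrow_ten C) (unit_ob C) (arrow_asc C) (\<lambda>a b c. arrow_inv C (arrow_asc C a b c))
    (arrow_lun C) (\<lambda>a. arrow_inv C (arrow_lun C a)) (arrow_run C) (\<lambda>a. arrow_inv C (arrow_run C a)) (hom_dim ?g)"
  proof (intro fin_rigid.intro arrow_rigid fin_rigid_axioms.intro)
    show "\<exists>n. R.comp_series n a" if "a \<in> Ob C" for a
      using finite_length_comp_series objects_finite_length that by blast
    show "\<exists>e. R.epi e \<and> trg e = a \<and> R.proj (src e)" if "a \<in> Ob C" for a using that by (rule enough_proj)
    show "hom_dim ?g (src P) = hom_dim ?g (src I) + hom_dim ?g (trg P)" if "R.is_ker P I" "R.epi P" for P I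
      using hom_dim_ses[OF E(3) that] .
    show "F = arrow_zer C (unit_ob C) (unit_ob C) \<or> R.iso F"
      if "is_arrow C F" "src F = unit_ob C" "trg F = unit_ob C" for F
      using End_unit_iso[OF that] .
    show "0 < hom_dim ?g a" if "a \<in> Ob C" "\<not> R.null a" for a using that by (rule pos)
    show "\<not> R.null (unit_ob C)" by (rule unit_not_null)
    show "\<exists>T. finite T \<and> (\<forall>t\<in>T. R.simple t) \<and> (\<forall>s. R.simple s \<longrightarrow> (\<exists>F. R.iso F \<and> src F = s \<and> trg F \<in> T))"
      by (rule finite_simple_set)
  qed
  then show ?thesis by (rule exI[of _ "hom_dim ?g"])
qed

end

section \<open>Algebras and modules in a tensor category\<close>

lemma arrow_eqI: "\<lbrakk>is_arrow C F; is_arrow C G; src F = src G; trg F = trg G; mor F = mor G\<rbrakk> \<Longrightarrow> F = G"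
  using is_arrowD(4)[of C F] is_arrowD(4)[of C G] by simp

lemma mor_cmp: "is_arrow C (arrow_cmp C G F) \<Longrightarrow> mor (arrow_cmp C G F) = mor G \<cdot>\<^bsub>C\<^esub> mor F"
  by (auto simp: arrow_cmp_def)

lemma mor_simps [simp]:
  "mor (arrow_idt C a) = Ident C a" "mor (arrow_ten D F G) = mor F \<star>\<^bsub>D\<^esub> mor G"
  "mor (arrow_asc D a b c) = associator D a b c" "mor (arrow_lun D a) = left_unitor D a"
  "mor (arrow_run D a) = right_unitor D a"
  by (simp_all add: arrow_idt_def arrow_ten_def arrow_asc_def arrow_lun_def arrow_run_def)

locale tensor_algebra = tensor_category C K
  for C :: "('o, 'm, 'k, 'z) monoidal_linear_category_scheme" (structure)
    and K :: "('k, 'x) ring_scheme" +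
  fixes A :: "('o, 'm) algebra_object"
  assumes alg: "algebra_in C A"
begin

abbreviation ao :: "'o" where
  "ao \<equiv> alg_ob A"

abbreviation am :: "('o \<times> 'm \<times> 'o) option" where
  "am \<equiv> arrow (alg_ob A \<boxtimes> alg_ob A) (algebra_object.alg_mult A) (alg_ob A)"

abbreviation au :: "('o \<times> 'm \<times> 'o) option" where
  "au \<equiv> arrow (unit_ob C) (alg_unit A) (alg_ob A)"

lemma arrow_algebra: "algebra (Ob C) (is_arrow C) src trg (arrow_cmp C) (arrow_idt C)
  (arrow_add C) (arrow_neg C) (arrow_zer C)
  (tensor_ob C) (arrow_ten C) (unit_ob C) (arrow_asc C) (\<lambda>a b c. arrow_inv C (arrow_asc C a b c))
  (arrow_lun C) (\<lambda>a. arrow_inv C (arrow_lun C a)) (arrow_run C) (\<lambda>a. arrow_inv C (arrow_run C a)) ao am au"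
proof (intro algebra.intro arrow_rigid algebra_axioms.intro)
  have h: "ao \<in> Ob C" "algebra_object.alg_mult A \<in> Hom C (ao \<boxtimes> ao) ao" "alg_unit A \<in> Hom C (unit_ob C) ao"
    and e: "algebra_object.alg_mult A \<cdot> (algebra_object.alg_mult A \<star> Ident C ao) = algebra_object.alg_mult A \<cdot> (Ident C ao \<star> algebra_object.alg_mult A) \<cdot> associator C ao ao ao"
      "algebra_object.alg_mult A \<cdot> (alg_unit A \<star> Ident C ao) = left_unitor C ao"
      "algebra_object.alg_mult A \<cdot> (Ident C ao \<star> alg_unit A) = right_unitor C ao"
    using alg by (auto simp: algebra_in_def Let_def)
  show "ao \<in> Ob C" by (rule h)
  show t: "is_arrow C am" "is_arrow C au" using h by (simp_all add: tensor_ob_closed unit_ob_closed)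
  show "arrow_cmp C am (arrow_ten C am (arrow_idt C ao))
      = arrow_cmp C am (arrow_cmp C (arrow_ten C (arrow_idt C ao) am) (arrow_asc C ao ao ao))"
    by (rule arrow_eqI[of C]) (use h t e(1) in \<open>simp_all add: mor_cmp\<close>)
  show "arrow_cmp C am (arrow_ten C au (arrow_idt C ao)) = arrow_lun C ao"
    by (rule arrow_eqI[of C]) (use h t e(2) in \<open>simp_all add: mor_cmp\<close>)
  show "arrow_cmp C am (arrow_ten C (arrow_idt C ao) au) = arrow_run C ao"
    by (rule arrow_eqI[of C]) (use h t e(3) in \<open>simp_all add: mor_cmp\<close>)
qed simp_all

sublocale R: algebra "Ob C" "is_arrow C" src trg "arrow_cmp C" "arrow_idt C" "arrow_add C" "arrow_neg C" "arrow_zer C"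
  "tensor_ob C" "arrow_ten C" "unit_ob C"
  "arrow_asc C" "\<lambda>a b c. arrow_inv C (arrow_asc C a b c)" "arrow_lun C" "\<lambda>a. arrow_inv C (arrow_lun C a)"
  "arrow_run C" "\<lambda>a. arrow_inv C (arrow_run C a)" "alg_ob A"
  "arrow (alg_ob A \<boxtimes> alg_ob A) (algebra_object.alg_mult A) (alg_ob A)" "arrow (unit_ob C) (alg_unit A) (alg_ob A)"
  by (rule arrow_algebra)

definition mod_arrow :: "'o \<times> 'm \<Rightarrow> ('o \<times> 'm \<times> 'o) option" where
  "mod_arrow M = arrow (fst M \<boxtimes> ao) (snd M) (fst M)"

lemma mod_arrow_sel [simp]: "src (mod_arrow M) = fst M \<boxtimes> ao" "trg (mod_arrow M) = fst M" "mor (mod_arrow M) = snd M"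
  by (simp_all add: mod_arrow_def)

lemma mod_iff: "right_module_in C A M \<longleftrightarrow> R.is_mod (mod_arrow M)"
proof -
  obtain x \<rho> where M: "M = (x, \<rho>)" by (cases M)
  let ?m = "mod_arrow M"
  have t: "R.act_typed ?m \<longleftrightarrow> x \<in> Ob C \<and> \<rho> \<in> Hom C (x \<boxtimes> ao) x"
    using R.A_Obj by (auto simp: R.act_typed_def M mod_arrow_def tensor_ob_closed)
  show ?thesis
  proof (cases "R.act_typed ?m")
    case True
    note ta = R.act_typedD[OF True]
    have x: "x \<in> Ob C" using True t by simp
    let ?l = "arrow_cmp C ?m (arrow_ten C ?m (arrow_idt C ao))"
    let ?r = "arrow_cmp C ?m (arrow_cmp C (arrow_ten C (arrow_idt C x) am) (arrow_asc C x ao ao))"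
    let ?v = "arrow_cmp C ?m (arrow_ten C (arrow_idt C x) au)"
    have a: "is_arrow C ?l" "is_arrow C ?r" "is_arrow C ?v" "is_arrow C (arrow_run C x)"
      using ta x R.arr_mu R.arr_u by (simp_all add: M)
    have b: "is_arrow C (arrow_cmp C (arrow_ten C (arrow_idt C x) am) (arrow_asc C x ao ao))"
      using a(2) by (simp only: R.arr_cmp)
    have "?l = ?r \<longleftrightarrow> mor ?l = mor ?r"
      using arrow_eqI[OF a(1,2)] ta x R.arr_mu by (auto simp: M)
    moreover have "?v = arrow_run C x \<longleftrightarrow> mor ?v = mor (arrow_run C x)"
      using arrow_eqI[OF a(3,4)] ta x R.arr_u by (auto simp: M)
    moreover have "mor ?l = \<rho> \<cdot> (\<rho> \<star> Ident C ao)"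
      "mor ?r = \<rho> \<cdot> (Ident C x \<star> algebra_object.alg_mult A) \<cdot> associator C x ao ao" "mor ?v = \<rho> \<cdot> (Ident C x \<star> alg_unit A)"
      using mor_cmp[OF a(1)] mor_cmp[OF a(2)] mor_cmp[OF a(3)] mor_cmp[OF b] by (simp_all add: M)
    ultimately show ?thesis
      using True t by (simp add: R.is_mod_def right_module_in_def M Let_def)
  next
    case False
    then show ?thesis using t by (auto simp: R.is_mod_def right_module_in_def M Let_def)
  qed
qed

lemma mod_arrow_eq:
  assumes "R.is_mod \<rho>" shows "\<rho> = mod_arrow (trg \<rho>, mor \<rho>)"
  using is_arrowD(4)[OF R.is_modD(2)[OF assms]] R.is_modD(3)[OF assms] by (simp add: mod_arrow_def)

lemma mod_hom_iff:
  assumes "right_module_in C A M" "right_module_in C A N"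
  shows "f \<in> Hom (right_modules C A) M N \<longleftrightarrow> R.mhom (arrow (fst M) f (fst N)) (mod_arrow M) (mod_arrow N)"
proof -
  obtain x \<rho> y \<sigma> where MN: "M = (x, \<rho>)" "N = (y, \<sigma>)" by (cases M, cases N)
  let ?m = "mod_arrow M" and ?n = "mod_arrow N" and ?f = "arrow x f y"
  have m: "R.is_mod ?m" "R.is_mod ?n" using assms mod_iff by auto
  note m' = R.is_modD[OF m(1)] R.is_modD[OF m(2)]
  have o: "x \<in> Ob C" "y \<in> Ob C" using m' by (auto simp: MN)
  show ?thesis
  proof (cases "f \<in> Hom C x y")
    case True
    let ?l = "arrow_cmp C ?f ?m" and ?r = "arrow_cmp C ?n (arrow_ten C ?f (arrow_idt C ao))"
    have fa: "is_arrow C ?f" using True o by simp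
    have a: "is_arrow C ?l" "is_arrow C ?r" using fa o m' by (simp_all add: MN)
    have "?l = ?r \<longleftrightarrow> mor ?l = mor ?r" using arrow_eqI[OF a] o m' fa by (auto simp: MN)
    moreover have "mor ?l = f \<cdot> \<rho>" "mor ?r = \<sigma> \<cdot> (f \<star> Ident C ao)"
      using mor_cmp[OF a(1)] mor_cmp[OF a(2)] by (simp_all add: MN)
    ultimately show ?thesis
      using True m o by (simp add: R.mhom_def R.equivariant_def right_modules_def MN)
  next
    case False
    then show ?thesis by (simp add: R.mhom_def R.equivariant_def right_modules_def MN)
  qed
qed

lemma act_arrow:
  assumes p: "p \<in> Ob C" and M: "right_module_in C A M"
  shows "mod_arrow (act_on_module C A p M) = R.act p (mod_arrow M)"
proof -
  have m: "R.is_mod (mod_arrow M)" using M mod_iff by simp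
  have a: "is_arrow C (R.act p (mod_arrow M))" "src (R.act p (mod_arrow M)) = (p \<boxtimes> fst M) \<boxtimes> ao"
    "trg (R.act p (mod_arrow M)) = p \<boxtimes> fst M"
    using R.act_arr[OF p R.is_modD(1)[OF m]] by simp_all
  have "mor (R.act p (mod_arrow M)) = (Ident C p \<star> snd M) \<cdot> associator C p (fst M) ao"
    using mor_cmp[OF a(1)[unfolded R.act_def]] by (simp add: R.act_def)
  then show ?thesis
    using is_arrowD(4)[OF a(1)] a by (simp add: mod_arrow_def act_on_module_def split_beta)
qed

lemma right_module_act:
  assumes "p \<in> Ob C" "right_module_in C A M"
  shows "right_module_in C A (act_on_module C A p M)"
  using R.is_mod_act[OF assms(1), of "mod_arrow M"] assms by (simp add: mod_iff act_arrow)

lemma mod_hom_cmp: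
  assumes "right_module_in C A M" "right_module_in C A N"
    and f: "f \<in> Hom (right_modules C A) M N"
  shows "arrow (fst M) f (fst N) = R.und (R.marrow (mod_arrow M) (arrow (fst M) f (fst N)) (mod_arrow N))"
    "R.marr (R.marrow (mod_arrow M) (arrow (fst M) f (fst N)) (mod_arrow N))"
  using mod_hom_iff[OF assms(1,2)] f by simp_all

lemma marr_hom:
  assumes "R.marr F"
  obtains M f N where "right_module_in C A M" "right_module_in C A N" "f \<in> Hom (right_modules C A) M N"
    "F = R.marrow (mod_arrow M) (arrow (fst M) f (fst N)) (mod_arrow N)"
proof -
  note f = R.marrD[OF assms]
  let ?M = "(trg (R.mdm F), mor (R.mdm F))" and ?N = "(trg (R.mcd F), mor (R.mcd F))"
  have m: "mod_arrow ?M = R.mdm F" "mod_arrow ?N = R.mcd F" using mod_arrow_eq f(2,3) by auto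
  then have r: "right_module_in C A ?M" "right_module_in C A ?N" using f(2,3) by (simp_all add: mod_iff)
  have u: "R.und F = arrow (fst ?M) (mor (R.und F)) (fst ?N)" using is_arrowD(4)[OF f(4)] f(5,6) by simp
  then have h: "mor (R.und F) \<in> Hom (right_modules C A) ?M ?N" using f(1) m mod_hom_iff[OF r] by simp
  show ?thesis
    by (rule that[OF r h]) (use assms R.marr_iff u m in metis)
qed

lemma projective_mod:
  assumes M: "right_module_in C A M" and p: "R.M.proj (mod_arrow M)"
  shows "projective (right_modules C A) M"
  unfolding projective_def
proof (intro conjI allI impI ballI)
  show "M \<in> Ob (right_modules C A)" using M by (simp add: right_modules_def)
  fix N1 N2 e f assume e: "epic (right_modules C A) N1 N2 e" and f: "f \<in> Hom (right_modules C A) M N2"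
  have N: "right_module_in C A N1" "right_module_in C A N2" "e \<in> Hom (right_modules C A) N1 N2"
    using e by (auto simp: epic_def right_modules_def)
  let ?E = "R.marrow (mod_arrow N1) (arrow (fst N1) e (fst N2)) (mod_arrow N2)"
  let ?F = "R.marrow (mod_arrow M) (arrow (fst M) f (fst N2)) (mod_arrow N2)"
  have EF: "R.marr ?E" "R.marr ?F" using mod_hom_cmp(2) N M f by auto
  have inj: "mod_arrow X1 = mod_arrow X2 \<Longrightarrow> X1 = X2" for X1 X2 by (simp add: mod_arrow_def prod_eq_iff)
  have cmp: "Comp (right_modules C A) = Comp C" by (simp add: right_modules_def)
  have HomC: "h \<in> Hom C (fst P) (fst Q)" "fst P \<in> Ob C" "fst Q \<in> Ob C"
    if "right_module_in C A P" "right_module_in C A Q" "h \<in> Hom (right_modules C A) P Q" for h P Q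
    using that by (auto simp: right_modules_def right_module_in_def Let_def split_beta)
  have "R.M.epi ?E" unfolding R.M.epi_def
  proof (intro conjI allI impI EF)
    fix G H assume gh: "R.marr G \<and> R.marr H \<and> R.mcd G = R.mcd H \<and> R.mdm G = R.mcd ?E \<and> R.mdm H = R.mcd ?E \<and>
      R.mcmp G ?E = R.mcmp H ?E"
    obtain P1 g Q1 where G: "right_module_in C A P1" "right_module_in C A Q1" "g \<in> Hom (right_modules C A) P1 Q1"
      "G = R.marrow (mod_arrow P1) (arrow (fst P1) g (fst Q1)) (mod_arrow Q1)" using gh marr_hom by metis
    obtain P2 h Q2 where H: "right_module_in C A P2" "right_module_in C A Q2" "h \<in> Hom (right_modules C A) P2 Q2"
      "H = R.marrow (mod_arrow P2) (arrow (fst P2) h (fst Q2)) (mod_arrow Q2)" using gh marr_hom by metis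
    have eq: "P1 = N2" "P2 = N2" "Q2 = Q1" using gh G(4) H(4) inj by auto
    have "R.und (R.mcmp G ?E) = R.und (R.mcmp H ?E)" using gh by simp
    then have "arrow_cmp C (R.und G) (R.und ?E) = arrow_cmp C (R.und H) (R.und ?E)"
      using R.und_simps(1) gh EF(1) by metis
    then have "g \<cdot> e = h \<cdot> e"
      using G H eq HomC[OF N(1,2,3)] HomC[OF G(1-3)] HomC[OF H(1-3)] by simp
    moreover have "Q1 \<in> Ob (right_modules C A)" using G(2) by (simp add: right_modules_def)
    moreover have "g \<in> Hom (right_modules C A) N2 Q1" "h \<in> Hom (right_modules C A) N2 Q1"
      using G(3) H(3) eq by simp_all
    ultimately have "g = h" using e unfolding epic_def cmp by blast
    then show "G = H" using G(4) H(4) eq by simp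
  qed
  then obtain G where G: "R.mcmp ?E G = ?F" using R.M.proj_lift[OF p, of ?E ?F] EF by auto
  have Ga: "R.marr G" "R.mdm G = mod_arrow M" "R.mcd G = mod_arrow N1"
    using R.M.cmp_arrD[OF G EF(2)] by auto
  obtain P g Q where g: "right_module_in C A P" "right_module_in C A Q" "g \<in> Hom (right_modules C A) P Q"
    "G = R.marrow (mod_arrow P) (arrow (fst P) g (fst Q)) (mod_arrow Q)" using Ga(1) by (rule marr_hom)
  have eq: "P = M" "Q = N1" using Ga g(4) inj by auto
  have "arrow_cmp C (R.und ?E) (R.und G) = R.und ?F"
    using R.und_simps(1)[OF EF(1) Ga(1)] Ga(3) G by simp
  then have "e \<cdot> g = f" using g eq HomC[OF N] HomC[OF g(1-3)] by simp
  then show "\<exists>g\<in>Hom (right_modules C A) M N1. e \<cdot>\<^bsub>right_modules C A\<^esub> g = f"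
    using g eq cmp by auto
qed

text \<open>Exactness in the subcategory makes \<open>p \<otimes> M\<close> projective there, so its action map splits.\<close>

lemma sub_exact_retract:
  assumes S: "tensor_subcategory C S" and ex: "exact_algebra (full_subcategory C S) A"
    and p: "projective (full_subcategory C S) p" and M: "right_module_in C A M" "fst M \<in> S"
  shows "R.M.retract (R.act p (mod_arrow M)) (R.act (p \<boxtimes> fst M) am)"
proof -
  let ?D = "full_subcategory C S"
  note S' = S[unfolded tensor_subcategory_def]
  have SO: "S \<subseteq> Ob C" using S' by (elim conjE)
  have "\<forall>a\<in>S. \<forall>b\<in>S. a \<boxtimes> b \<in> S" using S' by (elim conjE)
  then have St: "\<And>a b. a \<in> S \<Longrightarrow> b \<in> S \<Longrightarrow> a \<boxtimes> b \<in> S" by blast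
  have pS: "p \<in> S" "p \<in> Ob C" using p SO by (auto simp: projective_def full_subcategory_def)
  have aS: "ao \<in> S" using ex by (simp add: exact_algebra_def algebra_in_def full_subcategory_def Let_def)
  \<comment> \<open>Passing to the subcategory changes only the set of objects, so modules there are
    the modules whose underlying object lies in \<open>S\<close>, with the same maps and the same
    action.\<close>
  have full: "right_module_in ?D A Q \<longleftrightarrow> right_module_in C A Q \<and> fst Q \<in> S" for Q
    using SO by (auto simp: right_module_in_def full_subcategory_def Let_def split_beta)
  have hom: "Hom (right_modules ?D A) = Hom (right_modules C A)" "Comp (right_modules ?D A) = Comp C"
    "act_on_module ?D A = act_on_module C A"
    by (auto simp: right_modules_def full_subcategory_def act_on_module_def fun_eq_iff)
  let ?N = "act_on_module C A p M" and ?L = "act_on_module C A (p \<boxtimes> fst M) (ao, algebra_object.alg_mult A)"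
  have x: "p \<boxtimes> fst M \<in> S" "p \<boxtimes> fst M \<in> Ob C" using St pS M SO by auto
  have mu: "right_module_in C A (ao, algebra_object.alg_mult A)" "mod_arrow (ao, algebra_object.alg_mult A) = am"
    using R.is_mod_mu by (simp_all add: mod_iff mod_arrow_def)
  have fst_act: "fst (act_on_module C A q Q) = q \<boxtimes> fst Q" for q Q by (simp add: act_on_module_def split_beta)
  have L: "right_module_in C A ?L" "mod_arrow ?L = R.act (p \<boxtimes> fst M) am" "fst ?L = (p \<boxtimes> fst M) \<boxtimes> ao"
    using right_module_act[OF x(2) mu(1)] act_arrow[OF x(2) mu(1)] mu(2) fst_act[of "p \<boxtimes> fst M" "(ao, algebra_object.alg_mult A)"]
    by simp_all
  have N: "right_module_in C A ?N" "mod_arrow ?N = R.act p (mod_arrow M)" "fst ?N = p \<boxtimes> fst M"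
    using right_module_act[OF pS(2) M(1)] act_arrow[OF pS(2) M(1)] fst_act[of p M] by simp_all
  have NL: "right_module_in ?D A ?N" "right_module_in ?D A ?L" using N L x aS St by (simp_all add: full)
  have nm: "R.is_mod (mod_arrow ?N)" using N(1) mod_iff by simp
  have act: "R.mhom (mod_arrow ?N) (mod_arrow ?L) (mod_arrow ?N)"
    using R.mhom_action[OF nm] by (simp only: mod_arrow_sel N(3) L(2))
  have e: "R.epi (mod_arrow ?N)" by (rule R.epi_action[OF nm])
  have nl: "arrow (fst ?L) (snd ?N) (fst ?N) = mod_arrow ?N" using N(3) L(3) by (simp add: mod_arrow_def)
  have h: "snd ?N \<in> Hom (right_modules C A) ?L ?N" using mod_hom_iff[OF L(1) N(1)] act by (simp add: nl)
  have ep: "epic C (fst ?L) (fst ?N) (snd ?N)" unfolding epic_iff nl by (rule e)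
  \<comment> \<open>The underlying map is epic in the large category, so it is in particular epic
    when tested only against modules of the subcategory.\<close>
  have "epic (right_modules ?D A) ?L ?N (snd ?N)"
    unfolding epic_def
  proof (intro conjI ballI impI)
    show "?L \<in> Ob (right_modules ?D A)" "?N \<in> Ob (right_modules ?D A)" using NL by (simp_all add: right_modules_def)
    show "snd ?N \<in> Hom (right_modules ?D A) ?L ?N" unfolding hom by (rule h)
    fix Q g k assume Q: "Q \<in> Ob (right_modules ?D A)" "g \<in> Hom (right_modules ?D A) ?N Q"
      "k \<in> Hom (right_modules ?D A) ?N Q"
      "Comp (right_modules ?D A) g (snd ?N) = Comp (right_modules ?D A) k (snd ?N)"
    have "fst Q \<in> Ob C" using Q(1) SO full by (auto simp: right_modules_def)
    moreover have "g \<in> Hom C (fst ?N) (fst Q)" "k \<in> Hom C (fst ?N) (fst Q)"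
      using Q(2,3) by (auto simp: right_modules_def full_subcategory_def split_beta)
    ultimately show "g = k" using ep Q(4) unfolding epic_def hom by blast
  qed
  moreover have "M \<in> Ob (right_modules ?D A)" using M full[of M] by (simp add: right_modules_def)
  then have "projective (right_modules ?D A) ?N"
    using ex p unfolding exact_algebra_def hom by blast
  moreover have idh: "Ident C (fst ?N) \<in> Hom (right_modules C A) ?N ?N"
    using mod_hom_iff[OF N(1) N(1)] R.mhom_idt[OF nm] by (simp add: arrow_idt_def)
  ultimately obtain s where s: "s \<in> Hom (right_modules C A) ?N ?L" "snd ?N \<cdot> s = Ident C (fst ?N)"
    unfolding projective_def hom by blast
  have sm: "R.mhom (arrow (fst ?N) s (fst ?L)) (mod_arrow ?N) (mod_arrow ?L)"
    using s(1) mod_hom_iff[OF N(1) L(1)] by simp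
  have "arrow_cmp C (mod_arrow ?N) (arrow (fst ?N) s (fst ?L)) = arrow_idt C (trg (mod_arrow ?N))"
    using s(2) R.mhomD(3)[OF sm] R.mhomD(3)[OF act] unfolding nl[symmetric] by (simp add: arrow_idt_def)
  then have "R.M.retract (mod_arrow ?N) (mod_arrow ?L)" by (rule R.M_retractI[OF sm act])
  then show ?thesis by (simp only: N(2) L(2))
qed

end

section \<open>Transfer of exactness from the subcategory\<close>

theorem corollary12p4:
  fixes K :: "('k, 'x) ring_scheme"
    and D :: "('o, 'm, 'k, 'z) monoidal_linear_category_scheme"
    and S :: "'o set"
    and A :: "('o, 'm) algebra_object"
  assumes "algebraically_closed K"
    and "finite_tensor_category D K"
    and "tensor_subcategory D S"
    and "exact_algebra (full_subcategory D S) A"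
  shows "exact_algebra D A"
proof -
  interpret finite_tensor_category D K by fact
  let ?E = "full_subcategory D S"
  note S = assms(3)[unfolded tensor_subcategory_def]
  have SO: "S \<subseteq> Ob D" using S by (elim conjE)
  have Ssum: "\<forall>a\<in>S. \<forall>b\<in>S. \<forall>s. is_direct_sum D a b s \<longrightarrow> s \<in> S" using S by (elim conjE)
  have Ssub: "\<forall>a\<in>S. \<forall>b c i p. monic D b a i \<and> epic D b c p \<longrightarrow> c \<in> S" using S by (elim conjE)
  have Sunit: "unit_ob D \<in> S" using S by (elim conjE)
  have aS: "alg_ob A \<in> S" and alg: "algebra_in D A"
    using assms(4) SO by (auto simp: exact_algebra_def algebra_in_def full_subcategory_def Let_def)
  interpret tensor_algebra D K A by unfold_locales (rule alg)
  obtain sz where sz: "fin_rigid (Ob D) (is_arrow D) src trg (arrow_cmp D) (arrow_idt D)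
    (arrow_add D) (arrow_neg D) (arrow_zer D)
    (tensor_ob D) (arrow_ten D) (unit_ob D) (arrow_asc D) (\<lambda>a b c. arrow_inv D (arrow_asc D a b c))
    (arrow_lun D) (\<lambda>a. arrow_inv D (arrow_lun D a)) (arrow_run D) (\<lambda>a. arrow_inv D (arrow_run D a)) sz"
    using arrow_fin_rigid by blast
  interpret F: fin_algebra "Ob D" "is_arrow D" src trg "arrow_cmp D" "arrow_idt D" "arrow_add D" "arrow_neg D" "arrow_zer D"
    "tensor_ob D" "arrow_ten D" "unit_ob D"
    "arrow_asc D" "\<lambda>a b c. arrow_inv D (arrow_asc D a b c)" "arrow_lun D" "\<lambda>a. arrow_inv D (arrow_lun D a)"
    "arrow_run D" "\<lambda>a. arrow_inv D (arrow_run D a)" sz "alg_ob A"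
    "arrow (tensor_ob D (alg_ob A) (alg_ob A)) (algebra_object.alg_mult A) (alg_ob A)" "arrow (unit_ob D) (alg_unit A) (alg_ob A)"
    by (intro fin_algebra.intro sz arrow_algebra)
  \<comment> \<open>Closure under subquotients is used with the identity as the quotient map;
    \<open>quot\<close> uses the identity as the inclusion.\<close>
  have sub: "src m \<in> S" if m: "R.mono m" "trg m \<in> S" for m
  proof -
    have a: "is_arrow D m" using m by simp
    have "monic D (src m) (trg m) (mor m)" using m is_arrowD(4)[OF a] by (simp add: monic_iff)
    moreover have "epic D (src m) (src m) (Ident D (src m))"
      using R.epi_idt[of "src m"] is_arrowD(1)[OF a] by (simp add: epic_iff arrow_idt_def)
    ultimately show ?thesis using Ssub m(2) by blast
  qed
  have quot: "trg e \<in> S" if e: "R.epi e" "src e \<in> S" for e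
  proof -
    have a: "is_arrow D e" using e by simp
    have "epic D (src e) (trg e) (mor e)" using e is_arrowD(4)[OF a] by (simp add: epic_iff)
    moreover have "monic D (src e) (src e) (Ident D (src e))"
      using R.mono_idt[of "src e"] is_arrowD(1)[OF a] by (simp add: monic_iff arrow_idt_def)
    ultimately show ?thesis using Ssub e(2) by blast
  qed
  have sums: "trg i \<in> S" if "R.biprod i p j q" "src i \<in> S" "src j \<in> S" for i p j q
    using Ssum biprod_direct_sum[OF that(1)] that(2,3) by blast
  have "\<exists>t. R.epi t \<and> trg t = unit_ob D \<and> src t \<in> S \<and>
      (\<forall>e f. R.epi e \<and> src e \<in> S \<and> is_arrow D f \<and> src f = src t \<and> trg f = trg e \<longrightarrow>
        (\<exists>g. arrow_cmp D e g = f))"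
    by (rule F.sub_cover_unit[OF SO Sunit]) (erule (2) sums, erule (1) sub)
  then obtain t where t: "R.epi t" "trg t = unit_ob D" "src t \<in> S"
    and lift: "\<And>e f. R.epi e \<Longrightarrow> src e \<in> S \<Longrightarrow> is_arrow D f \<Longrightarrow> src f = src t \<Longrightarrow> trg f = trg e \<Longrightarrow>
      \<exists>g. arrow_cmp D e g = f"
    by blast
  let ?p = "src t"
  have pO: "?p \<in> Ob D" using t SO by blast
  \<comment> \<open>The cokernel taken in the large category is a quotient of an object of
    \<open>S\<close>, hence lies in \<open>S\<close>, where the map is known to be epic. So the
    cokernel map is zero and the map is epic in the large category as well.\<close>
  have epiS: "R.epi (arrow a e b)" if e: "epic ?E a b e" for a b e
  proof -
    have o: "a \<in> S" "b \<in> S" "a \<in> Ob D" "b \<in> Ob D" "e \<in> Hom D a b"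
      using e SO by (auto simp: epic_def full_subcategory_def)
    obtain c where c: "R.is_cok (arrow a e b) c" using R.ex_cok[of "arrow a e b"] o by auto
    then have ca: "R.epi c" "is_arrow D c" "src c = b" "arrow_cmp D c (arrow a e b) = arrow_zer D a (trg c)"
      by (auto simp: R.is_cok_def)
    have cS: "trg c \<in> S" "trg c \<in> Ob D" using quot[OF ca(1)] ca o SO by auto
    have z: "is_arrow D (arrow_zer D b (trg c))" using R.arr_zer[OF o(4) cS(2)] by simp
    have "arrow_cmp D c (arrow a e b) = arrow_cmp D (arrow_zer D b (trg c)) (arrow a e b)"
      using ca o cS by simp
    then have "mor c \<cdot>\<^bsub>D\<^esub> e = mor (arrow_zer D b (trg c)) \<cdot>\<^bsub>D\<^esub> e"
      using mor_cmp[of D c "arrow a e b"] mor_cmp[of D "arrow_zer D b (trg c)" "arrow a e b"] ca(2,3) o z R.arr_zer[OF o(4) cS(2)]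
      by (metis R.arr_cmp arrow_sel(2,3) is_arrow_arrow)
    moreover have "mor c \<in> Hom D b (trg c)" "mor (arrow_zer D b (trg c)) \<in> Hom D b (trg c)"
      using is_arrowD(3)[OF ca(2)] is_arrowD(3)[OF z] ca R.arr_zer[OF o(4) cS(2)] by simp_all
    ultimately have "mor c = mor (arrow_zer D b (trg c))"
      using e cS(1) unfolding epic_def full_subcategory_def by simp
    then have "c = arrow_zer D b (trg c)"
      by - (rule arrow_eqI[OF ca(2) z], use ca R.arr_zer[OF o(4) cS(2)] in auto)
    then have "R.null (trg c)" using R.zer_epi_null[OF ca(1)] ca(3) by simp
    then show ?thesis using R.cok_null_epi[OF c] by simp
  qed
  have p: "projective ?E ?p" unfolding projective_def
  proof (intro conjI allI impI ballI)
    show "?p \<in> Ob ?E" using t by (simp add: full_subcategory_def)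
    fix a b e f assume e: "epic ?E a b e" and "f \<in> Hom ?E ?p b"
    then have o: "a \<in> S" "a \<in> Ob D" "b \<in> Ob D" "e \<in> Hom D a b" and f: "f \<in> Hom D ?p b"
      using SO by (auto simp: epic_def full_subcategory_def)
    obtain G where G: "arrow_cmp D (arrow a e b) G = arrow ?p f b"
      using lift[OF epiS[OF e], of "arrow ?p f b"] o f pO by auto
    have "is_arrow D G" "src G = ?p" "trg G = a" using R.cmp_arrD[OF G] o f pO by auto
    then obtain g where g: "G = arrow ?p g a" "g \<in> Hom D ?p a" by (metis is_arrowD(3,4))
    then have "e \<cdot>\<^bsub>D\<^esub> g = f" using G o pO by simp
    then show "\<exists>g\<in>Hom ?E ?p a. e \<cdot>\<^bsub>?E\<^esub> g = f" using g by (auto simp: full_subcategory_def)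
  qed
  \<comment> \<open>The underlying object of A lies in \<open>S\<close>, and so does that of any
    quotient module of A; this places the quotient within reach of the hypothesis.\<close>
  have H: "R.M.proj (R.act q (R.mcd E))" if q: "R.proj q" and E: "R.M.epi E" "R.mdm E = am" for q E
  proof -
    have qO: "q \<in> Ob D" using q by (rule R.proj_Obj)
    have Ea: "R.marr E" using E by simp
    note e = R.marrD[OF Ea]
    let ?M = "(trg (R.mcd E), mor (R.mcd E))"
    have M: "mod_arrow ?M = R.mcd E" "right_module_in D A ?M"
      using mod_arrow_eq[OF e(3)] e(3) by (simp_all add: mod_iff)
    have MS: "fst ?M \<in> S" using quot[OF R.und_epi[OF E(1)]] e E(2) aS by simp
    have MO: "fst ?M \<in> Ob D" using MS SO by blast
    have r1: "R.M.retract (R.act ?p (R.mcd E)) (R.act (tensor_ob D ?p (fst ?M)) am)"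
      using sub_exact_retract[OF assms(3,4) p M(2) MS] by (simp only: M(1))
    \<comment> \<open>Tensoring the cover \<open>t\<close> of the unit with \<open>q\<close> gives
      an epimorphism onto \<open>q\<close>, which splits since \<open>q\<close> is projective; so q
      is a retract of q \<otimes> \<open>?p\<close>.\<close>
    have ep: "R.epi (arrow_cmp D (arrow_run D q) (arrow_ten D (arrow_idt D q) t))"
      using R.epi_cmp[OF R.epi_tl[OF t(1) qO] R.iso_epi[OF R.inv_pair_iso(1)[OF R.run_iso[OF qO]]]] t qO by simp
    have "\<exists>f. arrow_cmp D (arrow_cmp D (arrow_run D q) (arrow_ten D (arrow_idt D q) t)) f = arrow_idt D q"
      by (rule R.proj_split[OF q ep]) (use t qO in simp)
    then obtain f where f: "arrow_cmp D (arrow_cmp D (arrow_run D q) (arrow_ten D (arrow_idt D q) t)) f = arrow_idt D q" ..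
    have "R.retract q (tensor_ob D q ?p)" by (rule R.retractI[OF f qO]) (use t qO in simp)
    then have "R.M.retract (R.act q (R.mcd E)) (R.act (tensor_ob D q ?p) (R.mcd E))"
      using e(3) by (rule R.act_retract_left)
    also have "R.M.retract \<dots> (R.act q (R.act ?p (R.mcd E)))"
      by (rule R.act_act_retract(1)[OF qO pO e(3)])
    finally (R.M.retract_trans) have "R.M.retract (R.act q (R.mcd E)) (R.act q (R.act ?p (R.mcd E)))" .
    then have "R.M.retract (R.act q (R.mcd E)) (R.act q (R.act (tensor_ob D ?p (fst ?M)) am))"
      using R.M.retract_trans R.act_retract[OF qO r1] by blast
    then have "R.M.retract (R.act q (R.mcd E)) (R.act (tensor_ob D q (tensor_ob D ?p (fst ?M))) am)"
      using R.M.retract_trans R.act_act_retract(2)[OF qO tensor_ob_closed[OF pO MO] R.is_mod_mu] by blast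
    \<comment> \<open>The free module reached here has generator q \<otimes> (\<open>?p\<close>
      \<otimes> M), which is projective in the large category already because \<open>q\<close>
      is.\<close>
    then show ?thesis
      using R.M.proj_retract R.free_proj[OF R.proj_tr[OF q tensor_ob_closed[OF pO MO]]] by blast
  qed
  show ?thesis unfolding exact_algebra_def
  proof (intro conjI allI impI alg)
    fix q M assume qM: "projective D q \<and> M \<in> Ob (right_modules D A)"
    then have q: "R.proj q" and M: "right_module_in D A M"
      by (simp_all add: projective_iff right_modules_def)
    have qO: "q \<in> Ob D" using q by (rule R.proj_Obj)
    have m: "R.is_mod (mod_arrow M)" using M mod_iff by blast
    have "R.M.proj (R.act q (mod_arrow M))"
    proof (rule F.exact_of_quotients)
      show "R.proj q" by (rule q)
      show "R.is_mod (mod_arrow M)" by (rule m)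
      show "R.M.proj (R.act q (R.mcd E))" if "R.proj q" "R.M.epi E" "R.mdm E = am" for q E
        by (rule H) fact+
    qed
    then show "projective (right_modules D A) (act_on_module D A q M)"
      using projective_mod[OF right_module_act[OF qO M]] act_arrow[OF qO M] by simp
  qed
qed

end
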